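(* Let $X_1$ and $X_2$ be diffeological spaces, and let $f:X_1\supseteq Y\to X_2$ be a diffeomorphism of $Y$ with its image such that $\mathcal{D}_1^{\Omega}=\mathcal{D}_2^{\Omega}$. Let $g_1^{\Lambda}$ and $g_2^{\Lambda}$ be compatible pseudo-metrics on $\Lambda^1(X_1)$ and $\Lambda^1(X_2)$, and let $g^{\Lambda}$ be the induced pseudo-metric on $\Lambda^1(X_1\cup_f X_2)$. Let $\nabla^1$ and $\nabla^2$ be compatible connections on $\Lambda^1(X_1)$ and $\Lambda^1(X_2)$. If $\nabla^1$ and $\nabla^2$ are the Levi-Civita connections (relative to $g_1^{\Lambda}$ and $g_2^{\Lambda}$ respectively), then the induced connection $\nabla^{\cup}$ is the Levi-Civita connection on $\Lambda^1(X_1\cup_f X_2)$ relative to $g^{\Lambda}$.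
   Context: **Pseudo-bundles.** A diffeological vector pseudo-bundle is a smooth surjection $\pi:V\to X$ of diffeological spaces with vector space structures on the fibres such that fibrewise addition, scalar multiplication and the zero section are smooth (no local triviality). $C^\infty(X,V)$ is the space of smooth sections with the functional diffeology. The dual $V^*$ has as fibres the smooth duals of the fibres; $p:U\to V^*$ is a plot iff its projection to $X$ is smooth and, for every plot $q:U'\to V$, $(u,u')\mapsto p(u)(q(u'))$ is smooth on the set of $(u,u')$ over the same point of $X$. The plots of $V\otimes W$ (over $X$) are locally finite sums $\sum_i p_i\otimes q_i$ of plots over the same map to $X$. A pseudo-metric on a finite-dimensional $V$ is a smooth map $g:X\to V^*\otimes V^*$ over $X$ with each $g(x)$ symmetric positive semi-definite of rank $\dim((\pi^{-1}(x))^* )$. **Forms.** $\omega\in\Omega^1(X)$ assigns to each plot $p:U\to X$ a usual smooth $1$-form $\omega(p)$ on $U$ with $\omega(p\circ F)=F^*\omega(p)$ for smooth $F$; $r:U\to\Omega^1(X)$ is a plot iff $(u,u')\mapsto r(u)(q)(u')$ is smooth for every plot $q$ of $X$. $\Omega^1_x(X)$ is the space of $\omega$ with $\omega(p)(0)=0$ for all plots $p$ with $p(0)=x$. $\Lambda^1(X)=(X\times\Omega^1(X))/\bigcup_x\{x\}\times\Omega^1_x(X)$, with fibre $\Lambda^1_x(X)=\Omega^1(X)/\Omega^1_x(X)$. For smooth $h:X\to\mathbb{R}$, $dh(p)=d(h\circ p)$; $dh$ also denotes the induced section of $\Lambda^1(X)$. **Connections on $\Lambda^1(X)$.** A connection is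 a smooth linear operator $\nabla:C^\infty(X,\Lambda^1(X))\to C^\infty(X,\Lambda^1(X)\otimes\Lambda^1(X))$ with $\nabla(hs)=dh\otimes s+h\nabla s$. Let $g$ be a pseudo-metric on $\Lambda^1(X)$. For $t,s\in C^\infty(X,\Lambda^1(X))$: $\nabla_ts$ is the section with $(\nabla_ts)(x)=\sum_i g(x)(t(x),\alpha_i)\beta_i$ if $(\nabla s)(x)=\sum_i\alpha_i\otimes\beta_i$; $t(h)=g(t,dh)$ for $h\in C^\infty(X,\mathbb{R})$; the Lie bracket $[s,t]\in C^\infty(X,\Lambda^1(X))$ is the section determined by $[s,t](h)=s(t(h))-t(s(h))$ for all $h$ (standing assumption: this determines a well-defined smooth section, on $X_1$, $X_2$ and $X_1\cup_fX_2$). $\nabla$ is symmetric if $\nabla_st-\nabla_ts=[s,t]$ for all $s,t$; compatible with $g$ if $d(g(s,t))=g(\nabla s,t)+g(s,\nabla t)$ for all $s,t$, where $g(\alpha\otimes s,t)=g(s,\alpha\otimes t)=g(s,t)\,\alpha$. A Levi-Civita connection is one that is symmetric and compatible with $g$. **Gluing.** $X_1\cup_fX_2=(X_1\sqcup X_2)/(y\sim f(y),\,y\in Y)$ with the quotient diffeology; $\tilde i_1:X_1\to X_1\cup_fX_2$ and $i_2:X_2\to X_1\cup_fX_2$ are the natural maps, $i_1=\tilde i_1|_{X_1\setminus Y}$. Let $i:Y\hookrightarrow X_1$, $j:f(Y)\hookrightarrow X_2$ be the inclusions; $\mathcal{D}_1^\Omega$ and $\mathcal{D}_2^\Omega$ are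 the diffeologies on $\Omega^1(Y)$ that are the pushforwards of the functional diffeologies of $\Omega^1(X_1)$ by $i^*$ and of $\Omega^1(X_2)$ by $f^*j^*$. The pullbacks induce fibrewise maps $i_\Lambda^*:\Lambda^1_y(X_1)\to\Lambda^1_y(Y)$, $j_\Lambda^*:\Lambda^1_{f(y)}(X_2)\to\Lambda^1_{f(y)}(f(Y))$, $f_\Lambda^*:\Lambda^1_{f(y)}(f(Y))\to\Lambda^1_y(Y)$. Elements $\alpha_1\in\Lambda^1_y(X_1)$, $\alpha_2\in\Lambda^1_{f(y)}(X_2)$ are compatible if $i_\Lambda^*\alpha_1=f_\Lambda^*j_\Lambda^*\alpha_2$; sections $s_1,s_2$ are compatible if $s_1(y),s_2(f(y))$ are compatible for all $y\in Y$. $\tilde\rho_1^\Lambda$ (over $\tilde i_1(X_1)$) and $\tilde\rho_2^\Lambda$ (over $i_2(X_2)$) are the fibrewise linear maps from $\Lambda^1(X_1\cup_fX_2)$ to $\Lambda^1(X_1)$, $\Lambda^1(X_2)$ induced by pullback of forms by $\tilde i_1$, $i_2$; $\tilde\rho_1^\Lambda$ is an isomorphism on fibres over $i_1(X_1\setminus Y)$, $\tilde\rho_2^\Lambda$ on fibres over $i_2(X_2\setminus f(Y))$, and over $x=i_2(f(y))$ the map $\tilde\rho_1^\Lambda\oplus\tilde\rho_2^\Lambda$ is an isomorphism onto $\Lambda^1_y(X_1)\oplus_{comp}\Lambda^1_{f(y)}(X_2)$, the space of compatible pairs. For a section $s$ of $\Lambda^1(X_1\cup_fX_2)$, $s_1=\tilde\rho_1^\Lambda\circ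 s\circ\tilde i_1$ and $s_2=\tilde\rho_2^\Lambda\circ s\circ i_2$. **Compatible pseudo-metrics, induced $g^\Lambda$.** $g_1^\Lambda,g_2^\Lambda$ are compatible if $g_1^\Lambda(y)(\alpha_1,\beta_1)=g_2^\Lambda(f(y))(\alpha_2,\beta_2)$ for all $y\in Y$ and compatible pairs $(\alpha_1,\alpha_2)$, $(\beta_1,\beta_2)$ over $y,f(y)$. The induced $g^\Lambda$ is $g_1^\Lambda(\tilde\rho_1^\Lambda\cdot,\tilde\rho_1^\Lambda\cdot)$ over $i_1(X_1\setminus Y)$, $g_2^\Lambda(\tilde\rho_2^\Lambda\cdot,\tilde\rho_2^\Lambda\cdot)$ over $i_2(X_2\setminus f(Y))$, and the half-sum $\frac12\big(g_1^\Lambda(\tilde\rho_1^\Lambda\cdot,\tilde\rho_1^\Lambda\cdot)+g_2^\Lambda(\tilde\rho_2^\Lambda\cdot,\tilde\rho_2^\Lambda\cdot)\big)$ over $i_2(f(Y))$ (base points $\tilde i_1^{-1}(x)$, $i_2^{-1}(x)$); it is a pseudo-metric on $\Lambda^1(X_1\cup_fX_2)$. **Compatible connections, induced $\nabla^\cup$.** $\nabla^1,\nabla^2$ are compatible if for all compatible sections $s_1,s_2$ of $\Lambda^1(X_1),\Lambda^1(X_2)$ and all $y\in Y$, $(i_\Lambda^*\otimes i_\Lambda^* )\big((\nabla^1s_1)(y)\big)=\big((f_\Lambda^*j_\Lambda^* )\otimes(f_\Lambda^*j_\Lambda^* )\big)\big((\nabla^2s_2)(f(y))\big)$. For a section $s$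 of $\Lambda^1(X_1\cup_fX_2)$, $(\nabla^\cup s)(x)$ is the element $\tau$ of $\Lambda^1_x(X_1\cup_fX_2)\otimes\Lambda^1_x(X_1\cup_fX_2)$ with $(\tilde\rho_1^\Lambda\otimes\tilde\rho_1^\Lambda)(\tau)=(\nabla^1s_1)(\tilde i_1^{-1}(x))$ whenever $x\in\tilde i_1(X_1)$ and $(\tilde\rho_2^\Lambda\otimes\tilde\rho_2^\Lambda)(\tau)=(\nabla^2s_2)(i_2^{-1}(x))$ whenever $x\in i_2(X_2)$. *)

theory Defs
  imports "HOL-Analysis.Analysis" "HOL-Library.Function_Algebras"
begin

section \<open>Smooth functions on open subsets of \<open>\<real>\<^sup>n\<close>\<close>

text \<open>The space \<open>\<real>\<^sup>n\<close> is \<^const>\<open>Euclidean_space\<close> \<open>n\<close>, whose points are the sequences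
  vanishing from index \<open>n\<close> on. This keeps \<open>n\<close> a term, so that one can quantify over it.\<close>

type_synonym rvec = "nat \<Rightarrow> real"

definition pdiff :: "nat \<Rightarrow> (rvec \<Rightarrow> real) \<Rightarrow> rvec \<Rightarrow> real" where
  "pdiff i h u = deriv (\<lambda>t. h (u(i := t))) (u i)"

text \<open>\<open>Ck_on k n U h\<close>: all partial derivatives of \<open>h\<close> of order at most \<open>k\<close> exist and are
  continuous on the open set \<open>U\<close> of \<open>\<real>\<^sup>n\<close>.\<close>

fun Ck_on :: "nat \<Rightarrow> nat \<Rightarrow> rvec set \<Rightarrow> (rvec \<Rightarrow> real) \<Rightarrow> bool" where
  "Ck_on 0 n U h \<longleftrightarrow> continuous_on U h"
| "Ck_on (Suc k) n U h \<longleftrightarrow> continuous_on U h \<and>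
     (\<forall>i<n. (\<forall>u\<in>U. (\<lambda>t. h (u(i := t))) differentiable (at (u i))) \<and> Ck_on k n U (pdiff i h))"

definition smooth_fun :: "nat \<Rightarrow> rvec set \<Rightarrow> (rvec \<Rightarrow> real) \<Rightarrow> bool" where
  "smooth_fun n U h \<longleftrightarrow> (\<forall>k. Ck_on k n U h)"

definition smooth_map :: "nat \<Rightarrow> rvec set \<Rightarrow> nat \<Rightarrow> rvec set \<Rightarrow> (rvec \<Rightarrow> rvec) \<Rightarrow> bool" where
  "smooth_map n U m W F \<longleftrightarrow> F ` U \<subseteq> W \<and> W \<subseteq> topspace (Euclidean_space m) \<and>
     (\<forall>k<m. smooth_fun n U (\<lambda>u. F u k))"

text \<open>\<open>\<real>\<^sup>n \<times> \<real>\<^sup>m\<close> is identified with \<open>\<real>\<^sup>n\<^sup>+\<^sup>m\<close> through the two projections below.\<close>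

definition proj1 :: "nat \<Rightarrow> rvec \<Rightarrow> rvec" where
  "proj1 n w = (\<lambda>i. if i < n then w i else 0)"

definition proj2 :: "nat \<Rightarrow> rvec \<Rightarrow> rvec" where
  "proj2 n w = (\<lambda>i. w (n + i))"

definition prod_dom :: "nat \<Rightarrow> rvec set \<Rightarrow> nat \<Rightarrow> rvec set \<Rightarrow> rvec set" where
  "prod_dom n U m U' = {w \<in> topspace (Euclidean_space (n + m)). proj1 n w \<in> U \<and> proj2 n w \<in> U'}"

text \<open>Smoothness on an arbitrary subset \<open>S\<close> of \<open>\<real>\<^sup>n\<close>, taken with its subset diffeology.\<close>

definition smooth_on_subset :: "nat \<Rightarrow> rvec set \<Rightarrow> (rvec \<Rightarrow> real) \<Rightarrow> bool" where
  "smooth_on_subset n S h \<longleftrightarrow>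
     (\<forall>k W F. openin (Euclidean_space k) W \<and> smooth_map k W n S F \<longrightarrow> smooth_fun k W (h \<circ> F))"

definition near_each :: "nat \<Rightarrow> rvec set \<Rightarrow> (rvec set \<Rightarrow> bool) \<Rightarrow> bool" where
  "near_each n U P \<longleftrightarrow>
     (\<forall>u\<in>U. \<exists>V. openin (Euclidean_space n) V \<and> u \<in> V \<and> V \<subseteq> U \<and> P V)"


section \<open>Diffeological spaces\<close>

text \<open>\<open>plot X n U p\<close> says that the restriction of \<open>p\<close> to the open set \<open>U\<close> of \<open>\<real>\<^sup>n\<close> is a plot of
  \<open>X\<close>; the values of \<open>p\<close> outside \<open>U\<close> are irrelevant (first axiom below).\<close>

record 'a diffeology =
  dspace :: "'a set"
  plot :: "nat \<Rightarrow> rvec set \<Rightarrow> (rvec \<Rightarrow> 'a) \<Rightarrow> bool"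

definition diffeological_space :: "'a diffeology \<Rightarrow> bool" where
  "diffeological_space X \<longleftrightarrow>
     (\<forall>n U p q. plot X n U p \<and> (\<forall>u\<in>U. p u = q u) \<longrightarrow> plot X n U q) \<and>
     (\<forall>n U p. plot X n U p \<longrightarrow> openin (Euclidean_space n) U \<and> p ` U \<subseteq> dspace X) \<and>
     (\<forall>n U x. openin (Euclidean_space n) U \<and> x \<in> dspace X \<longrightarrow> plot X n U (\<lambda>_. x)) \<and>
     (\<forall>n U p m W F. plot X n U p \<and> openin (Euclidean_space m) W \<and> smooth_map m W n U F
        \<longrightarrow> plot X m W (p \<circ> F)) \<and>
     (\<forall>n U p. openin (Euclidean_space n) U \<and> near_each n U (\<lambda>V. plot X n V p)
        \<longrightarrow> plot X n U p)"

definition dsmooth :: "'a diffeology \<Rightarrow> 'b diffeology \<Rightarrow> ('a \<Rightarrow> 'b) \<Rightarrow> bool" where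
  "dsmooth X Z \<phi> \<longleftrightarrow> \<phi> ` dspace X \<subseteq> dspace Z \<and>
     (\<forall>n U p. plot X n U p \<longrightarrow> plot Z n U (\<phi> \<circ> p))"

definition smooth_real :: "'a diffeology \<Rightarrow> ('a \<Rightarrow> real) \<Rightarrow> bool" where
  "smooth_real X h \<longleftrightarrow> (\<forall>n U p. plot X n U p \<longrightarrow> smooth_fun n U (h \<circ> p))"

definition subset_diffeology :: "'a diffeology \<Rightarrow> 'a set \<Rightarrow> 'a diffeology" where
  "subset_diffeology X A = \<lparr>dspace = A, plot = (\<lambda>n U p. plot X n U p \<and> p ` U \<subseteq> A)\<rparr>"

definition prod_diffeology :: "'a diffeology \<Rightarrow> 'b diffeology \<Rightarrow> ('a \<times> 'b) diffeology" where
  "prod_diffeology X Z = \<lparr>dspace = dspace X \<times> dspace Z,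
     plot = (\<lambda>n U p. plot X n U (fst \<circ> p) \<and> plot Z n U (snd \<circ> p))\<rparr>"

definition sum_diffeology :: "'a diffeology \<Rightarrow> 'b diffeology \<Rightarrow> ('a + 'b) diffeology" where
  "sum_diffeology X Z = \<lparr>dspace = dspace X <+> dspace Z,
     plot = (\<lambda>n U p. openin (Euclidean_space n) U \<and> near_each n U (\<lambda>V.
        (\<exists>q. plot X n V q \<and> (\<forall>v\<in>V. p v = Inl (q v))) \<or>
        (\<exists>q. plot Z n V q \<and> (\<forall>v\<in>V. p v = Inr (q v)))))\<rparr>"

text \<open>The pushforward to the set \<open>B\<close>, i.e. the finest diffeology on \<open>B\<close> that makes \<open>\<phi>\<close> smooth.
  The constant plots are automatic only when \<open>\<phi>\<close> is onto \<open>B\<close>.\<close>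

definition pushforward_diffeology :: "'a diffeology \<Rightarrow> ('a \<Rightarrow> 'b) \<Rightarrow> 'b set \<Rightarrow> 'b diffeology" where
  "pushforward_diffeology X \<phi> B = \<lparr>dspace = B,
     plot = (\<lambda>n U p. openin (Euclidean_space n) U \<and> p ` U \<subseteq> B \<and> near_each n U (\<lambda>V.
        (\<exists>b. \<forall>v\<in>V. p v = b) \<or> (\<exists>q. plot X n V q \<and> (\<forall>v\<in>V. p v = \<phi> (q v)))))\<rparr>"

definition diffeomorphism_onto_image ::
  "'a diffeology \<Rightarrow> 'a set \<Rightarrow> 'b diffeology \<Rightarrow> ('a \<Rightarrow> 'b) \<Rightarrow> bool" where
  "diffeomorphism_onto_image X Y Z f \<longleftrightarrow>
     Y \<subseteq> dspace X \<and> f ` Y \<subseteq> dspace Z \<and> inj_on f Y \<and>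
     dsmooth (subset_diffeology X Y) (subset_diffeology Z (f ` Y)) f \<and>
     dsmooth (subset_diffeology Z (f ` Y)) (subset_diffeology X Y) (inv_into Y f)"


section \<open>Differential 1-forms\<close>

text \<open>\<open>\<omega> n U p u i\<close> is the \<open>i\<close>-th coefficient at \<open>u\<close> of the form \<open>\<omega>(p)\<close> on \<open>U\<close>. Coefficients
  that carry no information are set to zero, so that equality of forms is equality of functions and
  the vector space operations are the pointwise ones.\<close>

type_synonym 'a form = "nat \<Rightarrow> rvec set \<Rightarrow> (rvec \<Rightarrow> 'a) \<Rightarrow> rvec \<Rightarrow> rvec"

definition one_forms :: "'a diffeology \<Rightarrow> 'a form set" where
  "one_forms X = {\<omega>.
     (\<forall>n U p u i. \<not> (plot X n U p \<and> u \<in> U \<and> i < n) \<longrightarrow> \<omega> n U p u i = 0) \<and>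
     (\<forall>n U p q. plot X n U p \<and> (\<forall>u\<in>U. p u = q u) \<longrightarrow> \<omega> n U p = \<omega> n U q) \<and>
     (\<forall>n U p. plot X n U p \<longrightarrow> (\<forall>i<n. smooth_fun n U (\<lambda>u. \<omega> n U p u i))) \<and>
     (\<forall>n U p m W F. plot X n U p \<and> openin (Euclidean_space m) W \<and> smooth_map m W n U F \<longrightarrow>
        (\<forall>w\<in>W. \<forall>i<m. \<omega> m W (p \<circ> F) w i = (\<Sum>k<n. \<omega> n U p (F w) k * pdiff i (\<lambda>v. F v k) w)))}"

definition form_scale :: "real \<Rightarrow> 'a form \<Rightarrow> 'a form" where
  "form_scale c \<omega> = (\<lambda>n U p u i. c * \<omega> n U p u i)"

definition one_forms_diffeology :: "'a diffeology \<Rightarrow> 'a form diffeology" where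
  "one_forms_diffeology X = \<lparr>dspace = one_forms X,
     plot = (\<lambda>n U r. openin (Euclidean_space n) U \<and> r ` U \<subseteq> one_forms X \<and>
        (\<forall>m U' q. plot X m U' q \<longrightarrow> (\<forall>i<m. smooth_fun (n + m) (prod_dom n U m U')
           (\<lambda>w. r (proj1 n w) m U' q (proj2 n w) i))))\<rparr>"

definition vanishing_forms :: "'a diffeology \<Rightarrow> 'a \<Rightarrow> 'a form set" where
  "vanishing_forms X x = {\<omega> \<in> one_forms X.
     \<forall>n U p. plot X n U p \<and> 0 \<in> U \<and> p 0 = x \<longrightarrow> \<omega> n U p 0 = 0}"

definition form_pullback :: "'a diffeology \<Rightarrow> ('a \<Rightarrow> 'b) \<Rightarrow> 'b form \<Rightarrow> 'a form" where
  "form_pullback X \<phi> \<omega> = (\<lambda>n U p u i. if plot X n U p then \<omega> n U (\<phi> \<circ> p) u i else 0)"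

definition d_form :: "'a diffeology \<Rightarrow> ('a \<Rightarrow> real) \<Rightarrow> 'a form" where
  "d_form X h = (\<lambda>n U p u i. if plot X n U p \<and> u \<in> U \<and> i < n then pdiff i (h \<circ> p) u else 0)"


section \<open>Vector pseudo-bundles\<close>

text \<open>The points of the total space are pairs whose first component is the base point, so the
  projection is \<^const>\<open>fst\<close>. The operations matter only on elements of a common fibre. The record
  carries the data only; the pseudo-bundles used below are all constructed from 1-forms.\<close>

record ('b, 'f) pseudo_bundle =
  base :: "'b diffeology"
  tot :: "('b \<times> 'f) diffeology"
  vadd :: "'b \<times> 'f \<Rightarrow> 'b \<times> 'f \<Rightarrow> 'b \<times> 'f"
  vscale :: "real \<Rightarrow> 'b \<times> 'f \<Rightarrow> 'b \<times> 'f"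
  vzero :: "'b \<Rightarrow> 'b \<times> 'f"

definition fibre :: "('b, 'f) pseudo_bundle \<Rightarrow> 'b \<Rightarrow> ('b \<times> 'f) set" where
  "fibre V x = {v \<in> dspace (tot V). fst v = x}"

definition lincomb :: "('b, 'f) pseudo_bundle \<Rightarrow> 'b \<Rightarrow> (real \<times> ('b \<times> 'f)) list \<Rightarrow> 'b \<times> 'f" where
  "lincomb V x cvs = foldr (\<lambda>(c, v) r. vadd V (vscale V c v) r) cvs (vzero V x)"

text \<open>Sections are undefined outside the base, so that equal sections are equal functions.\<close>

definition smooth_sections :: "('b, 'f) pseudo_bundle \<Rightarrow> ('b \<Rightarrow> 'b \<times> 'f) set" where
  "smooth_sections V = {s \<in> (\<Pi>\<^sub>E x\<in>dspace (base V). fibre V x). dsmooth (base V) (tot V) s}"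

definition sections_diffeology :: "('b, 'f) pseudo_bundle \<Rightarrow> ('b \<Rightarrow> 'b \<times> 'f) diffeology" where
  "sections_diffeology V = \<lparr>dspace = smooth_sections V,
     plot = (\<lambda>n U r. openin (Euclidean_space n) U \<and> r ` U \<subseteq> smooth_sections V \<and>
        (\<forall>m U' q. plot (base V) m U' q \<longrightarrow>
           plot (tot V) (n + m) (prod_dom n U m U') (\<lambda>w. r (proj1 n w) (q (proj2 n w)))))\<rparr>"

definition sec_add where
  "sec_add V s t = (\<lambda>x\<in>dspace (base V). vadd V (s x) (t x))"

definition sec_scale where
  "sec_scale V h s = (\<lambda>x\<in>dspace (base V). vscale V (h x) (s x))"

definition sec_diff where
  "sec_diff V s t = (\<lambda>x\<in>dspace (base V). vadd V (s x) (vscale V (- 1) (t x)))"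


subsection \<open>Duals\<close>

text \<open>Functionals on a fibre are extended by zero, so that they form a linear subspace of the
  space of all real functions on the type of the total space.\<close>

definition smooth_dual :: "('b, 'f) pseudo_bundle \<Rightarrow> 'b \<Rightarrow> ('b \<times> 'f \<Rightarrow> real) set" where
  "smooth_dual V x = {\<phi>.
     (\<forall>v. v \<notin> fibre V x \<longrightarrow> \<phi> v = 0) \<and>
     (\<forall>v\<in>fibre V x. \<forall>w\<in>fibre V x. \<phi> (vadd V v w) = \<phi> v + \<phi> w) \<and>
     (\<forall>c. \<forall>v\<in>fibre V x. \<phi> (vscale V c v) = c * \<phi> v) \<and>
     smooth_real (subset_diffeology (tot V) (fibre V x)) \<phi>}"

definition dual_bundle :: "('b, 'f) pseudo_bundle \<Rightarrow> ('b, 'b \<times> 'f \<Rightarrow> real) pseudo_bundle" where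
  "dual_bundle V = \<lparr>
     base = base V,
     tot = \<lparr>dspace = (SIGMA x : dspace (base V). smooth_dual V x),
       plot = (\<lambda>n U p. openin (Euclidean_space n) U \<and>
         p ` U \<subseteq> (SIGMA x : dspace (base V). smooth_dual V x) \<and>
         plot (base V) n U (fst \<circ> p) \<and>
         (\<forall>m U' q. plot (tot V) m U' q \<longrightarrow>
            smooth_on_subset (n + m)
              {w \<in> prod_dom n U m U'. fst (p (proj1 n w)) = fst (q (proj2 n w))}
              (\<lambda>w. snd (p (proj1 n w)) (q (proj2 n w)))))\<rparr>,
     vadd = (\<lambda>a b. (fst a, \<lambda>v. snd a v + snd b v)),
     vscale = (\<lambda>c a. (fst a, \<lambda>v. c * snd a v)),
     vzero = (\<lambda>x. (x, \<lambda>v. 0))\<rparr>"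


subsection \<open>Tensor products\<close>

text \<open>The list \<open>[(v\<^sub>1, w\<^sub>1), \<dots>, (v\<^sub>k, w\<^sub>k)]\<close> stands for the formal sum
  \<open>v\<^sub>1 \<otimes> w\<^sub>1 + \<dots> + v\<^sub>k \<otimes> w\<^sub>k\<close> of elements of the fibres over \<open>x\<close>. The relation is the congruence
  generated by commutativity of the sum and the bilinearity relations; its classes are the elements
  of the algebraic tensor product of the two fibres.\<close>

inductive tensor_eq for V :: "('b, 'f) pseudo_bundle" and W :: "('b, 'g) pseudo_bundle" and x :: 'b
where
  refl: "set zs \<subseteq> fibre V x \<times> fibre W x \<Longrightarrow> tensor_eq V W x zs zs"
| sym: "tensor_eq V W x zs zs' \<Longrightarrow> tensor_eq V W x zs' zs"
| trans: "tensor_eq V W x zs zs' \<Longrightarrow> tensor_eq V W x zs' zs'' \<Longrightarrow> tensor_eq V W x zs zs''"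
| cong: "tensor_eq V W x zs zs' \<Longrightarrow> set us \<subseteq> fibre V x \<times> fibre W x \<Longrightarrow>
    set vs \<subseteq> fibre V x \<times> fibre W x \<Longrightarrow> tensor_eq V W x (us @ zs @ vs) (us @ zs' @ vs)"
| swap: "a \<in> fibre V x \<times> fibre W x \<Longrightarrow> b \<in> fibre V x \<times> fibre W x \<Longrightarrow> tensor_eq V W x [a, b] [b, a]"
| add_left: "v \<in> fibre V x \<Longrightarrow> v' \<in> fibre V x \<Longrightarrow> w \<in> fibre W x \<Longrightarrow>
    tensor_eq V W x [(vadd V v v', w)] [(v, w), (v', w)]"
| add_right: "v \<in> fibre V x \<Longrightarrow> w \<in> fibre W x \<Longrightarrow> w' \<in> fibre W x \<Longrightarrow>
    tensor_eq V W x [(v, vadd W w w')] [(v, w), (v, w')]"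
| scale: "v \<in> fibre V x \<Longrightarrow> w \<in> fibre W x \<Longrightarrow>
    tensor_eq V W x [(vscale V c v, w)] [(v, vscale W c w)]"
| zero: "w \<in> fibre W x \<Longrightarrow> tensor_eq V W x [(vzero V x, w)] []"

definition tensor_class where
  "tensor_class V W x zs = {zs'. tensor_eq V W x zs zs'}"

definition tensor_bundle :: "('b, 'f) pseudo_bundle \<Rightarrow> ('b, 'g) pseudo_bundle \<Rightarrow>
    ('b, (('b \<times> 'f) \<times> ('b \<times> 'g)) list set) pseudo_bundle" where
  "tensor_bundle V W = \<lparr>
     base = base V,
     tot = \<lparr>dspace = {(x, tensor_class V W x zs) | x zs.
           x \<in> dspace (base V) \<and> set zs \<subseteq> fibre V x \<times> fibre W x},
       plot = (\<lambda>n U p. openin (Euclidean_space n) U \<and> plot (base V) n U (fst \<circ> p) \<and>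
         near_each n U (\<lambda>U'. \<exists>pqs.
           (\<forall>(p1, p2)\<in>set pqs. plot (tot V) n U' p1 \<and> plot (tot W) n U' p2 \<and>
              (\<forall>u\<in>U'. fst (p1 u) = fst (p u) \<and> fst (p2 u) = fst (p u))) \<and>
           (\<forall>u\<in>U'. snd (p u) =
              tensor_class V W (fst (p u)) (map (\<lambda>(p1, p2). (p1 u, p2 u)) pqs))))\<rparr>,
     vadd = (\<lambda>a b. (fst a, \<Union>zs\<in>snd a. \<Union>zs'\<in>snd b. tensor_class V W (fst a) (zs @ zs'))),
     vscale = (\<lambda>c a. (fst a, \<Union>zs\<in>snd a.
        tensor_class V W (fst a) (map (\<lambda>(v, w). (vscale V c v, w)) zs))),
     vzero = (\<lambda>x. (x, tensor_class V W x []))\<rparr>"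

definition pure_tensor where
  "pure_tensor V W v w = (fst v, tensor_class V W (fst v) [(v, w)])"

text \<open>\<open>\<phi> \<otimes> \<psi>\<close>, for linear maps \<open>\<phi>\<close>, \<open>\<psi>\<close> into the fibres over \<open>x\<close> of \<open>V\<close>, \<open>W\<close>. The union is over
  the representatives of one tensor, all of which give the same class.\<close>

definition tensor_map where
  "tensor_map V W x \<phi> \<psi> \<tau> = (x, \<Union>zs\<in>snd \<tau>. tensor_class V W x (map (map_prod \<phi> \<psi>) zs))"

text \<open>For \<open>\<tau> = \<Sum>\<^sub>i \<alpha>\<^sub>i \<otimes> \<beta>\<^sub>i\<close> in the fibre over \<open>x\<close> and a linear functional \<open>\<phi>\<close>, these are
  \<open>\<Sum>\<^sub>i \<phi>(\<alpha>\<^sub>i) \<beta>\<^sub>i\<close> and \<open>\<Sum>\<^sub>i \<phi>(\<beta>\<^sub>i) \<alpha>\<^sub>i\<close>.\<close>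

definition contract_fst where
  "contract_fst V x \<phi> \<tau> = (THE b. \<forall>zs\<in>snd \<tau>. b = lincomb V x (map (\<lambda>(\<alpha>, \<beta>). (\<phi> \<alpha>, \<beta>)) zs))"

definition contract_snd where
  "contract_snd V x \<phi> \<tau> = (THE b. \<forall>zs\<in>snd \<tau>. b = lincomb V x (map (\<lambda>(\<alpha>, \<beta>). (\<phi> \<beta>, \<alpha>)) zs))"


subsection \<open>Pseudo-metrics\<close>

definition finite_dimensional :: "('b, 'f) pseudo_bundle \<Rightarrow> bool" where
  "finite_dimensional V \<longleftrightarrow> (\<forall>x\<in>dspace (base V). \<exists>es. set es \<subseteq> fibre V x \<and>
     (\<forall>v\<in>fibre V x. \<exists>cs. length cs = length es \<and> v = lincomb V x (zip cs es)))"

text \<open>Dimension of a linear subspace of the space of real functions on a type.\<close>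

abbreviation fun_dim :: "('v \<Rightarrow> real) set \<Rightarrow> nat" where
  "fun_dim \<equiv> vector_space.dim (\<lambda>c \<phi> v. c * \<phi> v)"

text \<open>A pseudo-metric is a smooth section \<open>G\<close> of \<open>V\<^sup>* \<otimes> V\<^sup>*\<close>. It is represented by the
  bilinear forms \<open>g x\<close> on the fibres that are associated to the elements \<open>G x\<close>, i.e.
  \<open>g x v w = \<Sum>\<^sub>i \<phi>\<^sub>i(v) \<psi>\<^sub>i(w)\<close> for \<open>G x = \<Sum>\<^sub>i \<phi>\<^sub>i \<otimes> \<psi>\<^sub>i\<close>. The rank of \<open>g x\<close> is the dimension of the
  image of \<open>v \<mapsto> g x v\<close>.\<close>

type_synonym ('b, 'f) fibre_forms = "'b \<Rightarrow> 'b \<times> 'f \<Rightarrow> 'b \<times> 'f \<Rightarrow> real"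

definition pseudo_metric :: "('b, 'f) pseudo_bundle \<Rightarrow> ('b, 'f) fibre_forms \<Rightarrow> bool" where
  "pseudo_metric V g \<longleftrightarrow> finite_dimensional V \<and>
     (\<exists>G\<in>smooth_sections (tensor_bundle (dual_bundle V) (dual_bundle V)).
        \<forall>x\<in>dspace (base V). \<forall>v\<in>fibre V x. \<forall>w\<in>fibre V x. \<forall>zs\<in>snd (G x).
          g x v w = (\<Sum>(\<phi>, \<psi>)\<leftarrow>zs. snd \<phi> v * snd \<psi> w)) \<and>
     (\<forall>x\<in>dspace (base V).
        (\<forall>v\<in>fibre V x. \<forall>w\<in>fibre V x. g x v w = g x w v) \<and>
        (\<forall>v\<in>fibre V x. 0 \<le> g x v v) \<and>
        fun_dim ((\<lambda>v w. if w \<in> fibre V x then g x v w else 0) ` fibre V x)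
          = fun_dim (smooth_dual V x))"


section \<open>The pseudo-bundle of values of 1-forms\<close>

definition form_class :: "'a diffeology \<Rightarrow> 'a \<Rightarrow> 'a form \<Rightarrow> 'a form set" where
  "form_class X x \<omega> = {\<eta> \<in> one_forms X. \<eta> - \<omega> \<in> vanishing_forms X x}"

definition Lambda1 :: "'a diffeology \<Rightarrow> ('a, 'a form set) pseudo_bundle" where
  "Lambda1 X = \<lparr>
     base = X,
     tot = pushforward_diffeology (prod_diffeology X (one_forms_diffeology X))
       (\<lambda>(x, \<omega>). (x, form_class X x \<omega>))
       ((\<lambda>(x, \<omega>). (x, form_class X x \<omega>)) ` (dspace X \<times> one_forms X)),
     vadd = (\<lambda>a b. (fst a, \<Union>\<omega>\<in>snd a. \<Union>\<eta>\<in>snd b. form_class X (fst a) (\<omega> + \<eta>))),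
     vscale = (\<lambda>c a. (fst a, \<Union>\<omega>\<in>snd a. form_class X (fst a) (form_scale c \<omega>))),
     vzero = (\<lambda>x. (x, vanishing_forms X x))\<rparr>"

abbreviation Lambda1_tensor where
  "Lambda1_tensor X \<equiv> tensor_bundle (Lambda1 X) (Lambda1 X)"

text \<open>The map \<open>\<phi>\<^sub>\<Lambda>\<^sup>*\<close> from the fibre over \<open>\<phi> x\<close> to the fibre over \<open>x\<close>.\<close>

definition Lambda_pullback where
  "Lambda_pullback X \<phi> x \<alpha> = (x, \<Union>\<omega>\<in>snd \<alpha>. form_class X x (form_pullback X \<phi> \<omega>))"

definition d_sec :: "'a diffeology \<Rightarrow> ('a \<Rightarrow> real) \<Rightarrow> 'a \<Rightarrow> 'a \<times> 'a form set" where
  "d_sec X h = (\<lambda>x\<in>dspace X. (x, form_class X x (d_form X h)))"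


section \<open>Levi-Civita connections\<close>

type_synonym 'a lsection = "'a \<Rightarrow> 'a \<times> 'a form set"
type_synonym 'a lconnection =
  "'a lsection \<Rightarrow> 'a \<Rightarrow> 'a \<times> (('a \<times> 'a form set) \<times> ('a \<times> 'a form set)) list set"
type_synonym 'a lmetric = "('a, 'a form set) fibre_forms"

definition connection :: "'a diffeology \<Rightarrow> 'a lconnection \<Rightarrow> bool" where
  "connection X nabla \<longleftrightarrow>
     dsmooth (sections_diffeology (Lambda1 X)) (sections_diffeology (Lambda1_tensor X)) nabla \<and>
     (\<forall>s\<in>smooth_sections (Lambda1 X). \<forall>t\<in>smooth_sections (Lambda1 X).
        nabla (sec_add (Lambda1 X) s t) = sec_add (Lambda1_tensor X) (nabla s) (nabla t)) \<and>
     (\<forall>c. \<forall>s\<in>smooth_sections (Lambda1 X).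
        nabla (sec_scale (Lambda1 X) (\<lambda>_. c) s) = sec_scale (Lambda1_tensor X) (\<lambda>_. c) (nabla s)) \<and>
     (\<forall>h. \<forall>s\<in>smooth_sections (Lambda1 X). smooth_real X h \<longrightarrow>
        nabla (sec_scale (Lambda1 X) h s) =
          sec_add (Lambda1_tensor X)
            (\<lambda>x\<in>dspace X. pure_tensor (Lambda1 X) (Lambda1 X) (d_sec X h x) (s x))
            (sec_scale (Lambda1_tensor X) h (nabla s)))"

definition covariant_derivative ::
  "'a diffeology \<Rightarrow> 'a lmetric \<Rightarrow> 'a lconnection \<Rightarrow> 'a lsection \<Rightarrow> 'a lsection \<Rightarrow> 'a lsection" where
  "covariant_derivative X g nabla t s =
     (\<lambda>x\<in>dspace X. contract_fst (Lambda1 X) x (\<lambda>\<alpha>. g x (t x) \<alpha>) (nabla s x))"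

definition sec_apply :: "'a diffeology \<Rightarrow> 'a lmetric \<Rightarrow> 'a lsection \<Rightarrow> ('a \<Rightarrow> real) \<Rightarrow> 'a \<Rightarrow> real" where
  "sec_apply X g t h = (\<lambda>x. g x (t x) (d_sec X h x))"

definition is_lie_bracket ::
  "'a diffeology \<Rightarrow> 'a lmetric \<Rightarrow> 'a lsection \<Rightarrow> 'a lsection \<Rightarrow> 'a lsection \<Rightarrow> bool" where
  "is_lie_bracket X g s t r \<longleftrightarrow> r \<in> smooth_sections (Lambda1 X) \<and>
     (\<forall>h. smooth_real X h \<longrightarrow> (\<forall>x\<in>dspace X.
        sec_apply X g r h x
          = sec_apply X g s (sec_apply X g t h) x - sec_apply X g t (sec_apply X g s h) x))"

definition lie_bracket :: "'a diffeology \<Rightarrow> 'a lmetric \<Rightarrow> 'a lsection \<Rightarrow> 'a lsection \<Rightarrow> 'a lsection" where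
  "lie_bracket X g s t = (THE r. is_lie_bracket X g s t r)"

definition lie_bracket_well_defined :: "'a diffeology \<Rightarrow> 'a lmetric \<Rightarrow> bool" where
  "lie_bracket_well_defined X g \<longleftrightarrow>
     (\<forall>s\<in>smooth_sections (Lambda1 X). \<forall>t\<in>smooth_sections (Lambda1 X).
        \<exists>!r. is_lie_bracket X g s t r)"

definition symmetric_connection :: "'a diffeology \<Rightarrow> 'a lmetric \<Rightarrow> 'a lconnection \<Rightarrow> bool" where
  "symmetric_connection X g nabla \<longleftrightarrow>
     (\<forall>s\<in>smooth_sections (Lambda1 X). \<forall>t\<in>smooth_sections (Lambda1 X).
        sec_diff (Lambda1 X) (covariant_derivative X g nabla s t) (covariant_derivative X g nabla t s)
          = lie_bracket X g s t)"

text \<open>The two summands on the right are \<open>g(\<nabla>s, t)\<close> and \<open>g(s, \<nabla>t)\<close>.\<close>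

definition metric_connection :: "'a diffeology \<Rightarrow> 'a lmetric \<Rightarrow> 'a lconnection \<Rightarrow> bool" where
  "metric_connection X g nabla \<longleftrightarrow>
     (\<forall>s\<in>smooth_sections (Lambda1 X). \<forall>t\<in>smooth_sections (Lambda1 X).
        d_sec X (\<lambda>x. g x (s x) (t x)) =
          sec_add (Lambda1 X)
            (\<lambda>x\<in>dspace X. contract_snd (Lambda1 X) x (\<lambda>\<beta>. g x \<beta> (t x)) (nabla s x))
            (\<lambda>x\<in>dspace X. contract_snd (Lambda1 X) x (\<lambda>\<beta>. g x (s x) \<beta>) (nabla t x)))"

definition levi_civita :: "'a diffeology \<Rightarrow> 'a lmetric \<Rightarrow> 'a lconnection \<Rightarrow> bool" where
  "levi_civita X g nabla \<longleftrightarrow>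
     connection X nabla \<and> symmetric_connection X g nabla \<and> metric_connection X g nabla"


section \<open>Gluing\<close>

definition glue_rel :: "'a diffeology \<Rightarrow> 'b diffeology \<Rightarrow> 'a set \<Rightarrow> ('a \<Rightarrow> 'b) \<Rightarrow> ('a + 'b) rel" where
  "glue_rel X1 X2 Y f =
     (let S = {(Inl y, Inr (f y)) | y. y \<in> Y} in (S \<union> S\<inverse>)\<^sup>*)
       \<inter> (dspace X1 <+> dspace X2) \<times> (dspace X1 <+> dspace X2)"

text \<open>The natural maps of \<open>X1\<close> and \<open>X2\<close> into the glued space.\<close>

definition glue_in1 where
  "glue_in1 X1 X2 Y f x = glue_rel X1 X2 Y f `` {Inl x}"

definition glue_in2 where
  "glue_in2 X1 X2 Y f x = glue_rel X1 X2 Y f `` {Inr x}"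

definition glue ::
  "'a diffeology \<Rightarrow> 'b diffeology \<Rightarrow> 'a set \<Rightarrow> ('a \<Rightarrow> 'b) \<Rightarrow> ('a + 'b) set diffeology" where
  "glue X1 X2 Y f = pushforward_diffeology (sum_diffeology X1 X2)
     (\<lambda>z. glue_rel X1 X2 Y f `` {z}) ((dspace X1 <+> dspace X2) // glue_rel X1 X2 Y f)"

definition glue_inv1 where
  "glue_inv1 X1 X2 Y f = inv_into (dspace X1) (glue_in1 X1 X2 Y f)"

definition glue_inv2 where
  "glue_inv2 X1 X2 Y f = inv_into (dspace X2) (glue_in2 X1 X2 Y f)"

definition D1_Omega :: "'a diffeology \<Rightarrow> 'a set \<Rightarrow> 'a form diffeology" where
  "D1_Omega X1 Y = pushforward_diffeology (one_forms_diffeology X1)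
     (form_pullback (subset_diffeology X1 Y) (\<lambda>y. y)) (one_forms (subset_diffeology X1 Y))"

definition D2_Omega :: "'a diffeology \<Rightarrow> 'b diffeology \<Rightarrow> 'a set \<Rightarrow> ('a \<Rightarrow> 'b) \<Rightarrow> 'a form diffeology" where
  "D2_Omega X1 X2 Y f = pushforward_diffeology (one_forms_diffeology X2)
     (form_pullback (subset_diffeology X1 Y) f \<circ>
        form_pullback (subset_diffeology X2 (f ` Y)) (\<lambda>z. z)) (one_forms (subset_diffeology X1 Y))"

text \<open>\<open>i\<^sub>\<Lambda>\<^sup>*\<close> and \<open>f\<^sub>\<Lambda>\<^sup>* j\<^sub>\<Lambda>\<^sup>*\<close>, with values in the fibre over \<open>y\<close>.\<close>

definition restr1 where
  "restr1 X1 Y y = Lambda_pullback (subset_diffeology X1 Y) (\<lambda>y. y) y"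

definition restr2 where
  "restr2 X1 X2 Y f y = Lambda_pullback (subset_diffeology X1 Y) f y \<circ>
     Lambda_pullback (subset_diffeology X2 (f ` Y)) (\<lambda>z. z) (f y)"

definition compatible_at where
  "compatible_at X1 X2 Y f y \<alpha>1 \<alpha>2 \<longleftrightarrow>
     \<alpha>1 \<in> fibre (Lambda1 X1) y \<and> \<alpha>2 \<in> fibre (Lambda1 X2) (f y) \<and>
     restr1 X1 Y y \<alpha>1 = restr2 X1 X2 Y f y \<alpha>2"

definition compatible_sections where
  "compatible_sections X1 X2 Y f s1 s2 \<longleftrightarrow>
     (\<forall>y\<in>Y. compatible_at X1 X2 Y f y (s1 y) (s2 (f y)))"

text \<open>The maps \<open>\<rho>\<^sub>1\<close> and \<open>\<rho>\<^sub>2\<close> on the fibre over \<open>x\<close>.\<close>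

definition rho1 where
  "rho1 X1 X2 Y f x = Lambda_pullback X1 (glue_in1 X1 X2 Y f) (glue_inv1 X1 X2 Y f x)"

definition rho2 where
  "rho2 X1 X2 Y f x = Lambda_pullback X2 (glue_in2 X1 X2 Y f) (glue_inv2 X1 X2 Y f x)"

definition sec_part1 where
  "sec_part1 X1 X2 Y f s =
     (\<lambda>x\<in>dspace X1. let z = glue_in1 X1 X2 Y f x in rho1 X1 X2 Y f z (s z))"

definition sec_part2 where
  "sec_part2 X1 X2 Y f s =
     (\<lambda>x\<in>dspace X2. let z = glue_in2 X1 X2 Y f x in rho2 X1 X2 Y f z (s z))"

definition compatible_metrics ::
  "'a diffeology \<Rightarrow> 'b diffeology \<Rightarrow> 'a set \<Rightarrow> ('a \<Rightarrow> 'b) \<Rightarrow> 'a lmetric \<Rightarrow> 'b lmetric \<Rightarrow> bool" where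
  "compatible_metrics X1 X2 Y f g1 g2 \<longleftrightarrow>
     (\<forall>y\<in>Y. \<forall>\<alpha>1 \<alpha>2 \<beta>1 \<beta>2.
        compatible_at X1 X2 Y f y \<alpha>1 \<alpha>2 \<and> compatible_at X1 X2 Y f y \<beta>1 \<beta>2 \<longrightarrow>
        g1 y \<alpha>1 \<beta>1 = g2 (f y) \<alpha>2 \<beta>2)"

definition glued_metric ::
  "'a diffeology \<Rightarrow> 'b diffeology \<Rightarrow> 'a set \<Rightarrow> ('a \<Rightarrow> 'b) \<Rightarrow> 'a lmetric \<Rightarrow> 'b lmetric
     \<Rightarrow> ('a + 'b) set lmetric" where
  "glued_metric X1 X2 Y f g1 g2 = (\<lambda>x \<alpha> \<beta>.
     let h1 = g1 (glue_inv1 X1 X2 Y f x) (rho1 X1 X2 Y f x \<alpha>) (rho1 X1 X2 Y f x \<beta>);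
         h2 = g2 (glue_inv2 X1 X2 Y f x) (rho2 X1 X2 Y f x \<alpha>) (rho2 X1 X2 Y f x \<beta>)
     in if x \<in> glue_in1 X1 X2 Y f ` (dspace X1 - Y) then h1
        else if x \<in> glue_in2 X1 X2 Y f ` (dspace X2 - f ` Y) then h2
        else (h1 + h2) / 2)"

definition compatible_connections ::
  "'a diffeology \<Rightarrow> 'b diffeology \<Rightarrow> 'a set \<Rightarrow> ('a \<Rightarrow> 'b) \<Rightarrow> 'a lconnection \<Rightarrow> 'b lconnection \<Rightarrow> bool" where
  "compatible_connections X1 X2 Y f nabla1 nabla2 \<longleftrightarrow>
     (\<forall>s1\<in>smooth_sections (Lambda1 X1). \<forall>s2\<in>smooth_sections (Lambda1 X2).
        compatible_sections X1 X2 Y f s1 s2 \<longrightarrow>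
        (\<forall>y\<in>Y. let L = Lambda1 (subset_diffeology X1 Y) in
           tensor_map L L y (restr1 X1 Y y) (restr1 X1 Y y) (nabla1 s1 y) =
           tensor_map L L y (restr2 X1 X2 Y f y) (restr2 X1 X2 Y f y) (nabla2 s2 (f y))))"

definition glued_connection ::
  "'a diffeology \<Rightarrow> 'b diffeology \<Rightarrow> 'a set \<Rightarrow> ('a \<Rightarrow> 'b) \<Rightarrow> 'a lconnection \<Rightarrow> 'b lconnection
     \<Rightarrow> ('a + 'b) set lconnection" where
  "glued_connection X1 X2 Y f nabla1 nabla2 s = (\<lambda>x\<in>dspace (glue X1 X2 Y f).
     THE \<tau>. \<tau> \<in> fibre (Lambda1_tensor (glue X1 X2 Y f)) x \<and>
       (x \<in> glue_in1 X1 X2 Y f ` dspace X1 \<longrightarrow>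
          (let x1 = glue_inv1 X1 X2 Y f x in
           tensor_map (Lambda1 X1) (Lambda1 X1) x1 (rho1 X1 X2 Y f x) (rho1 X1 X2 Y f x) \<tau>
             = nabla1 (sec_part1 X1 X2 Y f s) x1)) \<and>
       (x \<in> glue_in2 X1 X2 Y f ` dspace X2 \<longrightarrow>
          (let x2 = glue_inv2 X1 X2 Y f x in
           tensor_map (Lambda1 X2) (Lambda1 X2) x2 (rho2 X1 X2 Y f x) (rho2 X1 X2 Y f x) \<tau>
             = nabla2 (sec_part2 X1 X2 Y f s) x2)))"

end

theory Submission
  imports Defs
begin

text \<open>The key point is that compatible pseudo-metrics leave no freedom on the overlap. Values of 1-forms on
plots at \<open>0\<close> are smooth functionals on \<open>\<Lambda>\<^sup>1\<^sub>x(X)\<close> and separate its points, so a pseudo-metric, whose rank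
is the dimension of the smooth dual, is nondegenerate on every fibre
(\<open>pseudo_metric_nondegenerate\<close>). Equality of the two diffeologies on \<open>\<Omega>\<^sup>1(Y)\<close> makes every value on
\<open>X1\<close> over \<open>y\<close> compatible with some value on \<open>X2\<close> over \<open>f y\<close>. If a value \<open>\<alpha>\<close> on \<open>X1\<close> restricts to zero on \<open>Y\<close>, it is
compatible with \<open>0\<close>; compatibility of the metrics gives \<open>g1(\<alpha>, \<beta>) = g2(0, \<beta>') = 0\<close> for all \<open>\<beta>\<close>, hence \<open>\<alpha> = 0\<close>
(\<open>metric_reflects_vanishing\<close>). So both restriction maps to \<open>\<Lambda>\<^sup>1\<^sub>y(Y)\<close> are injective with the
same image, and over every point of the glued space each projection \<open>\<rho>\<^sub>i\<close> that is defined there is a linear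
isomorphism.

This is abstracted as a \<^emph>\<open>form embedding\<close> \<open>j : X \<rightarrow> Z\<close>: smooth families of forms on \<open>X\<close> lift locally to
\<open>Z\<close>, and a form on \<open>Z\<close> vanishes at \<open>j x\<close> as soon as its pullback vanishes at \<open>x\<close>. Along a form embedding
the fibres of \<open>\<Lambda>\<^sup>1\<close>, and of its tensor square, over \<open>x\<close> and \<open>j x\<close> are identified, and a family of values or tensors
on \<open>Z\<close> over a plot of \<open>X\<close> is smooth as soon as its image on \<open>X\<close> is smooth
(\<open>Lambda_plot_reflect\<close>, \<open>tensor_plot_reflect\<close>). The form that two matching forms define on a pushout
(\<open>glue_form\<close>) shows that both maps into the glued space are form embeddings (\<open>leg_embedding\<close>).

The induced connection is well defined. On one side the isomorphism \<open>\<rho>\<^sub>i \<otimes> \<rho>\<^sub>i\<close> prescribes its value. On the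
overlap the two prescriptions have the same restriction to \<open>Y\<close>, and restriction is injective on tensors
because an injective linear map of vector spaces has a linear left inverse (\<open>tensor_pullback_inj\<close>).

Finally every identity that makes \<open>\<nabla>\<^sup>\<union>\<close> a Levi-Civita connection is fibrewise and natural for the
isomorphisms \<open>\<rho>\<^sub>i\<close>, so it transfers from \<open>X1\<close> and \<open>X2\<close>. The one step that is not a mere transfer is
symmetry: a smooth function on \<open>X1\<close> need not extend to the glued space, so a Lie bracket on the glued
space cannot be restricted directly. Instead \<open>\<nabla>\<^sub>s t - \<nabla>\<^sub>t s\<close> is shown to be a smooth section that satisfies the
equation of the bracket for every smooth function on the glued space, because its two parts are the
brackets of the parts; uniqueness of the bracket identifies it (\<open>D_symmetric\<close>).\<close>

section \<open>Smooth functions on open subsets of Euclidean spaces\<close>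

abbreviation ropen :: "nat \<Rightarrow> rvec set \<Rightarrow> bool" where
  "ropen n \<equiv> openin (Euclidean_space n)"

lemma ropen_iff: "ropen n U \<longleftrightarrow> (\<exists>T. open T \<and> U = T \<inter> {x. \<forall>i\<ge>n. x i = 0})"
  by (simp add: Euclidean_space_def openin_subtopology euclidean_product_topology)

lemma ropen_subset: "ropen n U \<Longrightarrow> u \<in> U \<Longrightarrow> i \<ge> n \<Longrightarrow> u i = 0"
  using openin_subset[of "Euclidean_space n" U] by (auto simp: topspace_Euclidean_space)

lemma ropen_preimage:
  assumes W: "ropen m W" and F: "continuous_on W F" and V: "ropen n V"
    and e: "\<And>w i. w \<in> W \<Longrightarrow> n \<le> i \<Longrightarrow> F w i = 0"
  shows "ropen m {w\<in>W. F w \<in> V}"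
proof -
  obtain T where T: "open T" "V = T \<inter> {x. \<forall>i\<ge>n. x i = 0}" using V ropen_iff by auto
  obtain A where A: "open A" "A \<inter> W = F -` T \<inter> W" using F T(1) continuous_on_open_invariant by metis
  obtain B where B: "open B" "W = B \<inter> {x. \<forall>i\<ge>m. x i = 0}" using W ropen_iff by auto
  have "{w\<in>W. F w \<in> V} = F -` T \<inter> W" using e by (auto simp: T(2))
  also have "\<dots> = (A \<inter> B) \<inter> {x. \<forall>i\<ge>m. x i = 0}" using A(2) B(2) by auto
  finally have "{w\<in>W. F w \<in> V} = (A \<inter> B) \<inter> {x. \<forall>i\<ge>m. x i = 0}" .
  then show ?thesis unfolding ropen_iff using open_Int[OF A(1) B(1)] by (intro exI[of _ "A \<inter> B"] conjI)
qed

text \<open>Finitely many coordinates are free in \<open>\<real>\<^sup>n\<close>, so the product topology restricts to the usual one.\<close>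

lemma ropen_box:
  assumes U: "ropen n U" and u: "u \<in> U"
  obtains e where "0 < e"
    and "\<And>v. (\<And>i. i < n \<Longrightarrow> \<bar>v i - u i\<bar> < e) \<Longrightarrow> (\<And>i. i \<ge> n \<Longrightarrow> v i = 0) \<Longrightarrow> v \<in> U"
proof -
  obtain T where T: "open T" "U = T \<inter> {x. \<forall>i\<ge>n. x i = 0}" using U ropen_iff by auto
  have "openin (powertop_real UNIV) T" using T(1) by (simp add: euclidean_product_topology)
  then obtain X where X: "u \<in> PiE UNIV X" "\<And>i. open (X i)" "PiE UNIV X \<subseteq> T"
    using product_topology_open_contains_basis[of "\<lambda>_. euclidean" UNIV T u] u T(2) by auto
  have "\<forall>i. \<exists>e>0. \<forall>t. \<bar>t - u i\<bar> < e \<longrightarrow> t \<in> X i"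
    using X(1,2) by (auto simp: open_dist dist_real_def PiE_iff)
  then obtain e where e: "\<And>i. e i > 0" "\<And>i t. \<bar>t - u i\<bar> < e i \<Longrightarrow> t \<in> X i" by metis
  define d where "d = Min (insert 1 (e ` {..<n}))"
  have d: "d > 0" "\<And>i. i < n \<Longrightarrow> d \<le> e i" using e(1) by (auto simp: d_def)
  show ?thesis
  proof (rule that[OF d(1)])
    fix v assume v: "\<And>i. i < n \<Longrightarrow> \<bar>v i - u i\<bar> < d" "\<And>i. i \<ge> n \<Longrightarrow> v i = 0"
    have "v i \<in> X i" for i
    proof (cases "i < n")
      case True then show ?thesis using v(1)[of i] d(2)[of i] e(2)[of "v i" i] by linarith
    next
      case False
      then have "v i = u i" using v(2) ropen_subset[OF U u] by simp
      then show ?thesis using e(1)[of i] e(2)[of "v i" i] by simp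
    qed
    then have "v \<in> T" using X(3) by (auto simp: PiE_iff)
    then show "v \<in> U" using T(2) v(2) by auto
  qed
qed

text \<open>Partial derivatives at a point of an open set only see the values on that set.\<close>

lemma eventually_upd_in:
  assumes "ropen n U" "u \<in> U" "i < n"
  shows "\<forall>\<^sub>F t in nhds (u i). u(i := t) \<in> U"
proof -
  obtain e where e: "0 < e"
    "\<And>v. (\<And>i. i < n \<Longrightarrow> \<bar>v i - u i\<bar> < e) \<Longrightarrow> (\<And>i. i \<ge> n \<Longrightarrow> v i = 0) \<Longrightarrow> v \<in> U"
    using ropen_box[OF assms(1,2)] by metis
  have "u(i := t) \<in> U" if "dist t (u i) < e" for t
    using that e assms ropen_subset[OF assms(1,2)] by (intro e(2)) (auto simp: dist_real_def)
  then show ?thesis unfolding eventually_nhds_metric using e(1) by blast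
qed

lemma
  assumes "ropen n U" "u \<in> U" "i < n" "\<And>v. v \<in> U \<Longrightarrow> h v = h' v"
  shows pdiff_cong: "pdiff i h u = pdiff i h' u"
    and differentiable_cong: "(\<lambda>t. h (u(i := t))) differentiable (at (u i)) \<longleftrightarrow>
      (\<lambda>t. h' (u(i := t))) differentiable (at (u i))"
proof -
  have ev: "\<forall>\<^sub>F t in nhds (u i). h (u(i := t)) = h' (u(i := t))"
    using eventually_upd_in[OF assms(1-3)] by eventually_elim (use assms(4) in auto)
  show "pdiff i h u = pdiff i h' u" unfolding pdiff_def by (rule deriv_cong_ev[OF ev HOL.refl])
  show "(\<lambda>t. h (u(i := t))) differentiable (at (u i)) \<longleftrightarrow>
      (\<lambda>t. h' (u(i := t))) differentiable (at (u i))"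
    unfolding real_differentiable_def using DERIV_cong_ev[OF HOL.refl ev HOL.refl] by simp
qed

lemma Ck_on_mono: "Ck_on k n U h \<Longrightarrow> V \<subseteq> U \<Longrightarrow> Ck_on k n V h"
  by (induction k arbitrary: h) (auto intro: continuous_on_subset)

lemma Ck_on_cong:
  assumes U: "ropen n U" and h: "\<And>v. v \<in> U \<Longrightarrow> h v = h' v" and c: "Ck_on k n U h"
  shows "Ck_on k n U h'"
  using h c
proof (induction k arbitrary: h h')
  case 0 then show ?case using continuous_on_cong[OF HOL.refl 0(1), of U] by simp
next
  case (Suc k)
  have 1: "continuous_on U h'" using continuous_on_cong[OF HOL.refl Suc.prems(1), of U] Suc.prems(2) by simp
  have "Ck_on k n U (pdiff i h')" if "i < n" for i
  proof (rule Suc.IH)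
    show "pdiff i h v = pdiff i h' v" if "v \<in> U" for v
      by (rule pdiff_cong[OF U that \<open>i < n\<close> Suc.prems(1)])
    show "Ck_on k n U (pdiff i h)" using Suc.prems(2) \<open>i < n\<close> by simp
  qed
  moreover have "(\<lambda>t. h' (u(i := t))) differentiable (at (u i))" if "i < n" "u \<in> U" for i u
    using Suc.prems(2) that differentiable_cong[OF U that(2,1), of h h', OF Suc.prems(1)] by simp
  ultimately show ?case using 1 by simp
qed

lemma Ck_on_lower: "Ck_on (Suc k) n U h \<Longrightarrow> Ck_on k n U h"
  by (induction k arbitrary: h) auto

lemma Ck_on_local:
  assumes U: "ropen n U" and loc: "\<And>u. u \<in> U \<Longrightarrow> \<exists>V. ropen n V \<and> u \<in> V \<and> V \<subseteq> U \<and> Ck_on k n V h"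
  shows "Ck_on k n U h"
  using loc
proof (induction k arbitrary: h)
  have C: "continuous_on U h"
    if l: "\<And>u. u \<in> U \<Longrightarrow> \<exists>V. ropen n V \<and> u \<in> V \<and> V \<subseteq> U \<and> continuous_on V h" for h :: "rvec \<Rightarrow> real"
    unfolding continuous_on_eq_continuous_within
  proof
    fix u assume u: "u \<in> U"
    obtain V where V: "ropen n V" "u \<in> V" "V \<subseteq> U" "continuous_on V h" using l[OF u] by auto
    obtain T where T: "open T" "V = T \<inter> {x. \<forall>i\<ge>n. x i = 0}" using V ropen_iff by auto
    have "at u within V = at u within U"
      using T V(2,3) openin_subset[OF U]
      by (intro at_within_nhd[of u T]) (auto simp: topspace_Euclidean_space)
    then show "continuous (at u within U) h"
      using V(2,4) unfolding continuous_on_eq_continuous_within by metis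
  qed
  { case 0 then show ?case using C by simp }
  { case (Suc k)
    have "continuous_on U h" using Suc.prems by (intro C) force
    moreover have "(\<lambda>t. h (u(i := t))) differentiable (at (u i))" if "i < n" "u \<in> U" for i u
      using Suc.prems[OF that(2)] that(1) by auto
    moreover have "Ck_on k n U (pdiff i h)" if "i < n" for i
      using Suc.prems that by (intro Suc.IH) force
    ultimately show ?case by simp }
qed

lemma Ck_on_const: "Ck_on k n U (\<lambda>_. c)"
proof (induction k arbitrary: c)
  case (Suc k)
  have "pdiff i (\<lambda>_. c) = (\<lambda>_. 0)" for i by (simp add: pdiff_def fun_eq_iff)
  then show ?case using Suc[of 0] by auto
qed auto

lemma continuous_on_coord: "continuous_on U (\<lambda>u::rvec. u j)"
  using continuous_on_product_coordinates[of j] continuous_on_subset by blast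

lemma Ck_on_coord: "Ck_on k n U (\<lambda>u. u j)"
proof (cases k)
  case 0 then show ?thesis by (simp add: continuous_on_coord)
next
  case (Suc l)
  have P: "pdiff i (\<lambda>u. u j) = (\<lambda>_. if i = j then 1 else 0)" for i
    by (cases "i = j") (simp_all add: pdiff_def fun_eq_iff)
  have D: "(\<lambda>t. (u(i := t)) j) differentiable (at (u i))" for u :: rvec and i
    by (cases "i = j") (simp_all add: fun_upd_def)
  show ?thesis unfolding Suc Ck_on.simps P using D Ck_on_const[of l n U] continuous_on_coord[of U j] by blast
qed

lemma pdiff_has_derivative:
  "(\<lambda>t. h (u(i := t))) differentiable (at (u i)) \<Longrightarrow>
    ((\<lambda>t. h (u(i := t))) has_real_derivative pdiff i h u) (at (u i))"
  unfolding pdiff_def by (simp add: DERIV_deriv_iff_real_differentiable)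

lemma Ck_on_add:
  assumes U: "ropen n U"
  shows "Ck_on k n U h \<Longrightarrow> Ck_on k n U h' \<Longrightarrow> Ck_on k n U (\<lambda>u. h u + h' u)"
proof (induction k arbitrary: h h')
  case 0 then show ?case by (auto intro: continuous_intros)
next
  case (Suc k)
  have D: "((\<lambda>t. h (u(i := t)) + h' (u(i := t))) has_real_derivative pdiff i h u + pdiff i h' u) (at (u i))"
    if "i < n" "u \<in> U" for i u
    using Suc.prems that by (intro DERIV_add pdiff_has_derivative) auto
  have "Ck_on k n U (pdiff i (\<lambda>u. h u + h' u))" if "i < n" for i
  proof (rule Ck_on_cong[OF U])
    show "Ck_on k n U (\<lambda>u. pdiff i h u + pdiff i h' u)" using Suc that by auto
    show "pdiff i h v + pdiff i h' v = pdiff i (\<lambda>u. h u + h' u) v" if "v \<in> U" for v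
      using DERIV_imp_deriv[OF D[OF \<open>i < n\<close> that]] by (simp add: pdiff_def[of _ "\<lambda>u. h u + h' u"])
  qed
  then show ?case using Suc.prems D by (auto intro!: continuous_intros simp: real_differentiable_def)
qed

lemma Ck_on_mult:
  assumes U: "ropen n U"
  shows "Ck_on k n U h \<Longrightarrow> Ck_on k n U h' \<Longrightarrow> Ck_on k n U (\<lambda>u. h u * h' u)"
proof (induction k arbitrary: h h')
  case 0 then show ?case by (auto intro: continuous_intros)
next
  case (Suc k)
  have D: "((\<lambda>t. h (u(i := t)) * h' (u(i := t))) has_real_derivative pdiff i h u * h' u + pdiff i h' u * h u) (at (u i))"
    if "i < n" "u \<in> U" for i u
    using DERIV_mult[OF pdiff_has_derivative[of h u i] pdiff_has_derivative[of h' u i]] Suc.prems that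
    by auto
  have "Ck_on k n U (pdiff i (\<lambda>u. h u * h' u))" if "i < n" for i
  proof (rule Ck_on_cong[OF U])
    show "Ck_on k n U (\<lambda>u. pdiff i h u * h' u + pdiff i h' u * h u)"
      using Suc.prems that Ck_on_lower[OF Suc.prems(1)] Ck_on_lower[OF Suc.prems(2)]
      by (intro Ck_on_add[OF U] Suc.IH) simp_all
    show "pdiff i h v * h' v + pdiff i h' v * h v = pdiff i (\<lambda>u. h u * h' u) v" if "v \<in> U" for v
      using DERIV_imp_deriv[OF D[OF \<open>i < n\<close> that]] by (simp add: pdiff_def[of _ "\<lambda>u. h u * h' u"])
  qed
  then show ?case using Suc.prems D by (auto intro!: continuous_intros simp: real_differentiable_def)
qed

lemma smooth_fun_mono: "smooth_fun n U h \<Longrightarrow> V \<subseteq> U \<Longrightarrow> smooth_fun n V h"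
  by (auto simp: smooth_fun_def intro: Ck_on_mono)
lemma smooth_fun_cong: "ropen n U \<Longrightarrow> (\<And>v. v \<in> U \<Longrightarrow> h v = h' v) \<Longrightarrow> smooth_fun n U h \<Longrightarrow> smooth_fun n U h'"
  using Ck_on_cong by (fastforce simp: smooth_fun_def)
lemma smooth_fun_const: "smooth_fun n U (\<lambda>_. c)" by (simp add: smooth_fun_def Ck_on_const)
lemma smooth_fun_coord: "smooth_fun n U (\<lambda>u. u j)" by (simp add: smooth_fun_def Ck_on_coord)
lemma smooth_fun_add: "ropen n U \<Longrightarrow> smooth_fun n U h \<Longrightarrow> smooth_fun n U h' \<Longrightarrow> smooth_fun n U (\<lambda>u. h u + h' u)"
  by (simp add: smooth_fun_def Ck_on_add)
lemma smooth_fun_mult: "ropen n U \<Longrightarrow> smooth_fun n U h \<Longrightarrow> smooth_fun n U h' \<Longrightarrow> smooth_fun n U (\<lambda>u. h u * h' u)"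
  by (simp add: smooth_fun_def Ck_on_mult)
lemma smooth_fun_pdiff: "smooth_fun n U h \<Longrightarrow> i < n \<Longrightarrow> smooth_fun n U (pdiff i h)"
  unfolding smooth_fun_def by (metis Ck_on.simps(2))
lemma smooth_fun_continuous: "smooth_fun n U h \<Longrightarrow> continuous_on U h"
  unfolding smooth_fun_def by (metis Ck_on.simps(1))
lemma smooth_fun_differentiable: "smooth_fun n U h \<Longrightarrow> i < n \<Longrightarrow> u \<in> U \<Longrightarrow> (\<lambda>t. h (u(i := t))) differentiable (at (u i))"
  unfolding smooth_fun_def by (metis Ck_on.simps(2))

lemma smooth_fun_local:
  assumes "ropen n U" "near_each n U (\<lambda>V. smooth_fun n V h)"
  shows "smooth_fun n U h"
  unfolding smooth_fun_def
proof (intro allI Ck_on_local[OF assms(1)])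
  fix k u assume "u \<in> U"
  then show "\<exists>V. openin (Euclidean_space n) V \<and> u \<in> V \<and> V \<subseteq> U \<and> Ck_on k n V h"
    using assms(2) unfolding near_each_def smooth_fun_def by metis
qed

subsection \<open>Local properties and smooth maps\<close>

lemma near_each_self: "ropen n U \<Longrightarrow> P U \<Longrightarrow> near_each n U P"
  by (auto simp: near_each_def)

lemma near_each_bind:
  assumes "near_each n U P" "\<And>V. ropen n V \<Longrightarrow> V \<subseteq> U \<Longrightarrow> P V \<Longrightarrow> near_each n V Q"
  shows "near_each n U Q"
  using assms unfolding near_each_def by (meson order_trans)

lemma near_each_mono:
  assumes "near_each n U P" "\<And>V. ropen n V \<Longrightarrow> V \<subseteq> U \<Longrightarrow> P V \<Longrightarrow> Q V"
  shows "near_each n U Q"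
  using assms unfolding near_each_def by (meson order_trans)

lemma near_each_restrict:
  assumes "near_each n U P" "ropen n W" "W \<subseteq> U"
    "\<And>V V'. P V \<Longrightarrow> ropen n V' \<Longrightarrow> V' \<subseteq> V \<Longrightarrow> P V'"
  shows "near_each n W P"
  unfolding near_each_def
proof
  fix u assume u: "u \<in> W"
  then obtain V where V: "ropen n V" "u \<in> V" "V \<subseteq> U" "P V" using assms(1,3) unfolding near_each_def by (metis subsetD)
  have "ropen n (V \<inter> W)" using V assms by auto
  then show "\<exists>V. openin (Euclidean_space n) V \<and> u \<in> V \<and> V \<subseteq> W \<and> P V"
    using assms(4)[OF V(4), of "V \<inter> W"] u V(2) by (intro exI[of _ "V \<inter> W"]) auto
qed

lemma smooth_map_continuous:
  assumes "smooth_map m W n U F" shows "continuous_on W F"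
proof (rule continuous_on_coordinatewise_then_product)
  fix k show "continuous_on W (\<lambda>x. F x k)"
  proof (cases "k < n")
    case True then show ?thesis using assms by (auto simp: smooth_map_def intro: smooth_fun_continuous)
  next
    case False
    then have "\<And>w. w \<in> W \<Longrightarrow> F w k = 0" using assms by (force simp: smooth_map_def topspace_Euclidean_space)
    then show ?thesis using continuous_on_cong[of W W "\<lambda>w. F w k" "\<lambda>_. 0"] by simp
  qed
qed

lemma smooth_map_preimage:
  assumes "smooth_map m W n U F" "ropen m W" "ropen n V"
  shows "ropen m {w\<in>W. F w \<in> V}"
  using assms(1) by (intro ropen_preimage[OF assms(2) smooth_map_continuous[OF assms(1)] assms(3)])
    (force simp: smooth_map_def topspace_Euclidean_space)

lemma smooth_map_restrict:
  assumes "smooth_map m W n U F" "V \<subseteq> U" "W' \<subseteq> W" "F ` W' \<subseteq> V"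
  shows "smooth_map m W' n V F"
  using assms by (auto simp: smooth_map_def intro: smooth_fun_mono)

text \<open>Preimages of open sets under smooth maps are open, so local properties pull back.\<close>

lemma near_each_pullback:
  assumes near: "near_each n U P" and F: "smooth_map m W n U F" and W: "ropen m W"
    and Q: "\<And>V W'. ropen n V \<Longrightarrow> V \<subseteq> U \<Longrightarrow> P V \<Longrightarrow> ropen m W' \<Longrightarrow> W' \<subseteq> W \<Longrightarrow> F ` W' \<subseteq> V \<Longrightarrow>
      smooth_map m W' n V F \<Longrightarrow> Q W'"
  shows "near_each m W Q"
  unfolding near_each_def
proof
  fix w assume w: "w \<in> W"
  then have "F w \<in> U" using F by (auto simp: smooth_map_def)
  then obtain V where V: "ropen n V" "F w \<in> V" "V \<subseteq> U" "P V" using near unfolding near_each_def by metis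
  let ?W = "{w\<in>W. F w \<in> V}"
  have "ropen m ?W" by (rule smooth_map_preimage[OF F W V(1)])
  moreover have "Q ?W" using V calculation
    by (intro Q[of V] smooth_map_restrict[OF F]) auto
  ultimately show "\<exists>V. openin (Euclidean_space m) V \<and> w \<in> V \<and> V \<subseteq> W \<and> Q V"
    using w V(2) by (intro exI[of _ ?W]) auto
qed

lemma smooth_map_id: "ropen n U \<Longrightarrow> V \<subseteq> U \<Longrightarrow> smooth_map n V n U (\<lambda>u. u)"
  by (auto simp: smooth_map_def smooth_fun_coord dest: openin_subset)

lemma smooth_map_proj1:
  assumes "ropen n U" "W \<subseteq> prod_dom n U m U'"
  shows "smooth_map (n + m) W n U (proj1 n)"
  unfolding smooth_map_def
proof (intro conjI allI impI)
  show "proj1 n ` W \<subseteq> U" using assms by (auto simp: prod_dom_def)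
  show "smooth_fun (n + m) W (\<lambda>u. proj1 n u k)" if "k < n" for k
    using that by (simp add: proj1_def smooth_fun_coord)
qed (use assms openin_subset in auto)

lemma smooth_map_proj2:
  assumes "ropen m U'" "W \<subseteq> prod_dom n U m U'"
  shows "smooth_map (n + m) W m U' (proj2 n)"
  unfolding smooth_map_def
proof (intro conjI allI impI)
  show "proj2 n ` W \<subseteq> U'" using assms by (auto simp: prod_dom_def)
  show "smooth_fun (n + m) W (\<lambda>u. proj2 n u k)" for k
    by (simp add: proj2_def smooth_fun_coord)
qed (use assms openin_subset in auto)

lemma ropen_prod_dom:
  assumes "ropen n U" "ropen m U'" shows "ropen (n + m) (prod_dom n U m U')"
proof -
  let ?E = "topspace (Euclidean_space (n + m))"
  have E: "ropen (n + m) ?E" by simp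
  have "smooth_map (n + m) ?E n (topspace (Euclidean_space n)) (proj1 n)"
    by (auto simp: smooth_map_def proj1_def smooth_fun_coord topspace_Euclidean_space)
  then have "ropen (n + m) {w\<in>?E. proj1 n w \<in> U}"
    by (rule smooth_map_preimage[OF _ E assms(1)])
  moreover have "smooth_map (n + m) ?E m (topspace (Euclidean_space m)) (proj2 n)"
    by (auto simp: smooth_map_def proj2_def smooth_fun_coord topspace_Euclidean_space)
  then have "ropen (n + m) {w\<in>?E. proj2 n w \<in> U'}"
    by (rule smooth_map_preimage[OF _ E assms(2)])
  ultimately have "ropen (n + m) ({w\<in>?E. proj1 n w \<in> U} \<inter> {w\<in>?E. proj2 n w \<in> U'})" by blast
  moreover have "prod_dom n U m U' = {w\<in>?E. proj1 n w \<in> U} \<inter> {w\<in>?E. proj2 n w \<in> U'}"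
    by (auto simp: prod_dom_def)
  ultimately show ?thesis by simp
qed

text \<open>The diagonal \<open>\<real>\<^sup>n \<rightarrow> \<real>\<^sup>n\<^sup>+\<^sup>n\<close>, used to evaluate a family of functionals along a family of arguments with the same parameter.\<close>

definition diag :: "nat \<Rightarrow> rvec \<Rightarrow> rvec" where
  "diag n u = (\<lambda>i. if i < n then u i else u (i - n))"

lemma proj_diag:
  assumes "ropen n U" "u \<in> U" shows "proj1 n (diag n u) = u" "proj2 n (diag n u) = u"
  using ropen_subset[OF assms] by (auto simp: proj1_def proj2_def diag_def fun_eq_iff)

lemma smooth_map_diag:
  assumes U: "ropen n U" and "W \<subseteq> prod_dom n U n U" "diag n ` U \<subseteq> W"
  shows "smooth_map n U (n + n) W (diag n)"
  unfolding smooth_map_def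
proof (intro conjI allI impI)
  show "smooth_fun n U (\<lambda>u. diag n u k)" for k
    by (cases "k < n") (simp_all add: diag_def smooth_fun_coord)
  show "W \<subseteq> topspace (Euclidean_space (n + n))" using assms(2) by (auto simp: prod_dom_def)
qed (use assms in auto)

lemma diag_in_prod_dom: assumes "ropen n U" "u \<in> U" shows "diag n u \<in> prod_dom n U n U"
  using proj_diag[OF assms] assms ropen_subset[OF assms] by (auto simp: prod_dom_def topspace_Euclidean_space diag_def)

section \<open>The chain rule\<close>

lemma mvt_between:
  fixes \<phi> :: "real \<Rightarrow> real"
  assumes "a \<noteq> b" and D: "\<And>s. min a b \<le> s \<Longrightarrow> s \<le> max a b \<Longrightarrow> (\<phi> has_real_derivative \<phi>' s) (at s)"
  shows "\<exists>s. min a b \<le> s \<and> s \<le> max a b \<and> \<phi> b - \<phi> a = (b - a) * \<phi>' s"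
proof (cases "a < b")
  case True
  then obtain s where "a < s" "s < b" "\<phi> b - \<phi> a = (b - a) * \<phi>' s" using MVT2[of a b \<phi> \<phi>'] D by auto
  then show ?thesis using True by (intro exI[of _ s]) auto
next
  case False
  then have "b < a" using assms(1) by auto
  then obtain s where "b < s" "s < a" "\<phi> a - \<phi> b = (a - b) * \<phi>' s" using MVT2[of b a \<phi> \<phi>'] D by auto
  then show ?thesis using False by (intro exI[of _ s]) (auto simp: algebra_simps)
qed

lemma smooth_fun_near:
  assumes U: "ropen n U" and h: "smooth_fun n U h" and x: "x \<in> U" and e: "(0::real) < e"
  obtains d where "0 < d" "\<And>v. (\<And>i. i < n \<Longrightarrow> \<bar>v i - x i\<bar> < d) \<Longrightarrow> (\<And>i. i \<ge> n \<Longrightarrow> v i = 0) \<Longrightarrow>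
      v \<in> U \<and> \<bar>h v - h x\<bar> < e"
proof -
  have "openin (top_of_set U) (U \<inter> h -` ball (h x) e)"
    using smooth_fun_continuous[OF h] continuous_openin_preimage_gen[of U h "ball (h x) e"] by simp
  then obtain T where T: "open T" "U \<inter> h -` ball (h x) e = U \<inter> T" by (auto simp: openin_open)
  obtain B where B: "open B" "U = B \<inter> {x. \<forall>i\<ge>n. x i = 0}" using U ropen_iff by auto
  have "ropen n (U \<inter> T)" unfolding ropen_iff using B T(1) open_Int[OF B(1) T(1)]
    by (intro exI[of _ "B \<inter> T"]) auto
  moreover have "x \<in> U \<inter> T" using T(2) x e by auto
  ultimately obtain d where d: "0 < d"
    "\<And>v. (\<And>i. i < n \<Longrightarrow> \<bar>v i - x i\<bar> < d) \<Longrightarrow> (\<And>i. i \<ge> n \<Longrightarrow> v i = 0) \<Longrightarrow> v \<in> U \<inter> T"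
    using ropen_box[of n "U \<inter> T" x] by metis
  have eq: "U \<inter> T = U \<inter> h -` ball (h x) e" using T(2) by simp
  show ?thesis
  proof (rule that[OF d(1)])
    fix v assume "\<And>i. i < n \<Longrightarrow> \<bar>v i - x i\<bar> < d" "\<And>i. i \<ge> n \<Longrightarrow> v i = 0"
    then have "v \<in> U \<inter> T" by (rule d(2))
    then have "v \<in> U \<inter> h -` ball (h x) e" unfolding eq .
    then show "v \<in> U \<and> \<bar>h v - h x\<bar> < e" by (auto simp: dist_real_def)
  qed
qed

text \<open>A function with continuous first partial derivatives is differentiable along differentiable curves. The
coordinates are moved from \<open>x\<close> to \<open>c t\<close> one at a time, and the mean value theorem is applied to each move.\<close>

lemma chain_rule_curve:
  assumes U: "ropen n U" and h: "smooth_fun n U h" and x: "c t0 = x" "x \<in> U"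
    and zero: "\<And>t k. n \<le> k \<Longrightarrow> c t k = 0"
    and D: "\<And>k. k < n \<Longrightarrow> ((\<lambda>t. c t k) has_real_derivative d k) (at t0)"
  shows "((\<lambda>t. h (c t)) has_real_derivative (\<Sum>k<n. pdiff k h x * d k)) (at t0)"
proof -
  \<comment> \<open>the first \<open>j\<close> coordinates have already moved to \<open>c t\<close>\<close>
  define X where "X j t = (\<lambda>k. if k < j then c t k else x k)" for j t
  have x0: "x k = 0" if "n \<le> k" for k using ropen_subset[OF U x(2) that] .
  have step: "((\<lambda>t. h (X (Suc j) t) - h (X j t)) has_real_derivative pdiff j h x * d j) (at t0)" if j: "j < n" for j
  proof -
    \<comment> \<open>difference quotient in direction \<open>j\<close>, with its limit as value where the denominator vanishes\<close>
    define P where "P t = (if c t j = x j then pdiff j h x else (h (X (Suc j) t) - h (X j t)) / (c t j - x j))" for t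
    obtain gc where gc: "\<And>t. c t j - c t0 j = gc t * (t - t0)" "isCont gc t0" "gc t0 = d j"
      using D[OF j] unfolding CARAT_DERIV by blast
    have Xup: "X (Suc j) t = (X j t)(j := c t j)" "(X j t)(j := x j) = X j t" for t
      by (auto simp: X_def fun_eq_iff less_Suc_eq)
    have P: "h (X (Suc j) t) - h (X j t) = P t * (c t j - x j)" for t
    proof (cases "c t j = x j")
      case True then have "X (Suc j) t = X j t" using Xup by metis
      then show ?thesis using True by simp
    qed (simp add: P_def)
    have "isCont P t0" unfolding isCont_def LIM_eq
    proof (intro allI impI)
      fix e :: real assume "e > 0"
      obtain r where r: "0 < r" "\<And>v. (\<And>i. i < n \<Longrightarrow> \<bar>v i - x i\<bar> < r) \<Longrightarrow> (\<And>i. i \<ge> n \<Longrightarrow> v i = 0) \<Longrightarrow>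
          v \<in> U \<and> \<bar>pdiff j h v - pdiff j h x\<bar> < e"
        using smooth_fun_near[OF U smooth_fun_pdiff[OF h j] x(2) \<open>e > 0\<close>] by metis
      have "\<forall>\<^sub>F t in at t0. dist (c t k) (c t0 k) < r" if "k < n" for k
        using tendstoD[OF DERIV_isCont[OF D[OF that], unfolded isCont_def] r(1)] .
      then have "\<forall>\<^sub>F t in at t0. \<forall>k\<in>{..<n}. dist (c t k) (c t0 k) < r"
        by (intro eventually_ball_finite) auto
      then obtain s where s: "s > 0" "\<And>t k. t \<noteq> t0 \<Longrightarrow> dist t t0 < s \<Longrightarrow> k < n \<Longrightarrow> \<bar>c t k - x k\<bar> < r"
        unfolding eventually_at using x(1) by (auto simp: dist_real_def)
      have "\<bar>P t - P t0\<bar> < e" if t: "t \<noteq> t0" "dist t t0 < s" for t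
      proof (cases "c t j = x j")
        case True then show ?thesis using \<open>e > 0\<close> x(1) by (simp add: P_def)
      next
        case False
        have box: "(X j t)(j := z) \<in> U \<and> \<bar>pdiff j h ((X j t)(j := z)) - pdiff j h x\<bar> < e"
          if z: "min (x j) (c t j) \<le> z" "z \<le> max (x j) (c t j)" for z
        proof (rule r(2))
          show "\<bar>((X j t)(j := z)) i - x i\<bar> < r" if "i < n" for i
            using s(2)[OF t that] s(2)[OF t j] z r(1) by (auto simp: X_def)
          show "((X j t)(j := z)) i = 0" if "n \<le> i" for i
            using that j zero x0 by (auto simp: X_def)
        qed
        have "\<exists>z. min (x j) (c t j) \<le> z \<and> z \<le> max (x j) (c t j) \<and>
            h ((X j t)(j := c t j)) - h ((X j t)(j := x j)) = (c t j - x j) * pdiff j h ((X j t)(j := z))"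
        proof (rule mvt_between)
          fix z assume "min (x j) (c t j) \<le> z" "z \<le> max (x j) (c t j)"
          then have "(X j t)(j := z) \<in> U" using box by blast
          from pdiff_has_derivative[OF smooth_fun_differentiable[OF h j this]]
          show "((\<lambda>z. h ((X j t)(j := z))) has_real_derivative pdiff j h ((X j t)(j := z))) (at z)"
            by (simp only: fun_upd_upd fun_upd_same)
        qed (use False in auto)
        then obtain z where z: "min (x j) (c t j) \<le> z" "z \<le> max (x j) (c t j)"
           "h (X (Suc j) t) - h (X j t) = (c t j - x j) * pdiff j h ((X j t)(j := z))"
          unfolding Xup by auto
        then have "P t = pdiff j h ((X j t)(j := z))" using False by (simp add: P_def)
        then show ?thesis using box[OF z(1,2)] x(1) by (simp add: P_def)
      qed
      then show "\<exists>s>0. \<forall>t. t \<noteq> t0 \<and> norm (t - t0) < s \<longrightarrow> norm (P t - P t0) < e"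
        using s(1) by (auto simp: dist_real_def)
    qed
    then have "isCont (\<lambda>t. P t * gc t) t0" using gc(2) by (intro continuous_intros) auto
    moreover have "h (X (Suc j) t) - h (X j t) = P t * gc t * (t - t0)" for t
      unfolding P using gc(1)[of t] x(1) by simp
    moreover have "P t0 * gc t0 = pdiff j h x * d j" using gc(3) x(1) by (simp add: P_def)
    ultimately show ?thesis unfolding CARAT_DERIV by (intro exI[of _ "\<lambda>t. P t * gc t"]) simp
  qed
  have H: "j \<le> n \<Longrightarrow> ((\<lambda>t. h (X j t)) has_real_derivative (\<Sum>k<j. pdiff k h x * d k)) (at t0)" for j
  proof (induction j)
    case 0 then show ?case by (simp add: X_def)
  next
    case (Suc j)
    from DERIV_add[OF Suc.IH step[of j]] Suc.prems show ?case by simp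
  qed
  have "X n t = c t" for t using zero x0 by (auto simp: X_def fun_eq_iff)
  then show ?thesis using H[of n] by simp
qed

lemma chain_rule:
  assumes U: "ropen n U" and W: "ropen m W" and h: "smooth_fun n U h" and F: "smooth_map m W n U F"
    and w: "w \<in> W" and i: "i < m"
  shows "pdiff i (h \<circ> F) w = (\<Sum>k<n. pdiff k h (F w) * pdiff i (\<lambda>v. F v k) w)"
proof -
  define c where "c t = (\<lambda>k. if k < n then F (w(i := t)) k else 0)" for t
  have FU: "F w \<in> U" if "w \<in> W" for w using F that by (auto simp: smooth_map_def)
  have cF: "c t = F (w(i := t))" if "w(i := t) \<in> W" for t
    using ropen_subset[OF U FU[OF that]] by (auto simp: c_def fun_eq_iff)
  have c0: "c (w i) = F w" using cF[of "w i"] w by simp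
  have D: "((\<lambda>t. h (c t)) has_real_derivative (\<Sum>k<n. pdiff k h (F w) * pdiff i (\<lambda>v. F v k) w)) (at (w i))"
  proof (rule chain_rule_curve[where c = c, OF U h c0 FU[OF w]])
    fix k assume "k < n"
    then have "smooth_fun m W (\<lambda>v. F v k)" using F by (auto simp: smooth_map_def)
    from pdiff_has_derivative[OF smooth_fun_differentiable[OF this i w]] \<open>k < n\<close>
    show "((\<lambda>t. c t k) has_real_derivative pdiff i (\<lambda>v. F v k) w) (at (w i))"
      by (simp only: c_def if_True)
  qed (simp add: c_def)
  have ev: "\<forall>\<^sub>F t in nhds (w i). h (c t) = (h \<circ> F) (w(i := t))"
    using eventually_upd_in[OF W w i] by eventually_elim (simp add: cF)
  have "((\<lambda>t. (h \<circ> F) (w(i := t))) has_real_derivative (\<Sum>k<n. pdiff k h (F w) * pdiff i (\<lambda>v. F v k) w)) (at (w i))"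
    by (rule iffD1[OF DERIV_cong_ev[OF HOL.refl ev HOL.refl] D])
  then show ?thesis unfolding pdiff_def[of _ "h \<circ> F"] by (rule DERIV_imp_deriv)
qed

section \<open>Diffeological spaces\<close>

lemma
  assumes "diffeological_space X"
  shows plot_cong: "plot X n U p \<Longrightarrow> (\<And>u. u \<in> U \<Longrightarrow> p u = q u) \<Longrightarrow> plot X n U q"
    and plot_open: "plot X n U p \<Longrightarrow> ropen n U"
    and plot_in: "plot X n U p \<Longrightarrow> u \<in> U \<Longrightarrow> p u \<in> dspace X"
    and plot_const: "ropen n U \<Longrightarrow> x \<in> dspace X \<Longrightarrow> plot X n U (\<lambda>_. x)"
    and plot_comp: "plot X n U p \<Longrightarrow> ropen m W \<Longrightarrow> smooth_map m W n U F \<Longrightarrow> plot X m W (p \<circ> F)"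
    and plot_local: "ropen n U \<Longrightarrow> near_each n U (\<lambda>V. plot X n V p) \<Longrightarrow> plot X n U p"
proof -
  note A = assms[unfolded diffeological_space_def]
  show "plot X n U p \<Longrightarrow> (\<And>u. u \<in> U \<Longrightarrow> p u = q u) \<Longrightarrow> plot X n U q"
    using A[THEN conjunct1] by blast
  show "plot X n U p \<Longrightarrow> ropen n U" "plot X n U p \<Longrightarrow> u \<in> U \<Longrightarrow> p u \<in> dspace X"
    using A[THEN conjunct2, THEN conjunct1] by blast+
  show "ropen n U \<Longrightarrow> x \<in> dspace X \<Longrightarrow> plot X n U (\<lambda>_. x)"
    using A[THEN conjunct2, THEN conjunct2, THEN conjunct1] by blast
  show "plot X n U p \<Longrightarrow> ropen m W \<Longrightarrow> smooth_map m W n U F \<Longrightarrow> plot X m W (p \<circ> F)"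
    using A[THEN conjunct2, THEN conjunct2, THEN conjunct2, THEN conjunct1] by blast
  show "ropen n U \<Longrightarrow> near_each n U (\<lambda>V. plot X n V p) \<Longrightarrow> plot X n U p"
    using A[THEN conjunct2, THEN conjunct2, THEN conjunct2, THEN conjunct2] by blast
qed

lemma plot_restrict:
  assumes "diffeological_space X" "plot X n U p" "ropen n V" "V \<subseteq> U" shows "plot X n V p"
  using plot_comp[OF assms(1,2,3) smooth_map_id[OF plot_open[OF assms(1,2)] assms(4)]] by (simp add: comp_def)

lemma diffeological_spaceI:
  assumes "\<And>n U p q. plot X n U p \<Longrightarrow> (\<And>u. u \<in> U \<Longrightarrow> p u = q u) \<Longrightarrow> plot X n U q"
    and "\<And>n U p. plot X n U p \<Longrightarrow> ropen n U"
    and "\<And>n U p u. plot X n U p \<Longrightarrow> u \<in> U \<Longrightarrow> p u \<in> dspace X"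
    and "\<And>n U x. ropen n U \<Longrightarrow> x \<in> dspace X \<Longrightarrow> plot X n U (\<lambda>_. x)"
    and "\<And>n U p m W F. plot X n U p \<Longrightarrow> ropen m W \<Longrightarrow> smooth_map m W n U F \<Longrightarrow> plot X m W (p \<circ> F)"
    and "\<And>n U p. ropen n U \<Longrightarrow> near_each n U (\<lambda>V. plot X n V p) \<Longrightarrow> plot X n U p"
  shows "diffeological_space X"
  unfolding diffeological_space_def
proof (intro conjI allI impI image_subsetI)
  fix n U p q assume p: "plot X n U p \<and> (\<forall>u\<in>U. p u = q u)"
  show "plot X n U q" by (rule assms(1)[of n U p]) (use p in simp_all)
qed (erule assms(2), erule (1) assms(3), (elim conjE, rule assms(4-6); assumption)+)

lemma dsmooth_plot: "dsmooth X Z j \<Longrightarrow> plot X n U p \<Longrightarrow> plot Z n U (j \<circ> p)"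
  and dsmooth_in: "dsmooth X Z j \<Longrightarrow> x \<in> dspace X \<Longrightarrow> j x \<in> dspace Z"
  by (auto simp: dsmooth_def)

lemma diffeological_subset:
  assumes X: "diffeological_space X" and A: "A \<subseteq> dspace X"
  shows "diffeological_space (subset_diffeology X A)"
proof (rule diffeological_spaceI)
  fix n U p assume "ropen n U" and near: "near_each n U (\<lambda>V. plot (subset_diffeology X A) n V p)"
  from near have "near_each n U (\<lambda>V. plot X n V p)"
    by (rule near_each_mono) (simp add: subset_diffeology_def)
  then have "plot X n U p" by (rule plot_local[OF X \<open>ropen n U\<close>])
  moreover have "p ` U \<subseteq> A"
    using near unfolding near_each_def subset_diffeology_def by (auto simp: image_subset_iff subset_iff)
  ultimately show "plot (subset_diffeology X A) n U p" by (simp add: subset_diffeology_def)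
next
  fix n U p m W F
  assume p: "plot (subset_diffeology X A) n U p" and W: "ropen m W" and F: "smooth_map m W n U F"
  then have "plot X m W (p \<circ> F)" using plot_comp[OF X _ W F] by (simp add: subset_diffeology_def)
  moreover have "(p \<circ> F) ` W \<subseteq> A" using p F by (auto simp: subset_diffeology_def smooth_map_def)
  ultimately show "plot (subset_diffeology X A) m W (p \<circ> F)" by (simp add: subset_diffeology_def)
next
  fix n U and p q :: "rvec \<Rightarrow> 'a"
  assume p: "plot (subset_diffeology X A) n U p" and e: "\<And>u. u \<in> U \<Longrightarrow> p u = q u"
  from p e have "plot X n U q" using plot_cong[OF X, of n U p q] by (simp add: subset_diffeology_def)
  moreover have "q ` U = p ` U" using e by (intro image_cong) auto
  ultimately show "plot (subset_diffeology X A) n U q" using p by (simp add: subset_diffeology_def)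
qed (use X A in \<open>auto simp: subset_diffeology_def intro: plot_const dest: plot_open\<close>)

section \<open>Differential 1-forms\<close>

lemma one_formsI:
  assumes "\<And>n U p u i. \<not> (plot X n U p \<and> u \<in> U \<and> i < n) \<Longrightarrow> \<omega> n U p u i = 0"
    and "\<And>n U p q. plot X n U p \<Longrightarrow> (\<And>u. u \<in> U \<Longrightarrow> p u = q u) \<Longrightarrow> \<omega> n U p = \<omega> n U q"
    and "\<And>n U p i. plot X n U p \<Longrightarrow> i < n \<Longrightarrow> smooth_fun n U (\<lambda>u. \<omega> n U p u i)"
    and "\<And>n U p m W F w i. plot X n U p \<Longrightarrow> ropen m W \<Longrightarrow> smooth_map m W n U F \<Longrightarrow> w \<in> W \<Longrightarrow> i < m \<Longrightarrow>
      \<omega> m W (p \<circ> F) w i = (\<Sum>k<n. \<omega> n U p (F w) k * pdiff i (\<lambda>v. F v k) w)"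
  shows "\<omega> \<in> one_forms X"
  unfolding one_forms_def mem_Collect_eq
  by (intro conjI allI impI ballI; (elim conjE)?; (rule assms; blast)?)

lemma
  assumes "\<omega> \<in> one_forms X"
  shows form_zero: "\<not> (plot X n U p \<and> u \<in> U \<and> i < n) \<Longrightarrow> \<omega> n U p u i = 0"
    and form_cong: "plot X n U p \<Longrightarrow> (\<And>u. u \<in> U \<Longrightarrow> p u = q u) \<Longrightarrow> \<omega> n U p = \<omega> n U q"
    and form_smooth: "plot X n U p \<Longrightarrow> i < n \<Longrightarrow> smooth_fun n U (\<lambda>u. \<omega> n U p u i)"
    and form_comp: "plot X n U p \<Longrightarrow> ropen m W \<Longrightarrow> smooth_map m W n U F \<Longrightarrow> w \<in> W \<Longrightarrow> i < m \<Longrightarrow>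
      \<omega> m W (p \<circ> F) w i = (\<Sum>k<n. \<omega> n U p (F w) k * pdiff i (\<lambda>v. F v k) w)"
proof -
  note A = assms[unfolded one_forms_def mem_Collect_eq]
  show "\<not> (plot X n U p \<and> u \<in> U \<and> i < n) \<Longrightarrow> \<omega> n U p u i = 0"
    using A[THEN conjunct1] by blast
  show "plot X n U p \<Longrightarrow> (\<And>u. u \<in> U \<Longrightarrow> p u = q u) \<Longrightarrow> \<omega> n U p = \<omega> n U q"
    using A[THEN conjunct2, THEN conjunct1] by blast
  show "plot X n U p \<Longrightarrow> i < n \<Longrightarrow> smooth_fun n U (\<lambda>u. \<omega> n U p u i)"
    using A[THEN conjunct2, THEN conjunct2, THEN conjunct1] by blast
  show "plot X n U p \<Longrightarrow> ropen m W \<Longrightarrow> smooth_map m W n U F \<Longrightarrow> w \<in> W \<Longrightarrow> i < m \<Longrightarrow>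
      \<omega> m W (p \<circ> F) w i = (\<Sum>k<n. \<omega> n U p (F w) k * pdiff i (\<lambda>v. F v k) w)"
    using A[THEN conjunct2, THEN conjunct2, THEN conjunct2] by blast
qed

lemma pdiff_coord: "pdiff i (\<lambda>v. v k) w = (if k = i then 1 else 0)"
  by (cases "k = i") (simp_all add: pdiff_def)

text \<open>The value at a point does not depend on the domain of the plot: restriction is composition with an
inclusion, whose Jacobian is the identity.\<close>

lemma form_restrict:
  assumes X: "diffeological_space X" and \<omega>: "\<omega> \<in> one_forms X" and p: "plot X n U p"
    and V: "ropen n V" "V \<subseteq> U" "v \<in> V"
  shows "\<omega> n V p v = \<omega> n U p v"
proof
  fix i show "\<omega> n V p v i = \<omega> n U p v i"
  proof (cases "i < n")
    case True
    have "\<omega> n V (p \<circ> (\<lambda>u. u)) v i = (\<Sum>k<n. \<omega> n U p v k * pdiff i (\<lambda>v. v k) v)"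
      by (rule form_comp[OF \<omega> p V(1) smooth_map_id[OF plot_open[OF X p] V(2)] V(3) True])
    then show ?thesis using True by (simp add: pdiff_coord comp_def if_distrib cong: if_cong)
  qed (simp add: form_zero[OF \<omega>])
qed

lemma form_scale_apply [simp]: "form_scale c \<omega> n U p u i = c * \<omega> n U p u i"
  by (simp add: form_scale_def)

lemma one_forms_add:
  assumes X: "diffeological_space X" and "\<omega> \<in> one_forms X" "\<eta> \<in> one_forms X" shows "\<omega> + \<eta> \<in> one_forms X"
proof (rule one_formsI)
  fix n U and p q :: "rvec \<Rightarrow> 'a"
  assume "plot X n U p" "\<And>u. u \<in> U \<Longrightarrow> p u = q u"
  then have "\<omega> n U p = \<omega> n U q" "\<eta> n U p = \<eta> n U q" using assms form_cong by blast+
  then show "(\<omega> + \<eta>) n U p = (\<omega> + \<eta>) n U q" by simp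
next
  fix n U i and p :: "rvec \<Rightarrow> 'a" assume "plot X n U p" "i < n"
  then show "smooth_fun n U (\<lambda>u. (\<omega> + \<eta>) n U p u i)"
    using assms by (simp add: smooth_fun_add plot_open form_smooth)
next
  fix n U p m W F w i
  assume "plot X n U p" "ropen m W" "smooth_map m W n U F" "w \<in> W" "i < m"
  note a = this
  show "(\<omega> + \<eta>) m W (p \<circ> F) w i = (\<Sum>k<n. (\<omega> + \<eta>) n U p (F w) k * pdiff i (\<lambda>v. F v k) w)"
    using form_comp[OF assms(2) a] form_comp[OF assms(3) a] by (simp add: algebra_simps sum.distrib)
qed (use assms in \<open>simp add: form_zero\<close>)

lemma one_forms_scale:
  assumes X: "diffeological_space X" and "\<omega> \<in> one_forms X" shows "form_scale c \<omega> \<in> one_forms X"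
proof (rule one_formsI)
  fix n U and p q :: "rvec \<Rightarrow> 'a"
  assume "plot X n U p" "\<And>u. u \<in> U \<Longrightarrow> p u = q u"
  then have "\<omega> n U p = \<omega> n U q" using assms form_cong by blast
  then show "form_scale c \<omega> n U p = form_scale c \<omega> n U q" by (simp add: form_scale_def)
next
  fix n U i and p :: "rvec \<Rightarrow> 'a" assume "plot X n U p" "i < n"
  then show "smooth_fun n U (\<lambda>u. form_scale c \<omega> n U p u i)"
    using assms by (simp add: smooth_fun_mult smooth_fun_const plot_open form_smooth)
next
  fix n U p m W F w i
  assume "plot X n U p" "ropen m W" "smooth_map m W n U F" "w \<in> W" "i < m"
  note a = this
  show "form_scale c \<omega> m W (p \<circ> F) w i = (\<Sum>k<n. form_scale c \<omega> n U p (F w) k * pdiff i (\<lambda>v. F v k) w)"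
    using form_comp[OF assms(2) a] by (simp add: algebra_simps sum_distrib_left)
qed (use assms in \<open>simp add: form_zero\<close>)

lemma one_forms_zero: "0 \<in> one_forms X"
  by (rule one_formsI) (simp_all add: smooth_fun_const fun_eq_iff)

lemma form_diff_eq: "\<omega> - \<eta> = \<omega> + form_scale (- 1) \<eta>"
  by (simp add: fun_eq_iff fun_diff_def)

lemma one_forms_diff:
  assumes "diffeological_space X" "\<omega> \<in> one_forms X" "\<eta> \<in> one_forms X" shows "\<omega> - \<eta> \<in> one_forms X"
  unfolding form_diff_eq using assms by (intro one_forms_add one_forms_scale)

lemma vanishing_add:
  assumes "diffeological_space X" "\<omega> \<in> vanishing_forms X x" "\<eta> \<in> vanishing_forms X x"
  shows "\<omega> + \<eta> \<in> vanishing_forms X x"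
  using assms by (auto simp: vanishing_forms_def one_forms_add)

lemma vanishing_scale:
  assumes "diffeological_space X" "\<omega> \<in> vanishing_forms X x"
  shows "form_scale c \<omega> \<in> vanishing_forms X x"
  using assms by (auto simp: vanishing_forms_def one_forms_scale fun_eq_iff)

lemma vanishing_zero: "0 \<in> vanishing_forms X x"
  by (simp add: vanishing_forms_def one_forms_zero)

lemma vanishing_diff:
  assumes "diffeological_space X" "\<omega> \<in> vanishing_forms X x" "\<eta> \<in> vanishing_forms X x"
  shows "\<omega> - \<eta> \<in> vanishing_forms X x"
  unfolding form_diff_eq using assms by (intro vanishing_add vanishing_scale)

lemma vanishing_in: "\<omega> \<in> vanishing_forms X x \<Longrightarrow> \<omega> \<in> one_forms X"
  by (simp add: vanishing_forms_def)

subsection \<open>Pullback\<close>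

lemma form_pullback_in:
  assumes j: "dsmooth X Z j" and \<omega>: "\<omega> \<in> one_forms Z"
    and X: "diffeological_space X"
  shows "form_pullback X j \<omega> \<in> one_forms X"
proof (rule one_formsI)
  fix n U and p q :: "rvec \<Rightarrow> 'a"
  assume p: "plot X n U p" and e: "\<And>u. u \<in> U \<Longrightarrow> p u = q u"
  have "\<omega> n U (j \<circ> p) = \<omega> n U (j \<circ> q)"
    using e by (intro form_cong[OF \<omega> dsmooth_plot[OF j p]]) simp
  then show "form_pullback X j \<omega> n U p = form_pullback X j \<omega> n U q"
    using p plot_cong[OF X p e] by (simp add: form_pullback_def)
next
  fix n U p u i assume "\<not> (plot X n U p \<and> u \<in> U \<and> i < n)"
  then show "form_pullback X j \<omega> n U p u i = 0"
    using form_zero[OF \<omega>] by (auto simp: form_pullback_def)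
next
  fix n U i and p :: "rvec \<Rightarrow> 'a" assume "plot X n U p" "i < n"
  then show "smooth_fun n U (\<lambda>u. form_pullback X j \<omega> n U p u i)"
    using form_smooth[OF \<omega> dsmooth_plot[OF j]] by (simp add: form_pullback_def)
next
  fix n U p m W F w i
  assume p: "plot X n U p" and a: "ropen m W" "smooth_map m W n U F" "w \<in> W" "i < m"
  show "form_pullback X j \<omega> m W (p \<circ> F) w i = (\<Sum>k<n. form_pullback X j \<omega> n U p (F w) k * pdiff i (\<lambda>v. F v k) w)"
    using form_comp[OF \<omega> dsmooth_plot[OF j p] a] plot_comp[OF X p a(1,2)] p
    by (simp add: form_pullback_def comp_assoc)
qed

lemma form_pullback_add: "form_pullback X j (\<omega> + \<eta>) = form_pullback X j \<omega> + form_pullback X j \<eta>"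
  by (simp add: form_pullback_def fun_eq_iff)

lemma form_pullback_scale: "form_pullback X j (form_scale c \<omega>) = form_scale c (form_pullback X j \<omega>)"
  by (simp add: form_pullback_def fun_eq_iff)

lemma form_pullback_diff: "form_pullback X j (\<omega> - \<eta>) = form_pullback X j \<omega> - form_pullback X j \<eta>"
  by (simp add: form_diff_eq form_pullback_add form_pullback_scale)

lemma form_pullback_comp:
  assumes "dsmooth S X a"
  shows "form_pullback S a (form_pullback X j \<omega>) = form_pullback S (j \<circ> a) \<omega>"
  using dsmooth_plot[OF assms] by (auto simp: form_pullback_def fun_eq_iff comp_assoc)

lemma form_pullback_cong:
  assumes X: "diffeological_space X" and j: "dsmooth X Z j" and e: "\<And>x. x \<in> dspace X \<Longrightarrow> j x = j' x"
    and \<omega>: "\<omega> \<in> one_forms Z"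
  shows "form_pullback X j \<omega> = form_pullback X j' \<omega>"
proof -
  have "\<omega> n U (j \<circ> p) = \<omega> n U (j' \<circ> p)" if "plot X n U p" for n U p
    using plot_in[OF X that] e by (intro form_cong[OF \<omega> dsmooth_plot[OF j that]]) simp
  then show ?thesis by (auto simp: form_pullback_def fun_eq_iff)
qed

lemma vanishing_pullback:
  assumes "diffeological_space X" "dsmooth X Z j" "\<omega> \<in> vanishing_forms Z (j x)"
  shows "form_pullback X j \<omega> \<in> vanishing_forms X x"
  using assms dsmooth_plot[OF assms(2)] form_pullback_in[OF assms(2) _ assms(1)]
  by (auto simp: vanishing_forms_def form_pullback_def fun_eq_iff)

subsection \<open>Differential\<close>

text \<open>That \<open>dh\<close> is compatible with the composition of plots and smooth maps is the chain rule.\<close>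

lemma d_form_in:
  assumes X: "diffeological_space X" and h: "smooth_real X h"
  shows "d_form X h \<in> one_forms X"
proof (rule one_formsI)
  fix n U and p q :: "rvec \<Rightarrow> 'a"
  assume p: "plot X n U p" and e: "\<And>u. u \<in> U \<Longrightarrow> p u = q u"
  have "pdiff i (h \<circ> p) u = pdiff i (h \<circ> q) u" if "u \<in> U" "i < n" for u i
    using e by (intro pdiff_cong[OF plot_open[OF X p] that]) simp
  then show "d_form X h n U p = d_form X h n U q"
    using p plot_cong[OF X p e] by (auto simp: d_form_def fun_eq_iff)
next
  fix n U i and p :: "rvec \<Rightarrow> 'a" assume p: "plot X n U p" "i < n"
  have "smooth_fun n U (pdiff i (h \<circ> p))" using h p by (simp add: smooth_real_def smooth_fun_pdiff)
  then show "smooth_fun n U (\<lambda>u. d_form X h n U p u i)"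
    by (rule smooth_fun_cong[OF plot_open[OF X p(1)], rotated]) (simp add: d_form_def p)
next
  fix n U p m W F w i
  assume p: "plot X n U p" and a: "ropen m W" "smooth_map m W n U F" "w \<in> W" "i < m"
  have "F w \<in> U" using a by (auto simp: smooth_map_def)
  then show "d_form X h m W (p \<circ> F) w i = (\<Sum>k<n. d_form X h n U p (F w) k * pdiff i (\<lambda>v. F v k) w)"
    using chain_rule[OF plot_open[OF X p] a(1) _ a(2,3,4), of "h \<circ> p"] h p a plot_comp[OF X p a(1,2)]
    by (simp add: d_form_def smooth_real_def comp_assoc)
qed (auto simp: d_form_def)

lemma d_form_pullback:
  assumes "dsmooth X Z j" shows "form_pullback X j (d_form Z h) = d_form X (h \<circ> j)"
  using dsmooth_plot[OF assms] by (auto simp: form_pullback_def d_form_def fun_eq_iff comp_assoc)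

lemma d_form_cong:
  assumes X: "diffeological_space X" and e: "\<And>x. x \<in> dspace X \<Longrightarrow> h x = h' x"
  shows "d_form X h = d_form X h'"
proof -
  have "pdiff i (h \<circ> p) u = pdiff i (h' \<circ> p) u" if "plot X n U p" "u \<in> U" "i < n" for n U p u i
    using e plot_in[OF X that(1)] by (intro pdiff_cong[OF plot_open[OF X that(1)] that(2,3)]) simp
  then show ?thesis by (auto simp: d_form_def fun_eq_iff)
qed

lemma smooth_real_cong:
  assumes X: "diffeological_space X" and e: "\<And>x. x \<in> dspace X \<Longrightarrow> h x = h' x" and h: "smooth_real X h"
  shows "smooth_real X h'"
  unfolding smooth_real_def
proof (intro allI impI)
  fix n U p assume p: "plot X n U p"
  show "smooth_fun n U (h' \<circ> p)"
  proof (rule smooth_fun_cong[OF plot_open[OF X p]])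
    show "smooth_fun n U (h \<circ> p)" using h p by (simp add: smooth_real_def)
  qed (use plot_in[OF X p] e in simp)
qed

lemma smooth_real_comp: "dsmooth X Z j \<Longrightarrow> smooth_real Z h \<Longrightarrow> smooth_real X (h \<circ> j)"
  using dsmooth_plot by (fastforce simp: smooth_real_def comp_assoc)

subsection \<open>Smooth families of forms\<close>

abbreviation form_plot where "form_plot X \<equiv> plot (one_forms_diffeology X)"

lemma form_plotI:
  assumes "ropen n U" "\<And>u. u \<in> U \<Longrightarrow> r u \<in> one_forms X"
    "\<And>m U' q i. plot X m U' q \<Longrightarrow> i < m \<Longrightarrow> smooth_fun (n + m) (prod_dom n U m U') (\<lambda>w. r (proj1 n w) m U' q (proj2 n w) i)"
  shows "form_plot X n U r"
  using assms by (auto simp: one_forms_diffeology_def)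

lemma form_plotD:
  assumes "form_plot X n U r"
  shows "ropen n U" "\<And>u. u \<in> U \<Longrightarrow> r u \<in> one_forms X"
    "\<And>m U' q i. plot X m U' q \<Longrightarrow> i < m \<Longrightarrow> smooth_fun (n + m) (prod_dom n U m U') (\<lambda>w. r (proj1 n w) m U' q (proj2 n w) i)"
  using assms by (auto simp: one_forms_diffeology_def)

lemma form_plot_restrict:
  assumes "form_plot X n U r" "ropen n V" "V \<subseteq> U" shows "form_plot X n V r"
proof (rule form_plotI)
  fix m U' q i assume "plot X m U' q" "i < m"
  then have "smooth_fun (n + m) (prod_dom n U m U') (\<lambda>w. r (proj1 n w) m U' q (proj2 n w) i)"
    using form_plotD(3)[OF assms(1)] by simp
  then show "smooth_fun (n + m) (prod_dom n V m U') (\<lambda>w. r (proj1 n w) m U' q (proj2 n w) i)"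
    by (rule smooth_fun_mono) (use assms(3) in \<open>auto simp: prod_dom_def\<close>)
qed (use assms form_plotD(2)[OF assms(1)] in auto)

text \<open>A form, evaluated on a plot that does not depend on the first factor, is smooth on the product, because
its coefficients there are coefficients of the same form on the plot \<open>q \<circ> proj2\<close>.\<close>

lemma form_plot_const:
  assumes X: "diffeological_space X" and \<omega>: "\<omega> \<in> one_forms X" and U: "ropen n U"
  shows "form_plot X n U (\<lambda>_. \<omega>)"
proof (rule form_plotI[OF U \<omega>])
  fix m U' q i assume q: "plot X m U' q" and i: "i < m"
  let ?P = "prod_dom n U m U'"
  have P: "ropen (n + m) ?P" using U plot_open[OF X q] by (rule ropen_prod_dom)
  have s: "smooth_map (n + m) ?P m U' (proj2 n)" by (rule smooth_map_proj2[OF plot_open[OF X q] subset_refl])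
  have sm: "smooth_fun (n + m) ?P (\<lambda>w. \<omega> (n + m) ?P (q \<circ> proj2 n) w (n + i))"
    using i by (intro form_smooth[OF \<omega> plot_comp[OF X q P s]]) simp
  have "\<omega> (n + m) ?P (q \<circ> proj2 n) w (n + i) = \<omega> m U' q (proj2 n w) i" if "w \<in> ?P" for w
  proof -
    have pd: "pdiff (n + i) (\<lambda>v. proj2 n v k) w = (if k = i then 1 else 0)" for k
      unfolding proj2_def using pdiff_coord[of "n + i" "n + k" w] by simp
    show ?thesis using form_comp[OF \<omega> q P s that, of "n + i"] i unfolding pd by (simp add: if_distrib cong: if_cong)
  qed
  then show "smooth_fun (n + m) ?P (\<lambda>w. \<omega> m U' q (proj2 n w) i)"
    by (rule smooth_fun_cong[OF P _ sm])
qed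

lemma form_plot_add:
  assumes X: "diffeological_space X" and r: "form_plot X n U r" and r': "form_plot X n U r'"
  shows "form_plot X n U (\<lambda>u. r u + r' u)"
proof (rule form_plotI)
  fix m U' q i assume q: "plot X m U' q" and i: "i < m"
  have P: "ropen (n + m) (prod_dom n U m U')" using form_plotD(1)[OF r] plot_open[OF X q] by (rule ropen_prod_dom)
  show "smooth_fun (n + m) (prod_dom n U m U') (\<lambda>w. (r (proj1 n w) + r' (proj1 n w)) m U' q (proj2 n w) i)"
    using smooth_fun_add[OF P form_plotD(3)[OF r q i] form_plotD(3)[OF r' q i]] by simp
qed (use X form_plotD[OF r] form_plotD[OF r'] in \<open>auto intro: one_forms_add\<close>)

lemma form_plot_scale:
  assumes X: "diffeological_space X" and q: "plot X n U q" and h: "smooth_real X h" and r: "form_plot X n U r"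
  shows "form_plot X n U (\<lambda>u. form_scale (h (q u)) (r u))"
proof (rule form_plotI)
  fix m U' q' i assume q': "plot X m U' q'" and i: "i < m"
  have P: "ropen (n + m) (prod_dom n U m U')" using plot_open[OF X q] plot_open[OF X q'] by (rule ropen_prod_dom)
  have "plot X (n + m) (prod_dom n U m U') (q \<circ> proj1 n)"
    by (rule plot_comp[OF X q P smooth_map_proj1[OF plot_open[OF X q] subset_refl]])
  then have "smooth_fun (n + m) (prod_dom n U m U') (h \<circ> (q \<circ> proj1 n))"
    using h unfolding smooth_real_def by blast
  from smooth_fun_mult[OF P this form_plotD(3)[OF r q' i]]
  show "smooth_fun (n + m) (prod_dom n U m U') (\<lambda>w. form_scale (h (q (proj1 n w))) (r (proj1 n w)) m U' q' (proj2 n w) i)"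
    by simp
qed (use X form_plotD[OF r] in \<open>auto intro: one_forms_scale\<close>)

lemma form_plot_pullback:
  assumes X: "diffeological_space X" and j: "dsmooth X Z j" and r: "form_plot Z n U r"
  shows "form_plot X n U (\<lambda>u. form_pullback X j (r u))"
proof (rule form_plotI)
  fix m U' q i assume "plot X m U' q" "i < m"
  then show "smooth_fun (n + m) (prod_dom n U m U') (\<lambda>w. form_pullback X j (r (proj1 n w)) m U' q (proj2 n w) i)"
    using form_plotD(3)[OF r dsmooth_plot[OF j]] by (simp add: form_pullback_def)
qed (use form_plotD[OF r] form_pullback_in[OF j _ X] in auto)

section \<open>Values of 1-forms\<close>

text \<open>The value of a form at a point, as a point of the total space of \<open>\<Lambda>\<^sup>1\<close>.\<close>

definition form_val :: "'a diffeology \<Rightarrow> 'a \<Rightarrow> 'a form \<Rightarrow> 'a \<times> 'a form set" where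
  "form_val X x \<omega> = (x, form_class X x \<omega>)"

lemma fst_form_val [simp]: "fst (form_val X x \<omega>) = x" by (simp add: form_val_def)

lemma form_class_eq:
  assumes X: "diffeological_space X" and w: "\<omega> \<in> one_forms X" "\<eta> \<in> one_forms X"
  shows "form_class X x \<omega> = form_class X x \<eta> \<longleftrightarrow> \<omega> - \<eta> \<in> vanishing_forms X x"
proof
  assume "form_class X x \<omega> = form_class X x \<eta>"
  moreover have "\<omega> \<in> form_class X x \<omega>" using w vanishing_zero by (simp add: form_class_def)
  ultimately show "\<omega> - \<eta> \<in> vanishing_forms X x" by (auto simp: form_class_def)
next
  assume d: "\<omega> - \<eta> \<in> vanishing_forms X x"
  have "\<zeta> - \<omega> \<in> vanishing_forms X x \<longleftrightarrow> \<zeta> - \<eta> \<in> vanishing_forms X x" for \<zeta>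
  proof
    assume "\<zeta> - \<omega> \<in> vanishing_forms X x"
    from vanishing_add[OF X this d] show "\<zeta> - \<eta> \<in> vanishing_forms X x" by simp
  next
    assume "\<zeta> - \<eta> \<in> vanishing_forms X x"
    from vanishing_diff[OF X this d] show "\<zeta> - \<omega> \<in> vanishing_forms X x" by simp
  qed
  then show "form_class X x \<omega> = form_class X x \<eta>" by (auto simp: form_class_def)
qed

lemma form_val_eq:
  assumes "diffeological_space X" "\<omega> \<in> one_forms X" "\<eta> \<in> one_forms X"
  shows "form_val X x \<omega> = form_val X x \<eta> \<longleftrightarrow> \<omega> - \<eta> \<in> vanishing_forms X x"
  using form_class_eq[OF assms] by (simp add: form_val_def)

lemma form_class_member: "\<omega> \<in> one_forms X \<Longrightarrow> \<omega> \<in> form_class X x \<omega>"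
  using vanishing_zero by (simp add: form_class_def)

lemma Lambda1_simps [simp]:
  "base (Lambda1 X) = X"
  "vzero (Lambda1 X) x = form_val X x 0"
  by (auto simp: Lambda1_def form_val_def form_class_def vanishing_forms_def)

lemma dspace_Lambda1: "dspace (tot (Lambda1 X)) = (\<lambda>(x, \<omega>). form_val X x \<omega>) ` (dspace X \<times> one_forms X)"
  by (simp add: Lambda1_def pushforward_diffeology_def form_val_def)

lemma fibre_Lambda1: "v \<in> fibre (Lambda1 X) x \<longleftrightarrow> x \<in> dspace X \<and> (\<exists>\<omega>\<in>one_forms X. v = form_val X x \<omega>)"
  by (auto simp: fibre_def dspace_Lambda1)

lemma form_val_in_fibre: "x \<in> dspace X \<Longrightarrow> \<omega> \<in> one_forms X \<Longrightarrow> form_val X x \<omega> \<in> fibre (Lambda1 X) x"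
  by (auto simp: fibre_Lambda1)

lemma vadd_form_val:
  assumes X: "diffeological_space X" and w: "\<omega> \<in> one_forms X" "\<eta> \<in> one_forms X"
  shows "vadd (Lambda1 X) (form_val X x \<omega>) (form_val X x \<eta>) = form_val X x (\<omega> + \<eta>)"
proof -
  have "form_class X x (\<omega>' + \<eta>') = form_class X x (\<omega> + \<eta>)"
    if "\<omega>' \<in> form_class X x \<omega>" "\<eta>' \<in> form_class X x \<eta>" for \<omega>' \<eta>'
  proof -
    have "(\<omega>' + \<eta>') - (\<omega> + \<eta>) = (\<omega>' - \<omega>) + (\<eta>' - \<eta>)" by simp
    also have "\<dots> \<in> vanishing_forms X x" using that by (intro vanishing_add[OF X]) (auto simp: form_class_def)
    finally have v: "(\<omega>' + \<eta>') - (\<omega> + \<eta>) \<in> vanishing_forms X x" .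
    have "\<omega>' \<in> one_forms X" "\<eta>' \<in> one_forms X" using that by (simp_all add: form_class_def)
    then show ?thesis using iffD2[OF form_class_eq[OF X one_forms_add[OF X] one_forms_add[OF X w]] v] by simp
  qed
  then have "(\<Union>\<omega>'\<in>form_class X x \<omega>. \<Union>\<eta>'\<in>form_class X x \<eta>. form_class X x (\<omega>' + \<eta>')) =
      (\<Union>\<omega>'\<in>form_class X x \<omega>. \<Union>\<eta>'\<in>form_class X x \<eta>. form_class X x (\<omega> + \<eta>))"
    by (intro SUP_cong HOL.refl)
  also have "\<dots> = form_class X x (\<omega> + \<eta>)"
    using form_class_member[OF w(1), of x] form_class_member[OF w(2), of x] by blast
  finally show ?thesis by (simp add: Lambda1_def form_val_def)
qed

lemma vscale_form_val:
  assumes X: "diffeological_space X" and w: "\<omega> \<in> one_forms X"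
  shows "vscale (Lambda1 X) c (form_val X x \<omega>) = form_val X x (form_scale c \<omega>)"
proof -
  have "form_class X x (form_scale c \<omega>') = form_class X x (form_scale c \<omega>)"
    if "\<omega>' \<in> form_class X x \<omega>" for \<omega>'
  proof -
    have "form_scale c \<omega>' - form_scale c \<omega> = form_scale c (\<omega>' - \<omega>)" by (simp add: fun_eq_iff algebra_simps)
    also have "\<dots> \<in> vanishing_forms X x" using that by (intro vanishing_scale[OF X]) (auto simp: form_class_def)
    finally have v: "form_scale c \<omega>' - form_scale c \<omega> \<in> vanishing_forms X x" .
    have "\<omega>' \<in> one_forms X" using that by (simp add: form_class_def)
    then show ?thesis using iffD2[OF form_class_eq[OF X one_forms_scale[OF X] one_forms_scale[OF X w]] v] by simp
  qed
  then have "(\<Union>\<omega>'\<in>form_class X x \<omega>. form_class X x (form_scale c \<omega>')) =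
      (\<Union>\<omega>'\<in>form_class X x \<omega>. form_class X x (form_scale c \<omega>))"
    by (intro SUP_cong HOL.refl)
  also have "\<dots> = form_class X x (form_scale c \<omega>)"
    using form_class_member[OF w, of x] by blast
  finally show ?thesis by (simp add: Lambda1_def form_val_def)
qed

text \<open>The pullback of values is well defined because pullbacks of vanishing forms vanish.\<close>

lemma Lambda_pullback_form_val:
  assumes X: "diffeological_space X" and Z: "diffeological_space Z" and j: "dsmooth X Z j" and w: "\<omega> \<in> one_forms Z"
  shows "Lambda_pullback X j x (form_val Z (j x) \<omega>) = form_val X x (form_pullback X j \<omega>)"
proof -
  have "form_class X x (form_pullback X j \<omega>') = form_class X x (form_pullback X j \<omega>)"
    if "\<omega>' \<in> form_class Z (j x) \<omega>" for \<omega>'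
  proof -
    have w': "\<omega>' \<in> one_forms Z" "\<omega>' - \<omega> \<in> vanishing_forms Z (j x)" using that by (auto simp: form_class_def)
    have "form_pullback X j \<omega>' - form_pullback X j \<omega> \<in> vanishing_forms X x"
      using vanishing_pullback[OF X j w'(2)] unfolding form_pullback_diff .
    then show ?thesis
      by (rule iffD2[OF form_class_eq[OF X form_pullback_in[OF j w'(1) X] form_pullback_in[OF j w X]]])
  qed
  then have "(\<Union>\<omega>'\<in>form_class Z (j x) \<omega>. form_class X x (form_pullback X j \<omega>')) =
      (\<Union>\<omega>'\<in>form_class Z (j x) \<omega>. form_class X x (form_pullback X j \<omega>))"
    by (intro SUP_cong HOL.refl)
  also have "\<dots> = form_class X x (form_pullback X j \<omega>)"
    using form_class_member[OF w, of "j x"] by blast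
  finally show ?thesis by (simp add: Lambda_pullback_def form_val_def)
qed

subsection \<open>Covectors\<close>

text \<open>A value of a form is determined by the numbers that its representatives take at \<open>0\<close> on the plots sending
\<open>0\<close> to the base point. This embeds each fibre linearly in a concrete space of functions, in which the
vector space laws are the pointwise ones and in which linear algebra is available.\<close>

type_synonym 'a covector = "nat \<Rightarrow> rvec set \<Rightarrow> (rvec \<Rightarrow> 'a) \<Rightarrow> nat \<Rightarrow> real"

definition cov_scale :: "real \<Rightarrow> 'a covector \<Rightarrow> 'a covector" where
  "cov_scale c \<phi> = (\<lambda>n U p i. c * \<phi> n U p i)"

lemma cov_scale_apply: "cov_scale c \<phi> n U p i = c * \<phi> n U p i"
  by (simp add: cov_scale_def)

definition form_at :: "'a diffeology \<Rightarrow> 'a \<Rightarrow> 'a form \<Rightarrow> 'a covector" where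
  "form_at X x \<omega> = (\<lambda>n U p i. if plot X n U p \<and> 0 \<in> U \<and> p 0 = x then \<omega> n U p 0 i else 0)"

definition covec :: "'a diffeology \<Rightarrow> 'a \<times> 'a form set \<Rightarrow> 'a covector" where
  "covec X v = form_at X (fst v) (SOME \<omega>. \<omega> \<in> snd v)"

lemma form_at_linear:
  "form_at X x (\<omega> + \<eta>) = form_at X x \<omega> + form_at X x \<eta>"
  "form_at X x (form_scale c \<omega>) = cov_scale c (form_at X x \<omega>)"
  "form_at X x (\<omega> - \<eta>) = form_at X x \<omega> - form_at X x \<eta>"
  by (auto simp: form_at_def fun_eq_iff cov_scale_apply)

lemma form_at_zero_iff: "\<omega> \<in> one_forms X \<Longrightarrow> form_at X x \<omega> = 0 \<longleftrightarrow> \<omega> \<in> vanishing_forms X x"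
  by (auto simp: form_at_def vanishing_forms_def fun_eq_iff)

lemma covec_form_val:
  assumes w: "\<omega> \<in> one_forms X"
  shows "covec X (form_val X x \<omega>) = form_at X x \<omega>"
proof -
  have "(SOME \<omega>'. \<omega>' \<in> form_class X x \<omega>) \<in> form_class X x \<omega>"
    by (rule someI[of "\<lambda>\<omega>'. \<omega>' \<in> form_class X x \<omega>", OF form_class_member[OF w]])
  then have v: "(SOME \<omega>'. \<omega>' \<in> form_class X x \<omega>) - \<omega> \<in> vanishing_forms X x" by (simp add: form_class_def)
  have "form_at X x ((SOME \<omega>'. \<omega>' \<in> form_class X x \<omega>) - \<omega>) = 0"
    using iffD2[OF form_at_zero_iff[OF vanishing_in[OF v]] v] .
  then show ?thesis by (simp add: covec_def form_val_def form_at_linear)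
qed

text \<open>Two forms that agree on all plots at the point differ by a vanishing form.\<close>

lemma covec_inj:
  assumes X: "diffeological_space X" and v: "v \<in> fibre (Lambda1 X) x" "w \<in> fibre (Lambda1 X) x"
    and e: "covec X v = covec X w"
  shows "v = w"
proof -
  obtain \<omega> \<eta> where w: "\<omega> \<in> one_forms X" "v = form_val X x \<omega>" "\<eta> \<in> one_forms X" "w = form_val X x \<eta>"
    using v by (auto simp: fibre_Lambda1)
  then have "form_at X x (\<omega> - \<eta>) = 0" using e by (simp add: covec_form_val form_at_linear)
  then show ?thesis using w form_at_zero_iff one_forms_diff[OF X w(1,3)] form_val_eq[OF X w(1,3)] by metis
qed

lemma
  assumes X: "diffeological_space X" and v: "v \<in> fibre (Lambda1 X) x"
  shows vscale_in_fibre: "vscale (Lambda1 X) c v \<in> fibre (Lambda1 X) x"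
    and covec_vscale: "covec X (vscale (Lambda1 X) c v) = cov_scale c (covec X v)"
  using v one_forms_scale[OF X]
  by (auto simp: fibre_Lambda1 vscale_form_val[OF X] covec_form_val form_at_linear)

lemma
  assumes X: "diffeological_space X" and v: "v \<in> fibre (Lambda1 X) x" "w \<in> fibre (Lambda1 X) x"
  shows vadd_in_fibre: "vadd (Lambda1 X) v w \<in> fibre (Lambda1 X) x"
    and covec_vadd: "covec X (vadd (Lambda1 X) v w) = covec X v + covec X w"
  using v one_forms_add[OF X]
  by (auto simp: fibre_Lambda1 vadd_form_val[OF X] covec_form_val form_at_linear)

lemma vzero_in_fibre: "x \<in> dspace X \<Longrightarrow> form_val X x 0 \<in> fibre (Lambda1 X) x"
  by (simp add: form_val_in_fibre one_forms_zero)

lemma covec_vzero: "covec X (form_val X x 0) = 0"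
  by (simp add: covec_form_val one_forms_zero form_at_def fun_eq_iff)

lemma lincomb_Cons: "lincomb V x ((c, v) # cvs) = vadd V (vscale V c v) (lincomb V x cvs)"
  and lincomb_Nil: "lincomb V x [] = vzero V x"
  by (simp_all add: lincomb_def)

lemma
  assumes X: "diffeological_space X" and x: "x \<in> dspace X"
    and cvs: "snd ` set cvs \<subseteq> fibre (Lambda1 X) x"
  shows lincomb_in_fibre: "lincomb (Lambda1 X) x cvs \<in> fibre (Lambda1 X) x"
    and covec_lincomb: "covec X (lincomb (Lambda1 X) x cvs) = (\<Sum>(c, v)\<leftarrow>cvs. cov_scale c (covec X v))"
proof -
  have "lincomb (Lambda1 X) x cvs \<in> fibre (Lambda1 X) x \<and>
    covec X (lincomb (Lambda1 X) x cvs) = (\<Sum>(c, v)\<leftarrow>cvs. cov_scale c (covec X v))"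
    using cvs
  proof (induction cvs)
    case Nil then show ?case using x by (simp add: lincomb_Nil vzero_in_fibre covec_vzero)
  next
    case (Cons a cvs)
    obtain c v where a: "a = (c, v)" by (cases a)
    have v: "v \<in> fibre (Lambda1 X) x" using Cons.prems a by auto
    have IH: "lincomb (Lambda1 X) x cvs \<in> fibre (Lambda1 X) x"
      "covec X (lincomb (Lambda1 X) x cvs) = (\<Sum>(c, v)\<leftarrow>cvs. cov_scale c (covec X v))"
      using Cons.IH Cons.prems by auto
    show ?case using IH
      by (simp add: a lincomb_Cons vadd_in_fibre[OF X vscale_in_fibre[OF X v]] covec_vscale[OF X v]
          covec_vadd[OF X vscale_in_fibre[OF X v]])
  qed
  then show "lincomb (Lambda1 X) x cvs \<in> fibre (Lambda1 X) x"
    "covec X (lincomb (Lambda1 X) x cvs) = (\<Sum>(c, v)\<leftarrow>cvs. cov_scale c (covec X v))" by blast+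
qed

subsection \<open>Linear maps between fibres\<close>

text \<open>The zero of a fibre is separate data of a pseudo-bundle, so its preservation is a separate clause.\<close>

definition fibre_linear :: "'a diffeology \<Rightarrow> 'a \<Rightarrow> 'b diffeology \<Rightarrow> 'b \<Rightarrow>
    ('a \<times> 'a form set \<Rightarrow> 'b \<times> 'b form set) \<Rightarrow> bool" where
  "fibre_linear X x Z z \<phi> \<longleftrightarrow>
     (\<forall>v\<in>fibre (Lambda1 X) x. \<phi> v \<in> fibre (Lambda1 Z) z) \<and>
     (\<forall>v\<in>fibre (Lambda1 X) x. \<forall>w\<in>fibre (Lambda1 X) x.
        \<phi> (vadd (Lambda1 X) v w) = vadd (Lambda1 Z) (\<phi> v) (\<phi> w)) \<and>
     (\<forall>c. \<forall>v\<in>fibre (Lambda1 X) x. \<phi> (vscale (Lambda1 X) c v) = vscale (Lambda1 Z) c (\<phi> v)) \<and>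
     \<phi> (form_val X x 0) = form_val Z z 0"

lemma
  assumes "fibre_linear X x Z z \<phi>"
  shows fibre_linear_in: "v \<in> fibre (Lambda1 X) x \<Longrightarrow> \<phi> v \<in> fibre (Lambda1 Z) z"
    and fibre_linear_add: "v \<in> fibre (Lambda1 X) x \<Longrightarrow> w \<in> fibre (Lambda1 X) x \<Longrightarrow>
      \<phi> (vadd (Lambda1 X) v w) = vadd (Lambda1 Z) (\<phi> v) (\<phi> w)"
    and fibre_linear_scale: "v \<in> fibre (Lambda1 X) x \<Longrightarrow> \<phi> (vscale (Lambda1 X) c v) = vscale (Lambda1 Z) c (\<phi> v)"
    and fibre_linear_zero: "\<phi> (form_val X x 0) = form_val Z z 0"
  using assms by (auto simp: fibre_linear_def)

lemma fibre_linear_pullback: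
  assumes X: "diffeological_space X" and Z: "diffeological_space Z" and j: "dsmooth X Z j" and x: "x \<in> dspace X"
  shows "fibre_linear Z (j x) X x (Lambda_pullback X j x)"
proof -
  have z: "form_pullback X j (0 :: 'b form) = 0" by (simp add: form_pullback_def fun_eq_iff)
  show ?thesis
    unfolding fibre_linear_def
  proof (intro conjI ballI allI)
    fix v c assume "v \<in> fibre (Lambda1 Z) (j x)"
    then obtain \<omega> where w: "\<omega> \<in> one_forms Z" "v = form_val Z (j x) \<omega>" by (auto simp: fibre_Lambda1)
    show "Lambda_pullback X j x v \<in> fibre (Lambda1 X) x"
      using form_val_in_fibre[OF x form_pullback_in[OF j w(1) X]]
      by (simp add: w Lambda_pullback_form_val[OF X Z j])
    show "Lambda_pullback X j x (vscale (Lambda1 Z) c v) = vscale (Lambda1 X) c (Lambda_pullback X j x v)"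
      using form_pullback_in[OF j w(1) X] one_forms_scale[OF Z w(1)]
      by (simp add: w Lambda_pullback_form_val[OF X Z j] vscale_form_val[OF Z] vscale_form_val[OF X] form_pullback_scale)
    fix v' assume "v' \<in> fibre (Lambda1 Z) (j x)"
    then obtain \<eta> where e: "\<eta> \<in> one_forms Z" "v' = form_val Z (j x) \<eta>" by (auto simp: fibre_Lambda1)
    show "Lambda_pullback X j x (vadd (Lambda1 Z) v v') = vadd (Lambda1 X) (Lambda_pullback X j x v) (Lambda_pullback X j x v')"
      using form_pullback_in[OF j w(1) X] form_pullback_in[OF j e(1) X] one_forms_add[OF Z w(1) e(1)] w e
      by (simp add: Lambda_pullback_form_val[OF X Z j] vadd_form_val[OF Z] vadd_form_val[OF X] form_pullback_add)
  qed (simp add: Lambda_pullback_form_val[OF X Z j one_forms_zero] z)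
qed

lemma fibre_linear_lincomb:
  assumes X: "diffeological_space X" and x: "x \<in> dspace X" and \<phi>: "fibre_linear X x Z z \<phi>"
    and cvs: "snd ` set cvs \<subseteq> fibre (Lambda1 X) x"
  shows "\<phi> (lincomb (Lambda1 X) x cvs) = lincomb (Lambda1 Z) z (map (\<lambda>(c, v). (c, \<phi> v)) cvs)"
  using cvs
proof (induction cvs)
  case Nil then show ?case by (simp add: lincomb_Nil fibre_linear_zero[OF \<phi>])
next
  case (Cons a cvs)
  obtain c v where a: "a = (c, v)" by (cases a)
  have v: "v \<in> fibre (Lambda1 X) x" using Cons.prems a by auto
  have cvs: "snd ` set cvs \<subseteq> fibre (Lambda1 X) x" using Cons.prems by auto
  show ?case
    by (simp add: a lincomb_Cons Cons.IH[OF cvs] fibre_linear_scale[OF \<phi> v]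
       fibre_linear_add[OF \<phi> vscale_in_fibre[OF X v] lincomb_in_fibre[OF X x cvs]])
qed

subsection \<open>Smooth families of values\<close>

abbreviation Lambda_plot where "Lambda_plot X \<equiv> plot (tot (Lambda1 X))"

abbreviation form_rep where
  "form_rep X n V a \<equiv> \<exists>q r. plot X n V q \<and> form_plot X n V r \<and> (\<forall>v\<in>V. a v = form_val X (q v) (r v))"

lemma Lambda_plot_unfold:
  "Lambda_plot X n U a \<longleftrightarrow> ropen n U \<and> a ` U \<subseteq> dspace (tot (Lambda1 X)) \<and> near_each n U (\<lambda>V. (\<exists>b. \<forall>v\<in>V. a v = b) \<or>
      (\<exists>q. plot (prod_diffeology X (one_forms_diffeology X)) n V q \<and> (\<forall>v\<in>V. a v = (case q v of (x, \<omega>) \<Rightarrow> form_val X x \<omega>))))"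
  by (simp add: Lambda1_def pushforward_diffeology_def form_val_def del: split_paired_Ex)

text \<open>The quotient map is onto, so the constant families in the pushforward diffeology also come from a
point and a form, and every plot of \<open>\<Lambda>\<^sup>1\<close> is locally a plot of points together with a smooth family of forms.\<close>

lemma Lambda_plot_iff:
  assumes X: "diffeological_space X"
  shows "Lambda_plot X n U a \<longleftrightarrow> ropen n U \<and> near_each n U (\<lambda>V. form_rep X n V a)"
    (is "_ \<longleftrightarrow> _ \<and> near_each n U ?R")
proof
  assume a: "Lambda_plot X n U a"
  let ?Q = "\<lambda>V. (\<exists>b. \<forall>v\<in>V. a v = b) \<or>
      (\<exists>q. plot (prod_diffeology X (one_forms_diffeology X)) n V q \<and> (\<forall>v\<in>V. a v = (case q v of (x, \<omega>) \<Rightarrow> form_val X x \<omega>)))"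
  have *: "ropen n U" "a ` U \<subseteq> dspace (tot (Lambda1 X))" "near_each n U ?Q"
    using a unfolding Lambda_plot_unfold by blast+
  have "near_each n U ?R" using *(3)
  proof (rule near_each_mono)
    fix V assume V: "ropen n V" "V \<subseteq> U" "?Q V"
    show "?R V"
    proof (cases "V = {}")
      case True
      have "plot X n V q" for q using V(1) plot_local[OF X] by (simp add: True near_each_def)
      moreover have "form_plot X n V (\<lambda>_. 0)" by (rule form_plot_const[OF X one_forms_zero V(1)])
      ultimately show ?thesis using True by blast
    next
      case False
      from V(3) show ?thesis
      proof
        assume "\<exists>b. \<forall>v\<in>V. a v = b"
        then obtain b where b: "\<forall>v\<in>V. a v = b" by blast
        obtain v where v: "v \<in> V" using False by (metis equals0I)
        then have "a v \<in> dspace (tot (Lambda1 X))" by (intro subsetD[OF *(2)] imageI subsetD[OF V(2)])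
        then have "b \<in> dspace (tot (Lambda1 X))" using b v by simp
        then obtain x \<omega> where x: "b = form_val X x \<omega>" "x \<in> dspace X" "\<omega> \<in> one_forms X"
          by (auto simp: dspace_Lambda1)
        show ?thesis using b x(1) plot_const[OF X V(1) x(2)] form_plot_const[OF X x(3) V(1)]
          by (intro exI[of _ "\<lambda>_. x"] exI[of _ "\<lambda>_. \<omega>"] conjI) simp_all
      next
        assume "\<exists>q. plot (prod_diffeology X (one_forms_diffeology X)) n V q \<and> (\<forall>v\<in>V. a v = (case q v of (x, \<omega>) \<Rightarrow> form_val X x \<omega>))"
        then obtain q where q: "plot (prod_diffeology X (one_forms_diffeology X)) n V q"
          "\<forall>v\<in>V. a v = (case q v of (x, \<omega>) \<Rightarrow> form_val X x \<omega>)" by blast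
        show ?thesis
        proof (intro exI conjI)
          show "plot X n V (fst \<circ> q)" "form_plot X n V (snd \<circ> q)"
            using q(1) by (simp_all add: prod_diffeology_def)
          show "\<forall>v\<in>V. a v = form_val X ((fst \<circ> q) v) ((snd \<circ> q) v)"
            using q(2) by (simp add: split_def)
        qed
      qed
    qed
  qed
  then show "ropen n U \<and> near_each n U ?R" using * by blast
next
  assume "ropen n U \<and> near_each n U ?R"
  then have U: "ropen n U" and near: "near_each n U ?R" by auto
  have "a u \<in> dspace (tot (Lambda1 X))" if u: "u \<in> U" for u
  proof -
    obtain V q r where "u \<in> V" "plot X n V q" "form_plot X n V r" "\<forall>v\<in>V. a v = form_val X (q v) (r v)"
      using near u unfolding near_each_def by metis
    then have "a u = form_val X (q u) (r u)" "q u \<in> dspace X" "r u \<in> one_forms X"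
      by (simp_all add: plot_in[OF X] form_plotD(2))
    then show ?thesis by (simp add: dspace_Lambda1 image_iff) metis
  qed
  then have "a ` U \<subseteq> dspace (tot (Lambda1 X))" by (intro image_subsetI)
  moreover have "near_each n U (\<lambda>V. \<exists>q. plot (prod_diffeology X (one_forms_diffeology X)) n V q \<and> (\<forall>v\<in>V. a v = (case q v of (x, \<omega>) \<Rightarrow> form_val X x \<omega>)))"
    using near
  proof (rule near_each_mono)
    fix V assume "?R V"
    then obtain q r where "plot X n V q" "form_plot X n V r" "\<forall>v\<in>V. a v = form_val X (q v) (r v)" by blast
    then show "\<exists>q. plot (prod_diffeology X (one_forms_diffeology X)) n V q \<and> (\<forall>v\<in>V. a v = (case q v of (x, \<omega>) \<Rightarrow> form_val X x \<omega>))"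
      by (intro exI[of _ "\<lambda>v. (q v, r v)"]) (auto simp: prod_diffeology_def comp_def)
  qed
  then have "near_each n U (\<lambda>V. (\<exists>b. \<forall>v\<in>V. a v = b) \<or>
      (\<exists>q. plot (prod_diffeology X (one_forms_diffeology X)) n V q \<and> (\<forall>v\<in>V. a v = (case q v of (x, \<omega>) \<Rightarrow> form_val X x \<omega>))))"
    by (rule near_each_mono) blast
  ultimately show "Lambda_plot X n U a" unfolding Lambda_plot_unfold using U by (intro conjI)
qed

lemma Lambda_plot_val:
  assumes "diffeological_space X" "plot X n U q" "form_plot X n U r"
  shows "Lambda_plot X n U (\<lambda>u. form_val X (q u) (r u))"
  unfolding Lambda_plot_iff[OF assms(1)]
  using plot_open[OF assms(1,2)] assms by (auto intro!: near_each_self)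

lemma Lambda_plot_local:
  assumes X: "diffeological_space X" and "ropen n U" "near_each n U (\<lambda>V. Lambda_plot X n V a)"
  shows "Lambda_plot X n U a"
  unfolding Lambda_plot_iff[OF X] using assms(2) near_each_bind[OF assms(3)]
  unfolding Lambda_plot_iff[OF X] by blast

lemma Lambda_plot_restrict:
  assumes X: "diffeological_space X" and "Lambda_plot X n U a" "ropen n V" "V \<subseteq> U"
  shows "Lambda_plot X n V a"
proof -
  let ?R = "\<lambda>V. form_rep X n V a"
  have near: "near_each n U ?R" using assms(2) unfolding Lambda_plot_iff[OF X] by blast
  have "?R V'" if R: "?R V" "ropen n V'" "V' \<subseteq> V" for V V'
  proof -
    obtain q r where q: "plot X n V q" "form_plot X n V r" "\<forall>v\<in>V. a v = form_val X (q v) (r v)" using R(1) by blast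
    show ?thesis
      using plot_restrict[OF X q(1) R(2,3)] form_plot_restrict[OF q(2) R(2,3)] q(3) R(3)
      by (intro exI[of _ q] exI[of _ r]) (simp add: subset_iff)
  qed
  then have "near_each n V ?R" by (rule near_each_restrict[where P = ?R, OF near assms(3,4)])
  then show ?thesis unfolding Lambda_plot_iff[OF X] using assms(3) by simp
qed

lemma Lambda_plot_cong:
  assumes X: "diffeological_space X" and a: "Lambda_plot X n U a" and e: "\<And>u. u \<in> U \<Longrightarrow> a u = b u"
  shows "Lambda_plot X n U b"
proof -
  have "near_each n U (\<lambda>V. form_rep X n V a)"
    using a unfolding Lambda_plot_iff[OF X] by blast
  then have "near_each n U (\<lambda>V. form_rep X n V b)"
  proof (rule near_each_mono)
    fix V assume "V \<subseteq> U" "form_rep X n V a"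
    moreover then obtain q r where "plot X n V q" "form_plot X n V r" "\<forall>v\<in>V. a v = form_val X (q v) (r v)" by blast
    ultimately have "plot X n V q \<and> form_plot X n V r \<and> (\<forall>v\<in>V. b v = form_val X (q v) (r v))"
      using e by (auto simp: subset_iff)
    then show "form_rep X n V b" by blast
  qed
  then show ?thesis using a unfolding Lambda_plot_iff[OF X] by blast
qed

lemma Lambda_plot_open: "diffeological_space X \<Longrightarrow> Lambda_plot X n U a \<Longrightarrow> ropen n U"
  by (simp add: Lambda_plot_iff)

section \<open>Tensors of values\<close>

abbreviation Leq where "Leq X x \<equiv> tensor_eq (Lambda1 X) (Lambda1 X) x"
abbreviation Lpairs where "Lpairs X x \<equiv> fibre (Lambda1 X) x \<times> fibre (Lambda1 X) x"

text \<open>The tensor \<open>\<Sum>\<^sub>i v\<^sub>i \<otimes> w\<^sub>i\<close> of a list of pairs of values over \<open>x\<close>.\<close>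

definition tens :: "'a diffeology \<Rightarrow> 'a \<Rightarrow> (('a \<times> 'a form set) \<times> ('a \<times> 'a form set)) list \<Rightarrow>
    'a \<times> (('a \<times> 'a form set) \<times> ('a \<times> 'a form set)) list set" where
  "tens X x zs = (x, tensor_class (Lambda1 X) (Lambda1 X) x zs)"

lemma tensor_eq_valid:
  assumes X: "diffeological_space X" and x: "x \<in> dspace X" and e: "Leq X x zs zs'"
  shows "set zs \<subseteq> Lpairs X x \<and> set zs' \<subseteq> Lpairs X x"
  using e by induction (use x in \<open>auto simp: vadd_in_fibre[OF X] vscale_in_fibre[OF X] vzero_in_fibre\<close>)

lemma tensor_class_eq_iff:
  assumes "set zs \<subseteq> Lpairs X x"
  shows "tensor_class (Lambda1 X) (Lambda1 X) x zs = tensor_class (Lambda1 X) (Lambda1 X) x zs' \<longleftrightarrow> Leq X x zs zs'"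
proof
  assume "tensor_class (Lambda1 X) (Lambda1 X) x zs = tensor_class (Lambda1 X) (Lambda1 X) x zs'"
  moreover have "zs \<in> tensor_class (Lambda1 X) (Lambda1 X) x zs"
    using tensor_eq.refl[OF assms] by (simp add: tensor_class_def)
  ultimately show "Leq X x zs zs'" by (auto simp: tensor_class_def intro: tensor_eq.sym)
next
  assume e: "Leq X x zs zs'"
  have "Leq X x zs us \<longleftrightarrow> Leq X x zs' us" for us
    by (rule iffI) (erule tensor_eq.trans[OF tensor_eq.sym[OF e]], erule tensor_eq.trans[OF e])
  then show "tensor_class (Lambda1 X) (Lambda1 X) x zs = tensor_class (Lambda1 X) (Lambda1 X) x zs'"
    by (simp add: tensor_class_def)
qed

lemma fst_tens [simp]: "fst (tens X x zs) = x" by (simp add: tens_def)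

lemma snd_tens: "zs' \<in> snd (tens X x zs) \<longleftrightarrow> Leq X x zs zs'"
  by (simp add: tens_def tensor_class_def)

lemma fibre_tensor: "\<tau> \<in> fibre (Lambda1_tensor X) x \<longleftrightarrow>
    x \<in> dspace X \<and> (\<exists>zs. set zs \<subseteq> Lpairs X x \<and> \<tau> = tens X x zs)"
proof -
  have "\<tau> \<in> fibre (Lambda1_tensor X) x \<longleftrightarrow> (\<exists>y zs. \<tau> = tens X y zs \<and> y \<in> dspace X \<and> set zs \<subseteq> Lpairs X y) \<and> fst \<tau> = x"
    unfolding fibre_def[of "Lambda1_tensor X"] by (simp add: tensor_bundle_def tens_def)
  also have "\<dots> \<longleftrightarrow> x \<in> dspace X \<and> (\<exists>zs. set zs \<subseteq> Lpairs X x \<and> \<tau> = tens X x zs)"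
    by (metis fst_tens)
  finally show ?thesis .
qed

lemma tensor_simps [simp]: "base (Lambda1_tensor X) = X"
  by (simp add: tensor_bundle_def)

lemma class_UN:
  assumes "zs \<in> S" "\<And>zs'. zs' \<in> S \<Longrightarrow> F zs' = F zs" shows "(\<Union>zs'\<in>S. F zs') = F zs"
  using assms by blast

lemma tens_self: "set zs \<subseteq> Lpairs X x \<Longrightarrow> zs \<in> snd (tens X x zs)"
  by (simp add: snd_tens tensor_eq.refl)

lemma pairs_map:
  assumes \<phi>: "fibre_linear X x Z z \<phi>" and \<psi>: "fibre_linear X x Z z \<psi>" and zs: "set zs \<subseteq> Lpairs X x"
  shows "set (map (map_prod \<phi> \<psi>) zs) \<subseteq> Lpairs Z z"
  unfolding set_map
proof (rule image_subsetI)
  fix p assume "p \<in> set zs"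
  then have "fst p \<in> fibre (Lambda1 X) x" "snd p \<in> fibre (Lambda1 X) x" using zs by auto
  then show "map_prod \<phi> \<psi> p \<in> Lpairs Z z"
    using fibre_linear_in[OF \<phi>] fibre_linear_in[OF \<psi>] by (simp add: map_prod_def split_def)
qed

text \<open>Linear maps send each generating relation of the tensor congruence to an instance of the same relation.\<close>

lemma tensor_eq_map:
  assumes \<phi>: "fibre_linear X x Z z \<phi>" and \<psi>: "fibre_linear X x Z z \<psi>" and e: "Leq X x zs zs'"
  shows "Leq Z z (map (map_prod \<phi> \<psi>) zs) (map (map_prod \<phi> \<psi>) zs')"
  using e
proof induction
  case (refl zs)
  then show ?case by (rule tensor_eq.refl[OF pairs_map[OF \<phi> \<psi>]])
next
  case (sym zs zs') from sym.IH show ?case by (rule tensor_eq.sym)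
next
  case (trans zs zs' zs'') from trans.IH show ?case by (rule tensor_eq.trans)
next
  case (cong zs zs' us vs)
  show ?case unfolding map_append
    by (rule tensor_eq.cong[OF cong.IH pairs_map[OF \<phi> \<psi> cong.hyps(2)] pairs_map[OF \<phi> \<psi> cong.hyps(3)]])
next
  case (swap a b)
  have s: "set [a] \<subseteq> Lpairs X x" "set [b] \<subseteq> Lpairs X x" unfolding list.set using swap.hyps by blast+
  have "map_prod \<phi> \<psi> a \<in> Lpairs Z z" "map_prod \<phi> \<psi> b \<in> Lpairs Z z"
    using pairs_map[OF \<phi> \<psi> s(1)] pairs_map[OF \<phi> \<psi> s(2)] unfolding list.map list.set by blast+
  from tensor_eq.swap[OF this] show ?case unfolding list.map .
next
  case (add_left v v' w)
  then show ?case by (simp add: fibre_linear_add[OF \<phi>] tensor_eq.add_left fibre_linear_in[OF \<phi>] fibre_linear_in[OF \<psi>])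
next
  case (add_right v w w')
  then show ?case by (simp add: fibre_linear_add[OF \<psi>] tensor_eq.add_right fibre_linear_in[OF \<phi>] fibre_linear_in[OF \<psi>])
next
  case (scale v w c)
  then show ?case
    by (simp add: fibre_linear_scale[OF \<phi>] fibre_linear_scale[OF \<psi>] tensor_eq.scale fibre_linear_in[OF \<phi>] fibre_linear_in[OF \<psi>])
next
  case (zero w)
  then show ?case using tensor_eq.zero[where V = "Lambda1 Z", OF fibre_linear_in[OF \<psi>], of w] by (simp add: fibre_linear_zero[OF \<phi>])
qed

lemma tensor_map_tens:
  assumes \<phi>: "fibre_linear X x Z z \<phi>" and \<psi>: "fibre_linear X x Z z \<psi>" and zs: "set zs \<subseteq> Lpairs X x"
  shows "tensor_map (Lambda1 Z) (Lambda1 Z) z \<phi> \<psi> (tens X x zs) = tens Z z (map (map_prod \<phi> \<psi>) zs)"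
proof -
  have "(\<Union>zs'\<in>snd (tens X x zs). tensor_class (Lambda1 Z) (Lambda1 Z) z (map (map_prod \<phi> \<psi>) zs')) =
      tensor_class (Lambda1 Z) (Lambda1 Z) z (map (map_prod \<phi> \<psi>) zs)"
  proof (rule class_UN[OF tens_self[OF zs]])
    fix zs' assume "zs' \<in> snd (tens X x zs)"
    then have "Leq X x zs zs'" by (simp add: snd_tens)
    from tensor_eq_map[OF \<phi> \<psi> this]
    show "tensor_class (Lambda1 Z) (Lambda1 Z) z (map (map_prod \<phi> \<psi>) zs') =
        tensor_class (Lambda1 Z) (Lambda1 Z) z (map (map_prod \<phi> \<psi>) zs)"
      using tensor_class_eq_iff[OF pairs_map[OF \<phi> \<psi> zs]] by metis
  qed
  then show ?thesis by (simp add: tensor_map_def tens_def)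
qed

lemma tensor_eq_append:
  assumes "Leq X x zs zs'" "Leq X x us us'" "set zs \<subseteq> Lpairs X x" "set zs' \<subseteq> Lpairs X x"
    "set us \<subseteq> Lpairs X x" "set us' \<subseteq> Lpairs X x"
  shows "Leq X x (zs @ us) (zs' @ us')"
proof -
  have "Leq X x ([] @ zs @ us) ([] @ zs' @ us)" by (rule tensor_eq.cong) (use assms in auto)
  moreover have "Leq X x (zs' @ us @ []) (zs' @ us' @ [])" by (rule tensor_eq.cong) (use assms in auto)
  ultimately show ?thesis using tensor_eq.trans by fastforce
qed

lemma vadd_tens:
  assumes X: "diffeological_space X" and x: "x \<in> dspace X" and zs: "set zs \<subseteq> Lpairs X x" "set us \<subseteq> Lpairs X x"
  shows "vadd (Lambda1_tensor X) (tens X x zs) (tens X x us) = tens X x (zs @ us)"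
proof -
  let ?C = "tensor_class (Lambda1 X) (Lambda1 X) x"
  have inner: "?C (zs' @ us') = ?C (zs @ us)" if "zs' \<in> snd (tens X x zs)" "us' \<in> snd (tens X x us)" for zs' us'
  proof -
    have e: "Leq X x zs zs'" "Leq X x us us'" using that by (simp_all add: snd_tens)
    note v = tensor_eq_valid[OF X x e(1)] tensor_eq_valid[OF X x e(2)]
    have "Leq X x (zs @ us) (zs' @ us')" using tensor_eq_append[OF e] v by blast
    then show ?thesis using tensor_class_eq_iff[of "zs @ us" X x "zs' @ us'"] zs by simp
  qed
  have i: "(\<Union>us'\<in>snd (tens X x us). ?C (zs' @ us')) = ?C (zs @ us)" if "zs' \<in> snd (tens X x zs)" for zs'
    using class_UN[where F = "\<lambda>us'. ?C (zs' @ us')", OF tens_self[OF zs(2)]] inner[OF that] tens_self[OF zs(2)] by simp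
  have "(\<Union>zs'\<in>snd (tens X x zs). \<Union>us'\<in>snd (tens X x us). ?C (zs' @ us')) = ?C (zs @ us)"
    using class_UN[where F = "\<lambda>zs'. \<Union>us'\<in>snd (tens X x us). ?C (zs' @ us')", OF tens_self[OF zs(1)]] i tens_self[OF zs(1)] by simp
  then show ?thesis by (simp add: tensor_bundle_def tens_def)
qed

lemma fibre_linear_id: "x \<in> dspace X \<Longrightarrow> fibre_linear X x X x (\<lambda>v. v)"
  by (simp add: fibre_linear_def)

lemma fibre_linear_vscale:
  assumes X: "diffeological_space X" and x: "x \<in> dspace X"
  shows "fibre_linear X x X x (vscale (Lambda1 X) c)"
  unfolding fibre_linear_def
proof (intro conjI ballI allI)
  fix v w assume v: "v \<in> fibre (Lambda1 X) x" and w: "w \<in> fibre (Lambda1 X) x"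
  show "vscale (Lambda1 X) c (vadd (Lambda1 X) v w) = vadd (Lambda1 X) (vscale (Lambda1 X) c v) (vscale (Lambda1 X) c w)"
    by (rule covec_inj[OF X vscale_in_fibre[OF X vadd_in_fibre[OF X v w]] vadd_in_fibre[OF X vscale_in_fibre[OF X v] vscale_in_fibre[OF X w]]])
      (simp add: covec_vscale[OF X vadd_in_fibre[OF X v w]] covec_vadd[OF X v w] covec_vscale[OF X v] covec_vscale[OF X w]
        covec_vadd[OF X vscale_in_fibre[OF X v] vscale_in_fibre[OF X w]] cov_scale_def fun_eq_iff algebra_simps)
next
  fix v d assume v: "v \<in> fibre (Lambda1 X) x"
  show "vscale (Lambda1 X) c v \<in> fibre (Lambda1 X) x" by (rule vscale_in_fibre[OF X v])
  show "vscale (Lambda1 X) c (vscale (Lambda1 X) d v) = vscale (Lambda1 X) d (vscale (Lambda1 X) c v)"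
    by (rule covec_inj[OF X vscale_in_fibre[OF X vscale_in_fibre[OF X v]] vscale_in_fibre[OF X vscale_in_fibre[OF X v]]])
      (simp add: covec_vscale[OF X vscale_in_fibre[OF X v]] covec_vscale[OF X v] cov_scale_def fun_eq_iff algebra_simps)
next
  have "form_scale c (0 :: 'a form) = 0" by (simp add: form_scale_def fun_eq_iff)
  then show "vscale (Lambda1 X) c (form_val X x 0) = form_val X x 0"
    by (simp add: vscale_form_val[OF X one_forms_zero])
qed

lemma vscale_tens:
  assumes X: "diffeological_space X" and x: "x \<in> dspace X" and zs: "set zs \<subseteq> Lpairs X x"
  shows "vscale (Lambda1_tensor X) c (tens X x zs) = tens X x (map (map_prod (vscale (Lambda1 X) c) (\<lambda>v. v)) zs)"
proof -
  have "vscale (Lambda1_tensor X) c (tens X x zs) =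
      tensor_map (Lambda1 X) (Lambda1 X) x (vscale (Lambda1 X) c) (\<lambda>v. v) (tens X x zs)"
    by (simp add: tensor_bundle_def tensor_map_def map_prod_def tens_def)
  also have "\<dots> = tens X x (map (map_prod (vscale (Lambda1 X) c) (\<lambda>v. v)) zs)"
    by (rule tensor_map_tens[OF fibre_linear_vscale[OF X x] fibre_linear_id[OF x] zs])
  finally show ?thesis .
qed

lemma pure_tensor_tens: "pure_tensor (Lambda1 X) (Lambda1 X) v w = tens X (fst v) [(v, w)]"
  by (simp add: pure_tensor_def tens_def)

lemma fst_fibre: "v \<in> fibre V x \<Longrightarrow> fst v = x" by (simp add: fibre_def)

lemma
  assumes X: "diffeological_space X" and x: "x \<in> dspace X" and Z: "diffeological_space Z" and z: "z \<in> dspace Z"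
    and \<phi>: "fibre_linear X x Z z \<phi>"
  defines "T \<equiv> tensor_map (Lambda1 Z) (Lambda1 Z) z \<phi> \<phi>"
  shows tensor_map_in: "\<tau> \<in> fibre (Lambda1_tensor X) x \<Longrightarrow> T \<tau> \<in> fibre (Lambda1_tensor Z) z"
    and tensor_map_add: "\<tau> \<in> fibre (Lambda1_tensor X) x \<Longrightarrow> \<sigma> \<in> fibre (Lambda1_tensor X) x \<Longrightarrow>
      T (vadd (Lambda1_tensor X) \<tau> \<sigma>) = vadd (Lambda1_tensor Z) (T \<tau>) (T \<sigma>)"
    and tensor_map_scale: "\<tau> \<in> fibre (Lambda1_tensor X) x \<Longrightarrow>
      T (vscale (Lambda1_tensor X) c \<tau>) = vscale (Lambda1_tensor Z) c (T \<tau>)"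
    and tensor_map_pure: "v \<in> fibre (Lambda1 X) x \<Longrightarrow> w \<in> fibre (Lambda1 X) x \<Longrightarrow>
      T (pure_tensor (Lambda1 X) (Lambda1 X) v w) = pure_tensor (Lambda1 Z) (Lambda1 Z) (\<phi> v) (\<phi> w)"
proof -
  have T: "T (tens X x zs) = tens Z z (map (map_prod \<phi> \<phi>) zs)" if "set zs \<subseteq> Lpairs X x" for zs
    unfolding T_def by (rule tensor_map_tens[OF \<phi> \<phi> that])
  note pm = pairs_map[OF \<phi> \<phi>]
  show "T \<tau> \<in> fibre (Lambda1_tensor Z) z" if "\<tau> \<in> fibre (Lambda1_tensor X) x"
    using that pm z unfolding fibre_tensor by (metis T)
  show "T (vadd (Lambda1_tensor X) \<tau> \<sigma>) = vadd (Lambda1_tensor Z) (T \<tau>) (T \<sigma>)"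
    if t: "\<tau> \<in> fibre (Lambda1_tensor X) x" "\<sigma> \<in> fibre (Lambda1_tensor X) x"
  proof -
    obtain zs us where zs: "set zs \<subseteq> Lpairs X x" "\<tau> = tens X x zs" "set us \<subseteq> Lpairs X x" "\<sigma> = tens X x us"
      using t unfolding fibre_tensor by blast
    have "set (zs @ us) \<subseteq> Lpairs X x" using zs by simp
    then show ?thesis
      by (simp only: zs(2,4) vadd_tens[OF X x zs(1,3)] T T[OF zs(1)] T[OF zs(3)] map_append vadd_tens[OF Z z pm[OF zs(1)] pm[OF zs(3)]])
  qed
  show "T (vscale (Lambda1_tensor X) c \<tau>) = vscale (Lambda1_tensor Z) c (T \<tau>)"
    if t: "\<tau> \<in> fibre (Lambda1_tensor X) x"
  proof -
    obtain zs where zs: "set zs \<subseteq> Lpairs X x" "\<tau> = tens X x zs" using t unfolding fibre_tensor by blast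
    have "map (map_prod \<phi> \<phi>) (map (map_prod (vscale (Lambda1 X) c) (\<lambda>v. v)) zs) =
      map (map_prod (vscale (Lambda1 Z) c) (\<lambda>v. v)) (map (map_prod \<phi> \<phi>) zs)"
      using zs(1) by (auto simp: fibre_linear_scale[OF \<phi>] subset_iff)
    then show ?thesis
      by (simp only: zs(2) vscale_tens[OF X x zs(1)] T[OF pairs_map[OF fibre_linear_vscale[OF X x] fibre_linear_id[OF x] zs(1)]]
        T[OF zs(1)] vscale_tens[OF Z z pm[OF zs(1)]])
  qed
  show "T (pure_tensor (Lambda1 X) (Lambda1 X) v w) = pure_tensor (Lambda1 Z) (Lambda1 Z) (\<phi> v) (\<phi> w)"
    if "v \<in> fibre (Lambda1 X) x" "w \<in> fibre (Lambda1 X) x"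
    using that T[of "[(v, w)]"] by (simp add: pure_tensor_tens fst_fibre fst_fibre[OF fibre_linear_in[OF \<phi>]])
qed

lemma tensor_fibre_closed:
  assumes X: "diffeological_space X" and x: "x \<in> dspace X"
  shows "\<tau> \<in> fibre (Lambda1_tensor X) x \<Longrightarrow> \<sigma> \<in> fibre (Lambda1_tensor X) x \<Longrightarrow> vadd (Lambda1_tensor X) \<tau> \<sigma> \<in> fibre (Lambda1_tensor X) x"
    and "\<tau> \<in> fibre (Lambda1_tensor X) x \<Longrightarrow> vscale (Lambda1_tensor X) c \<tau> \<in> fibre (Lambda1_tensor X) x"
    and "v \<in> fibre (Lambda1 X) x \<Longrightarrow> w \<in> fibre (Lambda1 X) x \<Longrightarrow> pure_tensor (Lambda1 X) (Lambda1 X) v w \<in> fibre (Lambda1_tensor X) x"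
proof -
  show "vadd (Lambda1_tensor X) \<tau> \<sigma> \<in> fibre (Lambda1_tensor X) x"
    if t: "\<tau> \<in> fibre (Lambda1_tensor X) x" "\<sigma> \<in> fibre (Lambda1_tensor X) x"
  proof -
    obtain zs us where zs: "set zs \<subseteq> Lpairs X x" "\<tau> = tens X x zs" "set us \<subseteq> Lpairs X x" "\<sigma> = tens X x us"
      using t unfolding fibre_tensor by blast
    then have "set (zs @ us) \<subseteq> Lpairs X x" by simp
    then show ?thesis using zs x unfolding fibre_tensor by (metis vadd_tens[OF X x])
  qed
  show "vscale (Lambda1_tensor X) c \<tau> \<in> fibre (Lambda1_tensor X) x" if t: "\<tau> \<in> fibre (Lambda1_tensor X) x"
  proof -
    obtain zs where zs: "set zs \<subseteq> Lpairs X x" "\<tau> = tens X x zs" using t unfolding fibre_tensor by blast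
    show ?thesis unfolding fibre_tensor zs(2) vscale_tens[OF X x zs(1)]
      using pairs_map[OF fibre_linear_vscale[OF X x] fibre_linear_id[OF x] zs(1)] x by blast
  qed
  show "pure_tensor (Lambda1 X) (Lambda1 X) v w \<in> fibre (Lambda1_tensor X) x"
    if v: "v \<in> fibre (Lambda1 X) x" "w \<in> fibre (Lambda1 X) x"
    unfolding fibre_tensor pure_tensor_tens fst_fibre[OF v(1)] using v x by (intro conjI exI[of _ "[(v, w)]"]) auto
qed

text \<open>Functoriality of the tensor product; in this form it shows that a linear map with a left inverse is injective on tensors.\<close>

lemma tensor_map_left_inverse:
  assumes \<phi>: "fibre_linear X x Z z \<phi>" and \<psi>: "fibre_linear Z z X x \<psi>"
    and inv: "\<And>v. v \<in> fibre (Lambda1 X) x \<Longrightarrow> \<psi> (\<phi> v) = v" and t: "\<tau> \<in> fibre (Lambda1_tensor X) x"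
  shows "tensor_map (Lambda1 X) (Lambda1 X) x \<psi> \<psi> (tensor_map (Lambda1 Z) (Lambda1 Z) z \<phi> \<phi> \<tau>) = \<tau>"
proof -
  obtain zs where zs: "set zs \<subseteq> Lpairs X x" "\<tau> = tens X x zs" using t unfolding fibre_tensor by blast
  have "map (map_prod \<psi> \<psi>) (map (map_prod \<phi> \<phi>) zs) = zs"
    unfolding map_map by (rule map_idI) (use zs(1) inv in \<open>auto simp: subset_iff\<close>)
  then show ?thesis
    by (simp only: zs(2) tensor_map_tens[OF \<phi> \<phi> zs(1)] tensor_map_tens[OF \<psi> \<psi> pairs_map[OF \<phi> \<phi> zs(1)]])
qed

lemma tensor_map_compose:
  assumes \<phi>: "fibre_linear X x Z z \<phi>" and \<psi>: "fibre_linear Z z S y \<psi>" and t: "\<tau> \<in> fibre (Lambda1_tensor X) x"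
    and \<kappa>: "fibre_linear X x S y \<kappa>" "\<And>v. v \<in> fibre (Lambda1 X) x \<Longrightarrow> \<psi> (\<phi> v) = \<kappa> v"
  shows "tensor_map (Lambda1 S) (Lambda1 S) y \<psi> \<psi> (tensor_map (Lambda1 Z) (Lambda1 Z) z \<phi> \<phi> \<tau>) =
    tensor_map (Lambda1 S) (Lambda1 S) y \<kappa> \<kappa> \<tau>"
proof -
  obtain zs where zs: "set zs \<subseteq> Lpairs X x" "\<tau> = tens X x zs" using t unfolding fibre_tensor by blast
  have "map (map_prod \<psi> \<psi>) (map (map_prod \<phi> \<phi>) zs) = map (map_prod \<kappa> \<kappa>) zs"
    unfolding map_map by (rule map_cong) (use zs(1) \<kappa>(2) in \<open>auto simp: subset_iff\<close>)
  then show ?thesis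
    by (simp only: zs(2) tensor_map_tens[OF \<phi> \<phi> zs(1)] tensor_map_tens[OF \<kappa>(1) \<kappa>(1) zs(1)] tensor_map_tens[OF \<psi> \<psi> pairs_map[OF \<phi> \<phi> zs(1)]])
qed

subsection \<open>Contractions\<close>

definition fibre_functional :: "'a diffeology \<Rightarrow> 'a \<Rightarrow> ('a \<times> 'a form set \<Rightarrow> real) \<Rightarrow> bool" where
  "fibre_functional X x \<phi> \<longleftrightarrow>
     (\<forall>v\<in>fibre (Lambda1 X) x. \<forall>w\<in>fibre (Lambda1 X) x. \<phi> (vadd (Lambda1 X) v w) = \<phi> v + \<phi> w) \<and>
     (\<forall>c. \<forall>v\<in>fibre (Lambda1 X) x. \<phi> (vscale (Lambda1 X) c v) = c * \<phi> v)"

lemma fibre_functional_zero: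
  assumes X: "diffeological_space X" and x: "x \<in> dspace X" and \<phi>: "fibre_functional X x \<phi>"
  shows "\<phi> (form_val X x 0) = 0"
proof -
  have "\<phi> (vscale (Lambda1 X) 0 (form_val X x 0)) = 0"
    using \<phi> vzero_in_fibre[OF x] by (simp add: fibre_functional_def)
  then show ?thesis using fibre_linear_zero[OF fibre_linear_vscale[OF X x, of 0]] by simp
qed

lemma cov_scale_simps:
  "cov_scale (a + b) \<phi> = cov_scale a \<phi> + cov_scale b \<phi>"
  "cov_scale a (\<phi> + \<psi>) = cov_scale a \<phi> + cov_scale a \<psi>"
  "cov_scale a (cov_scale b \<phi>) = cov_scale (a * b) \<phi>"
  "cov_scale 0 \<phi> = 0" "cov_scale a 0 = 0"
  by (simp_all add: cov_scale_def fun_eq_iff algebra_simps)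

text \<open>Contraction with a linear functional respects the generating relations, so it does not depend on the
representative of a tensor. The sums are compared as covectors.\<close>

lemma contraction_sum_invariant:
  assumes X: "diffeological_space X" and x: "x \<in> dspace X" and \<phi>: "fibre_functional X x \<phi>" and e: "Leq X x zs zs'"
  shows "(\<Sum>(\<alpha>, \<beta>)\<leftarrow>zs. cov_scale (\<phi> \<alpha>) (covec X \<beta>)) = (\<Sum>(\<alpha>, \<beta>)\<leftarrow>zs'. cov_scale (\<phi> \<alpha>) (covec X \<beta>))"
    and "(\<Sum>(\<alpha>, \<beta>)\<leftarrow>zs. cov_scale (\<phi> \<beta>) (covec X \<alpha>)) = (\<Sum>(\<alpha>, \<beta>)\<leftarrow>zs'. cov_scale (\<phi> \<beta>) (covec X \<alpha>))"
proof -
  note F = \<phi>[unfolded fibre_functional_def]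
  show "(\<Sum>(\<alpha>, \<beta>)\<leftarrow>zs. cov_scale (\<phi> \<alpha>) (covec X \<beta>)) = (\<Sum>(\<alpha>, \<beta>)\<leftarrow>zs'. cov_scale (\<phi> \<alpha>) (covec X \<beta>))"
    using e
    by induction (use F in \<open>auto simp: split_def covec_vadd[OF X] covec_vscale[OF X] covec_vzero
       fibre_functional_zero[OF X x \<phi>] cov_scale_simps add_ac mult.commute\<close>)
  show "(\<Sum>(\<alpha>, \<beta>)\<leftarrow>zs. cov_scale (\<phi> \<beta>) (covec X \<alpha>)) = (\<Sum>(\<alpha>, \<beta>)\<leftarrow>zs'. cov_scale (\<phi> \<beta>) (covec X \<alpha>))"
    using e
    by induction (use F in \<open>auto simp: split_def covec_vadd[OF X] covec_vscale[OF X] covec_vzero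
       fibre_functional_zero[OF X x \<phi>] cov_scale_simps add_ac mult.commute\<close>)
qed

lemma
  assumes X: "diffeological_space X" and x: "x \<in> dspace X" and \<phi>: "fibre_functional X x \<phi>" and zs: "set zs \<subseteq> Lpairs X x"
  shows contract_fst_tens: "contract_fst (Lambda1 X) x \<phi> (tens X x zs) = lincomb (Lambda1 X) x (map (\<lambda>(\<alpha>, \<beta>). (\<phi> \<alpha>, \<beta>)) zs)"
    and contract_snd_tens: "contract_snd (Lambda1 X) x \<phi> (tens X x zs) = lincomb (Lambda1 X) x (map (\<lambda>(\<alpha>, \<beta>). (\<phi> \<beta>, \<alpha>)) zs)"
proof -
  have v: "snd ` set (map (\<lambda>(\<alpha>, \<beta>). (\<phi> \<alpha>, \<beta>)) us) \<subseteq> fibre (Lambda1 X) x"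
    "snd ` set (map (\<lambda>(\<alpha>, \<beta>). (\<phi> \<beta>, \<alpha>)) us) \<subseteq> fibre (Lambda1 X) x" if "set us \<subseteq> Lpairs X x" for us
    using that by auto
  have "lincomb (Lambda1 X) x (map (\<lambda>(\<alpha>, \<beta>). (\<phi> \<alpha>, \<beta>)) us) = lincomb (Lambda1 X) x (map (\<lambda>(\<alpha>, \<beta>). (\<phi> \<alpha>, \<beta>)) zs)"
    "lincomb (Lambda1 X) x (map (\<lambda>(\<alpha>, \<beta>). (\<phi> \<beta>, \<alpha>)) us) = lincomb (Lambda1 X) x (map (\<lambda>(\<alpha>, \<beta>). (\<phi> \<beta>, \<alpha>)) zs)"
    if us: "us \<in> snd (tens X x zs)" for us
  proof -
    have e: "Leq X x zs us" using us by (simp add: snd_tens)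
    have "set us \<subseteq> Lpairs X x" using tensor_eq_valid[OF X x e] by blast
    note vs = v[OF this] v[OF zs]
    show "lincomb (Lambda1 X) x (map (\<lambda>(\<alpha>, \<beta>). (\<phi> \<alpha>, \<beta>)) us) = lincomb (Lambda1 X) x (map (\<lambda>(\<alpha>, \<beta>). (\<phi> \<alpha>, \<beta>)) zs)"
      by (rule covec_inj[OF X lincomb_in_fibre[OF X x vs(1)] lincomb_in_fibre[OF X x vs(3)]])
        (use contraction_sum_invariant(1)[OF X x \<phi> e] in
          \<open>unfold covec_lincomb[OF X x vs(1)] covec_lincomb[OF X x vs(3)], simp add: split_def comp_def\<close>)
    show "lincomb (Lambda1 X) x (map (\<lambda>(\<alpha>, \<beta>). (\<phi> \<beta>, \<alpha>)) us) = lincomb (Lambda1 X) x (map (\<lambda>(\<alpha>, \<beta>). (\<phi> \<beta>, \<alpha>)) zs)"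
      by (rule covec_inj[OF X lincomb_in_fibre[OF X x vs(2)] lincomb_in_fibre[OF X x vs(4)]])
        (use contraction_sum_invariant(2)[OF X x \<phi> e] in
          \<open>unfold covec_lincomb[OF X x vs(2)] covec_lincomb[OF X x vs(4)], simp add: split_def comp_def\<close>)
  qed
  note L = this
  show "contract_fst (Lambda1 X) x \<phi> (tens X x zs) = lincomb (Lambda1 X) x (map (\<lambda>(\<alpha>, \<beta>). (\<phi> \<alpha>, \<beta>)) zs)"
    unfolding contract_fst_def
    by (rule the_equality, intro ballI, rule L(1)[symmetric], assumption, erule bspec[OF _ tens_self[OF zs]])
  show "contract_snd (Lambda1 X) x \<phi> (tens X x zs) = lincomb (Lambda1 X) x (map (\<lambda>(\<alpha>, \<beta>). (\<phi> \<beta>, \<alpha>)) zs)"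
    unfolding contract_snd_def
    by (rule the_equality, intro ballI, rule L(2)[symmetric], assumption, erule bspec[OF _ tens_self[OF zs]])
qed

text \<open>A linear map that carries one functional to the other intertwines the contractions.\<close>

lemma
  assumes X: "diffeological_space X" and x: "x \<in> dspace X" and Z: "diffeological_space Z" and z: "z \<in> dspace Z"
    and \<rho>: "fibre_linear X x Z z \<rho>" and \<phi>: "fibre_functional X x \<phi>" and \<psi>: "fibre_functional Z z \<psi>"
    and eq: "\<And>v. v \<in> fibre (Lambda1 X) x \<Longrightarrow> \<psi> (\<rho> v) = \<phi> v" and t: "\<tau> \<in> fibre (Lambda1_tensor X) x"
  shows contract_fst_natural: "\<rho> (contract_fst (Lambda1 X) x \<phi> \<tau>) =
      contract_fst (Lambda1 Z) z \<psi> (tensor_map (Lambda1 Z) (Lambda1 Z) z \<rho> \<rho> \<tau>)"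
    and contract_snd_natural: "\<rho> (contract_snd (Lambda1 X) x \<phi> \<tau>) =
      contract_snd (Lambda1 Z) z \<psi> (tensor_map (Lambda1 Z) (Lambda1 Z) z \<rho> \<rho> \<tau>)"
    and contract_fst_in: "contract_fst (Lambda1 X) x \<phi> \<tau> \<in> fibre (Lambda1 X) x"
    and contract_snd_in: "contract_snd (Lambda1 X) x \<phi> \<tau> \<in> fibre (Lambda1 X) x"
proof -
  obtain zs where zs: "set zs \<subseteq> Lpairs X x" "\<tau> = tens X x zs" using t unfolding fibre_tensor by blast
  have v: "snd ` set (map (\<lambda>(\<alpha>, \<beta>). (\<phi> \<alpha>, \<beta>)) zs) \<subseteq> fibre (Lambda1 X) x"
    "snd ` set (map (\<lambda>(\<alpha>, \<beta>). (\<phi> \<beta>, \<alpha>)) zs) \<subseteq> fibre (Lambda1 X) x"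
    using zs(1) by auto
  have m: "map (\<lambda>(c, v). (c, \<rho> v)) (map (\<lambda>(\<alpha>, \<beta>). (\<phi> \<alpha>, \<beta>)) zs) = map (\<lambda>(\<alpha>, \<beta>). (\<psi> \<alpha>, \<beta>)) (map (map_prod \<rho> \<rho>) zs)"
    "map (\<lambda>(c, v). (c, \<rho> v)) (map (\<lambda>(\<alpha>, \<beta>). (\<phi> \<beta>, \<alpha>)) zs) = map (\<lambda>(\<alpha>, \<beta>). (\<psi> \<beta>, \<alpha>)) (map (map_prod \<rho> \<rho>) zs)"
    using zs(1) by (auto simp: eq subset_iff)
  note pm = pairs_map[OF \<rho> \<rho> zs(1)]
  show "\<rho> (contract_fst (Lambda1 X) x \<phi> \<tau>) =
      contract_fst (Lambda1 Z) z \<psi> (tensor_map (Lambda1 Z) (Lambda1 Z) z \<rho> \<rho> \<tau>)"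
    by (simp only: zs(2) tensor_map_tens[OF \<rho> \<rho> zs(1)] contract_fst_tens[OF X x \<phi> zs(1)]
        contract_fst_tens[OF Z z \<psi> pm] fibre_linear_lincomb[OF X x \<rho> v(1)] m)
  show "\<rho> (contract_snd (Lambda1 X) x \<phi> \<tau>) =
      contract_snd (Lambda1 Z) z \<psi> (tensor_map (Lambda1 Z) (Lambda1 Z) z \<rho> \<rho> \<tau>)"
    by (simp only: zs(2) tensor_map_tens[OF \<rho> \<rho> zs(1)] contract_snd_tens[OF X x \<phi> zs(1)]
        contract_snd_tens[OF Z z \<psi> pm] fibre_linear_lincomb[OF X x \<rho> v(2)] m)
  show "contract_fst (Lambda1 X) x \<phi> \<tau> \<in> fibre (Lambda1 X) x"
    unfolding zs(2) contract_fst_tens[OF X x \<phi> zs(1)] by (rule lincomb_in_fibre[OF X x v(1)])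
  show "contract_snd (Lambda1 X) x \<phi> \<tau> \<in> fibre (Lambda1 X) x"
    unfolding zs(2) contract_snd_tens[OF X x \<phi> zs(1)] by (rule lincomb_in_fibre[OF X x v(2)])
qed

section \<open>Smooth sections\<close>

lemma smooth_sections_Lambda1:
  "s \<in> smooth_sections (Lambda1 X) \<longleftrightarrow> s \<in> (\<Pi>\<^sub>E x\<in>dspace X. fibre (Lambda1 X) x) \<and>
     (\<forall>n U p. plot X n U p \<longrightarrow> Lambda_plot X n U (s \<circ> p))"
  by (auto simp: smooth_sections_def dsmooth_def PiE_iff fibre_def)

abbreviation tensor_plot where "tensor_plot X \<equiv> plot (tot (Lambda1_tensor X))"

lemma smooth_sections_tensor:
  "s \<in> smooth_sections (Lambda1_tensor X) \<longleftrightarrow> s \<in> (\<Pi>\<^sub>E x\<in>dspace X. fibre (Lambda1_tensor X) x) \<and>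
     (\<forall>n U p. plot X n U p \<longrightarrow> tensor_plot X n U (s \<circ> p))"
  by (auto simp: smooth_sections_def dsmooth_def PiE_iff fibre_def)

lemma section_in_fibre: "s \<in> smooth_sections (Lambda1 X) \<Longrightarrow> x \<in> dspace X \<Longrightarrow> s x \<in> fibre (Lambda1 X) x"
  unfolding smooth_sections_Lambda1 by (elim conjE) (rule PiE_mem)

section \<open>Pseudo-metrics\<close>

lemma smooth_dualD:
  assumes "\<phi> \<in> smooth_dual (Lambda1 X) x"
  shows "v \<notin> fibre (Lambda1 X) x \<Longrightarrow> \<phi> v = 0" "fibre_functional X x \<phi>"
    "smooth_real (subset_diffeology (tot (Lambda1 X)) (fibre (Lambda1 X) x)) \<phi>"
  using assms unfolding smooth_dual_def fibre_functional_def by blast+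

lemma smooth_dualI:
  assumes "\<And>v. v \<notin> fibre (Lambda1 X) x \<Longrightarrow> \<phi> v = 0" "fibre_functional X x \<phi>"
    "smooth_real (subset_diffeology (tot (Lambda1 X)) (fibre (Lambda1 X) x)) \<phi>"
  shows "\<phi> \<in> smooth_dual (Lambda1 X) x"
  using assms unfolding smooth_dual_def fibre_functional_def by blast

lemma smooth_dual_linear:
  assumes X: "diffeological_space X"
  shows smooth_dual_zero: "(\<lambda>_. 0) \<in> smooth_dual (Lambda1 X) x"
    and smooth_dual_add: "\<phi> \<in> smooth_dual (Lambda1 X) x \<Longrightarrow> \<psi> \<in> smooth_dual (Lambda1 X) x \<Longrightarrow>
      (\<lambda>v. \<phi> v + \<psi> v) \<in> smooth_dual (Lambda1 X) x"
    and smooth_dual_scale: "\<phi> \<in> smooth_dual (Lambda1 X) x \<Longrightarrow> (\<lambda>v. c * \<phi> v) \<in> smooth_dual (Lambda1 X) x"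
proof -
  let ?F = "subset_diffeology (tot (Lambda1 X)) (fibre (Lambda1 X) x)"
  have op: "ropen n U" if "plot ?F n U p" for n U p
    by (rule Lambda_plot_open[OF X, of _ _ p]) (use that in \<open>simp add: subset_diffeology_def\<close>)
  show "(\<lambda>_. 0) \<in> smooth_dual (Lambda1 X) x"
    by (rule smooth_dualI) (simp_all add: fibre_functional_def smooth_real_def comp_def smooth_fun_const)
  show "(\<lambda>v. \<phi> v + \<psi> v) \<in> smooth_dual (Lambda1 X) x"
    if a: "\<phi> \<in> smooth_dual (Lambda1 X) x" "\<psi> \<in> smooth_dual (Lambda1 X) x"
  proof (rule smooth_dualI)
    show "fibre_functional X x (\<lambda>v. \<phi> v + \<psi> v)"
      using smooth_dualD(2)[OF a(1)] smooth_dualD(2)[OF a(2)] by (simp add: fibre_functional_def algebra_simps)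
    show "smooth_real ?F (\<lambda>v. \<phi> v + \<psi> v)" unfolding smooth_real_def
    proof (intro allI impI)
      fix n U p assume p: "plot ?F n U p"
      have "smooth_fun n U (\<phi> \<circ> p)" "smooth_fun n U (\<psi> \<circ> p)"
        using smooth_dualD(3)[OF a(1)] smooth_dualD(3)[OF a(2)] p unfolding smooth_real_def by metis+
      from smooth_fun_add[OF op[OF p] this] show "smooth_fun n U ((\<lambda>v. \<phi> v + \<psi> v) \<circ> p)" by (simp add: comp_def)
    qed
  qed (simp add: smooth_dualD(1)[OF a(1)] smooth_dualD(1)[OF a(2)])
  show "(\<lambda>v. c * \<phi> v) \<in> smooth_dual (Lambda1 X) x"
    if a: "\<phi> \<in> smooth_dual (Lambda1 X) x"
  proof (rule smooth_dualI)
    show "fibre_functional X x (\<lambda>v. c * \<phi> v)"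
      using smooth_dualD(2)[OF a] by (simp add: fibre_functional_def algebra_simps)
    show "smooth_real ?F (\<lambda>v. c * \<phi> v)" unfolding smooth_real_def
    proof (intro allI impI)
      fix n U p assume p: "plot ?F n U p"
      have "smooth_fun n U (\<phi> \<circ> p)" using smooth_dualD(3)[OF a] p unfolding smooth_real_def by metis
      from smooth_fun_mult[OF op[OF p] smooth_fun_const this]
      show "smooth_fun n U ((\<lambda>v. c * \<phi> v) \<circ> p)" by (simp add: comp_def)
    qed
  qed (simp add: smooth_dualD(1)[OF a])
qed

lemma fibre_dual: "\<phi> \<in> fibre (dual_bundle (Lambda1 X)) x \<longleftrightarrow> x \<in> dspace X \<and> fst \<phi> = x \<and> snd \<phi> \<in> smooth_dual (Lambda1 X) x"
  unfolding fibre_def by (cases \<phi>) (auto simp: dual_bundle_def)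

abbreviation metric_rep where
  "metric_rep X g n V p \<equiv> \<exists>pqs.
     (\<forall>(p1, p2)\<in>set pqs.
        plot (tot (dual_bundle (Lambda1 X))) n V p1 \<and> plot (tot (dual_bundle (Lambda1 X))) n V p2 \<and>
        (\<forall>u\<in>V. p1 u \<in> fibre (dual_bundle (Lambda1 X)) (p u) \<and> p2 u \<in> fibre (dual_bundle (Lambda1 X)) (p u))) \<and>
     (\<forall>u\<in>V. \<forall>v\<in>fibre (Lambda1 X) (p u). \<forall>w\<in>fibre (Lambda1 X) (p u).
        g (p u) v w = (\<Sum>(p1, p2)\<leftarrow>pqs. snd (p1 u) v * snd (p2 u) w))"

text \<open>Along a plot of the base, the metric is locally a finite sum of products of smooth families of
functionals.\<close>

lemma pseudo_metric_local:
  assumes X: "diffeological_space X" and g: "pseudo_metric (Lambda1 X) g" and p: "plot X n U p"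
  shows "near_each n U (\<lambda>V. metric_rep X g n V p)"
proof -
  let ?D = "dual_bundle (Lambda1 X)"
  have [simp]: "base ?D = X" by (simp add: dual_bundle_def)
  obtain G where G: "G \<in> smooth_sections (tensor_bundle ?D ?D)"
    "\<And>x v w zs. x \<in> dspace X \<Longrightarrow> v \<in> fibre (Lambda1 X) x \<Longrightarrow> w \<in> fibre (Lambda1 X) x \<Longrightarrow> zs \<in> snd (G x) \<Longrightarrow>
      g x v w = (\<Sum>(\<phi>, \<psi>)\<leftarrow>zs. snd \<phi> v * snd \<psi> w)"
    using g unfolding pseudo_metric_def Lambda1_simps by blast
  have "plot (tot (tensor_bundle ?D ?D)) n U (G \<circ> p)"
    using G(1) p by (simp add: smooth_sections_def dsmooth_def tensor_bundle_def)
  then have near: "near_each n U (\<lambda>U'. \<exists>pqs.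
           (\<forall>(p1, p2)\<in>set pqs. plot (tot ?D) n U' p1 \<and> plot (tot ?D) n U' p2 \<and>
              (\<forall>u\<in>U'. fst (p1 u) = fst ((G \<circ> p) u) \<and> fst (p2 u) = fst ((G \<circ> p) u))) \<and>
           (\<forall>u\<in>U'. snd ((G \<circ> p) u) =
              tensor_class ?D ?D (fst ((G \<circ> p) u)) (map (\<lambda>(p1, p2). (p1 u, p2 u)) pqs)))"
    unfolding tensor_bundle_def by simp
  have fstG: "fst ((G \<circ> p) u) = p u" if "u \<in> U" for u
  proof -
    have "G (p u) \<in> fibre (tensor_bundle ?D ?D) (p u)"
      using G(1) plot_in[OF X p that] unfolding smooth_sections_def by (auto simp: PiE_iff tensor_bundle_def)
    then show ?thesis by (simp add: fibre_def)
  qed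
  show ?thesis using near
  proof (rule near_each_mono)
    fix V assume V: "ropen n V" "V \<subseteq> U"
    assume "\<exists>pqs. (\<forall>(p1, p2)\<in>set pqs. plot (tot ?D) n V p1 \<and> plot (tot ?D) n V p2 \<and>
              (\<forall>u\<in>V. fst (p1 u) = fst ((G \<circ> p) u) \<and> fst (p2 u) = fst ((G \<circ> p) u))) \<and>
           (\<forall>u\<in>V. snd ((G \<circ> p) u) =
              tensor_class ?D ?D (fst ((G \<circ> p) u)) (map (\<lambda>(p1, p2). (p1 u, p2 u)) pqs))"
    then obtain pqs where pqs: "\<And>p1 p2. (p1, p2) \<in> set pqs \<Longrightarrow> plot (tot ?D) n V p1 \<and> plot (tot ?D) n V p2 \<and>
              (\<forall>u\<in>V. fst (p1 u) = fst ((G \<circ> p) u) \<and> fst (p2 u) = fst ((G \<circ> p) u))"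
      "\<And>u. u \<in> V \<Longrightarrow> snd ((G \<circ> p) u) = tensor_class ?D ?D (fst ((G \<circ> p) u)) (map (\<lambda>(p1, p2). (p1 u, p2 u)) pqs)"
      by blast
    have fib: "p1 u \<in> fibre ?D (p u)" if "plot (tot ?D) n V p1" "fst (p1 u) = fst ((G \<circ> p) u)" "u \<in> V" for p1 u
    proof -
      have "p1 ` V \<subseteq> dspace (tot ?D)" using that(1) by (simp add: dual_bundle_def)
      then have "p1 u \<in> dspace (tot ?D)" using that(3) by (rule subsetD[OF _ imageI])
      then show ?thesis using that(2) fstG[OF subsetD[OF V(2) that(3)]] by (simp add: fibre_def)
    qed
    have 1: "plot (tot ?D) n V p1 \<and> plot (tot ?D) n V p2 \<and> (\<forall>u\<in>V. p1 u \<in> fibre ?D (p u) \<and> p2 u \<in> fibre ?D (p u))"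
      if "(p1, p2) \<in> set pqs" for p1 p2
      using pqs(1)[OF that] fib by blast
    have 2: "g (p u) v w = (\<Sum>(p1, p2)\<leftarrow>pqs. snd (p1 u) v * snd (p2 u) w)"
      if u: "u \<in> V" and v: "v \<in> fibre (Lambda1 X) (p u)" "w \<in> fibre (Lambda1 X) (p u)" for u v w
    proof -
      let ?zs = "map (\<lambda>(p1, p2). (p1 u, p2 u)) pqs"
      have "set ?zs \<subseteq> fibre ?D (p u) \<times> fibre ?D (p u)" using 1 u by auto
      then have "?zs \<in> snd (G (p u))"
        using pqs(2)[OF u] fstG[OF subsetD[OF V(2) u]] by (simp add: tensor_class_def tensor_eq.refl)
      from G(2)[OF plot_in[OF X p subsetD[OF V(2) u]] v this]
      show ?thesis by (simp add: split_def comp_def)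
    qed
    show "metric_rep X g n V p"
      using 1 2 by (intro exI[of _ pqs]) blast
  qed
qed

lemma pseudo_metric_at:
  assumes X: "diffeological_space X" and g: "pseudo_metric (Lambda1 X) g" and x: "x \<in> dspace X"
  obtains zs where "\<And>\<phi> \<psi>. (\<phi>, \<psi>) \<in> set zs \<Longrightarrow> \<phi> \<in> smooth_dual (Lambda1 X) x \<and> \<psi> \<in> smooth_dual (Lambda1 X) x"
    "\<And>v w. v \<in> fibre (Lambda1 X) x \<Longrightarrow> w \<in> fibre (Lambda1 X) x \<Longrightarrow> g x v w = (\<Sum>(\<phi>, \<psi>)\<leftarrow>zs. \<phi> v * \<psi> w)"
proof -
  \<comment> \<open>a point of the base is a plot on the one-point space \<open>\<real>\<^sup>0\<close>\<close>
  have E: "ropen 0 (topspace (Euclidean_space 0))" by simp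
  have "(0::rvec) \<in> topspace (Euclidean_space 0)" by (simp add: topspace_Euclidean_space)
  from bspec[OF pseudo_metric_local[OF X g plot_const[OF X E x], unfolded near_each_def] this]
  obtain V pqs where V: "0 \<in> V" and pqs0: "\<forall>(p1, p2)\<in>set pqs.
      plot (tot (dual_bundle (Lambda1 X))) 0 V p1 \<and> plot (tot (dual_bundle (Lambda1 X))) 0 V p2 \<and>
      (\<forall>u\<in>V. p1 u \<in> fibre (dual_bundle (Lambda1 X)) x \<and> p2 u \<in> fibre (dual_bundle (Lambda1 X)) x)"
    and pqs2: "\<forall>u\<in>V. \<forall>v\<in>fibre (Lambda1 X) x. \<forall>w\<in>fibre (Lambda1 X) x. g x v w = (\<Sum>(p1, p2)\<leftarrow>pqs. snd (p1 u) v * snd (p2 u) w)"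
    by (elim exE conjE) (rule that)
  have pqs1: "p1 0 \<in> fibre (dual_bundle (Lambda1 X)) x" "p2 0 \<in> fibre (dual_bundle (Lambda1 X)) x"
    if "(p1, p2) \<in> set pqs" for p1 p2
    using bspec[OF pqs0 that] V by simp_all
  show ?thesis
  proof (rule that[of "map (\<lambda>(p1, p2). (snd (p1 0), snd (p2 0))) pqs"])
    fix \<phi> \<psi> assume "(\<phi>, \<psi>) \<in> set (map (\<lambda>(p1, p2). (snd (p1 (0::rvec)), snd (p2 (0::rvec)))) pqs)"
    then obtain p1 p2 where "(p1, p2) \<in> set pqs" "\<phi> = snd (p1 0)" "\<psi> = snd (p2 0)" by auto
    with pqs1 show "\<phi> \<in> smooth_dual (Lambda1 X) x \<and> \<psi> \<in> smooth_dual (Lambda1 X) x"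
      unfolding fibre_dual by simp
  next
    fix v w assume "v \<in> fibre (Lambda1 X) x" "w \<in> fibre (Lambda1 X) x"
    then show "g x v w = (\<Sum>(\<phi>, \<psi>)\<leftarrow>map (\<lambda>(p1, p2). (snd (p1 (0::rvec)), snd (p2 (0::rvec)))) pqs. \<phi> v * \<psi> w)"
      using bspec[OF pqs2 V] by (simp add: split_def comp_def)
  qed
qed

lemma pseudo_metricD:
  assumes "pseudo_metric (Lambda1 X) g" "x \<in> dspace X"
  shows "\<exists>es. set es \<subseteq> fibre (Lambda1 X) x \<and>
      (\<forall>v\<in>fibre (Lambda1 X) x. \<exists>cs. length cs = length es \<and> v = lincomb (Lambda1 X) x (zip cs es))"
    and "fun_dim ((\<lambda>v w. if w \<in> fibre (Lambda1 X) x then g x v w else 0) ` fibre (Lambda1 X) x)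
          = fun_dim (smooth_dual (Lambda1 X) x)"
proof -
  note A = assms(1)[unfolded pseudo_metric_def finite_dimensional_def Lambda1_simps]
  show "\<exists>es. set es \<subseteq> fibre (Lambda1 X) x \<and>
      (\<forall>v\<in>fibre (Lambda1 X) x. \<exists>cs. length cs = length es \<and> v = lincomb (Lambda1 X) x (zip cs es))"
    by (rule bspec[OF A[THEN conjunct1] assms(2)])
  show "fun_dim ((\<lambda>v w. if w \<in> fibre (Lambda1 X) x then g x v w else 0) ` fibre (Lambda1 X) x)
          = fun_dim (smooth_dual (Lambda1 X) x)"
    by (rule bspec[OF A[THEN conjunct2, THEN conjunct2] assms(2), THEN conjunct2, THEN conjunct2])
qed

lemma pseudo_metric_sym:
  assumes "pseudo_metric (Lambda1 X) g" "x \<in> dspace X" "v \<in> fibre (Lambda1 X) x" "w \<in> fibre (Lambda1 X) x"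
  shows "g x v w = g x w v"
  using assms unfolding pseudo_metric_def Lambda1_simps by blast

lemma pseudo_metric_row_in_dual:
  assumes X: "diffeological_space X" and g: "pseudo_metric (Lambda1 X) g" and x: "x \<in> dspace X"
    and v: "v \<in> fibre (Lambda1 X) x"
  shows "(\<lambda>w. if w \<in> fibre (Lambda1 X) x then g x v w else 0) \<in> smooth_dual (Lambda1 X) x"
proof -
  obtain zs where zs: "\<And>\<phi> \<psi>. (\<phi>, \<psi>) \<in> set zs \<Longrightarrow> \<phi> \<in> smooth_dual (Lambda1 X) x \<and> \<psi> \<in> smooth_dual (Lambda1 X) x"
    "\<And>v w. v \<in> fibre (Lambda1 X) x \<Longrightarrow> w \<in> fibre (Lambda1 X) x \<Longrightarrow> g x v w = (\<Sum>(\<phi>, \<psi>)\<leftarrow>zs. \<phi> v * \<psi> w)"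
    using pseudo_metric_at[OF X g x] by metis
  have S: "(\<lambda>w. \<Sum>(\<phi>, \<psi>)\<leftarrow>zs. \<phi> v * \<psi> w) \<in> smooth_dual (Lambda1 X) x"
    using zs(1)
  proof (induction zs)
    case Nil then show ?case using smooth_dual_zero[OF X] by simp
  next
    case (Cons a zs)
    obtain \<phi> \<psi> where a: "a = (\<phi>, \<psi>)" by (cases a)
    have "\<psi> \<in> smooth_dual (Lambda1 X) x" using Cons.prems[of \<phi> \<psi>] a by simp
    moreover have "(\<lambda>w. \<Sum>(\<phi>, \<psi>)\<leftarrow>zs. \<phi> v * \<psi> w) \<in> smooth_dual (Lambda1 X) x"
      by (rule Cons.IH) (rule Cons.prems, simp)
    ultimately show ?case using smooth_dual_add[OF X smooth_dual_scale[OF X]] by (simp add: a)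
  qed
  have "(\<lambda>w. if w \<in> fibre (Lambda1 X) x then g x v w else 0) = (\<lambda>w. \<Sum>(\<phi>, \<psi>)\<leftarrow>zs. \<phi> v * \<psi> w)"
  proof
    fix w show "(if w \<in> fibre (Lambda1 X) x then g x v w else 0) = (\<Sum>(\<phi>, \<psi>)\<leftarrow>zs. \<phi> v * \<psi> w)"
      using zs(2)[OF v] smooth_dualD(1)[OF S] by simp
  qed
  with S show ?thesis by simp
qed

lemma fibre_functional_cong:
  assumes X: "diffeological_space X" and "fibre_functional X x \<phi>" and e: "\<And>v. v \<in> fibre (Lambda1 X) x \<Longrightarrow> \<phi> v = \<psi> v"
  shows "fibre_functional X x \<psi>"
  unfolding fibre_functional_def
proof (intro conjI ballI allI)
  fix v w assume v: "v \<in> fibre (Lambda1 X) x" "w \<in> fibre (Lambda1 X) x"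
  show "\<psi> (vadd (Lambda1 X) v w) = \<psi> v + \<psi> w"
    using assms(2) v by (simp add: fibre_functional_def e[symmetric] vadd_in_fibre[OF X v])
next
  fix c v assume v: "v \<in> fibre (Lambda1 X) x"
  show "\<psi> (vscale (Lambda1 X) c v) = c * \<psi> v"
    using assms(2) v by (simp add: fibre_functional_def e[symmetric] vscale_in_fibre[OF X v])
qed

lemma
  assumes X: "diffeological_space X" and g: "pseudo_metric (Lambda1 X) g" and x: "x \<in> dspace X"
    and v: "v \<in> fibre (Lambda1 X) x"
  shows pseudo_metric_linear_right: "fibre_functional X x (\<lambda>w. g x v w)"
    and pseudo_metric_linear_left: "fibre_functional X x (\<lambda>w. g x w v)"
proof -
  show r: "fibre_functional X x (\<lambda>w. g x v w)"
    by (rule fibre_functional_cong[OF X smooth_dualD(2)[OF pseudo_metric_row_in_dual[OF X g x v]]]) simp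
  show "fibre_functional X x (\<lambda>w. g x w v)"
    by (rule fibre_functional_cong[OF X r pseudo_metric_sym[OF g x v]])
qed

text \<open>The smoothness of a family of functionals is stated on pairs of parameters over the same base point; the diagonal lies in this set.\<close>

lemma dual_plot_apply:
  assumes X: "diffeological_space X" and \<phi>: "plot (tot (dual_bundle (Lambda1 X))) n V \<phi>" and a: "Lambda_plot X n V a"
    and e: "\<And>u. u \<in> V \<Longrightarrow> fst (\<phi> u) = fst (a u)"
  shows "smooth_fun n V (\<lambda>u. snd (\<phi> u) (a u))"
proof -
  have V: "ropen n V" by (rule Lambda_plot_open[OF X a])
  let ?S = "{w \<in> prod_dom n V n V. fst (\<phi> (proj1 n w)) = fst (a (proj2 n w))}"
  let ?h = "\<lambda>w. snd (\<phi> (proj1 n w)) (a (proj2 n w))"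
  have "smooth_on_subset (n + n) ?S ?h" using \<phi> a by (simp add: dual_bundle_def)
  moreover have "smooth_map n V (n + n) ?S (diag n)"
  proof (rule smooth_map_diag[OF V])
    show "diag n ` V \<subseteq> ?S"
    proof (rule image_subsetI)
      fix u assume u: "u \<in> V"
      then show "diag n u \<in> ?S" using diag_in_prod_dom[OF V u] by (simp add: proj_diag[OF V u] e)
    qed
  qed simp
  ultimately have "smooth_fun n V (?h \<circ> diag n)" using V unfolding smooth_on_subset_def by blast
  then show ?thesis by (rule smooth_fun_cong[OF V, rotated]) (simp add: proj_diag[OF V])
qed

lemma pseudo_metric_smooth:
  assumes X: "diffeological_space X" and g: "pseudo_metric (Lambda1 X) g"
    and s: "s \<in> smooth_sections (Lambda1 X)" and t: "t \<in> smooth_sections (Lambda1 X)"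
  shows "smooth_real X (\<lambda>x. g x (s x) (t x))"
  unfolding smooth_real_def
proof (intro allI impI)
  fix n U p assume p: "plot X n U p"
  let ?D = "dual_bundle (Lambda1 X)"
  show "smooth_fun n U ((\<lambda>x. g x (s x) (t x)) \<circ> p)"
  proof (rule smooth_fun_local[OF plot_open[OF X p]], rule near_each_mono[OF pseudo_metric_local[OF X g p]])
    fix V assume V: "ropen n V" "V \<subseteq> U" and "metric_rep X g n V p"
    then obtain pqs where pqs: "\<And>p1 p2. (p1, p2) \<in> set pqs \<Longrightarrow> plot (tot ?D) n V p1 \<and> plot (tot ?D) n V p2 \<and>
        (\<forall>u\<in>V. p1 u \<in> fibre ?D (p u) \<and> p2 u \<in> fibre ?D (p u))"
      "\<And>u v w. u \<in> V \<Longrightarrow> v \<in> fibre (Lambda1 X) (p u) \<Longrightarrow> w \<in> fibre (Lambda1 X) (p u) \<Longrightarrow>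
        g (p u) v w = (\<Sum>(p1, p2)\<leftarrow>pqs. snd (p1 u) v * snd (p2 u) w)" by blast
    have pV: "plot X n V p" by (rule plot_restrict[OF X p V])
    have sp: "Lambda_plot X n V (\<lambda>u. s' (p u))" if "s' \<in> smooth_sections (Lambda1 X)" for s'
      using that pV unfolding smooth_sections_Lambda1 comp_def by blast
    have app: "smooth_fun n V (\<lambda>u. snd (\<phi> u) (s' (p u)))"
      if \<phi>: "plot (tot ?D) n V \<phi>" "\<forall>u\<in>V. \<phi> u \<in> fibre ?D (p u)" and s': "s' \<in> smooth_sections (Lambda1 X)" for \<phi> s'
    proof (rule dual_plot_apply[OF X \<phi>(1) sp[OF s']])
      fix u assume u: "u \<in> V"
      show "fst (\<phi> u) = fst (s' (p u))"
        unfolding fst_fibre[OF section_in_fibre[OF s' plot_in[OF X pV u]]] by (rule fst_fibre[OF bspec[OF \<phi>(2) u]])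
    qed
    have "smooth_fun n V (\<lambda>u. \<Sum>(p1, p2)\<leftarrow>pqs. snd (p1 u) (s (p u)) * snd (p2 u) (t (p u)))"
      using pqs(1)
    proof (induction pqs)
      case Nil then show ?case by (simp add: smooth_fun_const)
    next
      case (Cons a pqs)
      obtain p1 p2 where a: "a = (p1, p2)" by (cases a)
      have P: "plot (tot ?D) n V p1 \<and> plot (tot ?D) n V p2 \<and>
        (\<forall>u\<in>V. p1 u \<in> fibre ?D (p u) \<and> p2 u \<in> fibre ?D (p u))" using Cons.prems[of p1 p2] a by simp
      have "smooth_fun n V (\<lambda>u. snd (p1 u) (s (p u)) * snd (p2 u) (t (p u)))"
        by (intro smooth_fun_mult[OF V(1)] app s t) (use P in blast)+
      moreover have "smooth_fun n V (\<lambda>u. \<Sum>(p1, p2)\<leftarrow>pqs. snd (p1 u) (s (p u)) * snd (p2 u) (t (p u)))"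
        by (rule Cons.IH) (rule Cons.prems, simp)
      ultimately show ?case using smooth_fun_add[OF V(1)] by (simp add: a)
    qed
    then show "smooth_fun n V ((\<lambda>x. g x (s x) (t x)) \<circ> p)"
    proof (rule smooth_fun_cong[OF V(1), rotated])
      fix u assume u: "u \<in> V"
      show "(\<Sum>(p1, p2)\<leftarrow>pqs. snd (p1 u) (s (p u)) * snd (p2 u) (t (p u))) = ((\<lambda>x. g x (s x) (t x)) \<circ> p) u"
        using pqs(2)[OF u section_in_fibre[OF s plot_in[OF X pV u]] section_in_fibre[OF t plot_in[OF X pV u]]] by simp
    qed
  qed
qed

subsection \<open>Nondegeneracy\<close>

lemma vector_space_fun: "vector_space (\<lambda>c (\<phi>::'v \<Rightarrow> real) v. c * \<phi> v)"
  by unfold_locales (simp_all add: fun_eq_iff algebra_simps)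

text \<open>Equality of dimensions gives equality of spans only in finite dimension. This is ensured by a finite set
\<open>E\<close> of points on which the functions of \<open>W\<close> are determined.\<close>

lemma fun_dim_eq_imp_span:
  fixes A W :: "('v \<Rightarrow> real) set"
  assumes AW: "A \<subseteq> W" and sub: "module.subspace (\<lambda>c \<phi> v. c * \<phi> v) W" and E: "finite E"
    and sep: "\<And>\<phi>. \<phi> \<in> W \<Longrightarrow> (\<And>e. e \<in> E \<Longrightarrow> \<phi> e = 0) \<Longrightarrow> \<phi> = 0"
    and dim: "fun_dim A = fun_dim W"
  shows "W \<subseteq> module.span (\<lambda>c \<phi> v. c * \<phi> v) A"
proof -
  let ?s = "\<lambda>c (\<phi>::'v \<Rightarrow> real) v. c * \<phi> v"
  interpret vector_space ?s by (rule vector_space_fun)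
  \<comment> \<open>restriction to \<open>E\<close>: injective on \<open>W\<close>, with values in the span of finitely many indicator functions\<close>
  define T where "T \<phi> = (\<lambda>v. if v \<in> E then \<phi> v else (0::real))" for \<phi>
  have T: "Vector_Spaces.linear ?s ?s T"
    by unfold_locales (simp_all add: T_def fun_eq_iff)
  interpret T: Vector_Spaces.linear ?s ?s T by (rule T)
  define \<delta> where "\<delta> e = (\<lambda>v. if v = e then 1 else (0::real))" for e :: 'v
  have TE: "T \<phi> \<in> span (\<delta> ` E)" for \<phi>
  proof -
    have "T \<phi> = (\<Sum>e\<in>E. ?s (\<phi> e) (\<delta> e))"
    proof
      fix v have "(\<Sum>e\<in>E. ?s (\<phi> e) (\<delta> e)) v = (\<Sum>e\<in>E. \<phi> e * \<delta> e v)" by (induction E rule: infinite_finite_induct) auto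
      also have "\<dots> = (\<Sum>e\<in>E. if e = v then \<phi> e else 0)" by (intro sum.cong) (auto simp: \<delta>_def)
      also have "\<dots> = T \<phi> v" using E by (simp add: T_def)
      finally show "T \<phi> v = (\<Sum>e\<in>E. ?s (\<phi> e) (\<delta> e)) v" by simp
    qed
    also have "\<dots> \<in> span (\<delta> ` E)" by (intro span_sum span_scale span_base imageI)
    finally show ?thesis .
  qed
  have spanW: "span W = W" using sub by (simp add: span_eq_iff)
  have inj: "inj_on T (span B)" if "B \<subseteq> W" for B
  proof (rule inj_onI)
    fix \<phi> \<psi> assume a: "\<phi> \<in> span B" "\<psi> \<in> span B" "T \<phi> = T \<psi>"
    have "\<phi> \<in> W" "\<psi> \<in> W" using a span_mono[OF that] spanW by auto
    then have "\<phi> - \<psi> \<in> W" using subspace_diff[OF sub] by blast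
    moreover have "(\<phi> - \<psi>) e = 0" if "e \<in> E" for e
      using fun_cong[OF a(3), of e] that by (simp add: T_def)
    ultimately have "\<phi> - \<psi> = 0" by (rule sep)
    then show "\<phi> = \<psi>" by simp
  qed
  have fin: "finite B" if B: "B \<subseteq> W" "independent B" for B
  proof -
    have "independent (T ` B)" by (rule T.independent_injective_image[OF B(2) inj[OF B(1)]])
    then have "finite (T ` B)"
      using independent_span_bound[of "\<delta> ` E" "T ` B"] E TE by blast
    moreover have "inj_on T B" using inj[OF B(1)] span_superset inj_on_subset by blast
    ultimately show ?thesis by (rule finite_imageD)
  qed
  obtain BA where BA: "BA \<subseteq> A" "independent BA" "A \<subseteq> span BA" "card BA = dim A" by (rule basis_exists)
  obtain BW where BW: "BW \<subseteq> W" "independent BW" "W \<subseteq> span BW" "card BW = dim W" by (rule basis_exists)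
  have finA: "finite BA" using fin BA AW by blast
  have finW: "finite BW" using fin BW by blast
  show ?thesis
  proof
    fix \<psi> assume \<psi>: "\<psi> \<in> W"
    have "\<psi> \<in> span BA"
    proof (rule ccontr)
      assume n: "\<psi> \<notin> span BA"
      have i: "independent (insert \<psi> BA)" by (rule independent_insertI[OF n BA(2)])
      have "insert \<psi> BA \<subseteq> span BW" using \<psi> BA(1) AW BW(3) by blast
      then have "card (insert \<psi> BA) \<le> card BW" using independent_span_bound[OF finW i] by blast
      moreover have "\<psi> \<notin> BA" using n span_base by blast
      ultimately show False using finA BA(4) BW(4) dim by simp
    qed
    then show "\<psi> \<in> span A" using span_mono[OF BA(1)] by blast
  qed
qed

lemma fibre_functional_lincomb:
  assumes X: "diffeological_space X" and x: "x \<in> dspace X" and \<phi>: "fibre_functional X x \<phi>"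
    and cvs: "snd ` set cvs \<subseteq> fibre (Lambda1 X) x"
  shows "\<phi> (lincomb (Lambda1 X) x cvs) = (\<Sum>(c, v)\<leftarrow>cvs. c * \<phi> v)"
  using cvs
proof (induction cvs)
  case Nil then show ?case by (simp add: lincomb_Nil fibre_functional_zero[OF X x \<phi>])
next
  case (Cons a cvs)
  obtain c v where a: "a = (c, v)" by (cases a)
  have v: "v \<in> fibre (Lambda1 X) x" using Cons.prems a by auto
  have cvs: "snd ` set cvs \<subseteq> fibre (Lambda1 X) x" using Cons.prems by auto
  show ?case
    using \<phi> Cons.IH[OF cvs] lincomb_in_fibre[OF X x cvs] vscale_in_fibre[OF X v] v
    by (simp add: a lincomb_Cons fibre_functional_def)
qed

text \<open>Sequences vanishing from index \<open>n\<close> on are also points of \<open>\<real>\<^sup>n\<^sup>+\<^sup>m\<close>: the slice \<open>\<real>\<^sup>n \<times> {0}\<close> is literally \<open>\<real>\<^sup>n\<close>,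
and the first \<open>n\<close> partial derivatives agree.\<close>

lemma Ck_on_slice:
  "Ck_on k (n + m) P h \<Longrightarrow> V \<subseteq> P \<Longrightarrow> Ck_on k n V h"
  by (induction k arbitrary: h) (auto intro: continuous_on_subset)

text \<open>Evaluation of forms on a fixed plot at \<open>0\<close> depends smoothly on the form, by the definition of the functional diffeology on forms.\<close>

lemma evaluation_in_smooth_dual:
  assumes X: "diffeological_space X" and x: "x \<in> dspace X"
  shows "(\<lambda>v. if v \<in> fibre (Lambda1 X) x then covec X v m U q i else 0) \<in> smooth_dual (Lambda1 X) x"
    (is "?e \<in> _")
proof (rule smooth_dualI)
  show "fibre_functional X x ?e"
    unfolding fibre_functional_def
    by (simp add: vadd_in_fibre[OF X] vscale_in_fibre[OF X] covec_vadd[OF X] covec_vscale[OF X] cov_scale_apply)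
  show "smooth_real (subset_diffeology (tot (Lambda1 X)) (fibre (Lambda1 X) x)) ?e"
    unfolding smooth_real_def
  proof (intro allI impI)
    fix n V a assume "plot (subset_diffeology (tot (Lambda1 X)) (fibre (Lambda1 X) x)) n V a"
    then have a: "Lambda_plot X n V a" "a ` V \<subseteq> fibre (Lambda1 X) x" by (simp_all add: subset_diffeology_def)
    have V: "ropen n V" by (rule Lambda_plot_open[OF X a(1)])
    have "near_each n V (\<lambda>V. form_rep X n V a)"
      using a(1) unfolding Lambda_plot_iff[OF X] by blast
    then show "smooth_fun n V (?e \<circ> a)"
    proof (intro smooth_fun_local[OF V], elim near_each_mono)
      fix V' assume V': "ropen n V'" "V' \<subseteq> V" and "form_rep X n V' a"
      then obtain q' r where r: "form_plot X n V' r" "\<forall>v\<in>V'. a v = form_val X (q' v) (r v)" by blast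
      have fib: "a u \<in> fibre (Lambda1 X) x" if "u \<in> V'" for u
        using a(2) subsetD[OF V'(2) that] by (rule subsetD[OF _ imageI])
      have a': "(?e \<circ> a) u = form_at X x (r u) m U q i" if "u \<in> V'" for u
      proof -
        have "q' u = x" using fst_fibre[OF fib[OF that]] r(2) that by simp
        then have "a u = form_val X x (r u)" using r(2) that by simp
        then show ?thesis using covec_form_val[OF form_plotD(2)[OF r(1) that], of x] fib[OF that] by simp
      qed
      show "smooth_fun n V' (?e \<circ> a)"
      proof (cases "plot X m U q \<and> 0 \<in> U \<and> q 0 = x \<and> i < m")
        case True
        have S: "smooth_fun (n + m) (prod_dom n V' m U) (\<lambda>w. r (proj1 n w) m U q (proj2 n w) i)"
          using form_plotD(3)[OF r(1)] True by blast
        have p: "proj1 n u = u" "proj2 n u = 0" if "u \<in> V'" for u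
          using ropen_subset[OF V'(1) that] by (auto simp: proj1_def proj2_def fun_eq_iff)
        have "V' \<subseteq> prod_dom n V' m U"
        proof
          fix u assume u: "u \<in> V'"
          then show "u \<in> prod_dom n V' m U"
            using p[OF u] True ropen_subset[OF V'(1) u] by (simp add: prod_dom_def topspace_Euclidean_space)
        qed
        then have "smooth_fun n V' (\<lambda>w. r (proj1 n w) m U q (proj2 n w) i)"
          using S Ck_on_slice unfolding smooth_fun_def by blast
        then show ?thesis
        proof (rule smooth_fun_cong[OF V'(1), rotated])
          fix u assume "u \<in> V'"
          then show "r (proj1 n u) m U q (proj2 n u) i = (?e \<circ> a) u" using True by (simp only: a' p form_at_def if_True simp_thms)
        qed
      next
        case False
        have "form_at X x (r u) m U q i = 0" if "u \<in> V'" for u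
          using False form_zero[OF form_plotD(2)[OF r(1) that], of m U q 0 i] by (auto simp: form_at_def)
        then show ?thesis using a' by (intro smooth_fun_cong[OF V'(1) _ smooth_fun_const[of n V' 0]]) simp
      qed
    qed
  qed
qed simp

text \<open>The functionals \<open>g(w, \<cdot>)\<close> span a subspace of the smooth dual of the same dimension, hence all of it. A null vector is
therefore killed by all smooth functionals, in particular by the evaluations on plots, which separate values.\<close>

lemma pseudo_metric_nondegenerate:
  assumes X: "diffeological_space X" and g: "pseudo_metric (Lambda1 X) g" and x: "x \<in> dspace X"
    and v: "v \<in> fibre (Lambda1 X) x" and null: "\<And>w. w \<in> fibre (Lambda1 X) x \<Longrightarrow> g x v w = 0"
  shows "v = form_val X x 0"
proof -
  let ?W = "smooth_dual (Lambda1 X) x"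
  let ?A = "(\<lambda>v w. if w \<in> fibre (Lambda1 X) x then g x v w else 0) ` fibre (Lambda1 X) x"
  let ?s = "\<lambda>c (\<phi>::'a \<times> 'a form set \<Rightarrow> real) v. c * \<phi> v"
  interpret vector_space ?s by (rule vector_space_fun)
  obtain es where es: "set es \<subseteq> fibre (Lambda1 X) x"
    "\<And>v. v \<in> fibre (Lambda1 X) x \<Longrightarrow> \<exists>cs. length cs = length es \<and> v = lincomb (Lambda1 X) x (zip cs es)"
    using pseudo_metricD(1)[OF g x] by (elim exE conjE) (rule that, assumption, erule bspec)
  have "?W \<subseteq> span ?A"
  proof (rule fun_dim_eq_imp_span)
    show "?A \<subseteq> ?W" using pseudo_metric_row_in_dual[OF X g x] by (rule image_subsetI)
    show "subspace ?W"
      unfolding subspace_def zero_fun_def plus_fun_def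
      using smooth_dual_linear[OF X] by blast
    show "finite (set es)" by simp
    show "\<phi> = 0" if \<phi>: "\<phi> \<in> ?W" and z: "\<And>e. e \<in> set es \<Longrightarrow> \<phi> e = 0" for \<phi>
    proof
      fix w show "\<phi> w = 0 w"
      proof (cases "w \<in> fibre (Lambda1 X) x")
        case True
        then obtain cs where cs: "length cs = length es" "w = lincomb (Lambda1 X) x (zip cs es)" using es(2) by blast
        have sub: "snd ` set (zip cs es) \<subseteq> fibre (Lambda1 X) x"
          using es(1) by (auto dest: set_zip_rightD)
        have "\<phi> w = (\<Sum>(c, v)\<leftarrow>zip cs es. c * \<phi> v)"
          unfolding cs(2) by (rule fibre_functional_lincomb[OF X x smooth_dualD(2)[OF \<phi>] sub])
        also have "\<dots> = (\<Sum>(c, v)\<leftarrow>zip cs es. 0)"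
          using z by (intro arg_cong[of _ _ sum_list] map_cong) (auto dest: set_zip_rightD)
        also have "\<dots> = 0" by (simp add: split_def)
        finally show ?thesis by simp
      qed (simp add: smooth_dualD(1)[OF \<phi>])
    qed
    show "fun_dim ?A = fun_dim ?W" by (rule pseudo_metricD(2)[OF g x])
  qed
  moreover have "span ?A \<subseteq> {\<phi>. \<phi> v = 0}"
  proof (rule span_minimal)
    show "?A \<subseteq> {\<phi>. \<phi> v = 0}"
    proof (rule image_subsetI)
      fix w assume "w \<in> fibre (Lambda1 X) x"
      then show "(\<lambda>w'. if w' \<in> fibre (Lambda1 X) x then g x w w' else 0) \<in> {\<phi>. \<phi> v = 0}"
        using null pseudo_metric_sym[OF g x v] v by simp
    qed
  qed (simp add: subspace_def)
  ultimately have kill: "\<phi> v = 0" if "\<phi> \<in> ?W" for \<phi> using that by blast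
  have "covec X v n U p i = 0" for n U p i
    using kill[OF evaluation_in_smooth_dual[OF X x, of n U p i]] v by simp
  then have "covec X v = covec X (form_val X x 0)" by (simp add: covec_vzero fun_eq_iff)
  then show ?thesis by (rule covec_inj[OF X v vzero_in_fibre[OF x]])
qed

section \<open>Operations on smooth sections\<close>

abbreviation form_rep_along where
  "form_rep_along X n V p s \<equiv> \<exists>r. form_plot X n V r \<and> (\<forall>v\<in>V. s (p v) = form_val X (p v) (r v))"

lemma section_plot_local:
  assumes X: "diffeological_space X" and s: "s \<in> smooth_sections (Lambda1 X)" and p: "plot X n U p"
  shows "near_each n U (\<lambda>V. form_rep_along X n V p s)"
proof -
  have "Lambda_plot X n U (s \<circ> p)" using s p unfolding smooth_sections_Lambda1 by blast
  then have "near_each n U (\<lambda>V. form_rep X n V (s \<circ> p))"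
    unfolding Lambda_plot_iff[OF X] by (rule conjunct2)
  then show ?thesis
  proof (rule near_each_mono)
    fix V assume V: "V \<subseteq> U" and "form_rep X n V (s \<circ> p)"
    then obtain q r where r: "form_plot X n V r" "\<And>v. v \<in> V \<Longrightarrow> s (p v) = form_val X (q v) (r v)"
      unfolding comp_def by blast
    have "s (p v) = form_val X (p v) (r v)" if v: "v \<in> V" for v
      using r(2)[OF v] fst_fibre[OF section_in_fibre[OF s plot_in[OF X p subsetD[OF V v]]]] by simp
    with r(1) show "form_rep_along X n V p s" by blast
  qed
qed

lemma smooth_sectionI:
  assumes X: "diffeological_space X" and s: "s \<in> (\<Pi>\<^sub>E x\<in>dspace X. fibre (Lambda1 X) x)"
    and loc: "\<And>n U p. plot X n U p \<Longrightarrow>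
      near_each n U (\<lambda>V. form_rep_along X n V p s)"
  shows "s \<in> smooth_sections (Lambda1 X)"
  unfolding smooth_sections_Lambda1
proof (intro conjI allI impI s)
  fix n U p assume p: "plot X n U p"
  show "Lambda_plot X n U (s \<circ> p)"
  proof (rule Lambda_plot_local[OF X plot_open[OF X p]], rule near_each_mono[OF loc[OF p]])
    fix V assume V: "ropen n V" "V \<subseteq> U" and "form_rep_along X n V p s"
    then obtain r where r: "form_plot X n V r" "\<And>v. v \<in> V \<Longrightarrow> s (p v) = form_val X (p v) (r v)" by blast
    show "Lambda_plot X n V (s \<circ> p)"
      by (rule Lambda_plot_cong[OF X Lambda_plot_val[OF X plot_restrict[OF X p V] r(1)]]) (simp add: r(2))
  qed
qed

lemma sec_add_apply: "x \<in> dspace (base V) \<Longrightarrow> sec_add V s t x = vadd V (s x) (t x)"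
  and sec_scale_apply: "x \<in> dspace (base V) \<Longrightarrow> sec_scale V h s x = vscale V (h x) (s x)"
  and sec_diff_apply: "x \<in> dspace (base V) \<Longrightarrow> sec_diff V s t x = vadd V (s x) (vscale V (- 1) (t x))"
  by (simp_all add: sec_add_def sec_scale_def sec_diff_def)

lemma sec_add_smooth:
  assumes X: "diffeological_space X" and s: "s \<in> smooth_sections (Lambda1 X)" and t: "t \<in> smooth_sections (Lambda1 X)"
  shows "sec_add (Lambda1 X) s t \<in> smooth_sections (Lambda1 X)"
proof (rule smooth_sectionI[OF X])
  show "sec_add (Lambda1 X) s t \<in> (\<Pi>\<^sub>E x\<in>dspace X. fibre (Lambda1 X) x)"
    unfolding sec_add_def Lambda1_simps restrict_PiE_iff
    by (intro ballI vadd_in_fibre[OF X] section_in_fibre[OF s] section_in_fibre[OF t])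
  fix n U p assume p: "plot X n U p"
  show "near_each n U (\<lambda>V. form_rep_along X n V p (sec_add (Lambda1 X) s t))"
  proof (rule near_each_bind[OF section_plot_local[OF X s p]])
    fix V assume V: "ropen n V" "V \<subseteq> U" and "form_rep_along X n V p s"
    then obtain r where r: "form_plot X n V r" "\<And>v. v \<in> V \<Longrightarrow> s (p v) = form_val X (p v) (r v)" by blast
    show "near_each n V (\<lambda>V. form_rep_along X n V p (sec_add (Lambda1 X) s t))"
    proof (rule near_each_mono[OF section_plot_local[OF X t plot_restrict[OF X p V]]])
      fix V' assume V': "ropen n V'" "V' \<subseteq> V" and "form_rep_along X n V' p t"
      then obtain r' where r': "form_plot X n V' r'" "\<And>v. v \<in> V' \<Longrightarrow> t (p v) = form_val X (p v) (r' v)" by blast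
      have "sec_add (Lambda1 X) s t (p v) = form_val X (p v) (r v + r' v)" if v: "v \<in> V'" for v
      proof -
        have "p v \<in> dspace X" using plot_in[OF X p] V(2) V'(2) v by blast
        then show ?thesis
          using r(2)[OF subsetD[OF V'(2) v]] r'(2)[OF v] form_plotD(2)[OF r(1) subsetD[OF V'(2) v]] form_plotD(2)[OF r'(1) v]
          by (simp add: sec_add_apply vadd_form_val[OF X])
      qed
      then show "form_rep_along X n V' p (sec_add (Lambda1 X) s t)"
        using form_plot_add[OF X form_plot_restrict[OF r(1) V'] r'(1)]
        by (intro exI[of _ "\<lambda>v. r v + r' v"] conjI ballI)
    qed
  qed
qed

lemma sec_scale_smooth:
  assumes X: "diffeological_space X" and s: "s \<in> smooth_sections (Lambda1 X)" and h: "smooth_real X h"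
  shows "sec_scale (Lambda1 X) h s \<in> smooth_sections (Lambda1 X)"
proof (rule smooth_sectionI[OF X])
  show "sec_scale (Lambda1 X) h s \<in> (\<Pi>\<^sub>E x\<in>dspace X. fibre (Lambda1 X) x)"
    unfolding sec_scale_def Lambda1_simps restrict_PiE_iff
    by (intro ballI vscale_in_fibre[OF X] section_in_fibre[OF s])
  fix n U p assume p: "plot X n U p"
  show "near_each n U (\<lambda>V. form_rep_along X n V p (sec_scale (Lambda1 X) h s))"
  proof (rule near_each_mono[OF section_plot_local[OF X s p]])
    fix V assume V: "ropen n V" "V \<subseteq> U" and "form_rep_along X n V p s"
    then obtain r where r: "form_plot X n V r" "\<And>v. v \<in> V \<Longrightarrow> s (p v) = form_val X (p v) (r v)" by blast
    have pV: "plot X n V p" by (rule plot_restrict[OF X p V])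
    have "sec_scale (Lambda1 X) h s (p v) = form_val X (p v) (form_scale (h (p v)) (r v))" if v: "v \<in> V" for v
      using plot_in[OF X pV v] r(2)[OF v] form_plotD(2)[OF r(1) v]
      by (simp add: sec_scale_apply vscale_form_val[OF X])
    then show "form_rep_along X n V p (sec_scale (Lambda1 X) h s)"
      using form_plot_scale[OF X pV h r(1)] by (intro exI[of _ "\<lambda>v. form_scale (h (p v)) (r v)"] conjI ballI)
  qed
qed

lemma smooth_real_const: "smooth_real X (\<lambda>_. c)"
  by (simp add: smooth_real_def comp_def smooth_fun_const)

lemma d_sec_apply: "x \<in> dspace X \<Longrightarrow> d_sec X h x = form_val X x (d_form X h)"
  by (simp add: d_sec_def form_val_def)

lemma d_sec_smooth:
  assumes X: "diffeological_space X" and h: "smooth_real X h"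
  shows "d_sec X h \<in> smooth_sections (Lambda1 X)"
proof (rule smooth_sectionI[OF X])
  show "d_sec X h \<in> (\<Pi>\<^sub>E x\<in>dspace X. fibre (Lambda1 X) x)"
    using form_val_in_fibre[OF _ d_form_in[OF X h]] by (auto simp: d_sec_def form_val_def)
  fix n U p assume p: "plot X n U p"
  show "near_each n U (\<lambda>V. form_rep_along X n V p (d_sec X h))"
    using form_plot_const[OF X d_form_in[OF X h] plot_open[OF X p]] d_sec_apply[OF plot_in[OF X p]]
    by (intro near_each_self[OF plot_open[OF X p]] exI[of _ "\<lambda>_. d_form X h"] conjI ballI)
qed

lemma Lambda_plot_fibre: "Lambda_plot X n U a \<Longrightarrow> u \<in> U \<Longrightarrow> a u \<in> fibre (Lambda1 X) (fst (a u))"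
  unfolding Lambda_plot_unfold fibre_def by blast

abbreviation tensor_rep where
  "tensor_rep X n V t \<equiv> \<exists>pqs.
     (\<forall>(p1, p2)\<in>set pqs. Lambda_plot X n V p1 \<and> Lambda_plot X n V p2 \<and>
        (\<forall>u\<in>V. fst (p1 u) = fst (t u) \<and> fst (p2 u) = fst (t u))) \<and>
     (\<forall>u\<in>V. snd (t u) = snd (tens X (fst (t u)) (map (\<lambda>(p1, p2). (p1 u, p2 u)) pqs)))"

lemma tensor_plot_iff:
  "tensor_plot X n U p \<longleftrightarrow> ropen n U \<and> plot X n U (fst \<circ> p) \<and>
     near_each n U (\<lambda>V. tensor_rep X n V p)"
  by (simp add: tensor_bundle_def tens_def)

section \<open>Maps that identify values of 1-forms\<close>

text \<open>The last two conditions say that, on values of 1-forms, pullback along \<open>j\<close> is an isomorphism on each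
fibre, and that its inverse is smooth.\<close>

locale form_embedding =
  fixes X :: "'a diffeology" and Z :: "'c diffeology" and j :: "'a \<Rightarrow> 'c"
  assumes X: "diffeological_space X" and Z: "diffeological_space Z"
    and j: "dsmooth X Z j" and inj: "inj_on j (dspace X)"
    and lift: "\<And>n U r. form_plot X n U r \<Longrightarrow>
      near_each n U (\<lambda>V. \<exists>r'. form_plot Z n V r' \<and> (\<forall>v\<in>V. form_pullback X j (r' v) = r v))"
    and reflect: "\<And>\<omega> x. \<omega> \<in> one_forms Z \<Longrightarrow> x \<in> dspace X \<Longrightarrow>
      form_pullback X j \<omega> \<in> vanishing_forms X x \<Longrightarrow> \<omega> \<in> vanishing_forms Z (j x)"
begin

abbreviation \<rho> where "\<rho> x \<equiv> Lambda_pullback X j x"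

lemma jx: "x \<in> dspace X \<Longrightarrow> j x \<in> dspace Z" by (rule dsmooth_in[OF j])

lemma rho_val: "\<omega> \<in> one_forms Z \<Longrightarrow> \<rho> x (form_val Z (j x) \<omega>) = form_val X x (form_pullback X j \<omega>)"
  by (rule Lambda_pullback_form_val[OF X Z j])

lemma rho_linear: "x \<in> dspace X \<Longrightarrow> fibre_linear Z (j x) X x (\<rho> x)"
  by (rule fibre_linear_pullback[OF X Z j])

lemma rho_inj:
  assumes x: "x \<in> dspace X" and v: "v \<in> fibre (Lambda1 Z) (j x)" "w \<in> fibre (Lambda1 Z) (j x)" and e: "\<rho> x v = \<rho> x w"
  shows "v = w"
proof -
  obtain \<omega> \<eta> where w: "\<omega> \<in> one_forms Z" "v = form_val Z (j x) \<omega>" "\<eta> \<in> one_forms Z" "w = form_val Z (j x) \<eta>"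
    using v unfolding fibre_Lambda1 by blast
  have "form_pullback X j \<omega> - form_pullback X j \<eta> \<in> vanishing_forms X x"
    using e form_val_eq[OF X form_pullback_in[OF j w(1) X] form_pullback_in[OF j w(3) X]]
    unfolding w(2,4) rho_val[OF w(1)] rho_val[OF w(3)] by blast
  then have "form_pullback X j (\<omega> - \<eta>) \<in> vanishing_forms X x" unfolding form_pullback_diff .
  then have "\<omega> - \<eta> \<in> vanishing_forms Z (j x)" by (rule reflect[OF one_forms_diff[OF Z w(1,3)] x])
  then show ?thesis unfolding w(2,4) by (rule iffD2[OF form_val_eq[OF Z w(1,3)]])
qed

lemma forms_surj:
  assumes w: "\<omega> \<in> one_forms X"
  obtains \<omega>' where "\<omega>' \<in> one_forms Z" "form_pullback X j \<omega>' = \<omega>"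
proof -
  \<comment> \<open>the lifting condition for a constant family over \<open>\<real>\<^sup>0\<close>\<close>
  have E: "ropen 0 (topspace (Euclidean_space 0))" by simp
  have "(0::rvec) \<in> topspace (Euclidean_space 0)" by (simp add: topspace_Euclidean_space)
  from bspec[OF lift[OF form_plot_const[OF X w E], unfolded near_each_def] this]
  obtain V r' where "0 \<in> V" "form_plot Z 0 V r'" "\<forall>v\<in>V. form_pullback X j (r' v) = \<omega>" by blast
  then show ?thesis using that[of "r' 0"] form_plotD(2) by metis
qed

lemma rho_surj:
  assumes x: "x \<in> dspace X" and v: "v \<in> fibre (Lambda1 X) x"
  shows "\<exists>w\<in>fibre (Lambda1 Z) (j x). \<rho> x w = v"
proof -
  obtain \<omega> where w: "\<omega> \<in> one_forms X" "v = form_val X x \<omega>" using v unfolding fibre_Lambda1 by blast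
  obtain \<omega>' where w': "\<omega>' \<in> one_forms Z" "form_pullback X j \<omega>' = \<omega>" by (rule forms_surj[OF w(1)])
  show ?thesis
    by (rule bexI[OF _ form_val_in_fibre[OF jx[OF x] w'(1)]]) (simp add: rho_val[OF w'(1)] w'(2) w(2))
qed

definition rho_inv :: "'a \<Rightarrow> 'a \<times> 'a form set \<Rightarrow> 'c \<times> 'c form set" where
  "rho_inv x v = (SOME w. w \<in> fibre (Lambda1 Z) (j x) \<and> \<rho> x w = v)"

lemma
  assumes x: "x \<in> dspace X" and v: "v \<in> fibre (Lambda1 X) x"
  shows rho_inv_in: "rho_inv x v \<in> fibre (Lambda1 Z) (j x)" and rho_rho_inv: "\<rho> x (rho_inv x v) = v"
proof -
  from rho_surj[OF x v] have "\<exists>w. w \<in> fibre (Lambda1 Z) (j x) \<and> \<rho> x w = v" by blast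
  then have "rho_inv x v \<in> fibre (Lambda1 Z) (j x) \<and> \<rho> x (rho_inv x v) = v"
    unfolding rho_inv_def by (rule someI_ex)
  then show "rho_inv x v \<in> fibre (Lambda1 Z) (j x)" "\<rho> x (rho_inv x v) = v" by blast+
qed

lemma rho_in: "x \<in> dspace X \<Longrightarrow> v \<in> fibre (Lambda1 Z) (j x) \<Longrightarrow> \<rho> x v \<in> fibre (Lambda1 X) x"
  by (rule fibre_linear_in[OF rho_linear])

lemma rho_inv_rho: "x \<in> dspace X \<Longrightarrow> v \<in> fibre (Lambda1 Z) (j x) \<Longrightarrow> rho_inv x (\<rho> x v) = v"
  by (rule rho_inj[OF _ rho_inv_in _ rho_rho_inv]) (simp_all add: rho_in)

lemma rho_inv_linear:
  assumes x: "x \<in> dspace X" shows "fibre_linear X x Z (j x) (rho_inv x)"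
proof -
  note l = rho_linear[OF x]
  have u: "rho_inv x v = w" if "w \<in> fibre (Lambda1 Z) (j x)" "\<rho> x w = v" for v w
    using rho_inv_rho[OF x that(1)] that(2) by simp
  show ?thesis
    unfolding fibre_linear_def
  proof (intro conjI ballI allI)
    fix v c assume v: "v \<in> fibre (Lambda1 X) x"
    note i = rho_inv_in[OF x v] and r = rho_rho_inv[OF x v]
    show "rho_inv x v \<in> fibre (Lambda1 Z) (j x)" by (rule i)
    show "rho_inv x (vscale (Lambda1 X) c v) = vscale (Lambda1 Z) c (rho_inv x v)"
      by (rule u[OF vscale_in_fibre[OF Z i]]) (simp add: fibre_linear_scale[OF l i] r)
    fix w assume w: "w \<in> fibre (Lambda1 X) x"
    note i' = rho_inv_in[OF x w] and r' = rho_rho_inv[OF x w]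
    show "rho_inv x (vadd (Lambda1 X) v w) = vadd (Lambda1 Z) (rho_inv x v) (rho_inv x w)"
      by (rule u[OF vadd_in_fibre[OF Z i i']]) (simp add: fibre_linear_add[OF l i i'] r r')
  next
    show "rho_inv x (form_val X x 0) = form_val Z (j x) 0"
      by (rule u[OF vzero_in_fibre[OF jx[OF x]] fibre_linear_zero[OF l]])
  qed
qed

abbreviation \<rho>\<rho> where "\<rho>\<rho> x \<equiv> tensor_map (Lambda1 X) (Lambda1 X) x (\<rho> x) (\<rho> x)"

lemma rho2_inj:
  assumes x: "x \<in> dspace X" and t: "\<tau> \<in> fibre (Lambda1_tensor Z) (j x)" "\<sigma> \<in> fibre (Lambda1_tensor Z) (j x)"
    and e: "\<rho>\<rho> x \<tau> = \<rho>\<rho> x \<sigma>"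
  shows "\<tau> = \<sigma>"
proof -
  have l: "tensor_map (Lambda1 Z) (Lambda1 Z) (j x) (rho_inv x) (rho_inv x) (\<rho>\<rho> x \<tau>) = \<tau>"
    if "\<tau> \<in> fibre (Lambda1_tensor Z) (j x)" for \<tau>
    by (rule tensor_map_left_inverse[OF rho_linear[OF x] rho_inv_linear[OF x] _ that]) (rule rho_inv_rho[OF x])
  from l[OF t(1)] l[OF t(2)] e show ?thesis by metis
qed

lemma rho2_surj:
  assumes x: "x \<in> dspace X" and t: "\<tau> \<in> fibre (Lambda1_tensor X) x"
  obtains \<sigma> where "\<sigma> \<in> fibre (Lambda1_tensor Z) (j x)" "\<rho>\<rho> x \<sigma> = \<tau>"
proof (rule that)
  let ?\<sigma> = "tensor_map (Lambda1 Z) (Lambda1 Z) (j x) (rho_inv x) (rho_inv x) \<tau>"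
  show "?\<sigma> \<in> fibre (Lambda1_tensor Z) (j x)" by (rule tensor_map_in[OF X x Z jx[OF x] rho_inv_linear[OF x] t])
  show "\<rho>\<rho> x ?\<sigma> = \<tau>"
    by (rule tensor_map_left_inverse[OF rho_inv_linear[OF x] rho_linear[OF x] _ t]) (rule rho_rho_inv[OF x])
qed

lemma Lambda_plot_pull:
  assumes a: "Lambda_plot Z n U a" and q: "plot X n U q" and e: "\<And>u. u \<in> U \<Longrightarrow> fst (a u) = j (q u)"
  shows "Lambda_plot X n U (\<lambda>u. \<rho> (q u) (a u))"
proof (rule Lambda_plot_local[OF X plot_open[OF X q]])
  have near: "near_each n U (\<lambda>V. form_rep Z n V a)"
    using a unfolding Lambda_plot_iff[OF Z] by (rule conjunct2)
  show "near_each n U (\<lambda>V. Lambda_plot X n V (\<lambda>u. \<rho> (q u) (a u)))"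
  proof (rule near_each_mono[OF near])
    fix V assume V: "ropen n V" "V \<subseteq> U" and "form_rep Z n V a"
    then obtain q' r where r: "form_plot Z n V r" "\<And>v. v \<in> V \<Longrightarrow> a v = form_val Z (q' v) (r v)" by blast
    have "form_val X (q v) (form_pullback X j (r v)) = \<rho> (q v) (a v)" if v: "v \<in> V" for v
    proof -
      have "q' v = j (q v)" using e[OF subsetD[OF V(2) v]] r(2)[OF v] by simp
      then show ?thesis using r(2)[OF v] rho_val[OF form_plotD(2)[OF r(1) v]] by simp
    qed
    then show "Lambda_plot X n V (\<lambda>u. \<rho> (q u) (a u))"
      by (rule Lambda_plot_cong[OF X Lambda_plot_val[OF X plot_restrict[OF X q V] form_plot_pullback[OF X j r(1)]]])
  qed
qed

text \<open>A local lift of the forms that represent \<open>a\<close> represents \<open>b\<close>, since \<open>\<rho>\<close> is injective.\<close>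

lemma Lambda_plot_reflect:
  assumes a: "Lambda_plot X n U a" and b: "\<And>u. u \<in> U \<Longrightarrow> fst (a u) \<in> dspace X \<Longrightarrow> b u \<in> fibre (Lambda1 Z) (j (fst (a u)))"
    "\<And>u. u \<in> U \<Longrightarrow> \<rho> (fst (a u)) (b u) = a u"
  shows "Lambda_plot Z n U b"
proof (rule Lambda_plot_local[OF Z Lambda_plot_open[OF X a]])
  have near: "near_each n U (\<lambda>V. form_rep X n V a)"
    using a unfolding Lambda_plot_iff[OF X] by (rule conjunct2)
  show "near_each n U (\<lambda>V. Lambda_plot Z n V b)"
  proof (rule near_each_bind[OF near])
    fix V assume V: "ropen n V" "V \<subseteq> U" and "form_rep X n V a"
    then obtain q r where q: "plot X n V q" and r: "form_plot X n V r" and av: "\<And>v. v \<in> V \<Longrightarrow> a v = form_val X (q v) (r v)" by blast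
    show "near_each n V (\<lambda>V. Lambda_plot Z n V b)"
    proof (rule near_each_mono[OF lift[OF r]])
      fix V' assume V': "ropen n V'" "V' \<subseteq> V" and "\<exists>r'. form_plot Z n V' r' \<and> (\<forall>v\<in>V'. form_pullback X j (r' v) = r v)"
      then obtain r' where r': "form_plot Z n V' r'" "\<And>v. v \<in> V' \<Longrightarrow> form_pullback X j (r' v) = r v" by blast
      have qV: "plot X n V' q" by (rule plot_restrict[OF X q V'])
      have "form_val Z ((j \<circ> q) v) (r' v) = b v" if v: "v \<in> V'" for v
      proof -
        have vU: "v \<in> U" using v V'(2) V(2) by blast
        have qx: "q v \<in> dspace X" by (rule plot_in[OF X qV v])
        have f: "fst (a v) = q v" using av[OF subsetD[OF V'(2) v]] by simp
        show ?thesis unfolding comp_def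
        proof (rule rho_inj[OF qx form_val_in_fibre[OF jx[OF qx] form_plotD(2)[OF r'(1) v]]])
          show "b v \<in> fibre (Lambda1 Z) (j (q v))" using b(1)[OF vU] f qx by simp
          show "\<rho> (q v) (form_val Z (j (q v)) (r' v)) = \<rho> (q v) (b v)"
            using b(2)[OF vU] f rho_val[OF form_plotD(2)[OF r'(1) v]] r'(2)[OF v] av[OF subsetD[OF V'(2) v]] by simp
        qed
      qed
      then show "Lambda_plot Z n V' b"
        by (rule Lambda_plot_cong[OF Z Lambda_plot_val[OF Z dsmooth_plot[OF j qV] r'(1)]])
    qed
  qed
qed

text \<open>The factors of a local representation of the family downstairs are lifted one by one with the inverse of
\<open>\<rho>\<close>; injectivity of \<open>\<rho> \<otimes> \<rho>\<close> shows that the lifted factors represent \<open>\<sigma>\<close>.\<close>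

lemma tensor_plot_reflect:
  assumes t: "tensor_plot X n U t" and s: "\<And>u. u \<in> U \<Longrightarrow> \<sigma> u \<in> fibre (Lambda1_tensor Z) (j (fst (t u)))"
    "\<And>u. u \<in> U \<Longrightarrow> \<rho>\<rho> (fst (t u)) (\<sigma> u) = t u"
  shows "tensor_plot Z n U \<sigma>"
proof -
  let ?x = "\<lambda>u. fst (t u)"
  have U: "ropen n U" and x: "plot X n U (fst \<circ> t)" and near: "near_each n U (\<lambda>V. tensor_rep X n V t)"
    using t unfolding tensor_plot_iff by blast+
  have fs: "fst (\<sigma> u) = j (?x u)" if "u \<in> U" for u using s(1)[OF that] by (rule fst_fibre)
  have xd: "?x u \<in> dspace X" if "u \<in> U" for u using plot_in[OF X x that] by simp
  have "plot Z n U (fst \<circ> \<sigma>)" by (rule plot_cong[OF Z dsmooth_plot[OF j x]]) (simp add: fs)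
  moreover have "near_each n U (\<lambda>V. tensor_rep Z n V \<sigma>)"
  proof (rule near_each_mono[OF near])
    fix V assume V: "ropen n V" "V \<subseteq> U" and "tensor_rep X n V t"
    then obtain pqs where pqs: "\<forall>(p1, p2)\<in>set pqs. Lambda_plot X n V p1 \<and> Lambda_plot X n V p2 \<and>
        (\<forall>u\<in>V. fst (p1 u) = fst (t u) \<and> fst (p2 u) = fst (t u))"
      and tu: "\<And>u. u \<in> V \<Longrightarrow> snd (t u) = snd (tens X (fst (t u)) (map (\<lambda>(p1, p2). (p1 u, p2 u)) pqs))" by blast
    let ?L = "\<lambda>p u. rho_inv (?x u) (p u)"
    have L: "Lambda_plot Z n V (?L p) \<and> (\<forall>u\<in>V. fst (?L p u) = fst (\<sigma> u) \<and> \<rho> (?x u) (?L p u) = p u \<and> p u \<in> fibre (Lambda1 X) (?x u)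
        \<and> ?L p u \<in> fibre (Lambda1 Z) (j (?x u)))"
      if p: "Lambda_plot X n V p" "\<And>u. u \<in> V \<Longrightarrow> fst (p u) = ?x u" for p
    proof -
      have pf: "p u \<in> fibre (Lambda1 X) (?x u)" if "u \<in> V" for u
        using Lambda_plot_fibre[OF p(1) that] p(2)[OF that] by simp
      have i: "?L p u \<in> fibre (Lambda1 Z) (j (?x u))" "\<rho> (?x u) (?L p u) = p u" if "u \<in> V" for u
        using rho_inv_in[OF xd pf[OF that]] rho_rho_inv[OF xd pf[OF that]] that V(2) by blast+
      have "Lambda_plot Z n V (?L p)"
        by (rule Lambda_plot_reflect[OF p(1)]) (use p(2) i in simp_all)
      moreover have "fst (?L p u) = fst (\<sigma> u)" if "u \<in> V" for u
        using fst_fibre[OF i(1)[OF that]] fs[OF subsetD[OF V(2) that]] by simp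
      ultimately show ?thesis using i pf by blast
    qed
    let ?pqs = "map (\<lambda>(p1, p2). (?L p1, ?L p2)) pqs"
    have P: "Lambda_plot X n V p1" "Lambda_plot X n V p2" "\<And>u. u \<in> V \<Longrightarrow> fst (p1 u) = ?x u" "\<And>u. u \<in> V \<Longrightarrow> fst (p2 u) = ?x u"
      if "(p1, p2) \<in> set pqs" for p1 p2 using bspec[OF pqs that] by simp_all
    have L1: "Lambda_plot Z n V (?L p1)" "Lambda_plot Z n V (?L p2)"
      "\<And>u. u \<in> V \<Longrightarrow> fst (?L p1 u) = fst (\<sigma> u) \<and> \<rho> (?x u) (?L p1 u) = p1 u \<and> p1 u \<in> fibre (Lambda1 X) (?x u)
        \<and> ?L p1 u \<in> fibre (Lambda1 Z) (j (?x u))"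
      "\<And>u. u \<in> V \<Longrightarrow> fst (?L p2 u) = fst (\<sigma> u) \<and> \<rho> (?x u) (?L p2 u) = p2 u \<and> p2 u \<in> fibre (Lambda1 X) (?x u)
        \<and> ?L p2 u \<in> fibre (Lambda1 Z) (j (?x u))"
      if "(p1, p2) \<in> set pqs" for p1 p2
      using L[of p1, OF P(1,3)[OF that]] L[of p2, OF P(2,4)[OF that]] by blast+
    have "\<forall>(p1, p2)\<in>set ?pqs. Lambda_plot Z n V p1 \<and> Lambda_plot Z n V p2 \<and>
        (\<forall>u\<in>V. fst (p1 u) = fst (\<sigma> u) \<and> fst (p2 u) = fst (\<sigma> u))"
    proof
      fix a assume "a \<in> set ?pqs"
      then obtain p1 p2 where a: "a = (?L p1, ?L p2)" "(p1, p2) \<in> set pqs" by auto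
      show "case a of (p1, p2) \<Rightarrow> Lambda_plot Z n V p1 \<and> Lambda_plot Z n V p2 \<and>
        (\<forall>u\<in>V. fst (p1 u) = fst (\<sigma> u) \<and> fst (p2 u) = fst (\<sigma> u))"
        unfolding a(1) prod.case using L1[OF a(2)] by blast
    qed
    moreover have "snd (\<sigma> u) = snd (tens Z (fst (\<sigma> u)) (map (\<lambda>(p1, p2). (p1 u, p2 u)) ?pqs))" if u: "u \<in> V" for u
    proof -
      have uU: "u \<in> U" using u V(2) by blast
      let ?zs = "map (\<lambda>(p1, p2). (p1 u, p2 u)) pqs" and ?ws = "map (\<lambda>(p1, p2). (p1 u, p2 u)) ?pqs"
      have ws: "set ?ws \<subseteq> Lpairs Z (j (?x u))" using L1(3,4)[OF _ u] by auto
      have m: "map (map_prod (\<rho> (?x u)) (\<rho> (?x u))) ?ws = ?zs" using L1(3,4)[OF _ u] by auto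
      have tt: "tens X (?x u) ?zs = t u"
        using tu[OF u] by (intro prod_eqI) simp_all
      have "\<sigma> u = tens Z (j (?x u)) ?ws"
      proof (rule rho2_inj[OF xd[OF uU] s(1)[OF uU]])
        show "tens Z (j (?x u)) ?ws \<in> fibre (Lambda1_tensor Z) (j (?x u))"
          unfolding fibre_tensor using jx[OF xd[OF uU]] ws by blast
        show "\<rho>\<rho> (?x u) (\<sigma> u) = \<rho>\<rho> (?x u) (tens Z (j (?x u)) ?ws)"
          unfolding s(2)[OF uU] tensor_map_tens[OF rho_linear[OF xd[OF uU]] rho_linear[OF xd[OF uU]] ws] m tt ..
      qed
      then show ?thesis unfolding fs[OF uU] by (rule arg_cong)
    qed
    ultimately show "tensor_rep Z n V \<sigma>"
      by (intro exI[of _ ?pqs]) (rule conjI, assumption, rule ballI)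
  qed
  ultimately show ?thesis unfolding tensor_plot_iff using U by (intro conjI)
qed

definition part :: "('c \<Rightarrow> 'c \<times> 'c form set) \<Rightarrow> 'a \<Rightarrow> 'a \<times> 'a form set" where
  "part s = (\<lambda>x\<in>dspace X. \<rho> x (s (j x)))"

lemma part_apply: "x \<in> dspace X \<Longrightarrow> part s x = \<rho> x (s (j x))" by (simp add: part_def)

lemma part_smooth:
  assumes s: "s \<in> smooth_sections (Lambda1 Z)"
  shows "part s \<in> smooth_sections (Lambda1 X)"
  unfolding smooth_sections_Lambda1
proof (intro conjI allI impI)
  show "part s \<in> (\<Pi>\<^sub>E x\<in>dspace X. fibre (Lambda1 X) x)"
    unfolding part_def restrict_PiE_iff by (intro ballI rho_in section_in_fibre[OF s] jx)
  fix n U p assume p: "plot X n U p"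
  have a: "Lambda_plot Z n U (s \<circ> (j \<circ> p))" using s dsmooth_plot[OF j p] unfolding smooth_sections_Lambda1 by blast
  have "Lambda_plot X n U (\<lambda>u. \<rho> (p u) ((s \<circ> (j \<circ> p)) u))"
    by (rule Lambda_plot_pull[OF a p]) (simp add: fst_fibre[OF section_in_fibre[OF s jx[OF plot_in[OF X p]]]])
  then show "Lambda_plot X n U (part s \<circ> p)"
    by (rule Lambda_plot_cong[OF X]) (simp add: part_apply plot_in[OF X p])
qed

lemma part_family:
  assumes r: "plot (sections_diffeology (Lambda1 Z)) n U r"
  shows "plot (sections_diffeology (Lambda1 X)) n U (part \<circ> r)"
proof -
  have U: "ropen n U" and rs: "r ` U \<subseteq> smooth_sections (Lambda1 Z)"
    and rp: "\<And>m U' q. plot Z m U' q \<Longrightarrow> Lambda_plot Z (n + m) (prod_dom n U m U') (\<lambda>w. r (proj1 n w) (q (proj2 n w)))"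
    using r unfolding sections_diffeology_def by simp_all
  have rsu: "r u \<in> smooth_sections (Lambda1 Z)" if "u \<in> U" for u using rs imageI[OF that] by (rule subsetD)
  have "Lambda_plot X (n + m) (prod_dom n U m U') (\<lambda>w. (part \<circ> r) (proj1 n w) (q (proj2 n w)))"
    if q: "plot X m U' q" for m U' q
  proof -
    let ?P = "prod_dom n U m U'"
    have P: "ropen (n + m) ?P" by (rule ropen_prod_dom[OF U plot_open[OF X q]])
    have q2: "plot X (n + m) ?P (q \<circ> proj2 n)"
      by (rule plot_comp[OF X q P smooth_map_proj2[OF plot_open[OF X q] subset_refl]])
    have pr: "proj1 n w \<in> U" "proj2 n w \<in> U'" if "w \<in> ?P" for w using that by (simp_all add: prod_dom_def)
    have "Lambda_plot X (n + m) ?P (\<lambda>w. \<rho> ((q \<circ> proj2 n) w) (r (proj1 n w) ((j \<circ> q) (proj2 n w))))"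
      by (rule Lambda_plot_pull[OF rp[OF dsmooth_plot[OF j q]] q2])
        (simp add: fst_fibre[OF section_in_fibre[OF rsu[OF pr(1)] jx[OF plot_in[OF X q pr(2)]]]])
    then show ?thesis
      by (rule Lambda_plot_cong[OF X]) (simp add: part_apply plot_in[OF X q pr(2)])
  qed
  then show ?thesis using U rsu part_smooth unfolding sections_diffeology_def by (simp add: image_subset_iff)
qed

lemma rho_d_sec:
  assumes h: "smooth_real Z h" and x: "x \<in> dspace X"
  shows "\<rho> x (d_sec Z h (j x)) = d_sec X (h \<circ> j) x"
  by (simp add: d_sec_apply x jx[OF x] rho_val[OF d_form_in[OF Z h]] d_form_pullback[OF j])

lemma part_add:
  assumes s: "s \<in> smooth_sections (Lambda1 Z)" and t: "t \<in> smooth_sections (Lambda1 Z)"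
  shows "part (sec_add (Lambda1 Z) s t) = sec_add (Lambda1 X) (part s) (part t)"
proof
  fix x show "part (sec_add (Lambda1 Z) s t) x = sec_add (Lambda1 X) (part s) (part t) x"
  proof (cases "x \<in> dspace X")
    case True
    then show ?thesis using fibre_linear_add[OF rho_linear[OF True] section_in_fibre[OF s jx[OF True]] section_in_fibre[OF t jx[OF True]]]
      by (simp add: part_apply sec_add_apply jx)
  qed (simp add: part_def sec_add_def)
qed

lemma part_scale:
  assumes s: "s \<in> smooth_sections (Lambda1 Z)"
  shows "part (sec_scale (Lambda1 Z) h s) = sec_scale (Lambda1 X) (h \<circ> j) (part s)"
proof
  fix x show "part (sec_scale (Lambda1 Z) h s) x = sec_scale (Lambda1 X) (h \<circ> j) (part s) x"
  proof (cases "x \<in> dspace X")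
    case True
    then show ?thesis using fibre_linear_scale[OF rho_linear[OF True] section_in_fibre[OF s jx[OF True]]]
      by (simp add: part_apply sec_scale_apply jx)
  qed (simp add: part_def sec_scale_def)
qed

end

section \<open>Pushouts\<close>

abbreviation lifts where
  "lifts X j n V p \<equiv> \<exists>q. plot X n V q \<and> (\<forall>v\<in>V. p v = j (q v))"

text \<open>The gluing is described symmetrically, as the pushout \<open>Z\<close> of two maps \<open>a1\<close>, \<open>a2\<close> from the overlap \<open>S\<close>, so that
each statement about the first leg also yields one about the second.\<close>

locale pushout =
  fixes S :: "'s diffeology" and X1 :: "'a diffeology" and X2 :: "'b diffeology" and Z :: "'c diffeology"
    and a1 :: "'s \<Rightarrow> 'a" and a2 :: "'s \<Rightarrow> 'b" and j1 :: "'a \<Rightarrow> 'c" and j2 :: "'b \<Rightarrow> 'c"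
  assumes S: "diffeological_space S" and X1: "diffeological_space X1" and X2: "diffeological_space X2"
    and a1: "dsmooth S X1 a1" and a2: "dsmooth S X2 a2"
    and inj1: "inj_on j1 (dspace X1)" and inj2: "inj_on j2 (dspace X2)"
    and dspace_Z: "dspace Z = j1 ` dspace X1 \<union> j2 ` dspace X2"
    and plot_Z: "\<And>n U p. plot Z n U p \<longleftrightarrow> ropen n U \<and> near_each n U (\<lambda>V.
      lifts X1 j1 n V p \<or> lifts X2 j2 n V p)"
    and comm: "\<And>y. y \<in> dspace S \<Longrightarrow> j1 (a1 y) = j2 (a2 y)"
    and overlap: "\<And>n V q1 q2. plot X1 n V q1 \<Longrightarrow> plot X2 n V q2 \<Longrightarrow> (\<And>v. v \<in> V \<Longrightarrow> j1 (q1 v) = j2 (q2 v)) \<Longrightarrow>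
      \<exists>y. plot S n V y \<and> (\<forall>v\<in>V. q1 v = a1 (y v) \<and> q2 v = a2 (y v))"
    and same_forms: "pushforward_diffeology (one_forms_diffeology X1) (form_pullback S a1) (one_forms S)
      = pushforward_diffeology (one_forms_diffeology X2) (form_pullback S a2) (one_forms S)"
begin

lemma swap: "pushout S X2 X1 Z a2 a1 j2 j1"
proof
  show "plot Z n U p \<longleftrightarrow> ropen n U \<and> near_each n U (\<lambda>V.
      lifts X2 j2 n V p \<or> lifts X1 j1 n V p)" for n U p
    unfolding plot_Z by (simp only: disj_commute)
  show "\<exists>y. plot S n V y \<and> (\<forall>v\<in>V. q1 v = a2 (y v) \<and> q2 v = a1 (y v))"
    if q: "plot X2 n V q1" "plot X1 n V q2" and e: "\<And>v. v \<in> V \<Longrightarrow> j2 (q1 v) = j1 (q2 v)" for n V q1 q2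
    using overlap[OF q(2,1) e[symmetric]] by (simp only: conj_commute)
qed (use S X1 X2 a1 a2 inj1 inj2 dspace_Z comm same_forms in \<open>simp_all add: Un_commute\<close>)

lemma point_overlap:
  assumes "x1 \<in> dspace X1" "x2 \<in> dspace X2" "j1 x1 = j2 x2"
  obtains y where "y \<in> dspace S" "x1 = a1 y" "x2 = a2 y"
proof -
  let ?E = "topspace (Euclidean_space 0)"
  have E: "ropen 0 ?E" by simp
  have 0: "(0::rvec) \<in> ?E" by (simp add: topspace_Euclidean_space)
  from overlap[OF plot_const[OF X1 E assms(1)] plot_const[OF X2 E assms(2)] assms(3)]
  obtain y where y: "plot S 0 ?E y" "\<forall>v\<in>?E. x1 = a1 (y v) \<and> x2 = a2 (y v)" by (elim exE conjE) (rule that)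
  show ?thesis by (rule that[OF plot_in[OF S y(1) 0]]) (use bspec[OF y(2) 0] in simp_all)
qed

subsection \<open>The diffeology of the pushout\<close>

lemma lift_cases [consumes 2]:
  assumes p: "plot Z n U p" and u: "u \<in> U"
  obtains (left) V q where "ropen n V" "u \<in> V" "V \<subseteq> U" "plot X1 n V q" "\<And>v. v \<in> V \<Longrightarrow> p v = j1 (q v)"
    | (right) V q where "ropen n V" "u \<in> V" "V \<subseteq> U" "plot X2 n V q" "\<And>v. v \<in> V \<Longrightarrow> p v = j2 (q v)"
proof -
  have "near_each n U (\<lambda>V. lifts X1 j1 n V p \<or> lifts X2 j2 n V p)"
    using p unfolding plot_Z by (rule conjunct2)
  from bspec[OF this[unfolded near_each_def] u]
  obtain V where V: "ropen n V" "u \<in> V" "V \<subseteq> U"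
    "lifts X1 j1 n V p \<or> lifts X2 j2 n V p"
    by (elim exE conjE) (rule that)
  from V(4) show ?thesis
  proof (elim disjE exE conjE)
    fix q assume "plot X1 n V q" "\<forall>v\<in>V. p v = j1 (q v)"
    then show ?thesis using left[OF V(1-3)] by blast
  next
    fix q assume "plot X2 n V q" "\<forall>v\<in>V. p v = j2 (q v)"
    then show ?thesis using right[OF V(1-3)] by blast
  qed
qed

lemma diffeological_Z: "diffeological_space Z"
proof (rule diffeological_spaceI)
  let ?L = "\<lambda>n p V. lifts X1 j1 n V p \<or> lifts X2 j2 n V p"
  fix n U p
  show "ropen n U" if "plot Z n U p" using that unfolding plot_Z by (rule conjunct1)
  show "p u \<in> dspace Z" if p: "plot Z n U p" and u: "u \<in> U" for u
    using p u
  proof (cases rule: lift_cases)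
    case (left V q)
    then show ?thesis using plot_in[OF X1 left(4,2)] left(5)[OF left(2)] dspace_Z by simp
  next
    case (right V q)
    then show ?thesis using plot_in[OF X2 right(4,2)] right(5)[OF right(2)] dspace_Z by simp
  qed
  show "plot Z n U q" if p: "plot Z n U p" and e: "\<And>u. u \<in> U \<Longrightarrow> p u = q u" for q
  proof -
    have "near_each n U (?L n p)" using p unfolding plot_Z by (rule conjunct2)
    then have "near_each n U (?L n q)"
      by (rule near_each_mono) (use e in \<open>simp add: subset_iff\<close>)
    then show ?thesis using p unfolding plot_Z by blast
  qed
  show "plot Z m W (p \<circ> F)" if p: "plot Z n U p" and W: "ropen m W" and F: "smooth_map m W n U F" for m W F
    unfolding plot_Z
  proof (intro conjI W)
    have "near_each n U (?L n p)" using p unfolding plot_Z by (rule conjunct2)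
    then show "near_each m W (?L m (p \<circ> F))"
    proof (rule near_each_pullback[OF _ F W])
      fix V W' assume V: "?L n p V" and W': "ropen m W'" "F ` W' \<subseteq> V" and FV: "smooth_map m W' n V F"
      from V show "?L m (p \<circ> F) W'"
      proof (elim disjE exE conjE)
        fix q assume "plot X1 n V q" "\<forall>v\<in>V. p v = j1 (q v)"
        then show ?thesis using plot_comp[OF X1 _ W'(1) FV] W'(2)
          by (intro disjI1 exI[of _ "q \<circ> F"]) (simp add: image_subset_iff)
      next
        fix q assume "plot X2 n V q" "\<forall>v\<in>V. p v = j2 (q v)"
        then show ?thesis using plot_comp[OF X2 _ W'(1) FV] W'(2)
          by (intro disjI2 exI[of _ "q \<circ> F"]) (simp add: image_subset_iff)
      qed
    qed
  qed
  show "plot Z n U p" if U: "ropen n U" and near: "near_each n U (\<lambda>V. plot Z n V p)"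
    unfolding plot_Z
  proof (intro conjI U near_each_bind[OF near])
    fix V assume "plot Z n V p"
    then show "near_each n V (?L n p)" unfolding plot_Z by (rule conjunct2)
  qed
  show "plot Z n U (\<lambda>_. z)" if U: "ropen n U" and z: "z \<in> dspace Z" for z
    unfolding plot_Z
  proof (intro conjI U near_each_self)
    from z have "(\<exists>x\<in>dspace X1. z = j1 x) \<or> (\<exists>x\<in>dspace X2. z = j2 x)" unfolding dspace_Z by blast
    then show "?L n (\<lambda>_. z) U"
      using plot_const[OF X1 U] plot_const[OF X2 U] by blast
  qed
qed

lemma j1: "dsmooth X1 Z j1"
  unfolding dsmooth_def
proof (intro conjI allI impI)
  fix n U p assume p: "plot X1 n U p"
  show "plot Z n U (j1 \<circ> p)" unfolding plot_Z
    using p by (intro conjI near_each_self plot_open[OF X1 p] disjI1 exI[of _ p]) simp_all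
qed (use dspace_Z in blast)

subsection \<open>Extending forms across the overlap\<close>

text \<open>Equality of the two diffeologies says something about a single form only through a nonconstant family: all
constant families are plots of both. The family \<open>t \<mapsto> t \<omega>\<close> is a plot of the first, hence of the second
diffeology. Near \<open>t = 1\<close> it is either a family of pullbacks from \<open>X2\<close>, or constant, and then the restriction of \<open>\<omega>\<close> is zero.\<close>

lemma matching_form:
  assumes w: "\<omega> \<in> one_forms X1"
  obtains \<omega>2 where "\<omega>2 \<in> one_forms X2" "form_pullback S a2 \<omega>2 = form_pullback S a1 \<omega>"
proof -
  let ?E = "topspace (Euclidean_space 1)"
  define r where "r t = form_scale (t 0) \<omega>" for t :: rvec
  have E: "ropen 1 ?E" by simp
  have r: "form_plot X1 1 ?E r"
  proof (rule form_plotI[OF E])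
    fix m U' q i assume q: "plot X1 m U' q" and i: "i < m"
    have P: "ropen (1 + m) (prod_dom 1 ?E m U')" using E plot_open[OF X1 q] by (rule ropen_prod_dom)
    have c: "smooth_fun (1 + m) (prod_dom 1 ?E m U') (\<lambda>w. proj1 1 w 0)"
      by (simp add: proj1_def smooth_fun_coord)
    show "smooth_fun (1 + m) (prod_dom 1 ?E m U') (\<lambda>w. r (proj1 1 w) m U' q (proj2 1 w) i)"
      using smooth_fun_mult[OF P c form_plotD(3)[OF form_plot_const[OF X1 w E] q i]] by (simp add: r_def)
  qed (simp add: r_def one_forms_scale[OF X1 w])
  define e0 :: rvec where "e0 = (\<lambda>i. if i = 0 then 1 else 0)"
  have e0: "e0 \<in> ?E" by (simp add: topspace_Euclidean_space e0_def)
  have re0: "r e0 = \<omega>" by (simp add: r_def e0_def form_scale_def)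
  have "plot (pushforward_diffeology (one_forms_diffeology X1) (form_pullback S a1) (one_forms S)) 1 ?E
      (\<lambda>t. form_pullback S a1 (r t))"
    unfolding pushforward_diffeology_def diffeology.simps
  proof (intro conjI E near_each_self[OF E] disjI2 exI[of _ r] ballI r HOL.refl image_subsetI)
    fix t assume "t \<in> ?E"
    then show "form_pullback S a1 (r t) \<in> one_forms S" by (intro form_pullback_in[OF a1 _ S] form_plotD(2)[OF r])
  qed
  then have "near_each 1 ?E (\<lambda>V. (\<exists>b. \<forall>v\<in>V. form_pullback S a1 (r v) = b) \<or>
      (\<exists>q. form_plot X2 1 V q \<and> (\<forall>v\<in>V. form_pullback S a1 (r v) = form_pullback S a2 (q v))))"
    unfolding same_forms unfolding pushforward_diffeology_def diffeology.simps by blast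
  from bspec[OF this[unfolded near_each_def] e0]
  obtain V where V: "ropen 1 V" "e0 \<in> V" "(\<exists>b. \<forall>v\<in>V. form_pullback S a1 (r v) = b) \<or>
      (\<exists>q. form_plot X2 1 V q \<and> (\<forall>v\<in>V. form_pullback S a1 (r v) = form_pullback S a2 (q v)))"
    by (elim exE conjE) (rule that)
  from V(3) show ?thesis
  proof (elim disjE exE conjE)
    fix b assume b: "\<forall>v\<in>V. form_pullback S a1 (r v) = b"
    obtain e where e: "0 < e" "\<And>v. (\<And>i. i < 1 \<Longrightarrow> \<bar>v i - e0 i\<bar> < e) \<Longrightarrow> (\<And>i. i \<ge> 1 \<Longrightarrow> v i = 0) \<Longrightarrow> v \<in> V"
      using ropen_box[OF V(1,2)] by metis
    \<comment> \<open>a second parameter at which the family has the same value\<close>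
    let ?v = "\<lambda>i. if i = 0 then 1 + e / 2 else (0::real)"
    have "?v \<in> V" by (rule e(2)) (use e(1) in \<open>simp_all add: e0_def\<close>)
    then have "form_pullback S a1 (r ?v) = form_pullback S a1 (r e0)" using b V(2) by simp
    then have "form_scale (1 + e / 2) (form_pullback S a1 \<omega>) = form_pullback S a1 \<omega>"
      unfolding re0 by (simp add: r_def form_pullback_scale)
    then have "(1 + e / 2) * form_pullback S a1 \<omega> n U p u i = form_pullback S a1 \<omega> n U p u i" for n U p u i
      by (metis form_scale_apply)
    then have "e / 2 * form_pullback S a1 \<omega> n U p u i = 0" for n U p u i by (simp add: algebra_simps)
    then have "form_pullback S a1 \<omega> = form_pullback S a2 0"
      using e(1) by (simp add: form_pullback_def fun_eq_iff)
    then show ?thesis using that[OF one_forms_zero] by simp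
  next
    fix q assume q: "form_plot X2 1 V q" "\<forall>v\<in>V. form_pullback S a1 (r v) = form_pullback S a2 (q v)"
    show ?thesis using that[OF form_plotD(2)[OF q(1) V(2)]] bspec[OF q(2) V(2)] re0 by simp
  qed
qed

lemma matching_form_plot:
  assumes r: "form_plot X1 n U r"
  shows "near_each n U (\<lambda>V. \<exists>r2. form_plot X2 n V r2 \<and> (\<forall>v\<in>V. form_pullback S a1 (r v) = form_pullback S a2 (r2 v)))"
proof -
  have U: "ropen n U" by (rule form_plotD(1)[OF r])
  have "plot (pushforward_diffeology (one_forms_diffeology X1) (form_pullback S a1) (one_forms S)) n U
      (\<lambda>t. form_pullback S a1 (r t))"
    unfolding pushforward_diffeology_def diffeology.simps
  proof (intro conjI U near_each_self[OF U] disjI2 exI[of _ r] ballI r HOL.refl image_subsetI)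
    fix t assume "t \<in> U"
    then show "form_pullback S a1 (r t) \<in> one_forms S" by (intro form_pullback_in[OF a1 _ S] form_plotD(2)[OF r])
  qed
  then have "near_each n U (\<lambda>V. (\<exists>b. \<forall>v\<in>V. form_pullback S a1 (r v) = b) \<or>
      (\<exists>q. form_plot X2 n V q \<and> (\<forall>v\<in>V. form_pullback S a1 (r v) = form_pullback S a2 (q v))))"
    unfolding same_forms unfolding pushforward_diffeology_def diffeology.simps by blast
  then show ?thesis
  proof (rule near_each_mono)
    fix V assume V: "ropen n V" "V \<subseteq> U" and c: "(\<exists>b. \<forall>v\<in>V. form_pullback S a1 (r v) = b) \<or>
      (\<exists>q. form_plot X2 n V q \<and> (\<forall>v\<in>V. form_pullback S a1 (r v) = form_pullback S a2 (q v)))"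
    show "\<exists>r2. form_plot X2 n V r2 \<and> (\<forall>v\<in>V. form_pullback S a1 (r v) = form_pullback S a2 (r2 v))"
    proof (cases "\<exists>b. \<forall>v\<in>V. form_pullback S a1 (r v) = b")
      case True
      then obtain b where b: "\<And>v. v \<in> V \<Longrightarrow> form_pullback S a1 (r v) = b" by blast
      show ?thesis
      proof (cases "V = {}")
        case True
        then show ?thesis using form_plot_const[OF X2 one_forms_zero V(1)] by blast
      next
        case False
        then obtain v where v: "v \<in> V" by blast
        obtain \<omega>2 where w: "\<omega>2 \<in> one_forms X2" "form_pullback S a2 \<omega>2 = form_pullback S a1 (r v)"
          by (rule matching_form[OF form_plotD(2)[OF r subsetD[OF V(2) v]]])
        show ?thesis using form_plot_const[OF X2 w(1) V(1)] w(2) b[OF v] b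
          by (intro exI[of _ "\<lambda>_. \<omega>2"]) simp
      qed
    qed (use c in blast)
  qed
qed

subsection \<open>Gluing forms\<close>

text \<open>\<open>c\<close> is the value at \<open>u\<close> of the form that equals \<open>\<omega>1\<close> on plots through \<open>X1\<close> and \<open>\<omega>2\<close> on plots through \<open>X2\<close>, read off
from some local lift of \<open>p\<close>.\<close>

definition lift_value :: "'a form \<Rightarrow> 'b form \<Rightarrow> nat \<Rightarrow> rvec set \<Rightarrow> (rvec \<Rightarrow> 'c) \<Rightarrow> rvec \<Rightarrow> rvec \<Rightarrow> bool" where
  "lift_value \<omega>1 \<omega>2 n U p u c \<longleftrightarrow> (\<exists>V. ropen n V \<and> u \<in> V \<and> V \<subseteq> U \<and>
     ((\<exists>q. plot X1 n V q \<and> (\<forall>v\<in>V. p v = j1 (q v)) \<and> c = \<omega>1 n V q u) \<or>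
      (\<exists>q. plot X2 n V q \<and> (\<forall>v\<in>V. p v = j2 (q v)) \<and> c = \<omega>2 n V q u)))"

definition glue_form :: "'a form \<Rightarrow> 'b form \<Rightarrow> 'c form" where
  "glue_form \<omega>1 \<omega>2 n U p u i =
     (if plot Z n U p \<and> u \<in> U \<and> i < n then (SOME c. lift_value \<omega>1 \<omega>2 n U p u c) i else 0)"

context
  fixes \<omega>1 :: "'a form" and \<omega>2 :: "'b form"
  assumes w1: "\<omega>1 \<in> one_forms X1" and w2: "\<omega>2 \<in> one_forms X2"
    and match: "form_pullback S a1 \<omega>1 = form_pullback S a2 \<omega>2"
begin

lemma lift_unique_same:
  assumes "ropen n V" "u \<in> V" "plot X n V q" and "ropen n V'" "u \<in> V'" "plot X n V' q'"
    and e: "\<And>v. v \<in> V \<Longrightarrow> v \<in> V' \<Longrightarrow> q v = q' v" and X: "diffeological_space X" and w: "\<omega> \<in> one_forms X"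
  shows "\<omega> n V q u = \<omega> n V' q' u"
proof -
  have W: "ropen n (V \<inter> V')" using assms(1,4) by (rule openin_Int)
  have "\<omega> n V q u = \<omega> n (V \<inter> V') q u"
    by (rule form_restrict[OF X w assms(3) W, symmetric]) (use assms in auto)
  also have "\<dots> = \<omega> n (V \<inter> V') q' u"
    by (rule fun_cong[OF form_cong[OF w plot_restrict[OF X assms(3) W]]]) (use e in auto)
  also have "\<dots> = \<omega> n V' q' u"
    by (rule form_restrict[OF X w assms(6) W]) (use assms in auto)
  finally show ?thesis .
qed

text \<open>A plot with lifts to both sides comes from a plot of the overlap, where the two forms have the same pullback.\<close>

lemma lift_unique_mixed:
  assumes V: "ropen n V" "u \<in> V" "plot X1 n V q" and V': "ropen n V'" "u \<in> V'" "plot X2 n V' q'"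
    and e: "\<And>v. v \<in> V \<Longrightarrow> v \<in> V' \<Longrightarrow> j1 (q v) = j2 (q' v)"
  shows "\<omega>1 n V q u = \<omega>2 n V' q' u"
proof -
  let ?W = "V \<inter> V'"
  have W: "ropen n ?W" "u \<in> ?W" using assms by (auto intro: openin_Int)
  have q: "plot X1 n ?W q" "plot X2 n ?W q'"
    by (rule plot_restrict[OF X1 V(3) W(1)], simp) (rule plot_restrict[OF X2 V'(3) W(1)], simp)
  obtain y where y: "plot S n ?W y" "\<And>v. v \<in> ?W \<Longrightarrow> q v = a1 (y v) \<and> q' v = a2 (y v)"
    using overlap[OF q] e by blast
  have "\<omega>1 n V q u = \<omega>1 n ?W q u" by (rule form_restrict[OF X1 w1 V(3) W(1) _ W(2), symmetric]) simp
  also have "\<dots> = \<omega>1 n ?W (a1 \<circ> y) u" using y(2) by (intro fun_cong[OF form_cong[OF w1 q(1)]]) simp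
  also have "\<dots> = form_pullback S a1 \<omega>1 n ?W y u" using y(1) by (simp add: form_pullback_def)
  also have "\<dots> = form_pullback S a2 \<omega>2 n ?W y u" unfolding match ..
  also have "\<dots> = \<omega>2 n ?W (a2 \<circ> y) u" using y(1) by (simp add: form_pullback_def)
  also have "\<dots> = \<omega>2 n ?W q' u" using y(2) by (intro fun_cong[OF form_cong[OF w2 q(2), symmetric]]) simp
  also have "\<dots> = \<omega>2 n V' q' u" by (rule form_restrict[OF X2 w2 V'(3) W(1) _ W(2)]) simp
  finally show ?thesis .
qed

lemma lift_value_unique:
  assumes "lift_value \<omega>1 \<omega>2 n U p u c" "lift_value \<omega>1 \<omega>2 n U p u c'"
  shows "c = c'"
proof -
  obtain V where V: "ropen n V" "u \<in> V" and cV: "(\<exists>q. plot X1 n V q \<and> (\<forall>v\<in>V. p v = j1 (q v)) \<and> c = \<omega>1 n V q u) \<or>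
      (\<exists>q. plot X2 n V q \<and> (\<forall>v\<in>V. p v = j2 (q v)) \<and> c = \<omega>2 n V q u)"
    using assms(1) unfolding lift_value_def by blast
  obtain V' where V': "ropen n V'" "u \<in> V'" and cV': "(\<exists>q. plot X1 n V' q \<and> (\<forall>v\<in>V'. p v = j1 (q v)) \<and> c' = \<omega>1 n V' q u) \<or>
      (\<exists>q. plot X2 n V' q \<and> (\<forall>v\<in>V'. p v = j2 (q v)) \<and> c' = \<omega>2 n V' q u)"
    using assms(2) unfolding lift_value_def by blast
  from cV cV' show ?thesis
  proof (elim disjE exE conjE)
    fix q q' assume q: "plot X1 n V q" "\<forall>v\<in>V. p v = j1 (q v)" "c = \<omega>1 n V q u"
      and q': "plot X1 n V' q'" "\<forall>v\<in>V'. p v = j1 (q' v)" "c' = \<omega>1 n V' q' u"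
    have "q v = q' v" if "v \<in> V" "v \<in> V'" for v
      by (rule inj_onD[OF inj1 _ plot_in[OF X1 q(1) that(1)] plot_in[OF X1 q'(1) that(2)]])
        (use bspec[OF q(2) that(1)] bspec[OF q'(2) that(2)] in simp)
    then show ?thesis unfolding q(3) q'(3) by (rule lift_unique_same[OF V q(1) V' q'(1) _ X1 w1])
  next
    fix q q' assume q: "plot X2 n V q" "\<forall>v\<in>V. p v = j2 (q v)" "c = \<omega>2 n V q u"
      and q': "plot X2 n V' q'" "\<forall>v\<in>V'. p v = j2 (q' v)" "c' = \<omega>2 n V' q' u"
    have "q v = q' v" if "v \<in> V" "v \<in> V'" for v
      by (rule inj_onD[OF inj2 _ plot_in[OF X2 q(1) that(1)] plot_in[OF X2 q'(1) that(2)]])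
        (use bspec[OF q(2) that(1)] bspec[OF q'(2) that(2)] in simp)
    then show ?thesis unfolding q(3) q'(3) by (rule lift_unique_same[OF V q(1) V' q'(1) _ X2 w2])
  next
    fix q q' assume q: "plot X1 n V q" "\<forall>v\<in>V. p v = j1 (q v)" "c = \<omega>1 n V q u"
      and q': "plot X2 n V' q'" "\<forall>v\<in>V'. p v = j2 (q' v)" "c' = \<omega>2 n V' q' u"
    show ?thesis unfolding q(3) q'(3)
      by (rule lift_unique_mixed[OF V q(1) V' q'(1)]) (use q(2) q'(2) in force)
  next
    fix q q' assume q: "plot X2 n V q" "\<forall>v\<in>V. p v = j2 (q v)" "c = \<omega>2 n V q u"
      and q': "plot X1 n V' q'" "\<forall>v\<in>V'. p v = j1 (q' v)" "c' = \<omega>1 n V' q' u"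
    show ?thesis unfolding q(3) q'(3)
      by (rule lift_unique_mixed[OF V' q'(1) V q(1), symmetric]) (use q(2) q'(2) in force)
  qed
qed

lemma glue_form_eqI:
  assumes p: "plot Z n U p" and v: "lift_value \<omega>1 \<omega>2 n U p u c" and z: "\<And>i. \<not> i < n \<Longrightarrow> c i = 0"
  shows "glue_form \<omega>1 \<omega>2 n U p u = c"
proof
  fix i
  have u: "u \<in> U" using v unfolding lift_value_def by blast
  have "(SOME c. lift_value \<omega>1 \<omega>2 n U p u c) = c"
    using someI[of "lift_value \<omega>1 \<omega>2 n U p u", OF v] v by (rule lift_value_unique)
  then show "glue_form \<omega>1 \<omega>2 n U p u i = c i" using p u z[of i] by (simp add: glue_form_def)
qed

lemma glue_form_left:
  assumes p: "plot Z n U p" and V: "ropen n V" "u \<in> V" "V \<subseteq> U" and q: "plot X1 n V q" "\<And>v. v \<in> V \<Longrightarrow> p v = j1 (q v)"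
  shows "glue_form \<omega>1 \<omega>2 n U p u = \<omega>1 n V q u"
proof (rule glue_form_eqI[OF p])
  show "lift_value \<omega>1 \<omega>2 n U p u (\<omega>1 n V q u)" unfolding lift_value_def using V q by blast
qed (simp add: form_zero[OF w1])

lemma glue_form_right:
  assumes p: "plot Z n U p" and V: "ropen n V" "u \<in> V" "V \<subseteq> U" and q: "plot X2 n V q" "\<And>v. v \<in> V \<Longrightarrow> p v = j2 (q v)"
  shows "glue_form \<omega>1 \<omega>2 n U p u = \<omega>2 n V q u"
proof (rule glue_form_eqI[OF p])
  show "lift_value \<omega>1 \<omega>2 n U p u (\<omega>2 n V q u)" unfolding lift_value_def using V q by blast
qed (simp add: form_zero[OF w2])

lemma glue_form_in: "glue_form \<omega>1 \<omega>2 \<in> one_forms Z"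
proof (rule one_formsI)
  show "glue_form \<omega>1 \<omega>2 n U p u i = 0" if "\<not> (plot Z n U p \<and> u \<in> U \<and> i < n)" for n U p u i
    using that by (auto simp: glue_form_def)
next
  fix n U and p p' :: "rvec \<Rightarrow> 'c" assume p: "plot Z n U p" and e: "\<And>u. u \<in> U \<Longrightarrow> p u = p' u"
  have p': "plot Z n U p'" by (rule plot_cong[OF diffeological_Z p e])
  show "glue_form \<omega>1 \<omega>2 n U p = glue_form \<omega>1 \<omega>2 n U p'"
  proof
    fix u show "glue_form \<omega>1 \<omega>2 n U p u = glue_form \<omega>1 \<omega>2 n U p' u"
    proof (cases "u \<in> U")
      case True
      from p True show ?thesis
      proof (cases rule: lift_cases)
        case (left V q)
        have "p' v = j1 (q v)" if "v \<in> V" for v using left(5)[OF that] e[OF subsetD[OF left(3) that]] by simp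
        then show ?thesis using glue_form_left[OF p left] glue_form_left[OF p' left(1-4)] by simp
      next
        case (right V q)
        have "p' v = j2 (q v)" if "v \<in> V" for v using right(5)[OF that] e[OF subsetD[OF right(3) that]] by simp
        then show ?thesis using glue_form_right[OF p right] glue_form_right[OF p' right(1-4)] by simp
      qed
    qed (simp add: glue_form_def fun_eq_iff)
  qed
next
  fix n U i and p :: "rvec \<Rightarrow> 'c" assume p: "plot Z n U p" and i: "i < n"
  show "smooth_fun n U (\<lambda>u. glue_form \<omega>1 \<omega>2 n U p u i)"
  proof (rule smooth_fun_local[OF plot_open[OF diffeological_Z p]], unfold near_each_def, rule ballI)
    fix u assume u: "u \<in> U"
    from p u show "\<exists>V. ropen n V \<and> u \<in> V \<and> V \<subseteq> U \<and> smooth_fun n V (\<lambda>u. glue_form \<omega>1 \<omega>2 n U p u i)"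
    proof (cases rule: lift_cases)
      case (left V q)
      have "smooth_fun n V (\<lambda>u. glue_form \<omega>1 \<omega>2 n U p u i)"
        by (rule smooth_fun_cong[OF left(1) _ form_smooth[OF w1 left(4) i]])
          (simp add: glue_form_left[OF p left(1) _ left(3-5)])
      then show ?thesis using left(1-3) by blast
    next
      case (right V q)
      have "smooth_fun n V (\<lambda>u. glue_form \<omega>1 \<omega>2 n U p u i)"
        by (rule smooth_fun_cong[OF right(1) _ form_smooth[OF w2 right(4) i]])
          (simp add: glue_form_right[OF p right(1) _ right(3-5)])
      then show ?thesis using right(1-3) by blast
    qed
  qed
next
  fix n U p m W F w i
  assume p: "plot Z n U p" and W: "ropen m W" and F: "smooth_map m W n U F" and w: "w \<in> W" and i: "i < m"
  have pF: "plot Z m W (p \<circ> F)" by (rule plot_comp[OF diffeological_Z p W F])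
  have Fw: "F w \<in> U" using F w by (auto simp: smooth_map_def)
  from p Fw show "glue_form \<omega>1 \<omega>2 m W (p \<circ> F) w i = (\<Sum>k<n. glue_form \<omega>1 \<omega>2 n U p (F w) k * pdiff i (\<lambda>v. F v k) w)"
  proof (cases rule: lift_cases)
    case (left V q)
    let ?W = "{w \<in> W. F w \<in> V}"
    have W': "ropen m ?W" "w \<in> ?W" "?W \<subseteq> W" using smooth_map_preimage[OF F W left(1)] w left(2) by auto
    have FV: "smooth_map m ?W n V F" by (rule smooth_map_restrict[OF F left(3) W'(3)]) blast
    have "glue_form \<omega>1 \<omega>2 m W (p \<circ> F) w = \<omega>1 m ?W (q \<circ> F) w"
      by (rule glue_form_left[OF pF W' plot_comp[OF X1 left(4) W'(1) FV]]) (simp add: left(5))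
    then show ?thesis using form_comp[OF w1 left(4) W'(1) FV W'(2) i] glue_form_left[OF p left] by simp
  next
    case (right V q)
    let ?W = "{w \<in> W. F w \<in> V}"
    have W': "ropen m ?W" "w \<in> ?W" "?W \<subseteq> W" using smooth_map_preimage[OF F W right(1)] w right(2) by auto
    have FV: "smooth_map m ?W n V F" by (rule smooth_map_restrict[OF F right(3) W'(3)]) blast
    have "glue_form \<omega>1 \<omega>2 m W (p \<circ> F) w = \<omega>2 m ?W (q \<circ> F) w"
      by (rule glue_form_right[OF pF W' plot_comp[OF X2 right(4) W'(1) FV]]) (simp add: right(5))
    then show ?thesis using form_comp[OF w2 right(4) W'(1) FV W'(2) i] glue_form_right[OF p right] by simp
  qed
qed

lemma pullback_glue_form: "form_pullback X1 j1 (glue_form \<omega>1 \<omega>2) = \<omega>1"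
proof (intro ext)
  fix n U p u i
  show "form_pullback X1 j1 (glue_form \<omega>1 \<omega>2) n U p u i = \<omega>1 n U p u i"
  proof (cases "plot X1 n U p \<and> u \<in> U")
    case True
    then have p: "plot X1 n U p" and u: "u \<in> U" by blast+
    have "glue_form \<omega>1 \<omega>2 n U (j1 \<circ> p) u = \<omega>1 n U p u"
      by (rule glue_form_left[OF dsmooth_plot[OF j1 p] plot_open[OF X1 p] u subset_refl p]) simp
    then show ?thesis using True by (simp add: form_pullback_def)
  next
    case False
    then have "\<omega>1 n U p u i = 0" by (intro form_zero[OF w1]) blast
    moreover have "form_pullback X1 j1 (glue_form \<omega>1 \<omega>2) n U p u i = 0"
      using False by (auto simp: form_pullback_def glue_form_def)
    ultimately show ?thesis by simp
  qed
qed

end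

lemma form_plot_glue:
  assumes r1: "form_plot X1 n U r1" and r2: "form_plot X2 n U r2"
    and match: "\<And>u. u \<in> U \<Longrightarrow> form_pullback S a1 (r1 u) = form_pullback S a2 (r2 u)"
  shows "form_plot Z n U (\<lambda>u. glue_form (r1 u) (r2 u))"
proof (rule form_plotI[OF form_plotD(1)[OF r1]])
  fix u assume "u \<in> U" then show "glue_form (r1 u) (r2 u) \<in> one_forms Z"
    by (intro glue_form_in form_plotD(2)[OF r1] form_plotD(2)[OF r2] match)
next
  fix m U' q i assume q: "plot Z m U' q" and i: "i < m"
  let ?P = "prod_dom n U m U'" and ?h = "\<lambda>w. glue_form (r1 (proj1 n w)) (r2 (proj1 n w)) m U' q (proj2 n w) i"
  have U': "ropen m U'" by (rule plot_open[OF diffeological_Z q])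
  have P: "ropen (n + m) ?P" by (rule ropen_prod_dom[OF form_plotD(1)[OF r1] U'])
  have near: "near_each m U' (\<lambda>V. lifts X1 j1 m V q \<or> lifts X2 j2 m V q)"
    using q unfolding plot_Z by (rule conjunct2)
  show "smooth_fun (n + m) ?P ?h"
  proof (rule smooth_fun_local[OF P], rule near_each_pullback[OF near smooth_map_proj2[OF U' subset_refl] P])
    fix V W assume V: "ropen m V" "V \<subseteq> U'" and W: "ropen (n + m) W" "W \<subseteq> ?P" "proj2 n ` W \<subseteq> V"
      and c: "lifts X1 j1 m V q \<or> lifts X2 j2 m V q"
    have pU: "proj1 n w \<in> U" "proj2 n w \<in> V" "w \<in> prod_dom n U m V" if "w \<in> W" for w
      using W(2,3) that by (auto simp: prod_dom_def)
    have WV: "W \<subseteq> prod_dom n U m V" using pU(3) by blast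
    from c show "smooth_fun (n + m) W ?h"
    proof (elim disjE exE conjE)
      fix q1 assume q1: "plot X1 m V q1" "\<forall>v\<in>V. q v = j1 (q1 v)"
      have "r1 (proj1 n w) m V q1 (proj2 n w) i = ?h w" if "w \<in> W" for w
        using glue_form_left[OF form_plotD(2)[OF r1 pU(1)[OF that]] form_plotD(2)[OF r2 pU(1)[OF that]] match[OF pU(1)[OF that]] q V(1) pU(2)[OF that] V(2) q1(1)] q1(2) by simp
      then show ?thesis by (rule smooth_fun_cong[OF W(1) _ smooth_fun_mono[OF form_plotD(3)[OF r1 q1(1) i] WV]])
    next
      fix q1 assume q1: "plot X2 m V q1" "\<forall>v\<in>V. q v = j2 (q1 v)"
      have "r2 (proj1 n w) m V q1 (proj2 n w) i = ?h w" if "w \<in> W" for w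
        using glue_form_right[OF form_plotD(2)[OF r1 pU(1)[OF that]] form_plotD(2)[OF r2 pU(1)[OF that]] match[OF pU(1)[OF that]] q V(1) pU(2)[OF that] V(2) q1(1)] q1(2) by simp
      then show ?thesis by (rule smooth_fun_cong[OF W(1) _ smooth_fun_mono[OF form_plotD(3)[OF r2 q1(1) i] WV]])
    qed
  qed
qed

lemma lift_form_plot:
  assumes r: "form_plot X1 n U r"
  shows "near_each n U (\<lambda>V. \<exists>r'. form_plot Z n V r' \<and> (\<forall>v\<in>V. form_pullback X1 j1 (r' v) = r v))"
proof (rule near_each_mono[OF matching_form_plot[OF r]])
  fix V assume V: "ropen n V" "V \<subseteq> U" and "\<exists>r2. form_plot X2 n V r2 \<and> (\<forall>v\<in>V. form_pullback S a1 (r v) = form_pullback S a2 (r2 v))"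
  then obtain r2 where r2: "form_plot X2 n V r2" "\<And>v. v \<in> V \<Longrightarrow> form_pullback S a1 (r v) = form_pullback S a2 (r2 v)" by blast
  have rV: "form_plot X1 n V r" by (rule form_plot_restrict[OF r V])
  have "form_pullback X1 j1 (glue_form (r v) (r2 v)) = r v" if "v \<in> V" for v
    by (rule pullback_glue_form[OF form_plotD(2)[OF rV that] form_plotD(2)[OF r2(1) that] r2(2)[OF that]])
  then show "\<exists>r'. form_plot Z n V r' \<and> (\<forall>v\<in>V. form_pullback X1 j1 (r' v) = r v)"
    using form_plot_glue[OF rV r2] by blast
qed

subsection \<open>Compatible pseudo-metrics\<close>

text \<open>A value with zero restriction is compatible with \<open>0\<close>, and every value has a compatible partner; so
compatibility makes it a null vector of the metric.\<close>

lemma metric_reflects_vanishing: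
  assumes g1: "pseudo_metric (Lambda1 X1) g1" and g2: "pseudo_metric (Lambda1 X2) g2"
    and compat: "\<And>\<alpha>1 \<alpha>2 \<beta>1 \<beta>2. \<alpha>1 \<in> fibre (Lambda1 X1) (a1 y) \<Longrightarrow> \<alpha>2 \<in> fibre (Lambda1 X2) (a2 y) \<Longrightarrow>
      Lambda_pullback S a1 y \<alpha>1 = Lambda_pullback S a2 y \<alpha>2 \<Longrightarrow>
      \<beta>1 \<in> fibre (Lambda1 X1) (a1 y) \<Longrightarrow> \<beta>2 \<in> fibre (Lambda1 X2) (a2 y) \<Longrightarrow>
      Lambda_pullback S a1 y \<beta>1 = Lambda_pullback S a2 y \<beta>2 \<Longrightarrow> g1 (a1 y) \<alpha>1 \<beta>1 = g2 (a2 y) \<alpha>2 \<beta>2"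
    and y: "y \<in> dspace S" and w: "\<omega> \<in> one_forms X1" and v: "form_pullback S a1 \<omega> \<in> vanishing_forms S y"
  shows "\<omega> \<in> vanishing_forms X1 (a1 y)"
proof -
  have x1: "a1 y \<in> dspace X1" and x2: "a2 y \<in> dspace X2" using dsmooth_in[OF a1 y] dsmooth_in[OF a2 y] .
  have zero: "form_pullback S a2 0 = 0" by (simp add: form_pullback_def fun_eq_iff)
  have pull: "Lambda_pullback S a1 y (form_val X1 (a1 y) \<eta>) = form_val S y (form_pullback S a1 \<eta>)" if "\<eta> \<in> one_forms X1" for \<eta>
    by (rule Lambda_pullback_form_val[OF S X1 a1 that])
  have pull2: "Lambda_pullback S a2 y (form_val X2 (a2 y) \<eta>) = form_val S y (form_pullback S a2 \<eta>)" if "\<eta> \<in> one_forms X2" for \<eta>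
    by (rule Lambda_pullback_form_val[OF S X2 a2 that])
  have "form_val S y (form_pullback S a1 \<omega>) = form_val S y 0"
    by (rule iffD2[OF form_val_eq[OF S form_pullback_in[OF a1 w S] one_forms_zero]]) (use v in \<open>simp only: diff_zero\<close>)
  then have m0: "Lambda_pullback S a1 y (form_val X1 (a1 y) \<omega>) = Lambda_pullback S a2 y (form_val X2 (a2 y) 0)"
    unfolding pull[OF w] pull2[OF one_forms_zero] zero .
  have "form_val X1 (a1 y) \<omega> = form_val X1 (a1 y) 0"
  proof (rule pseudo_metric_nondegenerate[OF X1 g1 x1 form_val_in_fibre[OF x1 w]])
    fix \<beta> assume b: "\<beta> \<in> fibre (Lambda1 X1) (a1 y)"
    then obtain \<eta> where e: "\<eta> \<in> one_forms X1" "\<beta> = form_val X1 (a1 y) \<eta>" unfolding fibre_Lambda1 by blast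
    obtain \<eta>2 where e2: "\<eta>2 \<in> one_forms X2" "form_pullback S a2 \<eta>2 = form_pullback S a1 \<eta>" by (rule matching_form[OF e(1)])
    have f2: "form_val X2 (a2 y) \<eta>2 \<in> fibre (Lambda1 X2) (a2 y)" by (rule form_val_in_fibre[OF x2 e2(1)])
    have "g1 (a1 y) (form_val X1 (a1 y) \<omega>) \<beta> = g2 (a2 y) (form_val X2 (a2 y) 0) (form_val X2 (a2 y) \<eta>2)"
      by (rule compat[OF form_val_in_fibre[OF x1 w] vzero_in_fibre[OF x2] m0 b f2])
        (simp add: e(2) pull[OF e(1)] pull2[OF e2(1)] e2(2))
    also have "\<dots> = 0" by (rule fibre_functional_zero[OF X2 x2 pseudo_metric_linear_left[OF X2 g2 x2 f2]])
    finally show "g1 (a1 y) (form_val X1 (a1 y) \<omega>) \<beta> = 0" .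
  qed
  then have "\<omega> - 0 \<in> vanishing_forms X1 (a1 y)" by (rule iffD1[OF form_val_eq[OF X1 w one_forms_zero]])
  then show ?thesis by (simp only: diff_zero)
qed

text \<open>Plots at \<open>j1 x\<close> may pass through \<open>X2\<close>. On those, a form whose pullback to \<open>X1\<close> vanishes is controlled by its
restriction to the overlap, and the assumption on the second leg brings this back to \<open>X2\<close>.\<close>

lemma leg_embedding:
  assumes refl2: "\<And>y \<omega>. y \<in> dspace S \<Longrightarrow> \<omega> \<in> one_forms X2 \<Longrightarrow> form_pullback S a2 \<omega> \<in> vanishing_forms S y \<Longrightarrow>
    \<omega> \<in> vanishing_forms X2 (a2 y)"
  shows "form_embedding X1 Z j1"
proof
  show "diffeological_space X1" "diffeological_space Z" "dsmooth X1 Z j1" "inj_on j1 (dspace X1)"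
    by (rule X1 diffeological_Z j1 inj1)+
  show "near_each n U (\<lambda>V. \<exists>r'. form_plot Z n V r' \<and> (\<forall>v\<in>V. form_pullback X1 j1 (r' v) = r v))"
    if "form_plot X1 n U r" for n U r
    by (rule lift_form_plot[OF that])
  have j2: "dsmooth X2 Z j2" by (rule pushout.j1[OF swap])
  fix \<omega> x assume w: "\<omega> \<in> one_forms Z" and x: "x \<in> dspace X1" and v: "form_pullback X1 j1 \<omega> \<in> vanishing_forms X1 x"
  have "\<omega> n U p 0 = 0" if p: "plot Z n U p" "0 \<in> U" "p 0 = j1 x" for n U p
    using p(1,2)
  proof (cases rule: lift_cases)
    case (left V q)
    have "q 0 = x" using inj_onD[OF inj1 _ plot_in[OF X1 left(4,2)] x] left(5)[OF left(2)] p(3) by simp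
    then have "form_pullback X1 j1 \<omega> n V q 0 = 0" using v left(2,4) unfolding vanishing_forms_def by blast
    then have "\<omega> n V (j1 \<circ> q) 0 = 0" using left(4) by (simp add: form_pullback_def)
    moreover have "\<omega> n V p = \<omega> n V (j1 \<circ> q)"
      by (rule form_cong[OF w plot_restrict[OF diffeological_Z p(1) left(1,3)]]) (simp add: left(5))
    ultimately show ?thesis using form_restrict[OF diffeological_Z w p(1) left(1,3,2)] by simp
  next
    case (right V q)
    have q0: "q 0 \<in> dspace X2" by (rule plot_in[OF X2 right(4,2)])
    have "j1 x = j2 (q 0)" using right(5)[OF right(2)] p(3) by simp
    then obtain y where y: "y \<in> dspace S" "x = a1 y" "q 0 = a2 y" by (rule point_overlap[OF x q0])
    have "form_pullback S a1 (form_pullback X1 j1 \<omega>) \<in> vanishing_forms S y"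
      using vanishing_pullback[OF S a1] v unfolding y(2) by blast
    moreover have "form_pullback S a1 (form_pullback X1 j1 \<omega>) = form_pullback S a2 (form_pullback X2 j2 \<omega>)"
    proof -
      have "dsmooth S Z (j1 \<circ> a1)"
        using dsmooth_plot[OF a1] dsmooth_plot[OF j1] dsmooth_in[OF a1] dsmooth_in[OF j1]
        unfolding dsmooth_def comp_assoc image_subset_iff by simp
      from form_pullback_cong[OF S this _ w, of "j2 \<circ> a2"] comm
      show ?thesis unfolding form_pullback_comp[OF a1] form_pullback_comp[OF a2] by simp
    qed
    ultimately have "form_pullback S a2 (form_pullback X2 j2 \<omega>) \<in> vanishing_forms S y" by simp
    then have "form_pullback X2 j2 \<omega> \<in> vanishing_forms X2 (q 0)"
      unfolding y(3) by (rule refl2[OF y(1) form_pullback_in[OF j2 w X2]])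
    then have "form_pullback X2 j2 \<omega> n V q 0 = 0" using right(2,4) unfolding vanishing_forms_def by blast
    then have "\<omega> n V (j2 \<circ> q) 0 = 0" using right(4) by (simp add: form_pullback_def)
    moreover have "\<omega> n V p = \<omega> n V (j2 \<circ> q)"
      by (rule form_cong[OF w plot_restrict[OF diffeological_Z p(1) right(1,3)]]) (simp add: right(5))
    ultimately show ?thesis using form_restrict[OF diffeological_Z w p(1) right(1,3,2)] by simp
  qed
  then show "\<omega> \<in> vanishing_forms Z (j1 x)" using w unfolding vanishing_forms_def by blast
qed

end

section \<open>Restricting tensors to a subspace\<close>

text \<open>On covectors the pullback of values is the restriction of a linear map of function spaces that is injective
on the values at \<open>k y\<close>. A linear left inverse of it induces a linear map between fibres that undoes the
pullback, and hence undoes it on tensors.\<close>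

lemma tensor_pullback_inj:
  fixes S :: "'s diffeology" and Z :: "'c diffeology"
  assumes S: "diffeological_space S" and Z: "diffeological_space Z" and k: "dsmooth S Z k" and y: "y \<in> dspace S"
    and reflect: "\<And>\<omega>. \<omega> \<in> one_forms Z \<Longrightarrow> form_pullback S k \<omega> \<in> vanishing_forms S y \<Longrightarrow> \<omega> \<in> vanishing_forms Z (k y)"
    and t: "\<tau> \<in> fibre (Lambda1_tensor Z) (k y)" "\<sigma> \<in> fibre (Lambda1_tensor Z) (k y)"
    and e: "tensor_map (Lambda1 S) (Lambda1 S) y (Lambda_pullback S k y) (Lambda_pullback S k y) \<tau> =
      tensor_map (Lambda1 S) (Lambda1 S) y (Lambda_pullback S k y) (Lambda_pullback S k y) \<sigma>"
  shows "\<tau> = \<sigma>"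
proof -
  let ?sZ = "cov_scale :: real \<Rightarrow> 'c covector \<Rightarrow> _" and ?sS = "cov_scale :: real \<Rightarrow> 's covector \<Rightarrow> _"
  interpret vector_space_pair ?sZ ?sS
    by unfold_locales (simp_all add: cov_scale_def fun_eq_iff algebra_simps)
  define P :: "'c covector \<Rightarrow> 's covector" where
    "P \<phi> = (\<lambda>n U q i. if plot S n U q \<and> 0 \<in> U \<and> q 0 = y then \<phi> n U (k \<circ> q) i else 0)" for \<phi>
  have P: "Vector_Spaces.linear ?sZ ?sS P"
    by unfold_locales (auto simp: P_def cov_scale_def fun_eq_iff)
  have P_at: "P (form_at Z (k y) \<omega>) = form_at S y (form_pullback S k \<omega>)" for \<omega>
    using dsmooth_plot[OF k] by (auto simp: P_def form_at_def form_pullback_def fun_eq_iff)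
  let ?V = "form_at Z (k y) ` one_forms Z"
  have V: "vs1.subspace ?V"
    unfolding vs1.subspace_def
  proof (intro conjI ballI allI)
    have "form_at Z (k y) 0 = 0" by (simp add: form_at_def fun_eq_iff)
    then show "0 \<in> ?V" using one_forms_zero by (metis image_eqI)
  next
    fix a b assume "a \<in> ?V" "b \<in> ?V"
    then obtain \<omega> \<eta> where "\<omega> \<in> one_forms Z" "\<eta> \<in> one_forms Z" "a = form_at Z (k y) \<omega>" "b = form_at Z (k y) \<eta>" by blast
    then show "a + b \<in> ?V" using one_forms_add[OF Z] form_at_linear(1) by (metis image_eqI)
  next
    fix c a assume "a \<in> ?V"
    then obtain \<omega> where "\<omega> \<in> one_forms Z" "a = form_at Z (k y) \<omega>" by blast
    then show "cov_scale c a \<in> ?V" using one_forms_scale[OF Z] form_at_linear(2) by (metis image_eqI)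
  qed
  have "inj_on P ?V"
  proof (rule inj_onI)
    fix a b assume "a \<in> ?V" "b \<in> ?V" and ab: "P a = P b"
    then obtain \<omega> \<eta> where w: "\<omega> \<in> one_forms Z" "\<eta> \<in> one_forms Z" "a = form_at Z (k y) \<omega>" "b = form_at Z (k y) \<eta>" by blast
    have d: "\<omega> - \<eta> \<in> one_forms Z" by (rule one_forms_diff[OF Z w(1,2)])
    have "form_at S y (form_pullback S k (\<omega> - \<eta>)) = 0"
      using ab unfolding w(3,4) P_at form_pullback_diff form_at_linear(3) by simp
    then have "form_pullback S k (\<omega> - \<eta>) \<in> vanishing_forms S y"
      using form_at_zero_iff[OF form_pullback_in[OF k d S]] by blast
    then have "form_at Z (k y) (\<omega> - \<eta>) = 0" using form_at_zero_iff[OF d] reflect[OF d] by blast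
    then show "a = b" unfolding w(3,4) form_at_linear(3) by simp
  qed
  from linear_exists_left_inverse_on[OF P V this]
  obtain L where L: "L ` UNIV \<subseteq> ?V" "Vector_Spaces.linear ?sS ?sZ L" "\<And>v. v \<in> ?V \<Longrightarrow> L (P v) = v" by blast
  interpret L: Vector_Spaces.linear ?sS ?sZ L by (rule L(2))
  define ret where "ret v = (SOME w. w \<in> fibre (Lambda1 Z) (k y) \<and> covec Z w = L (covec S v))" for v
  have ky: "k y \<in> dspace Z" by (rule dsmooth_in[OF k y])
  have "\<exists>w. w \<in> fibre (Lambda1 Z) (k y) \<and> covec Z w = L (covec S v)" for v
  proof -
    have "L (covec S v) \<in> ?V" using L(1) by blast
    then obtain \<omega> where w: "\<omega> \<in> one_forms Z" "L (covec S v) = form_at Z (k y) \<omega>" by blast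
    then show ?thesis using form_val_in_fibre[OF ky w(1)] covec_form_val[OF w(1)] by metis
  qed
  then have l: "ret v \<in> fibre (Lambda1 Z) (k y) \<and> covec Z (ret v) = L (covec S v)" for v
    unfolding ret_def by (rule someI_ex)
  note l1 = l[THEN conjunct1] and l2 = l[THEN conjunct2]
  have lin: "fibre_linear S y Z (k y) ret"
    unfolding fibre_linear_def
  proof (intro conjI ballI allI l1)
    fix v c assume v: "v \<in> fibre (Lambda1 S) y"
    show "ret (vscale (Lambda1 S) c v) = vscale (Lambda1 Z) c (ret v)"
      by (rule covec_inj[OF Z l1 vscale_in_fibre[OF Z l1]]) (simp only: l2 covec_vscale[OF S v] covec_vscale[OF Z l1] L.scale)
    fix w assume w: "w \<in> fibre (Lambda1 S) y"
    show "ret (vadd (Lambda1 S) v w) = vadd (Lambda1 Z) (ret v) (ret w)"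
      by (rule covec_inj[OF Z l1 vadd_in_fibre[OF Z l1 l1]]) (simp only: l2 covec_vadd[OF S v w] covec_vadd[OF Z l1 l1] L.add)
  next
    show "ret (form_val S y 0) = form_val Z (k y) 0"
      by (rule covec_inj[OF Z l1 vzero_in_fibre[OF ky]]) (simp only: l2 covec_vzero L.zero)
  qed
  have inv: "ret (Lambda_pullback S k y v) = v" if v: "v \<in> fibre (Lambda1 Z) (k y)" for v
  proof -
    obtain \<omega> where w: "\<omega> \<in> one_forms Z" "v = form_val Z (k y) \<omega>" using v unfolding fibre_Lambda1 by blast
    have "L (covec S (Lambda_pullback S k y v)) = L (P (covec Z v))"
      unfolding w(2) Lambda_pullback_form_val[OF S Z k w(1)] covec_form_val[OF w(1)] P_at
        covec_form_val[OF form_pullback_in[OF k w(1) S]] ..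
    also have "\<dots> = covec Z v" using L(3)[of "covec Z v"] w covec_form_val[OF w(1), of "k y"] by simp
    finally show ?thesis by (intro covec_inj[OF Z l1 v]) (simp only: l2)
  qed
  have "tensor_map (Lambda1 Z) (Lambda1 Z) (k y) ret ret (tensor_map (Lambda1 S) (Lambda1 S) y (Lambda_pullback S k y) (Lambda_pullback S k y) \<tau>) = \<tau>"
    if "\<tau> \<in> fibre (Lambda1_tensor Z) (k y)" for \<tau>
    by (rule tensor_map_left_inverse[OF fibre_linear_pullback[OF S Z k y] lin _ that]) (rule inv)
  then show ?thesis using t e by metis
qed

section \<open>Connections along a form embedding\<close>

lemma
  assumes "connection X D" and s: "s \<in> smooth_sections (Lambda1 X)"
  shows connection_smooth: "D s \<in> smooth_sections (Lambda1_tensor X)"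
    and connection_add: "t \<in> smooth_sections (Lambda1 X) \<Longrightarrow>
      D (sec_add (Lambda1 X) s t) = sec_add (Lambda1_tensor X) (D s) (D t)"
    and connection_scale: "D (sec_scale (Lambda1 X) (\<lambda>_. c) s) = sec_scale (Lambda1_tensor X) (\<lambda>_. c) (D s)"
    and connection_Leibniz: "smooth_real X h \<Longrightarrow> D (sec_scale (Lambda1 X) h s) =
          sec_add (Lambda1_tensor X)
            (\<lambda>x\<in>dspace X. pure_tensor (Lambda1 X) (Lambda1 X) (d_sec X h x) (s x))
            (sec_scale (Lambda1_tensor X) h (D s))"
proof -
  note A = assms(1)[unfolded connection_def]
  have "D ` smooth_sections (Lambda1 X) \<subseteq> smooth_sections (Lambda1_tensor X)"
    using A[THEN conjunct1] by (simp add: dsmooth_def sections_diffeology_def)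
  then show "D s \<in> smooth_sections (Lambda1_tensor X)" using s by (simp add: image_subset_iff)
  show "D (sec_add (Lambda1 X) s t) = sec_add (Lambda1_tensor X) (D s) (D t)" if "t \<in> smooth_sections (Lambda1 X)"
    by (rule bspec[OF bspec[OF A[THEN conjunct2, THEN conjunct1] s] that])
  show "D (sec_scale (Lambda1 X) (\<lambda>_. c) s) = sec_scale (Lambda1_tensor X) (\<lambda>_. c) (D s)"
    by (rule bspec[OF spec[OF A[THEN conjunct2, THEN conjunct2, THEN conjunct1]] s])
  show "D (sec_scale (Lambda1 X) h s) = sec_add (Lambda1_tensor X)
            (\<lambda>x\<in>dspace X. pure_tensor (Lambda1 X) (Lambda1 X) (d_sec X h x) (s x))
            (sec_scale (Lambda1_tensor X) h (D s))" if "smooth_real X h"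
    using bspec[OF spec[OF A[THEN conjunct2, THEN conjunct2, THEN conjunct2], of h] s] that by blast
qed

lemma connection_family:
  assumes "connection X D" and "plot (sections_diffeology (Lambda1 X)) n U r" and "plot X m U' q"
  shows "tensor_plot X (n + m) (prod_dom n U m U') (\<lambda>w. D (r (proj1 n w)) (q (proj2 n w)))"
proof -
  have "plot (sections_diffeology (Lambda1_tensor X)) n U (D \<circ> r)"
    using assms(1)[unfolded connection_def, THEN conjunct1] assms(2) by (rule dsmooth_plot)
  then show ?thesis using assms(3) unfolding sections_diffeology_def by simp
qed

lemma tensor_section_in_fibre:
  "s \<in> smooth_sections (Lambda1_tensor X) \<Longrightarrow> x \<in> dspace X \<Longrightarrow> s x \<in> fibre (Lambda1_tensor X) x"
  unfolding smooth_sections_tensor by (elim conjE) (rule PiE_mem)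

lemma tensor_section_plot:
  "s \<in> smooth_sections (Lambda1_tensor X) \<Longrightarrow> plot X n U p \<Longrightarrow> tensor_plot X n U (\<lambda>u. s (p u))"
  unfolding smooth_sections_tensor comp_def by blast

lemma sec_apply_cong:
  assumes X: "diffeological_space X" and "\<And>x. x \<in> dspace X \<Longrightarrow> h x = h' x"
  shows "sec_apply X g t h = sec_apply X g t h'"
  using d_form_cong[OF X assms(2)] by (simp add: sec_apply_def d_sec_def)

text \<open>A metric and an operator on \<open>Z\<close> that correspond to a metric and a connection on \<open>X\<close> under the isomorphisms \<open>\<rho>\<close>.
The conclusions are pointwise on the image of \<open>j\<close>, or concern plots that pass through \<open>X\<close>.\<close>

locale connection_embedding = form_embedding X Z j
  for X :: "'a diffeology" and Z :: "'c diffeology" and j :: "'a \<Rightarrow> 'c" +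
  fixes gX :: "'a lmetric" and gZ :: "'c lmetric" and DX :: "'a lconnection" and DZ :: "'c lconnection"
  assumes metric: "pseudo_metric (Lambda1 X) gX"
    and gZ: "\<And>x v w. x \<in> dspace X \<Longrightarrow> v \<in> fibre (Lambda1 Z) (j x) \<Longrightarrow> w \<in> fibre (Lambda1 Z) (j x) \<Longrightarrow>
      gZ (j x) v w = gX x (\<rho> x v) (\<rho> x w)"
    and conn: "connection X DX"
    and DZ_in: "\<And>s x. s \<in> smooth_sections (Lambda1 Z) \<Longrightarrow> x \<in> dspace X \<Longrightarrow> DZ s (j x) \<in> fibre (Lambda1_tensor Z) (j x)"
    and DZ: "\<And>s x. s \<in> smooth_sections (Lambda1 Z) \<Longrightarrow> x \<in> dspace X \<Longrightarrow> \<rho>\<rho> x (DZ s (j x)) = DX (part s) x"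
begin

lemma sec_in: "s \<in> smooth_sections (Lambda1 Z) \<Longrightarrow> x \<in> dspace X \<Longrightarrow> s (j x) \<in> fibre (Lambda1 Z) (j x)"
  by (rule section_in_fibre[OF _ jx])

lemmas T_add = tensor_map_add[OF Z jx X _ rho_linear]
lemmas T_scale = tensor_map_scale[OF Z jx X _ rho_linear]
lemmas T_pure = tensor_map_pure[OF Z jx X _ rho_linear]
lemmas T_closed = tensor_fibre_closed[OF Z jx]

lemma DZ_add:
  assumes s: "s \<in> smooth_sections (Lambda1 Z)" and t: "t \<in> smooth_sections (Lambda1 Z)" and x: "x \<in> dspace X"
  shows "DZ (sec_add (Lambda1 Z) s t) (j x) = sec_add (Lambda1_tensor Z) (DZ s) (DZ t) (j x)"
proof -
  note st = sec_add_smooth[OF Z s t]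
  have "\<rho>\<rho> x (DZ (sec_add (Lambda1 Z) s t) (j x)) = \<rho>\<rho> x (vadd (Lambda1_tensor Z) (DZ s (j x)) (DZ t (j x)))"
    unfolding DZ[OF st x] part_add[OF s t] connection_add[OF conn part_smooth[OF s] part_smooth[OF t]]
      T_add[OF x x x DZ_in[OF s x] DZ_in[OF t x]] DZ[OF s x] DZ[OF t x]
    by (simp add: sec_add_apply x)
  then show ?thesis
    using rho2_inj[OF x DZ_in[OF st x] T_closed(1)[OF x DZ_in[OF s x] DZ_in[OF t x]]]
    by (simp add: sec_add_apply jx[OF x])
qed

lemma DZ_scale:
  assumes s: "s \<in> smooth_sections (Lambda1 Z)" and x: "x \<in> dspace X"
  shows "DZ (sec_scale (Lambda1 Z) (\<lambda>_. c) s) (j x) = sec_scale (Lambda1_tensor Z) (\<lambda>_. c) (DZ s) (j x)"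
proof -
  note cs = sec_scale_smooth[OF Z s smooth_real_const[of Z c]]
  have p: "part (sec_scale (Lambda1 Z) (\<lambda>_. c) s) = sec_scale (Lambda1 X) (\<lambda>_. c) (part s)"
    unfolding part_scale[OF s] comp_def ..
  have "\<rho>\<rho> x (DZ (sec_scale (Lambda1 Z) (\<lambda>_. c) s) (j x)) = \<rho>\<rho> x (vscale (Lambda1_tensor Z) c (DZ s (j x)))"
    unfolding DZ[OF cs x] p connection_scale[OF conn part_smooth[OF s]] T_scale[OF x x x DZ_in[OF s x]] DZ[OF s x]
    by (simp add: sec_scale_apply x)
  then show ?thesis
    using rho2_inj[OF x DZ_in[OF cs x] T_closed(2)[OF x DZ_in[OF s x]]]
    by (simp add: sec_scale_apply jx[OF x])
qed

lemma DZ_Leibniz: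
  assumes s: "s \<in> smooth_sections (Lambda1 Z)" and h: "smooth_real Z h" and x: "x \<in> dspace X"
  shows "DZ (sec_scale (Lambda1 Z) h s) (j x) = sec_add (Lambda1_tensor Z)
      (\<lambda>z\<in>dspace Z. pure_tensor (Lambda1 Z) (Lambda1 Z) (d_sec Z h z) (s z))
      (sec_scale (Lambda1_tensor Z) h (DZ s)) (j x)"
proof -
  note hs = sec_scale_smooth[OF Z s h] and hj = smooth_real_comp[OF j h]
  note dh = sec_in[OF d_sec_smooth[OF Z h] x] and sx = sec_in[OF s x]
  note pt = T_closed(3)[OF x dh sx] and sc = T_closed(2)[OF x DZ_in[OF s x], of "h (j x)"]
  have "\<rho>\<rho> x (DZ (sec_scale (Lambda1 Z) h s) (j x)) = \<rho>\<rho> x (vadd (Lambda1_tensor Z)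
      (pure_tensor (Lambda1 Z) (Lambda1 Z) (d_sec Z h (j x)) (s (j x))) (vscale (Lambda1_tensor Z) (h (j x)) (DZ s (j x))))"
    unfolding DZ[OF hs x] part_scale[OF s] connection_Leibniz[OF conn part_smooth[OF s] hj]
      T_add[OF x x x pt sc] T_scale[OF x x x DZ_in[OF s x]] T_pure[OF x x x dh sx] DZ[OF s x] rho_d_sec[OF h x]
    by (simp add: sec_add_apply sec_scale_apply x part_apply)
  then show ?thesis
    using rho2_inj[OF x DZ_in[OF hs x] T_closed(1)[OF x pt sc]]
    by (simp add: sec_add_apply sec_scale_apply jx[OF x])
qed

lemma DZ_plot:
  assumes s: "s \<in> smooth_sections (Lambda1 Z)" and q: "plot X n U q"
  shows "tensor_plot Z n U (\<lambda>u. DZ s (j (q u)))"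
proof (rule tensor_plot_reflect)
  show "tensor_plot X n U (\<lambda>u. DX (part s) (q u))"
    by (rule tensor_section_plot[OF connection_smooth[OF conn part_smooth[OF s]] q])
  fix u assume u: "u \<in> U"
  note qu = plot_in[OF X q u]
  have f: "fst (DX (part s) (q u)) = q u"
    by (rule fst_fibre[OF tensor_section_in_fibre[OF connection_smooth[OF conn part_smooth[OF s]] qu]])
  show "DZ s (j (q u)) \<in> fibre (Lambda1_tensor Z) (j (fst (DX (part s) (q u))))" unfolding f by (rule DZ_in[OF s qu])
  show "\<rho>\<rho> (fst (DX (part s) (q u))) (DZ s (j (q u))) = DX (part s) (q u)" unfolding f by (rule DZ[OF s qu])
qed

lemma DZ_family:
  assumes r: "plot (sections_diffeology (Lambda1 Z)) n U r" and q: "plot X m U' q"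
  shows "tensor_plot Z (n + m) (prod_dom n U m U') (\<lambda>w. DZ (r (proj1 n w)) (j (q (proj2 n w))))"
proof (rule tensor_plot_reflect)
  show "tensor_plot X (n + m) (prod_dom n U m U') (\<lambda>w. DX ((part \<circ> r) (proj1 n w)) (q (proj2 n w)))"
    by (rule connection_family[OF conn part_family[OF r] q])
  fix w assume "w \<in> prod_dom n U m U'"
  then have w: "proj1 n w \<in> U" "proj2 n w \<in> U'" by (simp_all add: prod_dom_def)
  note qw = plot_in[OF X q w(2)]
  have "r ` U \<subseteq> smooth_sections (Lambda1 Z)" using r by (simp add: sections_diffeology_def)
  then have s: "r (proj1 n w) \<in> smooth_sections (Lambda1 Z)" using imageI[OF w(1)] by (rule subsetD)
  have f: "fst (DX ((part \<circ> r) (proj1 n w)) (q (proj2 n w))) = q (proj2 n w)"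
    unfolding comp_def by (rule fst_fibre[OF tensor_section_in_fibre[OF connection_smooth[OF conn part_smooth[OF s]] qw]])
  show "DZ (r (proj1 n w)) (j (q (proj2 n w))) \<in> fibre (Lambda1_tensor Z) (j (fst (DX ((part \<circ> r) (proj1 n w)) (q (proj2 n w)))))"
    unfolding f by (rule DZ_in[OF s qw])
  show "\<rho>\<rho> (fst (DX ((part \<circ> r) (proj1 n w)) (q (proj2 n w)))) (DZ (r (proj1 n w)) (j (q (proj2 n w))))
      = DX ((part \<circ> r) (proj1 n w)) (q (proj2 n w))"
    unfolding f DZ[OF s qw] by simp
qed

subsection \<open>Metric contractions\<close>

lemma part_in: "s \<in> smooth_sections (Lambda1 Z) \<Longrightarrow> x \<in> dspace X \<Longrightarrow> part s x \<in> fibre (Lambda1 X) x"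
  by (rule section_in_fibre[OF part_smooth])

lemma gZ_linear_right:
  assumes x: "x \<in> dspace X" and v: "v \<in> fibre (Lambda1 Z) (j x)"
  shows "fibre_functional Z (j x) (\<lambda>w. gZ (j x) v w)"
proof (rule fibre_functional_cong[OF Z])
  show "fibre_functional Z (j x) (\<lambda>w. gX x (\<rho> x v) (\<rho> x w))"
    using pseudo_metric_linear_right[OF X metric x rho_in[OF x v]] rho_in[OF x]
    unfolding fibre_functional_def
    by (simp add: fibre_linear_add[OF rho_linear[OF x]] fibre_linear_scale[OF rho_linear[OF x]])
qed (simp add: gZ[OF x v])

lemma gZ_linear_left:
  assumes x: "x \<in> dspace X" and v: "v \<in> fibre (Lambda1 Z) (j x)"
  shows "fibre_functional Z (j x) (\<lambda>w. gZ (j x) w v)"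
proof (rule fibre_functional_cong[OF Z])
  show "fibre_functional Z (j x) (\<lambda>w. gX x (\<rho> x w) (\<rho> x v))"
    using pseudo_metric_linear_left[OF X metric x rho_in[OF x v]] rho_in[OF x]
    unfolding fibre_functional_def
    by (simp add: fibre_linear_add[OF rho_linear[OF x]] fibre_linear_scale[OF rho_linear[OF x]])
qed (simp add: gZ[OF x _ v])

lemma gZ_sections:
  assumes s: "s \<in> smooth_sections (Lambda1 Z)" and t: "t \<in> smooth_sections (Lambda1 Z)" and x: "x \<in> dspace X"
  shows "gZ (j x) (s (j x)) (t (j x)) = gX x (part s x) (part t x)"
  by (simp add: gZ[OF x sec_in[OF s x] sec_in[OF t x]] part_apply x)

lemma gZ_smooth:
  assumes s: "s \<in> smooth_sections (Lambda1 Z)" and t: "t \<in> smooth_sections (Lambda1 Z)"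
  shows "smooth_real X ((\<lambda>z. gZ z (s z) (t z)) \<circ> j)"
  by (rule smooth_real_cong[OF X _ pseudo_metric_smooth[OF X metric part_smooth[OF s] part_smooth[OF t]]])
    (simp add: gZ_sections[OF s t])

lemma
  assumes s: "s \<in> smooth_sections (Lambda1 Z)" and t: "t \<in> smooth_sections (Lambda1 Z)" and x: "x \<in> dspace X"
  shows covariant_derivative_in: "covariant_derivative Z gZ DZ t s (j x) \<in> fibre (Lambda1 Z) (j x)"
    and rho_covariant_derivative: "\<rho> x (covariant_derivative Z gZ DZ t s (j x)) =
      covariant_derivative X gX DX (part t) (part s) x"
proof -
  note ff = gZ_linear_right[OF x sec_in[OF t x]] pseudo_metric_linear_right[OF X metric x part_in[OF t x]]
  have e: "gX x (part t x) (\<rho> x v) = gZ (j x) (t (j x)) v" if "v \<in> fibre (Lambda1 Z) (j x)" for v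
    by (simp add: gZ[OF x sec_in[OF t x] that] part_apply x)
  show "covariant_derivative Z gZ DZ t s (j x) \<in> fibre (Lambda1 Z) (j x)"
    using contract_fst_in[OF Z jx[OF x] X x rho_linear[OF x] ff e DZ_in[OF s x]]
    by (simp add: covariant_derivative_def jx[OF x])
  show "\<rho> x (covariant_derivative Z gZ DZ t s (j x)) = covariant_derivative X gX DX (part t) (part s) x"
    using contract_fst_natural[OF Z jx[OF x] X x rho_linear[OF x] ff e DZ_in[OF s x]] DZ[OF s x]
    by (simp add: covariant_derivative_def jx[OF x] x)
qed

lemma compatible_at_point:
  assumes m: "metric_connection X gX DX" and s: "s \<in> smooth_sections (Lambda1 Z)" and t: "t \<in> smooth_sections (Lambda1 Z)"
    and smooth: "smooth_real Z (\<lambda>z. gZ z (s z) (t z))" and x: "x \<in> dspace X"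
  shows "d_sec Z (\<lambda>z. gZ z (s z) (t z)) (j x) = sec_add (Lambda1 Z)
            (\<lambda>x\<in>dspace Z. contract_snd (Lambda1 Z) x (\<lambda>\<beta>. gZ x \<beta> (t x)) (DZ s x))
            (\<lambda>x\<in>dspace Z. contract_snd (Lambda1 Z) x (\<lambda>\<beta>. gZ x (s x) \<beta>) (DZ t x)) (j x)"
proof -
  note f1 = gZ_linear_left[OF x sec_in[OF t x]] pseudo_metric_linear_left[OF X metric x part_in[OF t x]]
  note f2 = gZ_linear_right[OF x sec_in[OF s x]] pseudo_metric_linear_right[OF X metric x part_in[OF s x]]
  have e1: "gX x (\<rho> x v) (part t x) = gZ (j x) v (t (j x))" if "v \<in> fibre (Lambda1 Z) (j x)" for v
    by (simp add: gZ[OF x that sec_in[OF t x]] part_apply x)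
  have e2: "gX x (part s x) (\<rho> x v) = gZ (j x) (s (j x)) v" if "v \<in> fibre (Lambda1 Z) (j x)" for v
    by (simp add: gZ[OF x sec_in[OF s x] that] part_apply x)
  let ?c1 = "contract_snd (Lambda1 Z) (j x) (\<lambda>\<beta>. gZ (j x) \<beta> (t (j x))) (DZ s (j x))"
  let ?c2 = "contract_snd (Lambda1 Z) (j x) (\<lambda>\<beta>. gZ (j x) (s (j x)) \<beta>) (DZ t (j x))"
  have c1: "?c1 \<in> fibre (Lambda1 Z) (j x)"
    by (rule contract_snd_in[OF Z jx[OF x] X x rho_linear[OF x] f1 _ DZ_in[OF s x]]) (rule e1)
  have c2: "?c2 \<in> fibre (Lambda1 Z) (j x)"
    by (rule contract_snd_in[OF Z jx[OF x] X x rho_linear[OF x] f2 _ DZ_in[OF t x]]) (rule e2)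
  have n1: "\<rho> x ?c1 = contract_snd (Lambda1 X) x (\<lambda>\<beta>. gX x \<beta> (part t x)) (DX (part s) x)"
    unfolding DZ[OF s x, symmetric]
    by (rule contract_snd_natural[OF Z jx[OF x] X x rho_linear[OF x] f1 _ DZ_in[OF s x]]) (rule e1)
  have n2: "\<rho> x ?c2 = contract_snd (Lambda1 X) x (\<lambda>\<beta>. gX x (part s x) \<beta>) (DX (part t) x)"
    unfolding DZ[OF t x, symmetric]
    by (rule contract_snd_natural[OF Z jx[OF x] X x rho_linear[OF x] f2 _ DZ_in[OF t x]]) (rule e2)
  have M: "d_sec X (\<lambda>x. gX x (part s x) (part t x)) = sec_add (Lambda1 X)
            (\<lambda>x\<in>dspace X. contract_snd (Lambda1 X) x (\<lambda>\<beta>. gX x \<beta> (part t x)) (DX (part s) x))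
            (\<lambda>x\<in>dspace X. contract_snd (Lambda1 X) x (\<lambda>\<beta>. gX x (part s x) \<beta>) (DX (part t) x))"
    using m part_smooth[OF s] part_smooth[OF t] unfolding metric_connection_def by blast
  have "\<rho> x (d_sec Z (\<lambda>z. gZ z (s z) (t z)) (j x)) = d_sec X ((\<lambda>z. gZ z (s z) (t z)) \<circ> j) x"
    by (rule rho_d_sec[OF smooth x])
  also have "\<dots> = d_sec X (\<lambda>x. gX x (part s x) (part t x)) x"
    using d_form_cong[OF X, of "(\<lambda>z. gZ z (s z) (t z)) \<circ> j" "\<lambda>x. gX x (part s x) (part t x)"]
    by (simp add: gZ_sections[OF s t] d_sec_def)
  also have "\<dots> = vadd (Lambda1 X)
      (contract_snd (Lambda1 X) x (\<lambda>\<beta>. gX x \<beta> (part t x)) (DX (part s) x))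
      (contract_snd (Lambda1 X) x (\<lambda>\<beta>. gX x (part s x) \<beta>) (DX (part t) x))"
    unfolding M by (simp add: sec_add_apply x)
  also have "\<dots> = \<rho> x (vadd (Lambda1 Z)
      (contract_snd (Lambda1 Z) (j x) (\<lambda>\<beta>. gZ (j x) \<beta> (t (j x))) (DZ s (j x)))
      (contract_snd (Lambda1 Z) (j x) (\<lambda>\<beta>. gZ (j x) (s (j x)) \<beta>) (DZ t (j x))))"
    unfolding fibre_linear_add[OF rho_linear[OF x] c1 c2] n1 n2 ..
  finally show ?thesis
    using rho_inj[OF x sec_in[OF d_sec_smooth[OF Z smooth] x] vadd_in_fibre[OF Z c1 c2]]
    by (simp add: sec_add_apply jx[OF x])
qed

subsection \<open>Torsion and the Lie bracket\<close>

lemma sec_apply_Z: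
  assumes t: "t \<in> smooth_sections (Lambda1 Z)" and h: "smooth_real Z h" and x: "x \<in> dspace X"
  shows "sec_apply Z gZ t h (j x) = sec_apply X gX (part t) (h \<circ> j) x"
  unfolding sec_apply_def
  by (simp add: gZ[OF x sec_in[OF t x] sec_in[OF d_sec_smooth[OF Z h] x]] part_apply x rho_d_sec[OF h x])

definition torsion_term :: "'c lsection \<Rightarrow> 'c lsection \<Rightarrow> 'c lsection" where
  "torsion_term s t = sec_diff (Lambda1 Z) (covariant_derivative Z gZ DZ s t) (covariant_derivative Z gZ DZ t s)"

lemma
  assumes s: "s \<in> smooth_sections (Lambda1 Z)" and t: "t \<in> smooth_sections (Lambda1 Z)" and x: "x \<in> dspace X"
    and sym: "symmetric_connection X gX DX"
  shows torsion_term_in: "torsion_term s t (j x) \<in> fibre (Lambda1 Z) (j x)"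
    and rho_torsion_term: "\<rho> x (torsion_term s t (j x)) = lie_bracket X gX (part s) (part t) x"
proof -
  note c1 = covariant_derivative_in[OF t s x] and c2 = covariant_derivative_in[OF s t x]
  note c3 = vscale_in_fibre[OF Z c2, of "- 1"]
  have eq: "torsion_term s t (j x) = vadd (Lambda1 Z) (covariant_derivative Z gZ DZ s t (j x))
      (vscale (Lambda1 Z) (- 1) (covariant_derivative Z gZ DZ t s (j x)))"
    by (simp add: torsion_term_def sec_diff_apply jx[OF x])
  show "torsion_term s t (j x) \<in> fibre (Lambda1 Z) (j x)" unfolding eq by (rule vadd_in_fibre[OF Z c1 c3])
  have B: "sec_diff (Lambda1 X) (covariant_derivative X gX DX (part s) (part t)) (covariant_derivative X gX DX (part t) (part s))
      = lie_bracket X gX (part s) (part t)"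
    using sym part_smooth[OF s] part_smooth[OF t] unfolding symmetric_connection_def by blast
  show "\<rho> x (torsion_term s t (j x)) = lie_bracket X gX (part s) (part t) x"
    unfolding eq fibre_linear_add[OF rho_linear[OF x] c1 c3] fibre_linear_scale[OF rho_linear[OF x] c2]
      rho_covariant_derivative[OF t s x] rho_covariant_derivative[OF s t x] B[symmetric]
    by (simp add: sec_diff_apply x)
qed

lemma lie_bracket_X:
  assumes wd: "lie_bracket_well_defined X gX" and s: "s \<in> smooth_sections (Lambda1 Z)" and t: "t \<in> smooth_sections (Lambda1 Z)"
  shows "is_lie_bracket X gX (part s) (part t) (lie_bracket X gX (part s) (part t))"
proof -
  have "\<exists>!r. is_lie_bracket X gX (part s) (part t) r"
    using wd part_smooth[OF s] part_smooth[OF t] unfolding lie_bracket_well_defined_def by blast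
  then show ?thesis unfolding lie_bracket_def by (rule theI')
qed

text \<open>The equation of the bracket on \<open>X\<close> is used for the function \<open>h \<circ> j\<close> only, and \<open>t(h) \<circ> j = t\<^sub>X(h \<circ> j)\<close> for the part \<open>t\<^sub>X\<close> of \<open>t\<close>.\<close>

lemma torsion_term_bracket:
  assumes wd: "lie_bracket_well_defined X gX" and sym: "symmetric_connection X gX DX"
    and s: "s \<in> smooth_sections (Lambda1 Z)" and t: "t \<in> smooth_sections (Lambda1 Z)"
    and h: "smooth_real Z h" and sh: "smooth_real Z (sec_apply Z gZ s h)" and th: "smooth_real Z (sec_apply Z gZ t h)"
    and x: "x \<in> dspace X"
  shows "sec_apply Z gZ (torsion_term s t) h (j x) =
    sec_apply Z gZ s (sec_apply Z gZ t h) (j x) - sec_apply Z gZ t (sec_apply Z gZ s h) (j x)"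
proof -
  let ?b = "lie_bracket X gX (part s) (part t)"
  have b: "sec_apply X gX ?b (h \<circ> j) x = sec_apply X gX (part s) (sec_apply X gX (part t) (h \<circ> j)) x
      - sec_apply X gX (part t) (sec_apply X gX (part s) (h \<circ> j)) x"
    using lie_bracket_X[OF wd s t] smooth_real_comp[OF j h] x unfolding is_lie_bracket_def by blast
  have "sec_apply Z gZ (torsion_term s t) h (j x) = sec_apply X gX ?b (h \<circ> j) x"
    unfolding sec_apply_def
    by (simp add: gZ[OF x torsion_term_in[OF s t x sym] sec_in[OF d_sec_smooth[OF Z h] x]] rho_torsion_term[OF s t x sym] rho_d_sec[OF h x])
  moreover have "sec_apply X gX t' (sec_apply X gX (part t'') (h \<circ> j)) = sec_apply X gX t' (sec_apply Z gZ t'' h \<circ> j)"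
    if "t'' \<in> smooth_sections (Lambda1 Z)" for t' t''
    by (rule sec_apply_cong[OF X]) (simp add: sec_apply_Z[OF that h])
  ultimately show ?thesis
    unfolding sec_apply_Z[OF s th x] sec_apply_Z[OF t sh x] using b s t by simp
qed

text \<open>Lie brackets are smooth sections by definition, and smoothness lifts along a form embedding.\<close>

lemma torsion_term_plot:
  assumes wd: "lie_bracket_well_defined X gX" and sym: "symmetric_connection X gX DX"
    and s: "s \<in> smooth_sections (Lambda1 Z)" and t: "t \<in> smooth_sections (Lambda1 Z)" and q: "plot X n U q"
  shows "Lambda_plot Z n U (\<lambda>u. torsion_term s t (j (q u)))"
proof (rule Lambda_plot_reflect)
  let ?b = "lie_bracket X gX (part s) (part t)"
  have b: "?b \<in> smooth_sections (Lambda1 X)" using lie_bracket_X[OF wd s t] unfolding is_lie_bracket_def by blast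
  show "Lambda_plot X n U (\<lambda>u. ?b (q u))" using b q unfolding smooth_sections_Lambda1 comp_def by blast
  fix u assume u: "u \<in> U"
  note qu = plot_in[OF X q u]
  have f: "fst (?b (q u)) = q u" by (rule fst_fibre[OF section_in_fibre[OF b qu]])
  show "torsion_term s t (j (q u)) \<in> fibre (Lambda1 Z) (j (fst (?b (q u))))"
    unfolding f by (rule torsion_term_in[OF s t qu sym])
  show "\<rho> (fst (?b (q u))) (torsion_term s t (j (q u))) = ?b (q u)"
    unfolding f by (rule rho_torsion_term[OF s t qu sym])
qed

end

section \<open>Levi-Civita connections and covers by two embeddings\<close>

lemma tensor_plot_local:
  assumes X: "diffeological_space X" and U: "ropen n U" and near: "near_each n U (\<lambda>V. tensor_plot X n V t)"
  shows "tensor_plot X n U t"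
  unfolding tensor_plot_iff
proof (intro conjI U near_each_bind[OF near])
  show "plot X n U (fst \<circ> t)"
  proof (rule plot_local[OF X U near_each_mono[OF near]])
    fix V assume "tensor_plot X n V t" then show "plot X n V (fst \<circ> t)" unfolding tensor_plot_iff by blast
  qed
  fix V assume "tensor_plot X n V t"
  then show "near_each n V (\<lambda>V. tensor_rep X n V t)"
    unfolding tensor_plot_iff by blast
qed

lemma tensor_plot_cong:
  assumes X: "diffeological_space X" and t: "tensor_plot X n U t" and e: "\<And>u. u \<in> U \<Longrightarrow> t u = t' u"
  shows "tensor_plot X n U t'"
  unfolding tensor_plot_iff
proof (intro conjI)
  show "ropen n U" using t unfolding tensor_plot_iff by blast
  have "plot X n U (fst \<circ> t)" using t unfolding tensor_plot_iff by blast
  then show "plot X n U (fst \<circ> t')" by (rule plot_cong[OF X]) (simp add: e)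
  have "near_each n U (\<lambda>V. tensor_rep X n V t)"
    using t unfolding tensor_plot_iff by blast
  then show "near_each n U (\<lambda>V. tensor_rep X n V t')"
    by (rule near_each_mono) (simp add: e subset_iff cong: ball_cong)
qed

lemma tensor_plot_restrict:
  assumes X: "diffeological_space X" and t: "tensor_plot X n U t" and V: "ropen n V" "V \<subseteq> U"
  shows "tensor_plot X n V t"
  unfolding tensor_plot_iff
proof (intro conjI V(1))
  have "plot X n U (fst \<circ> t)" using t unfolding tensor_plot_iff by blast
  then show "plot X n V (fst \<circ> t)" by (rule plot_restrict[OF X _ V])
  let ?R = "\<lambda>V. tensor_rep X n V t"
  have near: "near_each n U ?R" using t unfolding tensor_plot_iff by blast
  have "?R W'" if W: "?R W" "ropen n W'" "W' \<subseteq> W" for W W'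
  proof -
    obtain pqs where pqs: "\<forall>(p1, p2)\<in>set pqs. Lambda_plot X n W p1 \<and> Lambda_plot X n W p2 \<and>
        (\<forall>u\<in>W. fst (p1 u) = fst (t u) \<and> fst (p2 u) = fst (t u))"
      "\<forall>u\<in>W. snd (t u) = snd (tens X (fst (t u)) (map (\<lambda>(p1, p2). (p1 u, p2 u)) pqs))" using W(1) by blast
    have "Lambda_plot X n W' p1 \<and> Lambda_plot X n W' p2 \<and>
        (\<forall>u\<in>W'. fst (p1 u) = fst (t u) \<and> fst (p2 u) = fst (t u))" if "(p1, p2) \<in> set pqs" for p1 p2
      using bspec[OF pqs(1) that] Lambda_plot_restrict[OF X _ W(2,3)] W(3) by auto
    then show ?thesis using pqs(2) W(3) by (intro exI[of _ pqs]) blast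
  qed
  then show "near_each n V ?R" by (rule near_each_restrict[where P = ?R, OF near V])
qed

text \<open>Two embeddings through which every plot of \<open>Z\<close> factors locally, so that smoothness and identities on \<open>Z\<close> can be
checked on \<open>X1\<close> and \<open>X2\<close>.\<close>

locale levi_civita_gluing =
  E1: connection_embedding X1 Z j1 g1 g D1 D + E2: connection_embedding X2 Z j2 g2 g D2 D
  for X1 :: "'a diffeology" and X2 :: "'b diffeology" and Z :: "'c diffeology" and j1 :: "'a \<Rightarrow> 'c" and j2 :: "'b \<Rightarrow> 'c"
    and g1 g2 g D1 D2 D +
  assumes dspace_Z: "dspace Z = j1 ` dspace X1 \<union> j2 ` dspace X2"
    and cover: "\<And>n U p. plot Z n U p \<Longrightarrow> near_each n U (\<lambda>V.
      lifts X1 j1 n V p \<or> lifts X2 j2 n V p)"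
    and D_ext: "\<And>s. s \<in> smooth_sections (Lambda1 Z) \<Longrightarrow> D s \<in> extensional (dspace Z)"
begin

lemmas Z = E1.Z

lemma Z_cases:
  assumes "z \<in> dspace Z"
  obtains x where "x \<in> dspace X1" "z = j1 x" | x where "x \<in> dspace X2" "z = j2 x"
  using assms unfolding dspace_Z by blast

lemma section_eqI:
  assumes "s \<in> extensional (dspace Z)" "t \<in> extensional (dspace Z)"
    and "\<And>x. x \<in> dspace X1 \<Longrightarrow> s (j1 x) = t (j1 x)" "\<And>x. x \<in> dspace X2 \<Longrightarrow> s (j2 x) = t (j2 x)"
  shows "s = t"
proof (rule extensionalityI[OF assms(1,2)])
  fix z assume "z \<in> dspace Z"
  then show "s z = t z" by (cases rule: Z_cases) (simp_all add: assms(3,4))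
qed

lemma smooth_realI:
  assumes "smooth_real X1 (h \<circ> j1)" "smooth_real X2 (h \<circ> j2)"
  shows "smooth_real Z h"
  unfolding smooth_real_def
proof (intro allI impI)
  fix n U p assume p: "plot Z n U p"
  show "smooth_fun n U (h \<circ> p)"
  proof (rule smooth_fun_local[OF plot_open[OF Z p]], rule near_each_mono[OF cover[OF p]])
    fix V assume V: "ropen n V" and c: "lifts X1 j1 n V p \<or> lifts X2 j2 n V p"
    from c show "smooth_fun n V (h \<circ> p)"
    proof (elim disjE exE conjE)
      fix q assume q: "plot X1 n V q" "\<forall>v\<in>V. p v = j1 (q v)"
      have "smooth_fun n V ((h \<circ> j1) \<circ> q)" using assms(1) q(1) unfolding smooth_real_def by blast
      then show ?thesis by (rule smooth_fun_cong[OF V, rotated]) (simp add: q(2))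
    next
      fix q assume q: "plot X2 n V q" "\<forall>v\<in>V. p v = j2 (q v)"
      have "smooth_fun n V ((h \<circ> j2) \<circ> q)" using assms(2) q(1) unfolding smooth_real_def by blast
      then show ?thesis by (rule smooth_fun_cong[OF V, rotated]) (simp add: q(2))
    qed
  qed
qed

lemma g_smooth:
  "s \<in> smooth_sections (Lambda1 Z) \<Longrightarrow> t \<in> smooth_sections (Lambda1 Z) \<Longrightarrow> smooth_real Z (\<lambda>z. g z (s z) (t z))"
  by (rule smooth_realI) (rule E1.gZ_smooth E2.gZ_smooth; assumption)+

lemma D_smooth:
  assumes s: "s \<in> smooth_sections (Lambda1 Z)"
  shows "D s \<in> smooth_sections (Lambda1_tensor Z)"
  unfolding smooth_sections_tensor
proof (intro conjI allI impI)
  show "D s \<in> (\<Pi>\<^sub>E z\<in>dspace Z. fibre (Lambda1_tensor Z) z)"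
  proof (rule PiE_I)
    fix z assume "z \<in> dspace Z"
    then show "D s z \<in> fibre (Lambda1_tensor Z) z"
      by (cases rule: Z_cases) (simp_all add: E1.DZ_in[OF s] E2.DZ_in[OF s])
  next
    fix z assume "z \<notin> dspace Z" then show "D s z = undefined" by (rule extensional_arb[OF D_ext[OF s]])
  qed
  fix n U p assume p: "plot Z n U p"
  show "tensor_plot Z n U (D s \<circ> p)"
  proof (rule tensor_plot_local[OF Z plot_open[OF Z p]], rule near_each_mono[OF cover[OF p]])
    fix V assume "lifts X1 j1 n V p \<or> lifts X2 j2 n V p"
    then show "tensor_plot Z n V (D s \<circ> p)"
    proof (elim disjE exE conjE)
      fix q assume q: "plot X1 n V q" "\<forall>v\<in>V. p v = j1 (q v)"
      show ?thesis by (rule tensor_plot_cong[OF Z E1.DZ_plot[OF s q(1)]]) (simp add: q(2))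
    next
      fix q assume q: "plot X2 n V q" "\<forall>v\<in>V. p v = j2 (q v)"
      show ?thesis by (rule tensor_plot_cong[OF Z E2.DZ_plot[OF s q(1)]]) (simp add: q(2))
    qed
  qed
qed

lemma D_family:
  assumes r: "plot (sections_diffeology (Lambda1 Z)) n U r"
  shows "plot (sections_diffeology (Lambda1_tensor Z)) n U (D \<circ> r)"
proof -
  have U: "ropen n U" and rs: "r ` U \<subseteq> smooth_sections (Lambda1 Z)"
    using r unfolding sections_diffeology_def by simp_all
  have "tensor_plot Z (n + m) (prod_dom n U m U') (\<lambda>w. (D \<circ> r) (proj1 n w) (p (proj2 n w)))"
    if p: "plot Z m U' p" for m U' p
  proof -
    let ?P = "prod_dom n U m U'"
    have U': "ropen m U'" by (rule plot_open[OF Z p])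
    have P: "ropen (n + m) ?P" by (rule ropen_prod_dom[OF U U'])
    show ?thesis
    proof (rule tensor_plot_local[OF Z P], rule near_each_pullback[OF cover[OF p] smooth_map_proj2[OF U' subset_refl] P])
      fix V W assume V: "ropen m V" "V \<subseteq> U'" and W: "ropen (n + m) W" "W \<subseteq> ?P" "proj2 n ` W \<subseteq> V"
        and c: "lifts X1 j1 m V p \<or> lifts X2 j2 m V p"
      have PV: "ropen (n + m) (prod_dom n U m V)" by (rule ropen_prod_dom[OF U V(1)])
      have WV: "W \<subseteq> prod_dom n U m V" using W(2,3) by (auto simp: prod_dom_def)
      have "tensor_plot Z (n + m) (prod_dom n U m V) (\<lambda>w. (D \<circ> r) (proj1 n w) (p (proj2 n w)))" using c
      proof (elim disjE exE conjE)
        fix q assume q: "plot X1 m V q" "\<forall>v\<in>V. p v = j1 (q v)"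
        show ?thesis by (rule tensor_plot_cong[OF Z E1.DZ_family[OF r q(1)]]) (simp add: q(2) prod_dom_def)
      next
        fix q assume q: "plot X2 m V q" "\<forall>v\<in>V. p v = j2 (q v)"
        show ?thesis by (rule tensor_plot_cong[OF Z E2.DZ_family[OF r q(1)]]) (simp add: q(2) prod_dom_def)
      qed
      then show "tensor_plot Z (n + m) W (\<lambda>w. (D \<circ> r) (proj1 n w) (p (proj2 n w)))"
        by (rule tensor_plot_restrict[OF Z _ W(1) WV])
    qed
  qed
  then show ?thesis using U rs D_smooth unfolding sections_diffeology_def by (simp add: image_subset_iff)
qed

lemma sec_op_ext:
  "sec_add V s t \<in> extensional (dspace (base V))" "sec_scale V h s \<in> extensional (dspace (base V))"
  "sec_diff V s t \<in> extensional (dspace (base V))"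
  unfolding sec_add_def sec_scale_def sec_diff_def by simp_all

lemmas sec_op_ext_tensor = sec_op_ext[of "Lambda1_tensor Z", unfolded tensor_simps]
lemmas sec_op_ext_Lambda = sec_op_ext[of "Lambda1 Z", unfolded Lambda1_simps]

lemma D_connection: "connection Z D"
  unfolding connection_def
proof (intro conjI ballI allI impI)
  show "dsmooth (sections_diffeology (Lambda1 Z)) (sections_diffeology (Lambda1_tensor Z)) D"
    unfolding dsmooth_def using D_family D_smooth by (simp add: sections_diffeology_def image_subset_iff)
  fix s assume s: "s \<in> smooth_sections (Lambda1 Z)"
  show "D (sec_add (Lambda1 Z) s t) = sec_add (Lambda1_tensor Z) (D s) (D t)" if t: "t \<in> smooth_sections (Lambda1 Z)" for t
    by (rule section_eqI[OF D_ext[OF sec_add_smooth[OF Z s t]] sec_op_ext_tensor(1) E1.DZ_add[OF s t] E2.DZ_add[OF s t]])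
  show "D (sec_scale (Lambda1 Z) (\<lambda>_. c) s) = sec_scale (Lambda1_tensor Z) (\<lambda>_. c) (D s)" for c
    by (rule section_eqI[OF D_ext[OF sec_scale_smooth[OF Z s smooth_real_const]] sec_op_ext_tensor(2) E1.DZ_scale[OF s] E2.DZ_scale[OF s]])
  show "D (sec_scale (Lambda1 Z) h s) = sec_add (Lambda1_tensor Z)
            (\<lambda>x\<in>dspace Z. pure_tensor (Lambda1 Z) (Lambda1 Z) (d_sec Z h x) (s x))
            (sec_scale (Lambda1_tensor Z) h (D s))" if h: "smooth_real Z h" for h
    by (rule section_eqI[OF D_ext[OF sec_scale_smooth[OF Z s h]] sec_op_ext_tensor(1) E1.DZ_Leibniz[OF s h] E2.DZ_Leibniz[OF s h]])
qed

lemma D_metric: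
  assumes "metric_connection X1 g1 D1" "metric_connection X2 g2 D2"
  shows "metric_connection Z g D"
  unfolding metric_connection_def
proof (intro ballI)
  fix s t assume s: "s \<in> smooth_sections (Lambda1 Z)" and t: "t \<in> smooth_sections (Lambda1 Z)"
  have ext: "d_sec Z h \<in> extensional (dspace Z)" for h unfolding d_sec_def by simp
  show "d_sec Z (\<lambda>x. g x (s x) (t x)) = sec_add (Lambda1 Z)
            (\<lambda>x\<in>dspace Z. contract_snd (Lambda1 Z) x (\<lambda>\<beta>. g x \<beta> (t x)) (D s x))
            (\<lambda>x\<in>dspace Z. contract_snd (Lambda1 Z) x (\<lambda>\<beta>. g x (s x) \<beta>) (D t x))"
    by (rule section_eqI[OF ext sec_op_ext_Lambda(1) E1.compatible_at_point[OF assms(1) s t g_smooth[OF s t]]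
       E2.compatible_at_point[OF assms(2) s t g_smooth[OF s t]]])
qed

text \<open>The difference \<open>\<nabla>\<^sub>s t - \<nabla>\<^sub>t s\<close> solves the equation of the bracket on \<open>Z\<close>, whose solution is unique.\<close>

lemma D_symmetric:
  assumes sym1: "symmetric_connection X1 g1 D1" and sym2: "symmetric_connection X2 g2 D2"
    and wd1: "lie_bracket_well_defined X1 g1" and wd2: "lie_bracket_well_defined X2 g2" and wd: "lie_bracket_well_defined Z g"
  shows "symmetric_connection Z g D"
  unfolding symmetric_connection_def
proof (intro ballI)
  fix s t assume s: "s \<in> smooth_sections (Lambda1 Z)" and t: "t \<in> smooth_sections (Lambda1 Z)"
  let ?r = "sec_diff (Lambda1 Z) (covariant_derivative Z g D s t) (covariant_derivative Z g D t s)"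
  have r: "E1.torsion_term s t = ?r" "E2.torsion_term s t = ?r" by (simp_all add: E1.torsion_term_def E2.torsion_term_def)
  note in1 = E1.torsion_term_in[OF s t _ sym1, unfolded r] and in2 = E2.torsion_term_in[OF s t _ sym2, unfolded r]
  have "?r \<in> smooth_sections (Lambda1 Z)"
    unfolding smooth_sections_Lambda1
  proof (intro conjI allI impI)
    show "?r \<in> (\<Pi>\<^sub>E z\<in>dspace Z. fibre (Lambda1 Z) z)"
    proof (rule PiE_I)
      fix z assume "z \<in> dspace Z"
      then show "?r z \<in> fibre (Lambda1 Z) z" by (cases rule: Z_cases) (simp_all add: in1 in2)
    next
      fix z assume "z \<notin> dspace Z" then show "?r z = undefined" by (rule extensional_arb[OF sec_op_ext_Lambda(3)])
    qed
    fix n U p assume p: "plot Z n U p"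
    show "Lambda_plot Z n U (?r \<circ> p)"
    proof (rule Lambda_plot_local[OF Z plot_open[OF Z p]], rule near_each_mono[OF cover[OF p]])
      fix V assume "lifts X1 j1 n V p \<or> lifts X2 j2 n V p"
      then show "Lambda_plot Z n V (?r \<circ> p)"
      proof (elim disjE exE conjE)
        fix q assume q: "plot X1 n V q" "\<forall>v\<in>V. p v = j1 (q v)"
        show ?thesis by (rule Lambda_plot_cong[OF Z E1.torsion_term_plot[OF wd1 sym1 s t q(1), unfolded r]]) (simp add: q(2))
      next
        fix q assume q: "plot X2 n V q" "\<forall>v\<in>V. p v = j2 (q v)"
        show ?thesis by (rule Lambda_plot_cong[OF Z E2.torsion_term_plot[OF wd2 sym2 s t q(1), unfolded r]]) (simp add: q(2))
      qed
    qed
  qed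
  moreover have "sec_apply Z g ?r h z = sec_apply Z g s (sec_apply Z g t h) z - sec_apply Z g t (sec_apply Z g s h) z"
    if h: "smooth_real Z h" and z: "z \<in> dspace Z" for h z
  proof -
    have sm: "smooth_real Z (sec_apply Z g s' h)" if "s' \<in> smooth_sections (Lambda1 Z)" for s'
      unfolding sec_apply_def by (rule g_smooth[OF that d_sec_smooth[OF Z h]])
    from z show ?thesis
      by (cases rule: Z_cases)
        (simp_all only: E1.torsion_term_bracket[OF wd1 sym1 s t h sm[OF s] sm[OF t], unfolded r]
          E2.torsion_term_bracket[OF wd2 sym2 s t h sm[OF s] sm[OF t], unfolded r])
  qed
  ultimately have "is_lie_bracket Z g s t ?r" unfolding is_lie_bracket_def by blast
  moreover have "\<exists>!r. is_lie_bracket Z g s t r" using wd s t unfolding lie_bracket_well_defined_def by blast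
  ultimately show "?r = lie_bracket Z g s t" unfolding lie_bracket_def by (rule the1_equality[symmetric, rotated])
qed

end

section \<open>The glued space\<close>

locale gluing =
  fixes X1 :: "'a diffeology" and X2 :: "'b diffeology" and Y :: "'a set" and f :: "'a \<Rightarrow> 'b"
  assumes X1: "diffeological_space X1" and X2: "diffeological_space X2"
    and diffeo: "diffeomorphism_onto_image X1 Y X2 f"
    and same_forms: "D1_Omega X1 Y = D2_Omega X1 X2 Y f"
begin

abbreviation "S \<equiv> subset_diffeology X1 Y"
abbreviation "S2 \<equiv> subset_diffeology X2 (f ` Y)"
abbreviation "Z \<equiv> glue X1 X2 Y f"
abbreviation "j1 \<equiv> glue_in1 X1 X2 Y f"
abbreviation "j2 \<equiv> glue_in2 X1 X2 Y f"

lemma Y: "Y \<subseteq> dspace X1" and fY: "f ` Y \<subseteq> dspace X2" and inj_f: "inj_on f Y" and f: "dsmooth S S2 f"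
  using diffeo by (simp_all add: diffeomorphism_onto_image_def)

text \<open>Since \<open>f\<close> is injective, one step of the gluing relation already gives the equivalence relation.\<close>

lemma glue_rel_iff:
  "(u, v) \<in> glue_rel X1 X2 Y f \<longleftrightarrow> u \<in> dspace X1 <+> dspace X2 \<and> v \<in> dspace X1 <+> dspace X2 \<and>
     (u = v \<or> (\<exists>y\<in>Y. u = Inl y \<and> v = Inr (f y) \<or> u = Inr (f y) \<and> v = Inl y))"
proof -
  define R where "R = {(Inl y, Inr (f y)) | y. y \<in> Y} \<union> {(Inl y, Inr (f y)) | y. y \<in> Y}\<inverse>"
  have "(u, v) \<in> R\<^sup>* \<longleftrightarrow> u = v \<or> (\<exists>y\<in>Y. u = Inl y \<and> v = Inr (f y) \<or> u = Inr (f y) \<and> v = Inl y)"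
  proof
    assume "(u, v) \<in> R\<^sup>*"
    then show "u = v \<or> (\<exists>y\<in>Y. u = Inl y \<and> v = Inr (f y) \<or> u = Inr (f y) \<and> v = Inl y)"
    proof induction
      case (step v w)
      from step.hyps(2) obtain y where "y \<in> Y" "v = Inl y \<and> w = Inr (f y) \<or> v = Inr (f y) \<and> w = Inl y"
        unfolding R_def by blast
      with step.IH inj_onD[OF inj_f] show ?case by (elim disjE bexE conjE) auto
    qed simp
  next
    assume "u = v \<or> (\<exists>y\<in>Y. u = Inl y \<and> v = Inr (f y) \<or> u = Inr (f y) \<and> v = Inl y)"
    moreover have "(Inl y, Inr (f y)) \<in> R" "(Inr (f y), Inl y) \<in> R" if "y \<in> Y" for y using that by (auto simp: R_def)
    ultimately show "(u, v) \<in> R\<^sup>*" by (elim disjE bexE conjE) auto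
  qed
  then show ?thesis unfolding glue_rel_def R_def Let_def by auto
qed

lemma j1_apply: "x \<in> dspace X1 \<Longrightarrow> j1 x = insert (Inl x) (if x \<in> Y then {Inr (f x)} else {})"
  using fY by (auto simp: glue_in1_def glue_rel_iff)

lemma j2_apply: "x \<in> dspace X2 \<Longrightarrow> j2 x = insert (Inr x) (Inl ` {y \<in> Y. f y = x})"
  using Y by (auto simp: glue_in2_def glue_rel_iff)

lemma j1_inj: "inj_on j1 (dspace X1)"
proof (rule inj_onI)
  fix x x' assume x: "x \<in> dspace X1" "x' \<in> dspace X1" and e: "j1 x = j1 x'"
  have "Inl x \<in> j1 x'" unfolding e[symmetric] j1_apply[OF x(1)] by simp
  then show "x = x'" unfolding j1_apply[OF x(2)] by (simp split: if_splits)
qed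

lemma j2_inj: "inj_on j2 (dspace X2)"
proof (rule inj_onI)
  fix x x' assume x: "x \<in> dspace X2" "x' \<in> dspace X2" and e: "j2 x = j2 x'"
  have "Inr x \<in> j2 x'" unfolding e[symmetric] j2_apply[OF x(1)] by simp
  then show "x = x'" unfolding j2_apply[OF x(2)] by auto
qed

lemma j1_eq_j2: assumes "x1 \<in> dspace X1" "x2 \<in> dspace X2" shows "j1 x1 = j2 x2 \<longleftrightarrow> x1 \<in> Y \<and> x2 = f x1"
proof
  assume e: "j1 x1 = j2 x2"
  have "Inl x1 \<in> j1 x1" by (simp add: j1_apply[OF assms(1)])
  then have "Inl x1 \<in> j2 x2" unfolding e .
  then show "x1 \<in> Y \<and> x2 = f x1" unfolding j2_apply[OF assms(2)] by auto
next
  assume "x1 \<in> Y \<and> x2 = f x1"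
  then show "j1 x1 = j2 x2" unfolding j1_apply[OF assms(1)] j2_apply[OF assms(2)]
    using inj_onD[OF inj_f] by auto
qed

lemma dspace_glue: "dspace Z = j1 ` dspace X1 \<union> j2 ` dspace X2"
  unfolding glue_def pushforward_diffeology_def diffeology.simps quotient_def glue_in1_def glue_in2_def Plus_def by blast

text \<open>Local lifts to the disjoint union pass through one of its summands. Constant families, which the pushforward
adds, lift because every class is the image of a point.\<close>

lemma plot_glue:
  "plot Z n U p \<longleftrightarrow> ropen n U \<and> near_each n U (\<lambda>V.
      lifts X1 j1 n V p \<or> lifts X2 j2 n V p)"
    (is "_ \<longleftrightarrow> _ \<and> near_each n U ?L")
proof -
  let ?cl = "\<lambda>z. glue_rel X1 X2 Y f `` {z}"
  let ?T = "\<lambda>q V. (\<exists>q'. plot X1 n V q' \<and> (\<forall>v\<in>V. q v = Inl (q' v))) \<or> (\<exists>q'. plot X2 n V q' \<and> (\<forall>v\<in>V. q v = Inr (q' v)))"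
  let ?Q = "\<lambda>V. (\<exists>b. \<forall>v\<in>V. p v = b) \<or> (\<exists>q. plot (sum_diffeology X1 X2) n V q \<and> (\<forall>v\<in>V. p v = ?cl (q v)))"
  have unfold: "plot Z n U p \<longleftrightarrow> ropen n U \<and> p ` U \<subseteq> dspace Z \<and> near_each n U ?Q"
    by (simp add: glue_def pushforward_diffeology_def)
  have sum: "plot (sum_diffeology X1 X2) n V q \<longleftrightarrow> ropen n V \<and> near_each n V (?T q)" for V q
    by (simp add: sum_diffeology_def)
  show ?thesis
  proof
    assume "plot Z n U p"
    then have U: "ropen n U" and pU: "p ` U \<subseteq> dspace Z" and near: "near_each n U ?Q" unfolding unfold by blast+
    have "near_each n U ?L"
    proof (rule near_each_bind[OF near])
      fix V assume V: "ropen n V" "V \<subseteq> U" and "?Q V"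
      from \<open>?Q V\<close> show "near_each n V ?L"
      proof
        assume "\<exists>b. \<forall>v\<in>V. p v = b"
        then obtain b where b: "\<And>v. v \<in> V \<Longrightarrow> p v = b" by blast
        show ?thesis unfolding near_each_def
        proof (intro ballI exI[of _ V] conjI V(1) subset_refl)
          fix u assume u: "u \<in> V"
          show "u \<in> V" by (rule u)
          have "p u \<in> dspace Z" by (rule subsetD[OF pU imageI[OF subsetD[OF V(2) u]]])
          then consider x where "x \<in> dspace X1" "p u = j1 x" | x where "x \<in> dspace X2" "p u = j2 x"
            unfolding dspace_glue by blast
          then show "?L V"
          proof cases
            case 1 then show ?thesis using plot_const[OF X1 V(1) 1(1)] b u by auto
          next
            case 2 then show ?thesis using plot_const[OF X2 V(1) 2(1)] b u by auto
          qed
        qed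
      next
        assume "\<exists>q. plot (sum_diffeology X1 X2) n V q \<and> (\<forall>v\<in>V. p v = ?cl (q v))"
        then obtain q where q: "near_each n V (?T q)" "\<And>v. v \<in> V \<Longrightarrow> p v = ?cl (q v)" unfolding sum by blast
        show ?thesis
        proof (rule near_each_mono[OF q(1)])
          fix V' assume V': "V' \<subseteq> V" and "?T q V'"
          from \<open>?T q V'\<close> show "?L V'"
          proof (elim disjE exE conjE)
            fix q' assume "plot X1 n V' q'" "\<forall>v\<in>V'. q v = Inl (q' v)"
            then show ?thesis using q(2) V' by (intro disjI1 exI[of _ q']) (simp add: glue_in1_def subset_iff)
          next
            fix q' assume "plot X2 n V' q'" "\<forall>v\<in>V'. q v = Inr (q' v)"
            then show ?thesis using q(2) V' by (intro disjI2 exI[of _ q']) (simp add: glue_in2_def subset_iff)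
          qed
        qed
      qed
    qed
    with U show "ropen n U \<and> near_each n U ?L" ..
  next
    assume "ropen n U \<and> near_each n U ?L"
    then have U: "ropen n U" and near: "near_each n U ?L" by blast+
    have "p u \<in> dspace Z" if u: "u \<in> U" for u
    proof -
      from bspec[OF near[unfolded near_each_def] u] obtain V where V: "u \<in> V" "?L V" by (elim exE conjE) (rule that)
      from V(2) show ?thesis
      proof (elim disjE exE conjE)
        fix q assume "plot X1 n V q" "\<forall>v\<in>V. p v = j1 (q v)"
        then show ?thesis using plot_in[OF X1 _ V(1)] V(1) unfolding dspace_glue by simp
      next
        fix q assume "plot X2 n V q" "\<forall>v\<in>V. p v = j2 (q v)"
        then show ?thesis using plot_in[OF X2 _ V(1)] V(1) unfolding dspace_glue by simp
      qed
    qed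
    moreover have "near_each n U ?Q"
    proof (rule near_each_mono[OF near])
      fix V assume V: "ropen n V" and "?L V"
      from \<open>?L V\<close> show "?Q V"
      proof (elim disjE exE conjE)
        fix q assume q: "plot X1 n V q" "\<forall>v\<in>V. p v = j1 (q v)"
        have "plot (sum_diffeology X1 X2) n V (\<lambda>v. Inl (q v))"
          unfolding sum using q(1) V by (intro conjI near_each_self disjI1 exI[of _ q]) simp_all
        then show ?thesis using q(2) by (intro disjI2 exI[of _ "\<lambda>v. Inl (q v)"]) (simp add: glue_in1_def)
      next
        fix q assume q: "plot X2 n V q" "\<forall>v\<in>V. p v = j2 (q v)"
        have "plot (sum_diffeology X1 X2) n V (\<lambda>v. Inr (q v))"
          unfolding sum using q(1) V by (intro conjI near_each_self disjI2 exI[of _ q]) simp_all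
        then show ?thesis using q(2) by (intro disjI2 exI[of _ "\<lambda>v. Inr (q v)"]) (simp add: glue_in2_def)
      qed
    qed
    ultimately show "plot Z n U p" unfolding unfold using U by (simp add: image_subset_iff)
  qed
qed

lemma S: "diffeological_space S" and S2: "diffeological_space S2"
  by (rule diffeological_subset[OF X1 Y], rule diffeological_subset[OF X2 fY])

lemma dspace_S [simp]: "dspace S = Y" by (simp add: subset_diffeology_def)

lemma incl1: "dsmooth S X1 (\<lambda>y. y)"
  using Y by (auto simp: dsmooth_def subset_diffeology_def comp_def)

lemma incl2: "dsmooth S2 X2 (\<lambda>y. y)"
  using fY by (auto simp: dsmooth_def subset_diffeology_def comp_def)

lemma f': "dsmooth S X2 f"
  using f fY by (auto simp: dsmooth_def subset_diffeology_def)

sublocale pushout S X1 X2 Z "\<lambda>y. y" f j1 j2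
proof
  show "diffeological_space S" "diffeological_space X1" "diffeological_space X2" "dsmooth S X1 (\<lambda>y. y)" "dsmooth S X2 f"
    "inj_on j1 (dspace X1)" "inj_on j2 (dspace X2)" "dspace Z = j1 ` dspace X1 \<union> j2 ` dspace X2"
    by (rule S X1 X2 incl1 f' j1_inj j2_inj dspace_glue)+
  show "plot Z n U p \<longleftrightarrow> ropen n U \<and> near_each n U (\<lambda>V.
      lifts X1 j1 n V p \<or> lifts X2 j2 n V p)" for n U p
    by (rule plot_glue)
  show "j1 y = j2 (f y)" if "y \<in> dspace S" for y
    using that Y fY by (subst j1_eq_j2) auto
  show "\<exists>y. plot S n V y \<and> (\<forall>v\<in>V. q1 v = y v \<and> q2 v = f (y v))"
    if q: "plot X1 n V q1" "plot X2 n V q2" and e: "\<And>v. v \<in> V \<Longrightarrow> j1 (q1 v) = j2 (q2 v)" for n V q1 q2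
  proof -
    have y: "q1 v \<in> Y \<and> q2 v = f (q1 v)" if "v \<in> V" for v
      using e[OF that] j1_eq_j2[OF plot_in[OF X1 q(1) that] plot_in[OF X2 q(2) that]] by blast
    then have "plot S n V q1" using q(1) by (auto simp: subset_diffeology_def)
    then show ?thesis using y by blast
  qed
  have "form_pullback S f \<circ> form_pullback S2 (\<lambda>z. z) = form_pullback S f"
    by (rule ext) (simp add: form_pullback_comp[OF f] comp_def[of "\<lambda>z. z"])
  then show "pushforward_diffeology (one_forms_diffeology X1) (form_pullback S (\<lambda>y. y)) (one_forms S)
      = pushforward_diffeology (one_forms_diffeology X2) (form_pullback S f) (one_forms S)"
    using same_forms unfolding D1_Omega_def D2_Omega_def by simp
qed

lemma restr1_eq: "restr1 X1 Y y = Lambda_pullback S (\<lambda>y. y) y"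
  by (simp add: restr1_def)

lemma restr2_eq:
  assumes y: "y \<in> Y" and a: "\<alpha> \<in> fibre (Lambda1 X2) (f y)"
  shows "restr2 X1 X2 Y f y \<alpha> = Lambda_pullback S f y \<alpha>"
proof -
  obtain \<omega> where w: "\<omega> \<in> one_forms X2" "\<alpha> = form_val X2 (f y) \<omega>" using a unfolding fibre_Lambda1 by blast
  have "form_pullback S f (form_pullback S2 (\<lambda>z. z) \<omega>) = form_pullback S f \<omega>"
    by (simp add: form_pullback_comp[OF f] comp_def[of "\<lambda>z. z"])
  then show ?thesis
    unfolding restr2_def w(2) comp_def
      Lambda_pullback_form_val[OF S2 X2 incl2 w(1), of "f y"]
      Lambda_pullback_form_val[OF S S2 f form_pullback_in[OF incl2 w(1) S2]] Lambda_pullback_form_val[OF S X2 f' w(1)]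
    by simp
qed

lemma inv1: "x \<in> dspace X1 \<Longrightarrow> glue_inv1 X1 X2 Y f (j1 x) = x"
  unfolding glue_inv1_def by (rule inv_into_f_f[OF j1_inj])

lemma inv2: "x \<in> dspace X2 \<Longrightarrow> glue_inv2 X1 X2 Y f (j2 x) = x"
  unfolding glue_inv2_def by (rule inv_into_f_f[OF j2_inj])

lemma rho1_eq: "x \<in> dspace X1 \<Longrightarrow> rho1 X1 X2 Y f (j1 x) = Lambda_pullback X1 j1 x"
  by (simp add: rho1_def inv1)

lemma rho2_eq: "x \<in> dspace X2 \<Longrightarrow> rho2 X1 X2 Y f (j2 x) = Lambda_pullback X2 j2 x"
  by (simp add: rho2_def inv2)

lemma j2: "dsmooth X2 Z j2" by (rule pushout.j1[OF swap])

lemma Y_to_glue: "dsmooth S Z j1"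
  using Y dsmooth_in[OF j1] dsmooth_plot[OF j1] by (auto simp: dsmooth_def subset_diffeology_def)

text \<open>Both restrictions to \<open>Y\<close> of a value on the glued space are its pullback along the common map from \<open>Y\<close>.\<close>

lemma restrictions_agree:
  assumes y: "y \<in> Y" and v: "v \<in> fibre (Lambda1 Z) (j1 y)"
  shows "Lambda_pullback S (\<lambda>y. y) y (Lambda_pullback X1 j1 y v) = Lambda_pullback S j1 y v"
    and "Lambda_pullback S f y (Lambda_pullback X2 j2 (f y) v) = Lambda_pullback S j1 y v"
proof -
  have e: "j1 y' = j2 (f y')" if "y' \<in> Y" for y' using comm that by simp
  obtain \<omega> where w: "\<omega> \<in> one_forms Z" "v = form_val Z (j1 y) \<omega>" using v unfolding fibre_Lambda1 by blast
  note Zs = diffeological_Z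
  show "Lambda_pullback S (\<lambda>y. y) y (Lambda_pullback X1 j1 y v) = Lambda_pullback S j1 y v"
    unfolding w(2) Lambda_pullback_form_val[OF X1 Zs j1 w(1)] Lambda_pullback_form_val[OF S Zs Y_to_glue w(1)]
      Lambda_pullback_form_val[OF S X1 incl1 form_pullback_in[OF j1 w(1) X1]] form_pullback_comp[OF incl1]
    by (simp add: comp_def)
  have "form_pullback S f (form_pullback X2 j2 \<omega>) = form_pullback S j1 \<omega>"
    unfolding form_pullback_comp[OF f'] by (rule form_pullback_cong[OF S Y_to_glue _ w(1), symmetric]) (simp add: e)
  moreover have "Lambda_pullback X2 j2 (f y) v = form_val X2 (f y) (form_pullback X2 j2 \<omega>)"
    unfolding w(2) e[OF y] by (rule Lambda_pullback_form_val[OF X2 Zs j2 w(1)])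
  ultimately show "Lambda_pullback S f y (Lambda_pullback X2 j2 (f y) v) = Lambda_pullback S j1 y v"
    unfolding w(2) Lambda_pullback_form_val[OF S Zs Y_to_glue w(1)]
    by (simp add: Lambda_pullback_form_val[OF S X2 f' form_pullback_in[OF j2 w(1) X2]])
qed

end

section \<open>Gluing metrics and connections\<close>

locale metric_gluing = gluing X1 X2 Y f
  for X1 :: "'a diffeology" and X2 :: "'b diffeology" and Y f +
  fixes g1 g2
  assumes g1: "pseudo_metric (Lambda1 X1) g1" and g2: "pseudo_metric (Lambda1 X2) g2"
    and compatible: "compatible_metrics X1 X2 Y f g1 g2"
begin

lemma compatible_at_pullback:
  assumes "y \<in> Y" "\<alpha>1 \<in> fibre (Lambda1 X1) y" "\<alpha>2 \<in> fibre (Lambda1 X2) (f y)"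
    "Lambda_pullback S (\<lambda>y. y) y \<alpha>1 = Lambda_pullback S f y \<alpha>2"
  shows "compatible_at X1 X2 Y f y \<alpha>1 \<alpha>2"
  using assms by (simp add: compatible_at_def restr1_eq restr2_eq)

lemma compatible_metrics_pullback:
  assumes y: "y \<in> Y" and a: "\<alpha>1 \<in> fibre (Lambda1 X1) y" "\<alpha>2 \<in> fibre (Lambda1 X2) (f y)"
    "Lambda_pullback S (\<lambda>y. y) y \<alpha>1 = Lambda_pullback S f y \<alpha>2"
    and b: "\<beta>1 \<in> fibre (Lambda1 X1) y" "\<beta>2 \<in> fibre (Lambda1 X2) (f y)"
    "Lambda_pullback S (\<lambda>y. y) y \<beta>1 = Lambda_pullback S f y \<beta>2"
  shows "g1 y \<alpha>1 \<beta>1 = g2 (f y) \<alpha>2 \<beta>2"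
  using compatible compatible_at_pullback[OF y a] compatible_at_pullback[OF y b] y
  unfolding compatible_metrics_def by blast

text \<open>Injectivity of the restriction of values from \<open>X1\<close> and from \<open>X2\<close> to \<open>Y\<close>.\<close>

lemma reflect1:
  assumes "y \<in> dspace S" "\<omega> \<in> one_forms X1" "form_pullback S (\<lambda>y. y) \<omega> \<in> vanishing_forms S y"
  shows "\<omega> \<in> vanishing_forms X1 y"
  by (rule metric_reflects_vanishing[OF g1 g2 _ assms]) (rule compatible_metrics_pullback, use assms(1) in simp_all)

lemma reflect2:
  assumes "y \<in> dspace S" "\<omega> \<in> one_forms X2" "form_pullback S f \<omega> \<in> vanishing_forms S y"
  shows "\<omega> \<in> vanishing_forms X2 (f y)"
  by (rule pushout.metric_reflects_vanishing[OF swap g2 g1 _ assms])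
    (rule compatible_metrics_pullback[symmetric], use assms(1) in simp_all)

sublocale E1: form_embedding X1 Z j1 by (rule leg_embedding[OF reflect2])
sublocale E2: form_embedding X2 Z j2 by (rule pushout.leg_embedding[OF swap reflect1])

lemma glue_point: "y \<in> Y \<Longrightarrow> j1 y = j2 (f y)" using comm by simp

lemma rho_compatible:
  assumes y: "y \<in> Y" and v: "v \<in> fibre (Lambda1 Z) (j1 y)"
  shows "compatible_at X1 X2 Y f y (E1.\<rho> y v) (E2.\<rho> (f y) v)"
proof (rule compatible_at_pullback[OF y])
  have yf: "y \<in> dspace X1" "f y \<in> dspace X2" using y Y fY by auto
  show "E1.\<rho> y v \<in> fibre (Lambda1 X1) y" by (rule E1.rho_in[OF yf(1) v])
  show "E2.\<rho> (f y) v \<in> fibre (Lambda1 X2) (f y)" by (rule E2.rho_in[OF yf(2)]) (use v glue_point[OF y] in simp)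
  show "Lambda_pullback S (\<lambda>y. y) y (E1.\<rho> y v) = Lambda_pullback S f y (E2.\<rho> (f y) v)"
    unfolding restrictions_agree[OF y v] ..
qed

lemma g_overlap:
  assumes y: "y \<in> Y" and v: "v \<in> fibre (Lambda1 Z) (j1 y)" "w \<in> fibre (Lambda1 Z) (j1 y)"
  shows "g1 y (E1.\<rho> y v) (E1.\<rho> y w) = g2 (f y) (E2.\<rho> (f y) v) (E2.\<rho> (f y) w)"
  using compatible rho_compatible[OF y v(1)] rho_compatible[OF y v(2)] y unfolding compatible_metrics_def by blast

abbreviation "g \<equiv> glued_metric X1 X2 Y f g1 g2"

text \<open>On the overlap the two summands of the half-sum coincide.\<close>

lemma g_on_Y:
  assumes y: "y \<in> Y" and v: "v \<in> fibre (Lambda1 Z) (j1 y)" "w \<in> fibre (Lambda1 Z) (j1 y)"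
  shows "g (j1 y) v w = g1 y (E1.\<rho> y v) (E1.\<rho> y w)"
proof -
  have yf: "y \<in> dspace X1" "f y \<in> dspace X2" using y Y fY by auto
  have n1: "j1 y \<notin> j1 ` (dspace X1 - Y)"
  proof
    assume "j1 y \<in> j1 ` (dspace X1 - Y)"
    then obtain x where "j1 y = j1 x" "x \<in> dspace X1" "x \<notin> Y" by blast
    then show False using inj_onD[OF j1_inj _ yf(1)] y by blast
  qed
  have n2: "j1 y \<notin> j2 ` (dspace X2 - f ` Y)"
  proof
    assume "j1 y \<in> j2 ` (dspace X2 - f ` Y)"
    then obtain x where "j1 y = j2 x" "x \<in> dspace X2" "x \<notin> f ` Y" by blast
    then show False using j1_eq_j2[OF yf(1)] y by blast
  qed
  have r2: "glue_inv2 X1 X2 Y f (j1 y) = f y" "rho2 X1 X2 Y f (j1 y) = E2.\<rho> (f y)"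
    unfolding glue_point[OF y] by (simp_all add: inv2 rho2_eq yf)
  show ?thesis
    by (simp add: glued_metric_def Let_def n1 n2 r2 inv1[OF yf(1)] rho1_eq[OF yf(1)] g_overlap[OF y v])
qed

lemma g_on_1:
  assumes x: "x \<in> dspace X1" and v: "v \<in> fibre (Lambda1 Z) (j1 x)" "w \<in> fibre (Lambda1 Z) (j1 x)"
  shows "g (j1 x) v w = g1 x (E1.\<rho> x v) (E1.\<rho> x w)"
proof (cases "x \<in> Y")
  case False
  then have "j1 x \<in> j1 ` (dspace X1 - Y)" using x by blast
  then show ?thesis by (simp add: glued_metric_def Let_def inv1[OF x] rho1_eq[OF x])
qed (rule g_on_Y[OF _ v])

lemma g_on_2:
  assumes x: "x \<in> dspace X2" and v: "v \<in> fibre (Lambda1 Z) (j2 x)" "w \<in> fibre (Lambda1 Z) (j2 x)"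
  shows "g (j2 x) v w = g2 x (E2.\<rho> x v) (E2.\<rho> x w)"
proof (cases "x \<in> f ` Y")
  case True
  then obtain y where y: "y \<in> Y" "x = f y" by blast
  then have e: "j2 x = j1 y" using glue_point by simp
  note v' = v[unfolded e]
  show ?thesis using g_on_Y[OF y(1) v'] g_overlap[OF y(1) v'] unfolding e by (simp add: y(2))
next
  case False
  have "j2 x \<notin> j1 ` (dspace X1 - Y)"
  proof
    assume "j2 x \<in> j1 ` (dspace X1 - Y)"
    then obtain x1 where "j1 x1 = j2 x" "x1 \<in> dspace X1" "x1 \<notin> Y" by (metis Diff_iff imageE)
    then show False using j1_eq_j2[OF _ x] by blast
  qed
  moreover have "j2 x \<in> j2 ` (dspace X2 - f ` Y)" using x False by blast
  ultimately show ?thesis by (simp add: glued_metric_def Let_def inv2[OF x] rho2_eq[OF x])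
qed

lemma sec_part1_eq: "sec_part1 X1 X2 Y f s = E1.part s"
  unfolding sec_part1_def E1.part_def Let_def by (rule restrict_ext) (simp add: rho1_eq)

lemma sec_part2_eq: "sec_part2 X1 X2 Y f s = E2.part s"
  unfolding sec_part2_def E2.part_def Let_def by (rule restrict_ext) (simp add: rho2_eq)

lemma overlap_reflects:
  assumes y: "y \<in> Y" and w: "\<omega> \<in> one_forms Z" and v: "form_pullback S j1 \<omega> \<in> vanishing_forms S y"
  shows "\<omega> \<in> vanishing_forms Z (j1 y)"
proof (rule E1.reflect[OF w])
  show "y \<in> dspace X1" using y Y by blast
  have "form_pullback S (\<lambda>y. y) (form_pullback X1 j1 \<omega>) = form_pullback S j1 \<omega>"
    unfolding form_pullback_comp[OF incl1] by (simp add: comp_def)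
  then show "form_pullback X1 j1 \<omega> \<in> vanishing_forms X1 y"
    using reflect1[OF _ form_pullback_in[OF j1 w X1], of y] v y by simp
qed

context
  fixes nabla1 nabla2
  assumes c1: "connection X1 nabla1" and c2: "connection X2 nabla2"
    and compat: "compatible_connections X1 X2 Y f nabla1 nabla2"
begin

abbreviation "nabla \<equiv> glued_connection X1 X2 Y f nabla1 nabla2"

text \<open>The prescriptions from \<open>X1\<close> and \<open>X2\<close> have the same restriction to \<open>Y\<close>, because the parts of a section are
compatible sections and the connections are compatible; restriction to \<open>Y\<close> is injective on tensors.\<close>

lemma nabla_overlap:
  assumes s: "s \<in> smooth_sections (Lambda1 Z)" and y: "y \<in> Y"
    and t1: "\<tau>1 \<in> fibre (Lambda1_tensor Z) (j1 y)" "E1.\<rho>\<rho> y \<tau>1 = nabla1 (E1.part s) y"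
    and t2: "\<tau>2 \<in> fibre (Lambda1_tensor Z) (j1 y)" "E2.\<rho>\<rho> (f y) \<tau>2 = nabla2 (E2.part s) (f y)"
  shows "\<tau>1 = \<tau>2"
proof -
  have yf: "y \<in> dspace X1" "f y \<in> dspace X2" and yS: "y \<in> dspace S" using y Y fY by auto
  note e = glue_point[OF y]
  let ?\<kappa> = "Lambda_pullback S j1 y" and ?L = "Lambda1 S"
  have \<kappa>: "fibre_linear Z (j1 y) S y ?\<kappa>" by (rule fibre_linear_pullback[OF S diffeological_Z Y_to_glue yS])
  have l1: "fibre_linear X1 y S y (restr1 X1 Y y)"
    unfolding restr1_eq using fibre_linear_pullback[OF S X1 incl1 yS] .
  have lf: "fibre_linear X2 (f y) S y (Lambda_pullback S f y)" by (rule fibre_linear_pullback[OF S X2 f' yS])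
  have l2: "fibre_linear X2 (f y) S y (restr2 X1 X2 Y f y)"
    using lf unfolding fibre_linear_def
    by (simp add: restr2_eq[OF y] vadd_in_fibre[OF X2] vscale_in_fibre[OF X2] vzero_in_fibre[OF yf(2)])
  have "compatible_sections X1 X2 Y f (E1.part s) (E2.part s)"
    unfolding compatible_sections_def
  proof
    fix y' assume y': "y' \<in> Y"
    then have yf': "y' \<in> dspace X1" "f y' \<in> dspace X2" using Y fY by auto
    show "compatible_at X1 X2 Y f y' (E1.part s y') (E2.part s (f y'))"
      using rho_compatible[OF y' section_in_fibre[OF s E1.jx[OF yf'(1)]]] glue_point[OF y']
      by (simp add: E1.part_apply E2.part_apply yf')
  qed
  then have "tensor_map ?L ?L y (restr1 X1 Y y) (restr1 X1 Y y) (nabla1 (E1.part s) y) =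
      tensor_map ?L ?L y (restr2 X1 X2 Y f y) (restr2 X1 X2 Y f y) (nabla2 (E2.part s) (f y))"
    using compat E1.part_smooth[OF s] E2.part_smooth[OF s] y unfolding compatible_connections_def Let_def by blast
  moreover have "tensor_map ?L ?L y (restr1 X1 Y y) (restr1 X1 Y y) (nabla1 (E1.part s) y) = tensor_map ?L ?L y ?\<kappa> ?\<kappa> \<tau>1"
    unfolding t1(2)[symmetric]
    by (rule tensor_map_compose[OF E1.rho_linear[OF yf(1)] l1 t1(1) \<kappa>]) (simp add: restr1_eq restrictions_agree[OF y])
  moreover have "tensor_map ?L ?L y (restr2 X1 X2 Y f y) (restr2 X1 X2 Y f y) (nabla2 (E2.part s) (f y)) = tensor_map ?L ?L y ?\<kappa> ?\<kappa> \<tau>2"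
    unfolding t2(2)[symmetric]
  proof (rule tensor_map_compose[OF E2.rho_linear[OF yf(2)] l2, unfolded e[symmetric], OF t2(1) \<kappa>])
    fix v assume v: "v \<in> fibre (Lambda1 Z) (j1 y)"
    have "E2.\<rho> (f y) v \<in> fibre (Lambda1 X2) (f y)" by (rule E2.rho_in[OF yf(2)]) (use v e in simp)
    then show "restr2 X1 X2 Y f y (E2.\<rho> (f y) v) = ?\<kappa> v"
      by (simp add: restr2_eq[OF y] restrictions_agree[OF y v])
  qed
  ultimately have "tensor_map ?L ?L y ?\<kappa> ?\<kappa> \<tau>1 = tensor_map ?L ?L y ?\<kappa> ?\<kappa> \<tau>2" by simp
  then show ?thesis 
    by (rule tensor_pullback_inj[OF S diffeological_Z Y_to_glue yS _ t1(1) t2(1), rotated]) (rule overlap_reflects[OF y])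
qed

text \<open>The description that defines \<open>\<nabla>\<^sup>\<union> s\<close> at a point is satisfied by exactly one tensor: \<open>\<rho>\<^sub>i \<otimes> \<rho>\<^sub>i\<close> is bijective for
either side, and the two sides agree where both apply.\<close>

lemma nabla_parts:
  assumes s: "s \<in> smooth_sections (Lambda1 Z)" and z: "z \<in> dspace Z"
  shows "nabla s z \<in> fibre (Lambda1_tensor Z) z \<and>
    (\<forall>x\<in>dspace X1. z = j1 x \<longrightarrow> E1.\<rho>\<rho> x (nabla s z) = nabla1 (E1.part s) x) \<and>
    (\<forall>x\<in>dspace X2. z = j2 x \<longrightarrow> E2.\<rho>\<rho> x (nabla s z) = nabla2 (E2.part s) x)"
proof -
  let ?P = "\<lambda>\<tau>. \<tau> \<in> fibre (Lambda1_tensor Z) z \<and>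
    (\<forall>x\<in>dspace X1. z = j1 x \<longrightarrow> E1.\<rho>\<rho> x \<tau> = nabla1 (E1.part s) x) \<and>
    (\<forall>x\<in>dspace X2. z = j2 x \<longrightarrow> E2.\<rho>\<rho> x \<tau> = nabla2 (E2.part s) x)"
  have in1: "nabla1 (E1.part s) x \<in> fibre (Lambda1_tensor X1) x" if "x \<in> dspace X1" for x
    by (rule tensor_section_in_fibre[OF connection_smooth[OF c1 E1.part_smooth[OF s]] that])
  have in2: "nabla2 (E2.part s) x \<in> fibre (Lambda1_tensor X2) x" if "x \<in> dspace X2" for x
    by (rule tensor_section_in_fibre[OF connection_smooth[OF c2 E2.part_smooth[OF s]] that])
  have "\<exists>\<tau>. ?P \<tau>"
  proof -
    from z consider (both) y where "y \<in> Y" "z = j1 y" | (one) x where "x \<in> dspace X1" "x \<notin> Y" "z = j1 x"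
      | (two) x where "x \<in> dspace X2" "x \<notin> f ` Y" "z = j2 x"
      unfolding dspace_glue using glue_point by blast
    then show ?thesis
    proof cases
      case both
      have yf: "y \<in> dspace X1" "f y \<in> dspace X2" using both(1) Y fY by auto
      obtain \<tau>1 where t1: "\<tau>1 \<in> fibre (Lambda1_tensor Z) (j1 y)" "E1.\<rho>\<rho> y \<tau>1 = nabla1 (E1.part s) y"
        by (rule E1.rho2_surj[OF yf(1) in1[OF yf(1)]])
      obtain \<tau>2 where t2: "\<tau>2 \<in> fibre (Lambda1_tensor Z) (j2 (f y))" "E2.\<rho>\<rho> (f y) \<tau>2 = nabla2 (E2.part s) (f y)"
        by (rule E2.rho2_surj[OF yf(2) in2[OF yf(2)]])
      have "\<tau>1 = \<tau>2" by (rule nabla_overlap[OF s both(1) t1 t2(1)[folded glue_point[OF both(1)]] t2(2)])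
      moreover have "x = y" if "x \<in> dspace X1" "z = j1 x" for x
        using inj_onD[OF j1_inj _ that(1) yf(1)] both(2) that(2) by simp
      moreover have "x = f y" if "x \<in> dspace X2" "z = j2 x" for x
        using j1_eq_j2[OF yf(1) that(1)] both(2) that(2) by simp
      ultimately show ?thesis using t1 t2(2) both(2) by (intro exI[of _ \<tau>1]) auto
    next
      case one
      obtain \<tau> where t: "\<tau> \<in> fibre (Lambda1_tensor Z) (j1 x)" "E1.\<rho>\<rho> x \<tau> = nabla1 (E1.part s) x"
        by (rule E1.rho2_surj[OF one(1) in1[OF one(1)]])
      moreover have "x' = x" if "x' \<in> dspace X1" "z = j1 x'" for x'
        using inj_onD[OF j1_inj _ that(1) one(1)] one(3) that(2) by simp
      moreover have False if "x' \<in> dspace X2" "z = j2 x'" for x'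
        using j1_eq_j2[OF one(1) that(1)] one(2,3) that(2) by simp
      ultimately show ?thesis using one(3) by (intro exI[of _ \<tau>]) auto
    next
      case two
      obtain \<tau> where t: "\<tau> \<in> fibre (Lambda1_tensor Z) (j2 x)" "E2.\<rho>\<rho> x \<tau> = nabla2 (E2.part s) x"
        by (rule E2.rho2_surj[OF two(1) in2[OF two(1)]])
      moreover have "x' = x" if "x' \<in> dspace X2" "z = j2 x'" for x'
        using inj_onD[OF j2_inj _ that(1) two(1)] two(3) that(2) by simp
      moreover have False if "x' \<in> dspace X1" "z = j1 x'" for x'
        using j1_eq_j2[OF that(1) two(1)] two(2,3) that(2) by simp
      ultimately show ?thesis using two(3) by (intro exI[of _ \<tau>]) auto
    qed
  qed
  moreover have "\<tau> = \<tau>'" if t: "?P \<tau>" "?P \<tau>'" for \<tau> \<tau>'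
  proof -
    from z consider x where "x \<in> dspace X1" "z = j1 x" | x where "x \<in> dspace X2" "z = j2 x"
      unfolding dspace_glue by blast
    then show ?thesis
    proof cases
      case 1 then show ?thesis using t E1.rho2_inj[OF 1(1), of \<tau> \<tau>'] by simp
    next
      case 2 then show ?thesis using t E2.rho2_inj[OF 2(1), of \<tau> \<tau>'] by simp
    qed
  qed
  ultimately have ex1: "\<exists>!\<tau>. ?P \<tau>" by (rule ex_ex1I)
  have nz: "nabla s z = (THE \<tau>. ?P \<tau>)"
  proof -
    have A: "(z \<in> j1 ` dspace X1 \<longrightarrow>
          (let x1 = glue_inv1 X1 X2 Y f z in
           tensor_map (Lambda1 X1) (Lambda1 X1) x1 (rho1 X1 X2 Y f z) (rho1 X1 X2 Y f z) \<tau>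
             = nabla1 (sec_part1 X1 X2 Y f s) x1)) \<longleftrightarrow>
        (\<forall>x\<in>dspace X1. z = j1 x \<longrightarrow> E1.\<rho>\<rho> x \<tau> = nabla1 (E1.part s) x)" for \<tau>
      by (auto simp: Let_def inv1 rho1_eq sec_part1_eq)
    have B: "(z \<in> j2 ` dspace X2 \<longrightarrow>
          (let x2 = glue_inv2 X1 X2 Y f z in
           tensor_map (Lambda1 X2) (Lambda1 X2) x2 (rho2 X1 X2 Y f z) (rho2 X1 X2 Y f z) \<tau>
             = nabla2 (sec_part2 X1 X2 Y f s) x2)) \<longleftrightarrow>
        (\<forall>x\<in>dspace X2. z = j2 x \<longrightarrow> E2.\<rho>\<rho> x \<tau> = nabla2 (E2.part s) x)" for \<tau>
      by (auto simp: Let_def inv2 rho2_eq sec_part2_eq)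
    show ?thesis unfolding glued_connection_def restrict_apply'[OF z] A B ..
  qed
  show ?thesis unfolding nz by (rule theI'[OF ex1])
qed

lemma glued_levi_civita:
  assumes wd: "lie_bracket_well_defined X1 g1" "lie_bracket_well_defined X2 g2" "lie_bracket_well_defined Z g"
    and lc: "levi_civita X1 g1 nabla1" "levi_civita X2 g2 nabla2"
  shows "levi_civita Z g nabla"
proof -
  have z1: "j1 x \<in> dspace Z" if "x \<in> dspace X1" for x by (rule E1.jx[OF that])
  have z2: "j2 x \<in> dspace Z" if "x \<in> dspace X2" for x by (rule E2.jx[OF that])
  interpret levi_civita_gluing X1 X2 Z j1 j2 g1 g2 g nabla1 nabla2 nabla
  proof
    show "pseudo_metric (Lambda1 X1) g1" "pseudo_metric (Lambda1 X2) g2" "connection X1 nabla1" "connection X2 nabla2"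
      by (rule g1 g2 c1 c2)+
    show "dspace Z = j1 ` dspace X1 \<union> j2 ` dspace X2" by (rule dspace_glue)
    show "near_each n U (\<lambda>V. lifts X1 j1 n V p \<or> lifts X2 j2 n V p)"
      if "plot Z n U p" for n U p
      using that unfolding plot_glue by (rule conjunct2)
    show "nabla s \<in> extensional (dspace Z)" for s unfolding glued_connection_def by simp
    show "g (j1 x) v w = g1 x (E1.\<rho> x v) (E1.\<rho> x w)"
      if "x \<in> dspace X1" "v \<in> fibre (Lambda1 Z) (j1 x)" "w \<in> fibre (Lambda1 Z) (j1 x)" for x v w
      by (rule g_on_1[OF that])
    show "g (j2 x) v w = g2 x (E2.\<rho> x v) (E2.\<rho> x w)"
      if "x \<in> dspace X2" "v \<in> fibre (Lambda1 Z) (j2 x)" "w \<in> fibre (Lambda1 Z) (j2 x)" for x v w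
      by (rule g_on_2[OF that])
    show "nabla s (j1 x) \<in> fibre (Lambda1_tensor Z) (j1 x)" if "s \<in> smooth_sections (Lambda1 Z)" "x \<in> dspace X1" for s x
      using nabla_parts[OF that(1) z1[OF that(2)]] by blast
    show "nabla s (j2 x) \<in> fibre (Lambda1_tensor Z) (j2 x)" if "s \<in> smooth_sections (Lambda1 Z)" "x \<in> dspace X2" for s x
      using nabla_parts[OF that(1) z2[OF that(2)]] by blast
    show "E1.\<rho>\<rho> x (nabla s (j1 x)) = nabla1 (E1.part s) x" if "s \<in> smooth_sections (Lambda1 Z)" "x \<in> dspace X1" for s x
      using nabla_parts[OF that(1) z1[OF that(2)]] that(2) by blast
    show "E2.\<rho>\<rho> x (nabla s (j2 x)) = nabla2 (E2.part s) x" if "s \<in> smooth_sections (Lambda1 Z)" "x \<in> dspace X2" for s x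
      using nabla_parts[OF that(1) z2[OF that(2)]] that(2) by blast
  qed
  show ?thesis
    using lc D_connection D_metric D_symmetric[OF _ _ wd] unfolding levi_civita_def by blast
qed

end

end

theorem corollary3p13:
  fixes X1 :: "'a diffeology" and X2 :: "'b diffeology"
    and Y :: "'a set" and f :: "'a \<Rightarrow> 'b"
    and g1 :: "'a lmetric" and g2 :: "'b lmetric"
    and nabla1 :: "'a lconnection" and nabla2 :: "'b lconnection"
  assumes "diffeological_space X1" and "diffeological_space X2"
    and "diffeomorphism_onto_image X1 Y X2 f"
    and "D1_Omega X1 Y = D2_Omega X1 X2 Y f"
    and "pseudo_metric (Lambda1 X1) g1" and "pseudo_metric (Lambda1 X2) g2"
    and "compatible_metrics X1 X2 Y f g1 g2"
    and "lie_bracket_well_defined X1 g1" and "lie_bracket_well_defined X2 g2"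
    and "lie_bracket_well_defined (glue X1 X2 Y f) (glued_metric X1 X2 Y f g1 g2)"
    and "connection X1 nabla1" and "connection X2 nabla2"
    and "compatible_connections X1 X2 Y f nabla1 nabla2"
    and "levi_civita X1 g1 nabla1" and "levi_civita X2 g2 nabla2"
  shows "levi_civita (glue X1 X2 Y f) (glued_metric X1 X2 Y f g1 g2)
    (glued_connection X1 X2 Y f nabla1 nabla2)"
proof -
  interpret metric_gluing X1 X2 Y f g1 g2
    by unfold_locales (rule assms)+
  show ?thesis by (rule glued_levi_civita) (rule assms)+
qed

end
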